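(* Let $d\ge 3$ be an integer and $2^*=2d/(d-2)$. (i) Let $\theta=1/2-1/2^*=1/d$. The inequality $$ h[u]^\theta \left( \int_{\mathbb{R}^d}\frac{|u(x)|^2}{|x|^2} \,dx \right)^{1-\theta} \ge C_{\mathrm{rad},2^*} \| u\|_{L^{2^*}}^{2}, \qquad \forall u\in \dot{H}^1_{\mathrm{rad}}(\mathbb{R}^d), $$ holds with a positive constant, and, with $C_{\mathrm{rad},2^*}>0$ denoting the optimal (largest possible) constant, all optimizers are given, up to dilation $u_\eta(x)\mapsto a\,u_\eta(bx)$ with $a\in\mathbb{C}$, $b>0$, by the family $$ u_\eta(x) = \frac{1} { \left(|x|^{1-\eta} (1+|x|^{2\eta})\right)^{(d-2)/2}}, \qquad \eta \in (0,\infty); $$ that is, $u\in \dot{H}^1_{\mathrm{rad}}(\mathbb{R}^d)$ gives equality if and only if $u(x)=a\,u_\eta(bx)$ for some $\eta\in(0,\infty)$, $a\in\mathbb{C}$, $b>0$. Furthermore, if a real number $\theta$ satisfies $\theta\ne 1/d$, then there is no constant $C>0$ such that $h[u]^\theta \left( \int_{\mathbb{R}^d}\frac{|u(x)|^2}{|x|^2} \,dx \right)^{1-\theta} \ge C \| u\|_{L^{2^*}}^{2}$ for all nonzero $u\in \dot{H}^1_{\mathrm{rad}}(\mathbb{R}^d)$. (ii) Let $\theta=1/2$. The inequality $$ h[u]^{\theta} \left( \int_{\mathbb{R}^d}\frac{|u(x)|^2}{|x|^2} \,dx \right)^{1-\theta} \ge C_{\mathrm{rad},\infty} \| u\|_{L^{2^*,\infty}}^{2},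 \qquad \forall u\in \dot{H}^1_{\mathrm{rad}}(\mathbb{R}^d), $$ holds with a positive constant, and, with $C_{\mathrm{rad},\infty}>0$ denoting the optimal (largest possible) constant, all optimizers are given, up to dilation $u_c(x)\mapsto a\,u_c(bx)$ with $a\in\mathbb{C}$, $b>0$, by the family $$ u_c(x)=\begin{cases} |x|^{c-d/2+1}, & |x|\le 1,\\ |x|^{-c-d/2+1}, & |x| > 1, \end{cases} \qquad c\in (0, d/2-1]; $$ that is, $u\in \dot{H}^1_{\mathrm{rad}}(\mathbb{R}^d)$ gives equality if and only if $u(x)=a\,u_c(bx)$ for some $c\in(0,d/2-1]$, $a\in\mathbb{C}$, $b>0$.
   Context: For $d\ge3$, $\dot H^1(\mathbb{R}^d)$ is the usual homogeneous Sobolev space of complex-valued functions (the completion of $C_c^\infty(\mathbb{R}^d)$ with respect to $\|\nabla u\|_{L^2}$, viewed as a subspace of $L^{2^*}(\mathbb{R}^d)$), and $\dot{H}^1_{\mathrm{rad}}(\mathbb{R}^d)=\{u \in \dot H^1(\mathbb{R}^d): u \text{ is radially symmetric}\}$. Functions are identified when equal almost everywhere. The Hardy quadratic form is $$ h[u]=\int_{\mathbb{R}^d} |\nabla u(x)|^2 \,dx - \frac{(d-2)^2}{4} \int_{\mathbb{R}^d}\frac{|u(x)|^2}{|x|^2} \,dx, $$ which is nonnegative on $\dot H^1(\mathbb{R}^d)$ by Hardy's inequality. The weak norm is $\|u\|_{L^{q,\infty}}=\sup_{s>0} s\,|\{x\in\mathbb{R}^d:|u(x)|>s\}|^{1/q}$,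 with $|\cdot|$ Lebesgue measure. *)

theory Defs
  imports "HOL-Analysis.Analysis"
begin

text \<open>Functions on \<open>real ^ 'n\<close> are Lebesgue measurable, and almost-everywhere statements and
  integrals refer to the complete measure \<^term>\<open>lebesgue\<close>; hence every notion below that is applied
  to Sobolev functions is invariant under changing the function on a null set.\<close>

definition sobolev_exponent :: "nat \<Rightarrow> real" where
  "sobolev_exponent d = 2 * real d / (real d - 2)"

definition partial_deriv :: "'n::finite \<Rightarrow> (real ^ 'n \<Rightarrow> complex) \<Rightarrow> real ^ 'n \<Rightarrow> complex" where
  "partial_deriv i f x = frechet_derivative f (at x) (axis i 1)"

definition classical_gradient :: "(real ^ 'n::finite \<Rightarrow> complex) \<Rightarrow> real ^ 'n \<Rightarrow> complex ^ 'n" where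
  "classical_gradient f x = (\<chi> i. partial_deriv i f x)"

primrec C_k :: "nat \<Rightarrow> (real ^ 'n::finite \<Rightarrow> complex) \<Rightarrow> bool" where
  "C_k 0 f \<longleftrightarrow> continuous_on UNIV f"
| "C_k (Suc k) f \<longleftrightarrow> f differentiable_on UNIV \<and> (\<forall>i. C_k k (partial_deriv i f))"

definition test_functions :: "(real ^ 'n::finite \<Rightarrow> complex) set" where
  "test_functions = {f. (\<forall>k. C_k k f) \<and> compact (closure {x. f x \<noteq> 0})}"

text \<open>The next definition is the usual \<open>L\<^sup>p\<close> norm only when the integral is finite (\<^term>\<open>lebesgue_integral\<close>
  is \<open>0\<close> otherwise). It is applied only to functions in \<open>L\<^sup>p\<close>. Vectors in \<open>complex ^ 'n\<close> carry the
  Euclidean norm.\<close>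

definition Lp_norm :: "real \<Rightarrow> (real ^ 'n::finite \<Rightarrow> 'b::real_normed_vector) \<Rightarrow> real" where
  "Lp_norm p u = (LINT x|lebesgue. norm (u x) powr p) powr (1 / p)"

text \<open>The supremum is over a bounded set whenever \<open>u\<close> belongs to \<open>L\<^sup>q\<close> (Chebyshev's inequality).\<close>

definition weak_Lp_norm :: "real \<Rightarrow> (real ^ 'n::finite \<Rightarrow> complex) \<Rightarrow> real" where
  "weak_Lp_norm q u = (SUP s\<in>{0<..}. s * measure lebesgue {x. norm (u x) > s} powr (1 / q))"

text \<open>The completion of the test functions in the gradient norm, realised inside \<open>L\<^sup>p\<close> with the critical
  exponent \<open>p = 2d/(d-2)\<close>: the \<open>L\<^sup>p\<close> limits of sequences of test functions whose gradients are Cauchy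
  in \<open>L\<^sup>2\<close>. Meaningful for \<open>d \<ge> 3\<close>.\<close>

definition homogeneous_H1 :: "(real ^ 'n::finite \<Rightarrow> complex) set" where
  "homogeneous_H1 = {u. let p = sobolev_exponent CARD('n) in
     u \<in> borel_measurable lebesgue \<and> integrable lebesgue (\<lambda>x. norm (u x) powr p) \<and>
     (\<exists>\<phi> :: nat \<Rightarrow> real ^ 'n \<Rightarrow> complex. (\<forall>k. \<phi> k \<in> test_functions) \<and>
        (\<forall>e>0. \<exists>N. \<forall>m\<ge>N. \<forall>n\<ge>N.
           Lp_norm 2 (\<lambda>x. classical_gradient (\<phi> m) x - classical_gradient (\<phi> n) x) < e) \<and>
        (\<lambda>k. Lp_norm p (\<lambda>x. \<phi> k x - u x)) \<longlonglongrightarrow> 0)}"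

definition radial :: "(real ^ 'n::finite \<Rightarrow> complex) \<Rightarrow> bool" where
  "radial u \<longleftrightarrow> (\<exists>f :: real \<Rightarrow> complex. AE x in lebesgue. u x = f (norm x))"

definition homogeneous_H1_rad :: "(real ^ 'n::finite \<Rightarrow> complex) set" where
  "homogeneous_H1_rad = {u \<in> homogeneous_H1. radial u}"

definition locally_integrable ::
  "(real ^ 'n::finite \<Rightarrow> 'b::{banach, second_countable_topology}) \<Rightarrow> bool" where
  "locally_integrable f \<longleftrightarrow> (\<forall>K. compact K \<longrightarrow> set_integrable lebesgue K f)"

definition is_weak_gradient ::
  "(real ^ 'n::finite \<Rightarrow> complex) \<Rightarrow> (real ^ 'n \<Rightarrow> complex ^ 'n) \<Rightarrow> bool" where
  "is_weak_gradient u G \<longleftrightarrow> locally_integrable u \<and> locally_integrable G \<and>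
     (\<forall>\<psi>\<in>test_functions. \<forall>i.
        (LINT x|lebesgue. u x * partial_deriv i \<psi> x) = - (LINT x|lebesgue. G x $ i * \<psi> x))"

text \<open>Weak gradients are unique up to null sets, so the integral in \<open>hardy_form\<close> does not depend on
  the choice made here.\<close>

definition weak_gradient :: "(real ^ 'n::finite \<Rightarrow> complex) \<Rightarrow> real ^ 'n \<Rightarrow> complex ^ 'n" where
  "weak_gradient u = (SOME G. is_weak_gradient u G)"

definition hardy_integral :: "(real ^ 'n::finite \<Rightarrow> complex) \<Rightarrow> real" where
  "hardy_integral u = (LINT x|lebesgue. (norm (u x))\<^sup>2 / (norm x)\<^sup>2)"

definition hardy_form :: "(real ^ 'n::finite \<Rightarrow> complex) \<Rightarrow> real" where
  "hardy_form u = (LINT x|lebesgue. (norm (weak_gradient u x))\<^sup>2)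
     - (real CARD('n) - 2)\<^sup>2 / 4 * hardy_integral u"

text \<open>Since \<open>0 powr a = 0\<close>, the value of these families at the origin is a convention, on a null set.\<close>

definition u_eta :: "real \<Rightarrow> real ^ 'n::finite \<Rightarrow> real" where
  "u_eta \<eta> x = 1 / (norm x powr (1 - \<eta>) * (1 + norm x powr (2 * \<eta>))) powr ((real CARD('n) - 2) / 2)"

definition u_c :: "real \<Rightarrow> real ^ 'n::finite \<Rightarrow> real" where
  "u_c c x = (if norm x \<le> 1 then norm x powr (c - real CARD('n) / 2 + 1)
              else norm x powr (- c - real CARD('n) / 2 + 1))"

end

theory Submission
  imports Defs
begin

text \<open>In the Emden--Fowler variables \<open>u x = norm x powr (- \<kappa>) * v (ln (norm x))\<close> with \<open>\<kappa> = (d - 2) / 2\<close>, the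
  form \<open>hardy_form u\<close>, the Hardy integral and the \<open>p\<close>-th power of the critical norm become the integrals
  over the line of \<open>(norm v')\<^sup>2\<close>, \<open>(norm v)\<^sup>2\<close> and \<open>norm v powr p\<close>, all multiplied by the area of the unit sphere.
  Part (i) is therefore the sharp Gagliardo--Nirenberg inequality on the line and part (ii) is
  \<open>norm (v t) ^ 4 \<le> A * B\<close>, where \<open>A\<close> and \<open>B\<close> are the integrals of \<open>(norm v')\<^sup>2\<close> and \<open>(norm v)\<^sup>2\<close>.

  Both follow by calibration. Translate so that \<open>norm v\<close> is maximal at \<open>0\<close>, and put
  \<open>Y t = sgn t * k ((norm (v t))\<^sup>2) * v t\<close> for a nonnegative continuous \<open>k\<close>. The integral of \<open>Y \<bullet> v'\<close> depends on \<open>v 0\<close>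
  only, so the Cauchy--Schwarz inequality bounds \<open>A\<close> times the integral of \<open>(norm Y)\<^sup>2\<close> from below, with equality
  only if \<open>v'\<close> is a multiple of \<open>Y\<close>. The choice \<open>k = 1\<close> gives (ii) and its optimizers \<open>exp (- l * \<bar>t\<bar>)\<close>; the
  \<open>k\<close> for which \<open>v' = - Y\<close> is solved by the soliton \<open>cosh (t / \<kappa>) powr (- \<kappa>)\<close> gives (i) after a convexity
  argument. Scaling the soliton excludes every other exponent in (i). In (ii) the weak norm of \<open>u\<close> is at most
  the supremum of \<open>norm v\<close> times that of \<open>norm x powr (- \<kappa>)\<close>; for exponential profiles it equals this bound
  exactly if the decay rate is at most \<open>\<kappa>\<close>.\<close>

section \<open>Calibrated inequalities on the line\<close>

text \<open>The equation \<open>v' = - Y\<close> of the soliton calibration has a square root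
  singularity at the maximum, so its solutions are not unique: they may rest at the maximum before
  they descend. Equality is therefore decided by comparison. Every solution lies above the soliton,
  and equal integrals then force both to agree. The calibration itself gives
  \<open>a\<^sup>2 + A * D \<le> A * B\<close>, where \<open>a\<close> is the energy of the soliton
  and \<open>D\<close> the integral of the critical power. This is tied to the normalization of the
  maximum to 1. Weighted AM-GM, with the weights for which the soliton gives equality, turns it into
  the product form, from which the normalization drops out. For a general radial Sobolev function
  only a bound is derived: the energy of the profile times the area of the sphere is at most
  \<open>hardy_form u\<close>, since the derivative along one well chosen orbit is compared with the
  full gradient. The bound suffices for the inequalities and for the necessity of the optimizers.
  Sufficiency is computed on the explicit families, for which approximating test functions are built
  and the exact value of the form is available.\<close>

text \<open>Over a fine uniform subdivision the local bounds telescope to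
  \<open>\<bar>h b - h a\<bar> \<le> e * (G b - G a)\<close>, and \<open>e\<close> is arbitrary.
  This yields the chain rule below without differentiating absolutely continuous functions almost
  everywhere.\<close>

lemma eq_by_subdivision:
  fixes h G :: "real \<Rightarrow> real"
  assumes ab: "a \<le> b"
    and loc: "\<And>e. e > 0 \<Longrightarrow> \<exists>\<delta>>0. \<forall>s t. a \<le> s \<and> s \<le> t \<and> t \<le> b \<and> t - s < \<delta> \<longrightarrow> \<bar>h t - h s\<bar> \<le> e * (G t - G s)"
  shows "h b = h a"
proof -
  have bound: "\<bar>h b - h a\<bar> \<le> e * (G b - G a)" if e: "e > 0" for e
  proof -
    obtain \<delta> where \<delta>: "\<delta> > 0"
      and L: "\<And>s t. a \<le> s \<Longrightarrow> s \<le> t \<Longrightarrow> t \<le> b \<Longrightarrow> t - s < \<delta> \<Longrightarrow> \<bar>h t - h s\<bar> \<le> e * (G t - G s)"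
      using loc[OF e] by blast
    obtain n :: nat where n: "(b - a) / \<delta> < n" "n > 0"
    proof -
      obtain m :: nat where "(b - a) / \<delta> < m" using reals_Archimedean2 by blast
      then show thesis by (intro that[of "Suc m"]) auto
    qed
    define c where "c = (b - a) / n"
    define T where "T i = a + real i * c" for i
    have nc: "real n * c = b - a" using n by (simp add: c_def)
    have T: "T 0 = a" "T n = b" using nc by (auto simp: T_def)
    have inc: "T (Suc i) - T i = c" for i
      by (simp add: T_def algebra_simps)
    have step: "c < \<delta>" using n \<delta> by (simp add: c_def field_simps)
    have nn: "c \<ge> 0" using ab by (simp add: c_def)
    have le_b: "T i \<le> b" if "i \<le> n" for i
    proof -
      have "real i * c \<le> real n * c"
        using that nn by (intro mult_right_mono) auto
      then show ?thesis using nc by (simp add: T_def)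
    qed
    have ge_a: "a \<le> T i" for i using nn by (simp add: T_def)
    have "i \<le> n \<Longrightarrow> \<bar>h (T i) - h a\<bar> \<le> e * (G (T i) - G a)" for i
    proof (induction i)
      case 0 then show ?case by (simp add: T)
    next
      case (Suc i)
      have "\<bar>h (T (Suc i)) - h (T i)\<bar> \<le> e * (G (T (Suc i)) - G (T i))"
        using Suc.prems inc[of i] nn step by (intro L ge_a le_b) auto
      then show ?case using Suc by (simp add: algebra_simps)
    qed
    from this[of n] show ?thesis by (simp add: T)
  qed
  have "\<bar>h b - h a\<bar> \<le> 0"
  proof (rule field_le_epsilon)
    fix e :: real assume e: "e > 0"
    define c where "c = \<bar>G b - G a\<bar> + 1"
    have c: "c > 0" by (simp add: c_def)
    have "\<bar>h b - h a\<bar> \<le> (e / c) * (G b - G a)" by (intro bound divide_pos_pos e c)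
    also have "\<dots> \<le> (e / c) * c" using e c by (intro mult_left_mono) (auto simp: c_def)
    finally show "\<bar>h b - h a\<bar> \<le> 0 + e" using c by simp
  qed
  then show ?thesis by simp
qed

text \<open>Absolute continuity encoded by the fundamental theorem: \<open>w\<close> counts only up
  to null sets, and \<open>v\<close> need not be differentiable at any given point. Limits of smooth
  profiles arrive in this form.\<close>

definition weak_primitive :: "(real \<Rightarrow> complex) \<Rightarrow> (real \<Rightarrow> complex) \<Rightarrow> bool" where
  "weak_primitive v w \<longleftrightarrow> (\<forall>a b. w absolutely_integrable_on {a..b}) \<and>
     (\<forall>s t. s \<le> t \<longrightarrow> v t - v s = integral {s..t} w)"

lemma weak_primitive_continuous:
  assumes "weak_primitive v w"
  shows "continuous_on S v"
proof -
  have "continuous (at x) v" for x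
  proof -
    have "w integrable_on {x - 1..x + 1}"
      using assms by (auto simp: weak_primitive_def absolutely_integrable_on_def)
    then have c: "continuous_on {x - 1..x + 1} (\<lambda>t. v (x - 1) + integral {x - 1..t} w)"
      by (intro continuous_intros indefinite_integral_continuous_1)
    have eq: "v t = v (x - 1) + integral {x - 1..t} w" if "t \<in> {x - 1..x + 1}" for t
    proof -
      have "v t - v (x - 1) = integral {x - 1..t} w"
        using assms that by (auto simp: weak_primitive_def)
      then show ?thesis by (simp add: algebra_simps)
    qed
    have "continuous_on {x - 1..x + 1} v"
      by (rule continuous_on_eq[OF c]) (erule eq[symmetric])
    then have "continuous_on {x - 1<..<x + 1} v"
      by (rule continuous_on_subset) auto
    then show ?thesis
      by (simp add: continuous_on_eq_continuous_at)
  qed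
  then show ?thesis by (simp add: continuous_at_imp_continuous_on)
qed

text \<open>On a short interval both \<open>F (v t) - F (v s)\<close> and the integral of
  \<open>g (v r) \<bullet> w r\<close> differ from \<open>g (v s) \<bullet> (v t - v s)\<close> by
  at most \<open>e / 2\<close> times the integral of \<open>norm w\<close>. Hence the difference of
  the two sides meets the hypothesis of \<open>eq_by_subdivision\<close>.\<close>

lemma weak_primitive_chain_rule:
  fixes F :: "complex \<Rightarrow> real"
  assumes vw: "weak_primitive v w"
    and der: "\<And>z. (F has_derivative (\<lambda>h. g z \<bullet> h)) (at z)"
    and g: "continuous_on UNIV g"
    and ab: "a \<le> b"
  shows "(\<lambda>t. g (v t) \<bullet> w t) absolutely_integrable_on {a..b}"
    and "F (v b) - F (v a) = integral {a..b} (\<lambda>t. g (v t) \<bullet> w t)"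
proof -
  have w: "w absolutely_integrable_on {s..t}" for s t
    using vw by (simp add: weak_primitive_def)
  have vd: "v t - v s = integral {s..t} w" if "s \<le> t" for s t
    using vw that by (simp add: weak_primitive_def)
  have v: "continuous_on S v" for S using vw by (rule weak_primitive_continuous)
  have gv: "continuous_on S (\<lambda>t. g (v t))" for S
    by (rule continuous_on_compose2[OF g v]) auto
  have ai: "(\<lambda>t. f t \<bullet> w t) absolutely_integrable_on {s..t}" if "continuous_on {s..t} f" for f s t
  proof (rule absolutely_integrable_bounded_measurable_product[of "(\<bullet>)" f])
    show "bilinear ((\<bullet>) :: complex \<Rightarrow> _)"
      using bilinear_conv_bounded_bilinear bounded_bilinear_inner by blast
    show "f \<in> borel_measurable (lebesgue_on {s..t})"
      using that by (intro continuous_imp_measurable_on_sets_lebesgue) auto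
    show "bounded (f ` {s..t})"
      using that compact_continuous_image compact_imp_bounded compact_Icc by blast
  qed (use w in auto)
  show "(\<lambda>t. g (v t) \<bullet> w t) absolutely_integrable_on {a..b}" by (rule ai[OF gv])
  define I where "I t = integral {a..t} (\<lambda>t. g (v t) \<bullet> w t)" for t
  define G where "G t = integral {a..t} (\<lambda>t. norm (w t))" for t
  have int: "(\<lambda>t. g (v t) \<bullet> w t) integrable_on {s..t}" "(\<lambda>t. norm (w t)) integrable_on {s..t}"
     "w integrable_on {s..t}" for s t
    using ai[OF gv] w by (auto simp: absolutely_integrable_on_def)
  have diff: "I t - I s = integral {s..t} (\<lambda>t. g (v t) \<bullet> w t)"
       "G t - G s = integral {s..t} (\<lambda>t. norm (w t))" if "a \<le> s" "s \<le> t" for s t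
    using Henstock_Kurzweil_Integration.integral_combine[OF that int(1)]
          Henstock_Kurzweil_Integration.integral_combine[OF that int(2)]
    unfolding I_def G_def by linarith+
  have "bounded (v ` {a..b})"
    using compact_continuous_image compact_imp_bounded compact_Icc v by blast
  then obtain R where R: "\<And>t. t \<in> {a..b} \<Longrightarrow> norm (v t) \<le> R"
    unfolding bounded_iff by blast
  have cs: "norm (x \<bullet> h - y \<bullet> h) \<le> c * norm h" if "dist x y \<le> c" for x y h :: complex and c
  proof -
    have "norm (x \<bullet> h - y \<bullet> h) \<le> norm (x - y) * norm h"
      using Cauchy_Schwarz_ineq2[of "x - y" h] by (simp add: inner_diff_left)
    also have "\<dots> \<le> c * norm h" using that by (intro mult_right_mono) (auto simp: dist_norm)
    finally show ?thesis .
  qed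
  have "F (v b) - I b = F (v a) - I a"
  proof (rule eq_by_subdivision[OF ab, of "\<lambda>t. F (v t) - I t" G])
    fix e :: real assume e: "e > 0"
    have "uniformly_continuous_on (cball 0 R) g"
      by (rule compact_uniformly_continuous) (auto intro: continuous_on_subset[OF g])
    from uniformly_continuous_onE[OF this half_gt_zero[OF e]] obtain d1 where d1: "d1 > 0"
      and gu': "\<And>x y. x \<in> cball 0 R \<Longrightarrow> y \<in> cball 0 R \<Longrightarrow> dist y x < d1 \<Longrightarrow> dist (g y) (g x) < e / 2"
      by blast
    have gu: "dist (g y) (g x) < e / 2" if "norm x \<le> R" "norm y \<le> R" "dist y x < d1" for x y
      using gu'[of x y] that by simp
    have "uniformly_continuous_on {a..b} v"
      by (rule compact_uniformly_continuous[OF v]) auto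
    from uniformly_continuous_onE[OF this d1] obtain d2 where d2: "d2 > 0"
      and vu: "\<And>x y. x \<in> {a..b} \<Longrightarrow> y \<in> {a..b} \<Longrightarrow> dist y x < d2 \<Longrightarrow> dist (v y) (v x) < d1"
      by blast
    have "\<bar>(F (v t) - I t) - (F (v s) - I s)\<bar> \<le> e * (G t - G s)"
      if st: "a \<le> s" "s \<le> t" "t \<le> b" "t - s < d2" for s t
    proof -
      have near: "dist (v r) (v s) < d1" if "r \<in> {s..t}" for r
        using vu[of s r] that st by (auto simp: dist_real_def)
      have nG: "norm (v t - v s) \<le> G t - G s"
        using vd[OF st(2)] integral_norm_bound_integral[OF int(3)[of s t] int(2)[of s t]] diff[OF st(1,2)] by auto
      \<comment> \<open>The segment from \<open>v s\<close> to \<open>v t\<close> stays in the ball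
        of radius \<open>R\<close> by convexity and within \<open>d1\<close> of \<open>v s\<close>,
        where \<open>g\<close> varies by less than \<open>e / 2\<close>.\<close>
      have "norm (F (v t) - F (v s) - g (v s) \<bullet> (v t - v s)) \<le> norm (v t - v s) * (e / 2)"
      proof (rule differentiable_bound_linearization[where S="closed_segment (v s) (v t)" and f'="\<lambda>z h. g z \<bullet> h"])
        show "\<And>r. r \<in> {0..1} \<Longrightarrow> v s + r *\<^sub>R (v t - v s) \<in> closed_segment (v s) (v t)"
          unfolding in_segment by (auto simp: algebra_simps intro!: exI)
        show "\<And>x. x \<in> closed_segment (v s) (v t) \<Longrightarrow> (F has_derivative (\<bullet>) (g x)) (at x within closed_segment (v s) (v t))"
          using der has_derivative_at_withinI by blast
        fix x assume x: "x \<in> closed_segment (v s) (v t)"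
        have "dist x (v s) \<le> dist (v t) (v s)"
          using segment_bound(1)[OF x] by (simp add: dist_norm)
        then have "dist x (v s) < d1" using near[of t] st by auto
        moreover have "norm x \<le> R"
        proof -
          have "closed_segment (v s) (v t) \<subseteq> cball 0 R"
            by (rule closed_segment_subset) (use R st in auto)
          then show ?thesis using x by auto
        qed
        ultimately have "dist (g x) (g (v s)) < e / 2" using R[of s] st by (intro gu) auto
        then show "onorm ((\<bullet>) (g x) - (\<bullet>) (g (v s))) \<le> e / 2"
          unfolding fun_diff_def by (intro onorm_le cs) auto
      qed auto
      also have "\<dots> \<le> (e / 2) * (G t - G s)" using nG e by (simp add: mult.commute mult_left_mono)
      finally have 1: "\<bar>F (v t) - F (v s) - g (v s) \<bullet> (v t - v s)\<bar> \<le> (e / 2) * (G t - G s)" by simp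
      have ci: "(\<lambda>r. g (v s) \<bullet> w r) integrable_on {s..t}"
        using ai[of s t "\<lambda>_. g (v s)"] by (auto simp: absolutely_integrable_on_def)
      have "g (v s) \<bullet> (v t - v s) = integral {s..t} (\<lambda>r. g (v s) \<bullet> w r)"
        using integral_linear[OF int(3)[of s t] bounded_linear_inner_right[of "g (v s)"]] vd[OF st(2)] by (simp add: o_def)
      then have "I t - I s - g (v s) \<bullet> (v t - v s) = integral {s..t} (\<lambda>r. g (v r) \<bullet> w r - g (v s) \<bullet> w r)"
        using diff[OF st(1,2)] by (simp add: Henstock_Kurzweil_Integration.integral_diff int ci)
      also have "norm \<dots> \<le> integral {s..t} (\<lambda>r. (e/2) * norm (w r))"
      proof (rule integral_norm_bound_integral)
        fix r assume r: "r \<in> {s..t}"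
        have "dist (g (v r)) (g (v s)) < e / 2" using R st r near by (intro gu) auto
        then show "norm (g (v r) \<bullet> w r - g (v s) \<bullet> w r) \<le> (e/2) * norm (w r)"
          by (intro cs) auto
      qed (use int ci integrable_cmul[OF int(2), of "e/2" s t] in \<open>auto intro!: Henstock_Kurzweil_Integration.integrable_diff\<close>)
      also have "\<dots> = (e / 2) * (G t - G s)" using diff[OF st(1,2)] by simp
      finally have 2: "\<bar>I t - I s - g (v s) \<bullet> (v t - v s)\<bar> \<le> (e / 2) * (G t - G s)" by simp
      show ?thesis using 1 2 by linarith
    qed
    then show "\<exists>\<delta>>0. \<forall>s t. a \<le> s \<and> s \<le> t \<and> t \<le> b \<and> t - s < \<delta> \<longrightarrow>
        \<bar>(F (v t) - I t) - (F (v s) - I s)\<bar> \<le> e * (G t - G s)" using d2 by blast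
  qed
  then show "F (v b) - F (v a) = integral {a..b} (\<lambda>t. g (v t) \<bullet> w t)"
    by (simp add: I_def)
qed

section \<open>Profiles with square-integrable derivative and their decay at infinity\<close>

lemma integrable_small_value_at_top:
  fixes f :: "real \<Rightarrow> real"
  assumes f: "integrable lborel f" and e: "e > 0"
  shows "\<exists>t\<ge>T. \<bar>f t\<bar> < e"
proof (rule ccontr)
  assume "\<not> ?thesis"
  then have *: "\<And>t. t \<ge> T \<Longrightarrow> \<bar>f t\<bar> \<ge> e" by force
  have "integrable lborel (\<lambda>t. indicator {T..} t * e)"
    by (rule Bochner_Integration.integrable_bound[OF f]) (use * e in \<open>auto split: split_indicator\<close>)
  then have "integrable lborel (indicator {T..} :: real \<Rightarrow> real)" using e by simp
  then have "emeasure lborel {T..} < \<infinity>" by (simp add: integrable_indicator_iff)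
  moreover have "emeasure lborel {T..} \<ge> ennreal (real n)" for n
  proof -
    have "emeasure lborel {T..T+real n} \<le> emeasure lborel {T..}" by (rule emeasure_mono) auto
    then show ?thesis by simp
  qed
  moreover obtain n where "emeasure lborel {T..} < of_nat n"
    using ennreal_Ex_less_of_nat calculation(1) by auto
  ultimately show False
    unfolding ennreal_of_nat_eq_real_of_nat by (meson leD)
qed

lemma integrable_inner_L2:
  fixes f g :: "'a \<Rightarrow> 'b::{euclidean_space}"
  assumes [measurable]: "f \<in> borel_measurable M" "g \<in> borel_measurable M"
    and f: "integrable M (\<lambda>x. (norm (f x))\<^sup>2)" and g: "integrable M (\<lambda>x. (norm (g x))\<^sup>2)"
  shows "integrable M (\<lambda>x. f x \<bullet> g x)"
proof (rule Bochner_Integration.integrable_bound)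
  show "integrable M (\<lambda>x. (norm (f x))\<^sup>2 + (norm (g x))\<^sup>2)" using f g by simp
  show "AE x in M. norm (f x \<bullet> g x) \<le> norm ((norm (f x))\<^sup>2 + (norm (g x))\<^sup>2)"
  proof (intro AE_I2)
    fix x
    have "\<bar>f x \<bullet> g x\<bar> \<le> norm (f x) * norm (g x)" by (rule Cauchy_Schwarz_ineq2)
    also have "\<dots> \<le> (norm (f x))\<^sup>2 + (norm (g x))\<^sup>2"
      using sum_squares_bound[of "norm (f x)" "norm (g x)"]
            mult_nonneg_nonneg[OF norm_ge_zero norm_ge_zero, of "f x" "g x"] by linarith
    finally show "norm (f x \<bullet> g x) \<le> norm ((norm (f x))\<^sup>2 + (norm (g x))\<^sup>2)" by simp
  qed
qed simp

lemma integrable_exp_abs: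
  assumes c: "c > (0::real)"
  shows "integrable lborel (\<lambda>t. exp (- c * \<bar>t\<bar>))"
proof -
  have "(\<lambda>t. exp (- c * t)) absolutely_integrable_on {0..}"
    using has_integral_exp_minus_to_infinity[OF c, of 0]
    by (intro nonnegative_absolutely_integrable_1) (auto simp: has_integral_integrable)
  then have "integrable lebesgue (\<lambda>t. indicator {0..} t * exp (- c * t))"
    by (simp add: set_integrable_def)
  then have 1: "integrable lborel (\<lambda>t. indicator {0..} t * exp (- c * t))"
    by (subst (asm) integrable_completion) auto
  have "integrable lborel (\<lambda>t. indicator {0..} (-t) * exp (- c * -t))"
    using lborel_integrable_real_affine[OF 1, of "-1" 0] by simp
  from Bochner_Integration.integrable_add[OF 1 this] show ?thesis
    by (rule Bochner_Integration.integrable_bound) (auto split: split_indicator)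
qed

lemma integral_Icc_tendsto:
  fixes f :: "real \<Rightarrow> real"
  assumes f: "integrable lborel f"
  shows "((\<lambda>T. integral {0..T} f) \<longlongrightarrow> (LINT t|lborel. indicator {0..} t * f t)) at_top"
    and "((\<lambda>T. integral {-T..0} f) \<longlongrightarrow> (LINT t|lborel. indicator {..0} t * f t)) at_top"
proof -
  have [measurable]: "f \<in> borel_measurable borel" using f by auto
  have eq: "integral {a..b} f = (LINT t|lborel. indicator {a..b} t * f t)" for a b
  proof -
    have "set_integrable lborel {a..b} f"
      unfolding set_integrable_def by (rule integrable_mult_indicator[OF _ f]) simp
    from set_borel_integral_eq_integral(2)[OF this] show ?thesis
      by (simp add: set_lebesgue_integral_def)
  qed
  have ev: "eventually (\<lambda>T. P T) at_top" if "\<And>T. T \<ge> \<bar>t\<bar> \<Longrightarrow> P T" for P and t :: real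
    using that eventually_ge_at_top[of "\<bar>t\<bar>"] by (rule eventually_mono[rotated])
  show "((\<lambda>T. integral {0..T} f) \<longlongrightarrow> (LINT t|lborel. indicator {0..} t * f t)) at_top"
    unfolding eq
  proof (rule integral_dominated_convergence_at_top[where w="\<lambda>t. \<bar>f t\<bar>"])
    show "\<forall>\<^sub>F T in at_top. AE x in lborel. norm (indicator {0..T} x * f x) \<le> \<bar>f x\<bar>"
      by (auto intro!: always_eventually AE_I2 split: split_indicator)
    show "AE x in lborel. ((\<lambda>T. indicator {0..T} x * f x) \<longlongrightarrow> indicator {0..} x * f x) at_top"
      by (intro AE_I2 tendsto_eventually, rule_tac t=x in ev) (auto split: split_indicator)
  qed (use f in auto)
  show "((\<lambda>T. integral {-T..0} f) \<longlongrightarrow> (LINT t|lborel. indicator {..0} t * f t)) at_top"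
    unfolding eq
  proof (rule integral_dominated_convergence_at_top[where w="\<lambda>t. \<bar>f t\<bar>"])
    show "\<forall>\<^sub>F T in at_top. AE x in lborel. norm (indicator {-T..0} x * f x) \<le> \<bar>f x\<bar>"
      by (auto intro!: always_eventually AE_I2 split: split_indicator)
    show "AE x in lborel. ((\<lambda>T. indicator {-T..0} x * f x) \<longlongrightarrow> indicator {..0} x * f x) at_top"
      by (intro AE_I2 tendsto_eventually, rule_tac t=x in ev) (auto split: split_indicator)
  qed (use f in auto)
qed

lemma tendsto_integrable_eq_0:
  fixes f :: "real \<Rightarrow> real"
  assumes "integrable lborel f" "(f \<longlongrightarrow> L) at_top"
  shows "L = 0"
proof (rule ccontr)
  assume "L \<noteq> 0"
  then have "eventually (\<lambda>t. dist (f t) L < \<bar>L\<bar> / 2) at_top"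
    using assms(2) by (intro tendstoD) auto
  then obtain T where T: "\<And>t. t \<ge> T \<Longrightarrow> \<bar>f t - L\<bar> < \<bar>L\<bar> / 2"
    by (auto simp: eventually_at_top_linorder dist_real_def)
  obtain t where "t \<ge> T" "\<bar>f t\<bar> < \<bar>L\<bar> / 2"
    using integrable_small_value_at_top[OF assms(1), of "\<bar>L\<bar>/2" T] \<open>L \<noteq> 0\<close> by auto
  with T[of t] show False by linarith
qed

definition H1_line :: "(real \<Rightarrow> complex) \<Rightarrow> (real \<Rightarrow> complex) \<Rightarrow> bool" where
  "H1_line v w \<longleftrightarrow> weak_primitive v w \<and> w \<in> borel_measurable borel \<and>
     integrable lborel (\<lambda>t. (norm (w t))\<^sup>2) \<and> integrable lborel (\<lambda>t. (norm (v t))\<^sup>2)"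

lemma H1_lineD:
  assumes "H1_line v w"
  shows "weak_primitive v w" "w \<in> borel_measurable borel" "v \<in> borel_measurable borel"
    "integrable lborel (\<lambda>t. (norm (w t))\<^sup>2)" "integrable lborel (\<lambda>t. (norm (v t))\<^sup>2)"
    "continuous_on S v" "integrable lborel (\<lambda>t. v t \<bullet> w t)"
proof -
  show *: "weak_primitive v w" "w \<in> borel_measurable borel"
    "integrable lborel (\<lambda>t. (norm (w t))\<^sup>2)" "integrable lborel (\<lambda>t. (norm (v t))\<^sup>2)"
    using assms by (auto simp: H1_line_def)
  show "continuous_on S v" using *(1) by (rule weak_primitive_continuous)
  show v: "v \<in> borel_measurable borel"
    using weak_primitive_continuous[OF *(1)] by (rule borel_measurable_continuous_onI)
  show "integrable lborel (\<lambda>t. v t \<bullet> w t)"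
    by (rule integrable_inner_L2) (use * v in auto)
qed

lemma weak_primitive_reflect:
  assumes "weak_primitive v w"
  shows "weak_primitive (\<lambda>t. v (- t)) (\<lambda>t. - w (- t))"
  unfolding weak_primitive_def
proof (intro conjI allI impI)
  fix a b :: real
  have "w absolutely_integrable_on {-b..-a}" using assms by (simp add: weak_primitive_def)
  then have "(\<lambda>t. w (- t)) absolutely_integrable_on {a..b}"
    using absolutely_integrable_reflect_real[where f=w and a="-b" and b="-a"] by simp
  then show "(\<lambda>t. - w (- t)) absolutely_integrable_on {a..b}"
    using set_integrable_mult_right[of "-1::complex" lebesgue "{a..b}" "\<lambda>t. w (- t)"] by simp
next
  fix s t :: real assume "s \<le> t"
  then have "v (-s) - v (-t) = integral {-t..-s} w" using assms by (simp add: weak_primitive_def)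
  also have "\<dots> = integral {s..t} (\<lambda>t. w (- t))"
    using Henstock_Kurzweil_Integration.integral_reflect_real[where a="-t" and b="-s" and f=w] by simp
  finally show "v (- t) - v (- s) = integral {s..t} (\<lambda>t. - w (- t))"
    by (simp add: algebra_simps)
qed

lemma H1_line_reflect:
  assumes "H1_line v w"
  shows "H1_line (\<lambda>t. v (- t)) (\<lambda>t. - w (- t))"
proof -
  have [measurable]: "w \<in> borel_measurable borel" using assms by (simp add: H1_line_def)
  have "integrable lborel (\<lambda>t. f (- t))" if "integrable lborel f" for f :: "real \<Rightarrow> real"
    using lborel_integrable_real_affine[OF that, of "-1" 0] by simp
  from this[OF H1_lineD(4)[OF assms]] this[OF H1_lineD(5)[OF assms]] show ?thesis
    using weak_primitive_reflect[OF H1_lineD(1)[OF assms]] by (simp add: H1_line_def)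
qed

lemma weak_primitive_shift_scale:
  assumes "weak_primitive v w"
  shows "weak_primitive (\<lambda>t. c * v (t + r)) (\<lambda>t. c * w (t + r))"
  unfolding weak_primitive_def
proof (intro conjI allI impI)
  fix a b :: real
  have "w absolutely_integrable_on {a + r..b + r}"
    using assms by (simp add: weak_primitive_def)
  then have "(\<lambda>t. w (t + r)) absolutely_integrable_on {a..b}"
    unfolding absolutely_integrable_on_def
    using integrable_on_shift_cbox[of w r a b] integrable_on_shift_cbox[of "\<lambda>t. norm (w t)" r a b]
    by (simp add: comp_def add.commute)
  then show "(\<lambda>t. c * w (t + r)) absolutely_integrable_on {a..b}"
    by (rule set_integrable_mult_right)
next
  fix s t :: real assume "s \<le> t"
  then have "v (t + r) - v (s + r) = integral {s + r..t + r} w" using assms by (simp add: weak_primitive_def)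
  also have "\<dots> = integral {s..t} (\<lambda>t. w (t + r))"
    using integral_shift_Icc_real[of s t w r] by (simp add: comp_def add.commute)
  finally show "c * v (t + r) - c * v (s + r) = integral {s..t} (\<lambda>t. c * w (t + r))"
    by (simp flip: right_diff_distrib)
qed

lemma H1_line_shift_scale:
  assumes "H1_line v w"
  shows "H1_line (\<lambda>t. c * v (t + r)) (\<lambda>t. c * w (t + r))"
proof -
  have [measurable]: "w \<in> borel_measurable borel" using assms by (simp add: H1_line_def)
  have "integrable lborel (\<lambda>t. f (t + r))" if "integrable lborel f" for f :: "real \<Rightarrow> real"
    using lborel_integrable_real_affine[OF that, of 1 r] by (simp add: add.commute)
  from this[OF H1_lineD(4)[OF assms]] this[OF H1_lineD(5)[OF assms]] show ?thesis
    using weak_primitive_shift_scale[OF H1_lineD(1)[OF assms]]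
    by (simp add: H1_line_def norm_mult power_mult_distrib)
qed

text \<open>At 0 only a one-sided derivative of \<open>H\<close> is available; it suffices because
  \<open>z \<bullet> z\<close> takes its values in \<open>{0..}\<close>. The factor 1/2 absorbs the
  2 that comes from differentiating the square.\<close>

lemma has_derivative_norm_square_compose:
  fixes H :: "real \<Rightarrow> real"
  assumes "\<And>\<rho>. \<rho> \<ge> 0 \<Longrightarrow> (H has_real_derivative k \<rho> / 2) (at \<rho> within {0..})"
  shows "((\<lambda>z::complex. H ((norm z)\<^sup>2)) has_derivative (\<lambda>h. (k ((norm z)\<^sup>2) *\<^sub>R z) \<bullet> h)) (at z)"
proof -
  have "((\<lambda>z::complex. z \<bullet> z) has_derivative (\<lambda>h. z \<bullet> h + h \<bullet> z)) (at z)"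
    by (rule has_derivative_inner[OF has_derivative_ident has_derivative_ident])
  moreover have "(H has_derivative (*) (k (z \<bullet> z) / 2)) (at (z \<bullet> z) within range (\<lambda>z::complex. z \<bullet> z))"
    using assms[of "z \<bullet> z"] unfolding has_field_derivative_def
    by (rule has_derivative_subset) auto
  ultimately have "((\<lambda>z::complex. H (z \<bullet> z)) has_derivative (\<lambda>h. k (z \<bullet> z) / 2 * (z \<bullet> h + h \<bullet> z))) (at z)"
    by (rule has_derivative_in_compose)
  then show ?thesis
    by (simp add: power2_norm_eq_inner inner_commute)
qed

text \<open>The derivative \<open>2 * (v t \<bullet> w t)\<close> of the squared norm is integrable,
  so the squared norm has a limit, and an integrable function can only converge to 0.\<close>

lemma H1_line_tendsto_0_at_top:
  assumes vw: "H1_line v w"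
  shows "((\<lambda>t. (norm (v t))\<^sup>2) \<longlongrightarrow> 0) at_top"
proof -
  note D = H1_lineD[OF vw]
  have der: "((\<lambda>z::complex. (norm z)\<^sup>2) has_derivative (\<lambda>h. (2 *\<^sub>R z) \<bullet> h)) (at z)" for z
    using has_derivative_norm_square_compose[of "\<lambda>\<rho>. \<rho>" "\<lambda>_. 2"] by simp
  have int: "integrable lborel (\<lambda>t. (2 *\<^sub>R v t) \<bullet> w t)" using D(7) by simp
  have "((\<lambda>T. (norm (v 0))\<^sup>2 + integral {0..T} (\<lambda>t. (2 *\<^sub>R v t) \<bullet> w t)) \<longlongrightarrow>
        (norm (v 0))\<^sup>2 + (LINT t|lborel. indicator {0..} t * ((2 *\<^sub>R v t) \<bullet> w t))) at_top"
    by (intro tendsto_add tendsto_const integral_Icc_tendsto(1) int)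
  moreover have "eventually (\<lambda>T. (norm (v 0))\<^sup>2 + integral {0..T} (\<lambda>t. (2 *\<^sub>R v t) \<bullet> w t) = (norm (v T))\<^sup>2) at_top"
    using eventually_ge_at_top[of 0]
  proof eventually_elim
    case (elim T)
    have "(norm (v T))\<^sup>2 - (norm (v 0))\<^sup>2 = integral {0..T} (\<lambda>t. (2 *\<^sub>R v t) \<bullet> w t)"
      by (rule weak_primitive_chain_rule(2)[OF D(1) der _ elim]) (intro continuous_intros)
    then show ?case by simp
  qed
  ultimately have lim: "((\<lambda>t. (norm (v t))\<^sup>2) \<longlongrightarrow>
     (norm (v 0))\<^sup>2 + (LINT t|lborel. indicator {0..} t * ((2 *\<^sub>R v t) \<bullet> w t))) at_top"
    by (rule Lim_transform_eventually)
  from tendsto_integrable_eq_0[OF D(5) this] lim show ?thesis by simp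
qed

section \<open>The calibration inequality and its equality case\<close>

lemma tendsto_within_nonneg:
  fixes H :: "real \<Rightarrow> real"
  assumes "(H \<longlongrightarrow> H 0) (at 0 within {0..})" "(f \<longlongrightarrow> 0) F" "\<And>x. f x \<ge> 0"
  shows "((\<lambda>x. H (f x)) \<longlongrightarrow> H 0) F"
proof -
  have "continuous (at 0 within {0..}) H" using assms(1) by (simp add: continuous_within)
  then show ?thesis
    using assms(2,3) by (auto intro!: continuous_within_tendsto_compose'[where S="{0..}" and f=H])
qed

text \<open>Off 0, \<open>Y t \<bullet> w t\<close> is plus or minus the derivative of
  \<open>H ((norm (v t))\<^sup>2)\<close>, which vanishes at both ends. The change of sign at 0
  makes the two half lines contribute the same amount instead of cancelling. The bound
  \<open>k \<rho> \<le> 1\<close> gives \<open>norm (Y t) \<le> norm (v t)\<close> and with it all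
  integrability.\<close>

lemma calibration:
  fixes k H :: "real \<Rightarrow> real"
  assumes vw: "H1_line v w"
    and k: "continuous_on UNIV k" "\<And>\<rho>. 0 \<le> k \<rho>" "\<And>\<rho>. k \<rho> \<le> 1"
    and H: "\<And>\<rho>. \<rho> \<ge> 0 \<Longrightarrow> (H has_real_derivative k \<rho> / 2) (at \<rho> within {0..})" "H 0 = 0"
  defines "Y \<equiv> \<lambda>t. (sgn t * k ((norm (v t))\<^sup>2)) *\<^sub>R v t"
  shows "Y \<in> borel_measurable borel" "integrable lborel (\<lambda>t. (norm (Y t))\<^sup>2)"
    "integrable lborel (\<lambda>t. Y t \<bullet> w t)" "(LINT t|lborel. Y t \<bullet> w t) = - 2 * H ((norm (v 0))\<^sup>2)"
proof -
  note D = H1_lineD[OF vw]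
  note [measurable] = D(2,3)
  have [measurable]: "k \<in> borel_measurable borel" using k(1) by (rule borel_measurable_continuous_onI)
  show Ym[measurable]: "Y \<in> borel_measurable borel" unfolding Y_def by measurable
  define g where "g z = k ((norm z)\<^sup>2) *\<^sub>R z" for z :: complex
  define f where "f t = g (v t) \<bullet> w t" for t
  have le: "norm (Y t) \<le> norm (v t)" "norm (g (v t)) \<le> norm (v t)" for t
    using k(2,3)[of "(norm (v t))\<^sup>2"]
    by (auto simp: Y_def g_def abs_mult abs_sgn_eq intro!: mult_left_le_one_le)
  have [measurable]: "(\<lambda>t. g (v t)) \<in> borel_measurable borel" unfolding g_def by measurable
  show Y2: "integrable lborel (\<lambda>t. (norm (Y t))\<^sup>2)"
    by (rule Bochner_Integration.integrable_bound[OF D(5)]) (use le in \<open>auto intro!: power_mono\<close>)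
  have g2: "integrable lborel (\<lambda>t. (norm (g (v t)))\<^sup>2)"
    by (rule Bochner_Integration.integrable_bound[OF D(5)]) (use le in \<open>auto intro!: power_mono\<close>)
  have fi: "integrable lborel f"
    unfolding f_def by (rule integrable_inner_L2) (use g2 D in auto)
  have der: "((\<lambda>z::complex. H ((norm z)\<^sup>2)) has_derivative (\<lambda>h. g z \<bullet> h)) (at z)" for z
    unfolding g_def by (rule has_derivative_norm_square_compose[OF H(1)])
  have gc: "continuous_on UNIV g"
    unfolding g_def by (intro continuous_intros continuous_on_compose2[OF k(1)]) auto
  have ftc: "H ((norm (v b))\<^sup>2) - H ((norm (v a))\<^sup>2) = integral {a..b} f" if "a \<le> b" for a b
    unfolding f_def by (rule weak_primitive_chain_rule(2)[OF D(1) der gc that])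
  have Hlim: "((\<lambda>T. H ((norm (u T))\<^sup>2)) \<longlongrightarrow> 0) at_top" if "((\<lambda>t. (norm (u t))\<^sup>2) \<longlongrightarrow> 0) at_top" for u :: "real \<Rightarrow> complex"
  proof -
    have "continuous (at 0 within {0..}) H"
      using H(1)[of 0] by (auto intro!: DERIV_continuous)
    then have "(H \<longlongrightarrow> H 0) (at 0 within {0..})" by (simp add: continuous_within)
    from tendsto_within_nonneg[OF this that] show ?thesis using H(2) by simp
  qed
  have r: "((\<lambda>T. integral {0..T} f) \<longlongrightarrow> - H ((norm (v 0))\<^sup>2)) at_top"
  proof (rule Lim_transform_eventually)
    show "((\<lambda>T. H ((norm (v T))\<^sup>2) - H ((norm (v 0))\<^sup>2)) \<longlongrightarrow> - H ((norm (v 0))\<^sup>2)) at_top"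
      using tendsto_diff[OF Hlim[OF H1_line_tendsto_0_at_top[OF vw]] tendsto_const] by simp
    show "\<forall>\<^sub>F T in at_top. H ((norm (v T))\<^sup>2) - H ((norm (v 0))\<^sup>2) = integral {0..T} f"
      using eventually_ge_at_top[of 0] by eventually_elim (rule ftc)
  qed
  have l: "((\<lambda>T. integral {-T..0} f) \<longlongrightarrow> H ((norm (v 0))\<^sup>2)) at_top"
  proof (rule Lim_transform_eventually)
    show "((\<lambda>T. H ((norm (v 0))\<^sup>2) - H ((norm (v (-T)))\<^sup>2)) \<longlongrightarrow> H ((norm (v 0))\<^sup>2)) at_top"
      using tendsto_diff[OF tendsto_const Hlim[OF H1_line_tendsto_0_at_top[OF H1_line_reflect[OF vw]]]] by simp
    show "\<forall>\<^sub>F T in at_top. H ((norm (v 0))\<^sup>2) - H ((norm (v (-T)))\<^sup>2) = integral {-T..0} f"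
      using eventually_ge_at_top[of 0] by eventually_elim (rule ftc, simp)
  qed
  have R: "(LINT t|lborel. indicator {0..} t * f t) = - H ((norm (v 0))\<^sup>2)"
    using tendsto_unique[OF _ integral_Icc_tendsto(1)[OF fi] r] by simp
  have L: "(LINT t|lborel. indicator {..0} t * f t) = H ((norm (v 0))\<^sup>2)"
    using tendsto_unique[OF _ integral_Icc_tendsto(2)[OF fi] l] by simp
  have eq: "Y t \<bullet> w t = indicator {0..} t * f t - indicator {..0} t * f t" for t
    by (auto simp: Y_def f_def g_def sgn_real_def split: split_indicator)
  have ii: "integrable lborel (\<lambda>t. indicator {0..} t * f t)" "integrable lborel (\<lambda>t. indicator {..0} t * f t)"
    using fi by (auto intro!: integrable_real_mult_indicator simp: mult.commute[of "indicator _ _"])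
  show "integrable lborel (\<lambda>t. Y t \<bullet> w t)" unfolding eq using ii by simp
  show "(LINT t|lborel. Y t \<bullet> w t) = - 2 * H ((norm (v 0))\<^sup>2)"
    unfolding eq using ii by (simp add: R L)
qed

text \<open>The integral of \<open>(norm (w t + l *\<^sub>R Y t))\<^sup>2\<close> is a nonnegative
  quadratic polynomial in \<open>l\<close>, and its discriminant gives the inequality. In the
  equality case the polynomial vanishes at \<open>l = 2 * h / E\<close>, so the integrand vanishes
  almost everywhere.\<close>

lemma calibration_inequality:
  fixes k H :: "real \<Rightarrow> real"
  assumes vw: "H1_line v w"
    and k: "continuous_on UNIV k" "\<And>\<rho>. 0 \<le> k \<rho>" "\<And>\<rho>. k \<rho> \<le> 1"
    and H: "\<And>\<rho>. \<rho> \<ge> 0 \<Longrightarrow> (H has_real_derivative k \<rho> / 2) (at \<rho> within {0..})" "H 0 = 0"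
  defines "Y \<equiv> \<lambda>t. (sgn t * k ((norm (v t))\<^sup>2)) *\<^sub>R v t"
    and "A \<equiv> LINT t|lborel. (norm (w t))\<^sup>2"
  defines "E \<equiv> LINT t|lborel. (norm (Y t))\<^sup>2"
    and "h \<equiv> H ((norm (v 0))\<^sup>2)"
  shows "4 * h\<^sup>2 \<le> A * E"
    and "A * E = 4 * h\<^sup>2 \<Longrightarrow> E > 0 \<Longrightarrow> AE t in lborel. w t = - ((2 * h / E) *\<^sub>R Y t)"
proof -
  have cal: "Y \<in> borel_measurable borel" "integrable lborel (\<lambda>t. (norm (Y t))\<^sup>2)"
    "integrable lborel (\<lambda>t. Y t \<bullet> w t)" "(LINT t|lborel. Y t \<bullet> w t) = - 2 * H ((norm (v 0))\<^sup>2)"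
    using calibration[OF vw k H] unfolding Y_def by simp_all
  note D = H1_lineD[OF vw]
  note [measurable] = D(2,3) cal(1)
  have expand: "(norm (w t + l *\<^sub>R Y t))\<^sup>2 = (norm (w t))\<^sup>2 + 2 * l * (Y t \<bullet> w t) + l\<^sup>2 * (norm (Y t))\<^sup>2" for t l
    by (simp only: power2_norm_eq_inner)
       (simp add: inner_add_left inner_add_right inner_commute power2_eq_square algebra_simps)
  have int: "integrable lborel (\<lambda>t. (norm (w t + l *\<^sub>R Y t))\<^sup>2)" for l
    unfolding expand using D(4) cal(2,3) by simp
  have val: "(LINT t|lborel. (norm (w t + l *\<^sub>R Y t))\<^sup>2) = A - 4 * l * h + l\<^sup>2 * E" for l
  proof -
    have "(LINT t|lborel. (norm (w t + l *\<^sub>R Y t))\<^sup>2) = A + 2 * l * (LINT t|lborel. Y t \<bullet> w t) + l\<^sup>2 * E"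
      unfolding expand A_def E_def using D(4) cal(2,3) by simp
    then show ?thesis unfolding cal(4) h_def by simp
  qed
  have nn: "A - 4 * l * h + l\<^sup>2 * E \<ge> 0" for l
    unfolding val[symmetric] by (rule Bochner_Integration.integral_nonneg) simp
  have E0: "E \<ge> 0" and A0: "A \<ge> 0" unfolding E_def A_def by (rule Bochner_Integration.integral_nonneg; simp)+
  show "4 * h\<^sup>2 \<le> A * E"
  proof (cases "E = 0")
    case True
    have "h = 0"
    proof (rule ccontr)
      assume "h \<noteq> 0"
      \<comment> \<open>For \<open>E = 0\<close> the polynomial is affine in \<open>l\<close>; at
        this value of \<open>l\<close> it would equal -1.\<close>
      with nn[of "(A + 1) / (4 * h)"] True A0 show False by simp
    qed
    with True show ?thesis by simp
  next
    case False
    then have "E > 0" using E0 by simp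
    with nn[of "2 * h / E"] show ?thesis by (simp add: field_simps power2_eq_square)
  qed
  assume eq: "A * E = 4 * h\<^sup>2" and E: "E > 0"
  have "A - 4 * (2 * h / E) * h + (2 * h / E)\<^sup>2 * E = 0"
    using eq E by (simp add: field_simps power2_eq_square)
  then have "(LINT t|lborel. (norm (w t + (2 * h / E) *\<^sub>R Y t))\<^sup>2) = 0" by (simp only: val)
  then have "AE t in lborel. (norm (w t + (2 * h / E) *\<^sub>R Y t))\<^sup>2 = 0"
    by (subst (asm) integral_nonneg_eq_0_iff_AE[OF int]) auto
  then show "AE t in lborel. w t = - ((2 * h / E) *\<^sub>R Y t)"
    by eventually_elim (simp add: eq_neg_iff_add_eq_0)
qed

text \<open>Integrating factor. The coefficient \<open>a\<close> is a function of time, but it may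
  be built from \<open>v\<close> itself: along a fixed solution the nonlinear equation of the
  soliton case is linear, and \<open>v t\<close> is seen to be a positive real multiple of
  \<open>v 0\<close>.\<close>

lemma weak_primitive_linear_ode:
  fixes a :: "real \<Rightarrow> real"
  assumes vw: "weak_primitive v w" and a: "continuous_on UNIV a"
    and w: "AE t in lborel. t > 0 \<longrightarrow> w t = - (a t *\<^sub>R v t)" and t: "t \<ge> 0"
  shows "v t = exp (- integral {0..t} a) *\<^sub>R v 0"
proof -
  have vc: "continuous_on S v" for S using vw by (rule weak_primitive_continuous)
  have ac: "continuous_on S a" for S using a by (rule continuous_on_subset) simp
  have vi: "v s = v 0 + integral {0..s} (\<lambda>r. - (a r *\<^sub>R v r))" if "s \<ge> 0" for s
  proof -
    obtain N where N: "\<And>r. r \<notin> N \<Longrightarrow> r > 0 \<longrightarrow> w r = - (a r *\<^sub>R v r)" "N \<in> null_sets lborel"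
      using AE_E3[OF w] by auto
    have "negligible N"
      using N(2) by (simp add: negligible_iff_null_sets null_sets_completionI)
    then have "negligible (insert 0 N)" by simp
    \<comment> \<open>The point 0 joins the exceptional set because the equation is assumed for
      positive times only. Under the integral \<open>w\<close> is replaced by a continuous function,
      which makes \<open>v\<close> continuously differentiable on the half line.\<close>
    then have "integral {0..s} w = integral {0..s} (\<lambda>r. - (a r *\<^sub>R v r))"
    proof (rule integral_spike)
      fix r assume "r \<in> {0..s} - insert 0 N"
      then show "- (a r *\<^sub>R v r) = w r" using N(1)[of r] by auto
    qed
    moreover have "v s - v 0 = integral {0..s} w"
      using vw that by (simp add: weak_primitive_def)
    ultimately show ?thesis by (simp add: algebra_simps)
  qed
  define m where "m s = exp (integral {0..s} a) *\<^sub>R (v 0 + integral {0..s} (\<lambda>r. - (a r *\<^sub>R v r)))" for s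
  have "(m has_vector_derivative 0) (at s within {0..t})" if s: "s \<in> {0..t}" for s
  proof -
    have 1: "((\<lambda>s. exp (integral {0..s} a)) has_real_derivative exp (integral {0..s} a) * a s) (at s within {0..t})"
      by (rule DERIV_chain2[OF DERIV_exp integral_has_real_derivative[OF ac s]])
    have 2: "((\<lambda>s. v 0 + integral {0..s} (\<lambda>r. - (a r *\<^sub>R v r))) has_vector_derivative - (a s *\<^sub>R v s)) (at s within {0..t})"
    proof -
      have "continuous_on {0..t} (\<lambda>r. - (a r *\<^sub>R v r))" by (intro continuous_intros vc ac)
      from has_vector_derivative_add[OF has_vector_derivative_const[of "v 0"] integral_has_vector_derivative[OF this s]]
      show ?thesis by (simp only: add_0_left)
    qed
    have "(m has_vector_derivative (exp (integral {0..s} a) *\<^sub>R (- (a s *\<^sub>R v s)) +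
       (exp (integral {0..s} a) * a s) *\<^sub>R (v 0 + integral {0..s} (\<lambda>r. - (a r *\<^sub>R v r))))) (at s within {0..t})"
      unfolding m_def by (rule has_vector_derivative_scaleR[OF 1 2])
    also have "v 0 + integral {0..s} (\<lambda>r. - (a r *\<^sub>R v r)) = v s" by (rule vi[symmetric]) (use s in auto)
    finally show ?thesis by simp
  qed
  from has_vector_derivative_zero_constant[OF convex_real_interval(5) this]
  obtain c where "\<And>s. s \<in> {0..t} \<Longrightarrow> m s = c" by blast
  then have "m t = m 0" using t by simp
  moreover have "m t = exp (integral {0..t} a) *\<^sub>R v t" unfolding m_def vi[OF t, symmetric] ..
  moreover have "m 0 = v 0" by (simp add: m_def)
  ultimately have "exp (integral {0..t} a) *\<^sub>R v t = v 0" by simp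
  then have "exp (- integral {0..t} a) *\<^sub>R (exp (integral {0..t} a) *\<^sub>R v t) = exp (- integral {0..t} a) *\<^sub>R v 0" by simp
  then show ?thesis by (simp flip: exp_add)
qed

section \<open>The soliton: its equation, comparison with it, and its integrals\<close>

text \<open>Scaled so that the maximum and the exponential decay rate at infinity are both
  1.\<close>

definition soliton :: "real \<Rightarrow> real \<Rightarrow> real" where
  "soliton \<kappa> t = cosh (t / \<kappa>) powr (- \<kappa>)"

text \<open>\<open>soliton_coeff \<kappa> (s\<^sup>2)\<close> is the relative decay rate of the soliton where its value is \<open>s\<close>; the truncations by
  \<open>max 0\<close> make it continuous on the whole line.\<close>

definition soliton_coeff :: "real \<Rightarrow> real \<Rightarrow> real" where
  "soliton_coeff \<kappa> \<rho> = sqrt (max 0 (1 - (max 0 \<rho>) powr (1 / \<kappa>)))"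

lemma soliton_coeff_props:
  assumes "\<kappa> > 0"
  shows "continuous_on UNIV (soliton_coeff \<kappa>)" "0 \<le> soliton_coeff \<kappa> \<rho>" "soliton_coeff \<kappa> \<rho> \<le> 1"
proof -
  show "continuous_on UNIV (soliton_coeff \<kappa>)"
    unfolding soliton_coeff_def using assms
    by (intro continuous_intros continuous_on_powr') auto
qed (auto simp: soliton_coeff_def)

lemma soliton_pos: "soliton \<kappa> t > 0"
  by (simp add: soliton_def)

lemma soliton_le_1:
  assumes "\<kappa> > 0" shows "soliton \<kappa> t \<le> 1"
  using powr_mono2'[of "-\<kappa>" 1 "cosh (t / \<kappa>)"] assms cosh_real_ge_1[of "t / \<kappa>"] by (simp add: soliton_def)

lemma soliton_0 [simp]: "soliton \<kappa> 0 = 1"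
  by (simp add: soliton_def)

lemma soliton_deriv:
  assumes "\<kappa> > 0"
  shows "(soliton \<kappa> has_real_derivative - tanh (t / \<kappa>) * soliton \<kappa> t) (at t)"
proof -
  have "((\<lambda>t. cosh (t / \<kappa>)) has_real_derivative sinh (t / \<kappa>) / \<kappa>) (at t)"
    using assms by (auto intro!: derivative_eq_intros)
  from DERIV_chain2[OF has_real_derivative_powr[of "cosh (t / \<kappa>)" "-\<kappa>"] this]
  have "(soliton \<kappa> has_real_derivative - \<kappa> * cosh (t / \<kappa>) powr (- \<kappa> - 1) * (sinh (t / \<kappa>) / \<kappa>)) (at t)"
    unfolding soliton_def[abs_def] by simp
  moreover have "cosh (t / \<kappa>) powr (- \<kappa> - 1) = soliton \<kappa> t / cosh (t / \<kappa>)"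
    by (simp add: soliton_def powr_diff)
  ultimately show ?thesis using assms by (simp add: tanh_def mult.commute)
qed

lemma soliton_powr_tanh:
  assumes "\<kappa> > 0"
  shows "soliton \<kappa> t powr (2 / \<kappa>) = 1 - (tanh (t / \<kappa>))\<^sup>2"
proof -
  have "soliton \<kappa> t powr (2 / \<kappa>) = cosh (t / \<kappa>) powr (- 2)"
    using assms by (simp add: soliton_def powr_powr)
  also have "\<dots> = 1 / (cosh (t / \<kappa>))\<^sup>2" by (simp add: powr_minus_divide)
  also have "\<dots> = 1 - (tanh (t / \<kappa>))\<^sup>2"
  proof -
    have "(cosh (t / \<kappa>))\<^sup>2 - (sinh (t / \<kappa>))\<^sup>2 = 1" by (simp add: cosh_square_eq)
    moreover have "(cosh (t / \<kappa>))\<^sup>2 \<noteq> 0" by simp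
    ultimately show ?thesis
      by (simp only: tanh_def power_divide diff_divide_eq_iff eq_divide_eq) (simp add: divide_eq_eq field_simps)
  qed
  finally show ?thesis .
qed

lemma soliton_le_exp:
  assumes "\<kappa> > 0"
  shows "soliton \<kappa> t \<le> 2 powr \<kappa> * exp (- \<bar>t\<bar>)"
proof -
  have "exp \<bar>t / \<kappa>\<bar> / 2 \<le> cosh (t / \<kappa>)"
  proof (cases "t \<ge> 0")
    case True
    then have "\<bar>t / \<kappa>\<bar> = t / \<kappa>" using assms by simp
    then show ?thesis by (simp add: cosh_def)
  next
    case False
    then have "\<bar>t / \<kappa>\<bar> = - (t / \<kappa>)" using assms by (simp add: field_simps abs_if divide_less_0_iff)
    then show ?thesis by (simp add: cosh_def)
  qed
  then have "soliton \<kappa> t \<le> (exp \<bar>t / \<kappa>\<bar> / 2) powr (- \<kappa>)"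
    unfolding soliton_def using assms by (intro powr_mono2') auto
  also have "\<dots> = 2 powr \<kappa> * exp (- \<bar>t\<bar>)"
    using assms by (simp add: powr_divide exp_powr_real powr_minus exp_minus field_simps)
  finally show ?thesis .
qed

lemma soliton_measurable [measurable]: "\<kappa> > 0 \<Longrightarrow> soliton \<kappa> \<in> borel_measurable borel"
  by (intro borel_measurable_continuous_onI continuous_at_imp_continuous_on ballI DERIV_isCont[OF soliton_deriv])

lemma integrable_soliton_powr:
  assumes "\<kappa> > 0" "q > 0"
  shows "integrable lborel (\<lambda>t. soliton \<kappa> t powr q)"
proof (rule Bochner_Integration.integrable_bound)
  show "integrable lborel (\<lambda>t. (2 powr \<kappa>) powr q * exp (- q * \<bar>t\<bar>))"
    using integrable_exp_abs[OF assms(2)] by simp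
  show "(\<lambda>t. soliton \<kappa> t powr q) \<in> borel_measurable lborel" using assms by measurable
  show "AE x in lborel. norm (soliton \<kappa> x powr q) \<le> norm ((2 powr \<kappa>) powr q * exp (- q * \<bar>x\<bar>))"
  proof (intro AE_I2)
    fix x
    have "soliton \<kappa> x powr q \<le> (2 powr \<kappa> * exp (- \<bar>x\<bar>)) powr q"
      using assms soliton_le_exp[OF assms(1)] soliton_pos[of \<kappa> x] by (intro powr_mono2) (auto simp: less_imp_le)
    also have "\<dots> = (2 powr \<kappa>) powr q * exp (- q * \<bar>x\<bar>)"
      by (simp add: powr_mult exp_powr_real mult.commute)
    finally show "norm (soliton \<kappa> x powr q) \<le> norm ((2 powr \<kappa>) powr q * exp (- q * \<bar>x\<bar>))" by simp
  qed
qed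

lemma weak_primitive_C1:
  assumes "\<And>t. (v has_vector_derivative w t) (at t)" "continuous_on UNIV w"
  shows "weak_primitive v w"
  unfolding weak_primitive_def
proof (intro conjI allI impI)
  show "w absolutely_integrable_on {a..b}" for a b
    using assms(2) by (intro absolutely_integrable_continuous_real) (auto intro: continuous_on_subset)
  fix s t :: real assume "s \<le> t"
  have "(w has_integral v t - v s) {s..t}"
    using \<open>s \<le> t\<close> by (rule fundamental_theorem_of_calculus) (rule has_vector_derivative_at_within[OF assms(1)])
  then show "v t - v s = integral {s..t} w" by (rule integral_unique[symmetric])
qed

text \<open>The equation is not Lipschitz where \<open>m\<close> equals 1, so \<open>m\<close> may
  stay at 1 for a while. After the last time \<open>s0\<close> at which it is 1,
  \<open>arcosh (m s powr (-1 / \<kappa>))\<close> grows with constant slope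
  \<open>l / \<kappa>\<close>. Thus \<open>m\<close> is the soliton delayed by \<open>s0\<close>,
  which lies above the soliton without delay.\<close>

lemma soliton_comparison:
  fixes m :: "real \<Rightarrow> real"
  assumes \<kappa>: "\<kappa> > 0" and l: "l > 0"
    and m: "\<And>t. t \<ge> 0 \<Longrightarrow> (m has_real_derivative - l * soliton_coeff \<kappa> ((m t)\<^sup>2) * m t) (at t within {0..})"
    and m0: "m 0 = 1" and mb: "\<And>t. t \<ge> 0 \<Longrightarrow> 0 < m t" "\<And>t. t \<ge> 0 \<Longrightarrow> m t \<le> 1"
    and t: "t \<ge> 0"
  shows "soliton \<kappa> (l * t) \<le> m t"
proof (cases "m t = 1")
  case True then show ?thesis using soliton_le_1[OF \<kappa>] by simp
next
  case False
  have mc: "continuous_on S m" if "S \<subseteq> {0..}" for S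
    by (rule continuous_on_subset[OF _ that])
       (auto simp: continuous_on_eq_continuous_within intro!: DERIV_continuous m)
  define Z where "Z = {s \<in> {0..t}. m s = 1}"
  have "closed Z" unfolding Z_def
    by (rule continuous_closed_preimage_constant[OF mc]) auto
  moreover have "bounded Z"
    by (rule bounded_subset[of "{0..t}"]) (auto simp: Z_def)
  ultimately have "compact Z" by (simp add: compact_eq_bounded_closed)
  moreover have "0 \<in> Z" using t m0 by (simp add: Z_def)
  ultimately obtain s0 where s0: "s0 \<in> Z" "\<And>s. s \<in> Z \<Longrightarrow> s \<le> s0"
    using compact_attains_sup[of Z] by blast
  then have s0': "0 \<le> s0" "s0 < t" "m s0 = 1" using False by (auto simp: Z_def order_le_less)
  have lt1: "m s < 1" if "s0 < s" "s \<le> t" for s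
  proof -
    have "m s \<noteq> 1" using s0(2)[of s] that s0' by (auto simp: Z_def)
    then show ?thesis using mb(2)[of s] that s0' by simp
  qed
  \<comment> \<open>If \<open>m s\<close> were \<open>soliton \<kappa> (l * s)\<close>, this would
    be \<open>cosh (l * s / \<kappa>)\<close>; its \<open>arcosh\<close> therefore serves as a
    clock.\<close>
  define \<zeta> where "\<zeta> s = m s powr (-1 / \<kappa>)" for s
  have \<zeta>1: "\<zeta> s \<ge> 1" if "s \<ge> 0" for s
    using powr_mono2'[of "-1/\<kappa>" "m s" 1] \<kappa> mb[OF that] by (simp add: \<zeta>_def)
  have \<zeta>2: "\<zeta> s > 1" if "s0 < s" "s \<le> t" for s
    using powr_less_mono2_neg[of "-1/\<kappa>" "m s" 1] \<kappa> lt1[OF that] mb(1)[of s] that s0' by (simp add: \<zeta>_def)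
  \<comment> \<open>\<open>arcosh\<close> has no derivative at 1, the value of
    \<open>\<zeta>\<close> at \<open>s0\<close>. The mean value theorem needs the derivative in the
    open interval only, where it is the constant \<open>l / \<kappa>\<close>.\<close>
  have "arcosh (\<zeta> t) - arcosh (\<zeta> s0) = (l / \<kappa>) * (t - s0)"
  proof (rule mvt[OF s0'(2), of "\<lambda>s. arcosh (\<zeta> s)" "\<lambda>_ h. (l / \<kappa>) * h"])
    show "continuous_on {s0..t} (\<lambda>s. arcosh (\<zeta> s))"
    proof (intro continuous_on_arcosh')
      show "continuous_on {s0..t} \<zeta>"
        unfolding \<zeta>_def
      proof (intro continuous_on_powr mc continuous_intros ballI)
        show "{s0..t} \<subseteq> {0..}" using s0' by auto
        show "m x \<noteq> 0" if "x \<in> {s0..t}" for x using mb(1)[of x] that s0' by auto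
      qed
    qed (use \<zeta>1 s0' in auto)
    fix s assume s: "s0 < s" "s < t"
    have ms: "0 < m s" "m s < 1" using mb(1)[of s] lt1[of s] s s0' by auto
    have "at s within {0..} = at s" using s s0' by (intro at_within_interior) auto
    then have dm: "(m has_real_derivative - l * soliton_coeff \<kappa> ((m s)\<^sup>2) * m s) (at s)"
      using m[of s] s s0' by simp
    have "(\<zeta> has_real_derivative (-1/\<kappa>) * m s powr (-1/\<kappa> - 1) * (- l * soliton_coeff \<kappa> ((m s)\<^sup>2) * m s)) (at s)"
      unfolding \<zeta>_def by (rule DERIV_chain2[OF has_real_derivative_powr[OF ms(1)] dm])
    also have "(-1/\<kappa>) * m s powr (-1/\<kappa> - 1) * (- l * soliton_coeff \<kappa> ((m s)\<^sup>2) * m s) =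
       l / \<kappa> * (\<zeta> s * soliton_coeff \<kappa> ((m s)\<^sup>2))"
    proof -
      have "(-1/\<kappa>) * X * (- l * c * y) = l / \<kappa> * ((X * y) * c)" for X c y :: real by simp
      moreover have "m s powr (-1/\<kappa> - 1) * m s = \<zeta> s"
        using ms powr_add[of "m s" "-1/\<kappa> - 1" 1] by (simp add: \<zeta>_def)
      ultimately show ?thesis by simp
    qed
    also have "\<zeta> s * soliton_coeff \<kappa> ((m s)\<^sup>2) = sqrt ((\<zeta> s)\<^sup>2 - 1)"
    proof -
      have e: "((m s)\<^sup>2) powr (1 / \<kappa>) = 1 / (\<zeta> s)\<^sup>2"
      proof -
        have "((m s)\<^sup>2) powr (1 / \<kappa>) = m s powr (2 / \<kappa>)"
          using ms by (simp add: powr_powr flip: powr_numeral)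
        moreover have "(\<zeta> s)\<^sup>2 = m s powr (- (2 / \<kappa>))"
          using ms unfolding \<zeta>_def by (simp add: power2_eq_square flip: powr_add)
        ultimately show ?thesis by (simp add: powr_minus_divide)
      qed
      have "1 / (\<zeta> s)\<^sup>2 \<le> 1" using \<zeta>2[of s] s by simp
      then have "soliton_coeff \<kappa> ((m s)\<^sup>2) = sqrt (1 - 1 / (\<zeta> s)\<^sup>2)"
        by (simp add: soliton_coeff_def e)
      moreover have "\<zeta> s = sqrt ((\<zeta> s)\<^sup>2)" using \<zeta>2[of s] s by simp
      ultimately have "\<zeta> s * soliton_coeff \<kappa> ((m s)\<^sup>2) = sqrt ((\<zeta> s)\<^sup>2 * (1 - 1 / (\<zeta> s)\<^sup>2))"
        by (simp add: real_sqrt_mult del: real_sqrt_abs)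
      also have "(\<zeta> s)\<^sup>2 * (1 - 1 / (\<zeta> s)\<^sup>2) = (\<zeta> s)\<^sup>2 - 1" using \<zeta>2[of s] s by (simp add: field_simps)
      finally show ?thesis .
    qed
    finally have d\<zeta>: "(\<zeta> has_real_derivative l / \<kappa> * sqrt ((\<zeta> s)\<^sup>2 - 1)) (at s)" .
    have "\<zeta> s > 1" using \<zeta>2[of s] s by simp
    then have "(\<zeta> s)\<^sup>2 > 1" by (simp add: one_less_power)
    then have nz: "sqrt ((\<zeta> s)\<^sup>2 - 1) \<noteq> 0" by simp
    have "((\<lambda>s. arcosh (\<zeta> s)) has_real_derivative 1 / sqrt ((\<zeta> s)\<^sup>2 - 1) * (l / \<kappa> * sqrt ((\<zeta> s)\<^sup>2 - 1))) (at s)"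
      by (rule DERIV_chain2[OF arcosh_real_has_field_derivative d\<zeta>]) fact
    then have "((\<lambda>s. arcosh (\<zeta> s)) has_real_derivative l / \<kappa>) (at s)" using nz by simp
    then show "((\<lambda>s. arcosh (\<zeta> s)) has_derivative (\<lambda>h. (l / \<kappa>) * h)) (at s)"
      unfolding has_field_derivative_def .
  qed simp
  moreover have "\<zeta> s0 = 1" using s0' by (simp add: \<zeta>_def)
  ultimately have "arcosh (\<zeta> t) = (l / \<kappa>) * (t - s0)" by auto
  also have "\<dots> \<le> l * t / \<kappa>" using s0' l \<kappa> by (simp add: field_simps)
  finally have "cosh (arcosh (\<zeta> t)) \<le> cosh (l * t / \<kappa>)"
    using \<zeta>1[OF t] l t \<kappa> by (subst cosh_real_nonneg_le_iff) auto
  then have "\<zeta> t \<le> cosh (l * t / \<kappa>)" using \<zeta>1[OF t] by simp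
  then have "soliton \<kappa> (l * t) \<le> \<zeta> t powr (- \<kappa>)"
    unfolding soliton_def using \<zeta>1[OF t] \<kappa> by (intro powr_mono2') auto
  also have "\<dots> = m t" using mb(1)[OF t] \<kappa> by (simp add: \<zeta>_def powr_powr)
  finally show ?thesis .
qed

lemma half_antiderivative:
  fixes k :: "real \<Rightarrow> real"
  assumes k: "continuous_on UNIV k"
  obtains H where "\<And>\<rho>. \<rho> \<ge> 0 \<Longrightarrow> (H has_real_derivative k \<rho> / 2) (at \<rho> within {0..})" "H 0 = 0"
proof (rule that[of "\<lambda>\<rho>. integral {0..\<rho>} (\<lambda>r. k r / 2)"])
  fix \<rho> :: real assume \<rho>: "\<rho> \<ge> 0"
  have c: "continuous_on {0..\<rho> + 1} (\<lambda>r. k r / 2)"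
    by (intro continuous_intros continuous_on_subset[OF k]) auto
  have "((\<lambda>\<rho>. integral {0..\<rho>} (\<lambda>r. k r / 2)) has_real_derivative k \<rho> / 2) (at \<rho> within {0..\<rho> + 1})"
    by (rule integral_has_real_derivative[OF c]) (use \<rho> in auto)
  also have "at \<rho> within {0..\<rho> + 1} = at \<rho> within {0..}"
    by (rule at_within_nhd[of _ "{..<\<rho> + 1}"]) (use \<rho> in auto)
  finally show "((\<lambda>\<rho>. integral {0..\<rho>} (\<lambda>r. k r / 2)) has_real_derivative k \<rho> / 2) (at \<rho> within {0..})" .
qed simp

lemma integral_deriv_eq_0:
  fixes q q' :: "real \<Rightarrow> real"
  assumes d: "\<And>t. (q has_real_derivative q' t) (at t)" and i: "integrable lborel q'"
    and lim: "(q \<longlongrightarrow> 0) at_top" "((\<lambda>t. q (- t)) \<longlongrightarrow> 0) at_top"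
  shows "(LINT t|lborel. q' t) = 0"
proof -
  have [measurable]: "q' \<in> borel_measurable borel" using i by auto
  have ftc: "integral {a..b} q' = q b - q a" if "a \<le> b" for a b
  proof (rule integral_unique, rule fundamental_theorem_of_calculus[OF that])
    fix x assume "x \<in> {a..b}"
    show "(q has_vector_derivative q' x) (at x within {a..b})"
      using DERIV_subset[OF d[of x], of "{a..b}"]
      by (simp add: has_real_derivative_iff_has_vector_derivative)
  qed
  have r: "((\<lambda>T. integral {0..T} q') \<longlongrightarrow> 0 - q 0) at_top"
  proof (rule Lim_transform_eventually)
    show "((\<lambda>T. q T - q 0) \<longlongrightarrow> 0 - q 0) at_top" by (intro tendsto_diff lim tendsto_const)
    show "\<forall>\<^sub>F T in at_top. q T - q 0 = integral {0..T} q'"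
      using eventually_ge_at_top[of 0] by eventually_elim (rule ftc[symmetric])
  qed
  have l: "((\<lambda>T. integral {-T..0} q') \<longlongrightarrow> q 0 - 0) at_top"
  proof (rule Lim_transform_eventually)
    show "((\<lambda>T. q 0 - q (- T)) \<longlongrightarrow> q 0 - 0) at_top" by (intro tendsto_diff lim tendsto_const)
    show "\<forall>\<^sub>F T in at_top. q 0 - q (- T) = integral {-T..0} q'"
      using eventually_ge_at_top[of 0] by eventually_elim (rule ftc[symmetric], simp)
  qed
  have R: "(LINT t|lborel. indicator {0..} t * q' t) = 0 - q 0"
    by (rule tendsto_unique[OF _ integral_Icc_tendsto(1)[OF i] r]) simp
  have L: "(LINT t|lborel. indicator {..0} t * q' t) = q 0 - 0"
    by (rule tendsto_unique[OF _ integral_Icc_tendsto(2)[OF i] l]) simp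
  have ii: "integrable lborel (\<lambda>t. indicator {0..} t * q' t)" "integrable lborel (\<lambda>t. indicator {..0} t * q' t)"
    using i by (auto intro!: integrable_real_mult_indicator simp: mult.commute[of "indicator _ _"])
  have "AE t in lborel. q' t = indicator {0..} t * q' t + indicator {..0} t * q' t"
    using AE_lborel_singleton[of 0] by eventually_elim (auto split: split_indicator)
  then have "(LINT t|lborel. q' t) = (LINT t|lborel. indicator {0..} t * q' t + indicator {..0} t * q' t)"
    by (intro integral_cong_AE) auto
  also have "\<dots> = 0" using ii by (simp add: R L)
  finally show ?thesis .
qed

lemma soliton_continuous: "\<kappa> > 0 \<Longrightarrow> continuous_on S (soliton \<kappa>)"
  by (intro continuous_at_imp_continuous_on ballI DERIV_isCont[OF soliton_deriv])

lemma tanh_quot_continuous: "\<kappa> > 0 \<Longrightarrow> continuous_on S (\<lambda>t::real. tanh (t / \<kappa>))"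
  by (intro continuous_on_tanh continuous_intros) auto

lemma abs_tanh_le_1: "\<bar>tanh (x::real)\<bar> \<le> 1"
  using tanh_real_bounds[of x] by (simp add: abs_le_iff)

lemma integrable_soliton_squares:
  assumes "\<kappa> > 0"
  shows "integrable lborel (\<lambda>t. (soliton \<kappa> t)\<^sup>2)" "integrable lborel (\<lambda>t. (tanh (t / \<kappa>) * soliton \<kappa> t)\<^sup>2)"
proof -
  show 1: "integrable lborel (\<lambda>t. (soliton \<kappa> t)\<^sup>2)"
    using integrable_soliton_powr[OF assms, of 2] soliton_pos by (simp add: less_imp_le)
  have [measurable]: "(\<lambda>t. tanh (t / \<kappa>)) \<in> borel_measurable borel" "soliton \<kappa> \<in> borel_measurable borel"
    by (intro borel_measurable_continuous_onI tanh_quot_continuous soliton_continuous assms)+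
  show "integrable lborel (\<lambda>t. (tanh (t / \<kappa>) * soliton \<kappa> t)\<^sup>2)"
  proof (rule Bochner_Integration.integrable_bound[OF 1])
    show "AE x in lborel. norm ((tanh (x / \<kappa>) * soliton \<kappa> x)\<^sup>2) \<le> norm ((soliton \<kappa> x)\<^sup>2)"
    proof (intro AE_I2)
      fix x
      have "(tanh (x / \<kappa>))\<^sup>2 \<le> 1" using abs_tanh_le_1 by (simp add: abs_square_le_1)
      then have "(tanh (x / \<kappa>))\<^sup>2 * (soliton \<kappa> x)\<^sup>2 \<le> 1 * (soliton \<kappa> x)\<^sup>2" by (intro mult_right_mono) auto
      then show "norm ((tanh (x / \<kappa>) * soliton \<kappa> x)\<^sup>2) \<le> norm ((soliton \<kappa> x)\<^sup>2)"
        by (simp add: power_mult_distrib)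
    qed
  qed measurable
qed

lemma soliton_H1_line:
  assumes "\<kappa> > 0"
  shows "H1_line (\<lambda>t. of_real (soliton \<kappa> t)) (\<lambda>t. of_real (- tanh (t / \<kappa>) * soliton \<kappa> t))"
proof -
  have c: "continuous_on UNIV (\<lambda>t. complex_of_real (- tanh (t / \<kappa>) * soliton \<kappa> t))"
    by (intro continuous_on_of_real continuous_on_mult continuous_on_minus tanh_quot_continuous soliton_continuous assms)
  have "weak_primitive (\<lambda>t. of_real (soliton \<kappa> t)) (\<lambda>t. of_real (- tanh (t / \<kappa>) * soliton \<kappa> t))"
  proof (rule weak_primitive_C1[OF _ c])
    fix t
    show "((\<lambda>t. complex_of_real (soliton \<kappa> t)) has_vector_derivative of_real (- tanh (t / \<kappa>) * soliton \<kappa> t)) (at t)"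
      by (rule bounded_linear.has_vector_derivative[OF bounded_linear_of_real])
         (rule soliton_deriv[OF assms, unfolded has_real_derivative_iff_has_vector_derivative])
  qed
  with borel_measurable_continuous_onI[OF c] integrable_soliton_squares[OF assms] show ?thesis
    by (simp add: H1_line_def norm_mult flip: power_mult_distrib) (simp add: power_mult_distrib)
qed

definition soliton_energy :: "real \<Rightarrow> real" where
  "soliton_energy \<kappa> = (LINT t|lborel. (tanh (t / \<kappa>) * soliton \<kappa> t)\<^sup>2)"

definition soliton_mass :: "real \<Rightarrow> real" where
  "soliton_mass \<kappa> = (LINT t|lborel. (soliton \<kappa> t)\<^sup>2)"

definition soliton_potential :: "real \<Rightarrow> real" where
  "soliton_potential \<kappa> = (LINT t|lborel. soliton \<kappa> t powr (2 + 2 / \<kappa>))"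

text \<open>The first integral of the soliton equation: the squared derivative is the square of the
  soliton minus its power of order \<open>2 + 2 / \<kappa>\<close>.\<close>

lemma soliton_powr_split:
  assumes "\<kappa> > 0"
  shows "soliton \<kappa> t powr (2 + 2 / \<kappa>) = (soliton \<kappa> t)\<^sup>2 - (tanh (t / \<kappa>) * soliton \<kappa> t)\<^sup>2"
proof -
  have "soliton \<kappa> t powr (2 + 2 / \<kappa>) = (soliton \<kappa> t)\<^sup>2 * soliton \<kappa> t powr (2 / \<kappa>)"
    using soliton_pos[of \<kappa> t] by (simp add: powr_add)
  then show ?thesis by (simp only: soliton_powr_tanh[OF assms]) (simp add: power_mult_distrib algebra_simps)
qed

lemma soliton_mass_eq:
  assumes "\<kappa> > 0"
  shows "soliton_mass \<kappa> = soliton_energy \<kappa> + soliton_potential \<kappa>"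
  unfolding soliton_mass_def soliton_energy_def soliton_potential_def soliton_powr_split[OF assms]
  using integrable_soliton_squares[OF assms] by simp

lemma soliton_square_tendsto_0:
  assumes "\<kappa> > 0"
  shows "((\<lambda>t. (soliton \<kappa> t)\<^sup>2) \<longlongrightarrow> 0) at_top"
  using H1_line_tendsto_0_at_top[OF soliton_H1_line[OF assms]] by simp

lemma soliton_even: "soliton \<kappa> (- t) = soliton \<kappa> t"
  by (simp add: soliton_def)

text \<open>A virial identity. Up to sign,
  \<open>tanh (t / \<kappa>) * (soliton \<kappa> t)\<^sup>2\<close> is the soliton times its
  derivative; it vanishes at both ends, so its derivative integrates to 0. Together with
  \<open>soliton_mass_eq\<close> this fixes all ratios of the three integrals without computing any
  of them.\<close>

lemma soliton_potential_eq:
  assumes \<kappa>: "\<kappa> > 0"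
  shows "soliton_potential \<kappa> = 2 * \<kappa> * soliton_energy \<kappa>"
proof -
  define q' where "q' t = soliton \<kappa> t powr (2 + 2 / \<kappa>) / \<kappa> - 2 * (tanh (t / \<kappa>) * soliton \<kappa> t)\<^sup>2" for t
  have pi: "integrable lborel (\<lambda>t. soliton \<kappa> t powr (2 + 2 / \<kappa>))"
    using \<kappa> by (intro integrable_soliton_powr) (auto intro: add_pos_pos)
  have i: "integrable lborel q'"
    unfolding q'_def using pi integrable_soliton_squares[OF \<kappa>] by simp
  have "(LINT t|lborel. q' t) = 0"
  proof (rule integral_deriv_eq_0[OF _ i, of "\<lambda>t. tanh (t / \<kappa>) * (soliton \<kappa> t)\<^sup>2"])
    fix t
    have d1: "((\<lambda>t. tanh (t / \<kappa>)) has_real_derivative (1 - (tanh (t / \<kappa>))\<^sup>2) * (1 / \<kappa>)) (at t)"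
      using \<kappa> by (auto intro!: derivative_eq_intros)
    have d2: "((\<lambda>t. (soliton \<kappa> t)\<^sup>2) has_real_derivative 2 * soliton \<kappa> t * (- tanh (t / \<kappa>) * soliton \<kappa> t)) (at t)"
      using DERIV_power[OF soliton_deriv[OF \<kappa>], of 2 t] by (simp add: mult_ac)
    have "((\<lambda>t. tanh (t / \<kappa>) * (soliton \<kappa> t)\<^sup>2) has_real_derivative
        (1 - (tanh (t / \<kappa>))\<^sup>2) * (1 / \<kappa>) * (soliton \<kappa> t)\<^sup>2 + 2 * soliton \<kappa> t * (- tanh (t / \<kappa>) * soliton \<kappa> t) * tanh (t / \<kappa>)) (at t)"
      by (rule DERIV_mult[OF d1 d2])
    also have "(1 - (tanh (t / \<kappa>))\<^sup>2) * (1 / \<kappa>) * (soliton \<kappa> t)\<^sup>2 + 2 * soliton \<kappa> t * (- tanh (t / \<kappa>) * soliton \<kappa> t) * tanh (t / \<kappa>) = q' t"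
      unfolding q'_def soliton_powr_split[OF \<kappa>] using \<kappa> by (simp add: field_simps power2_eq_square)
    finally show "((\<lambda>t. tanh (t / \<kappa>) * (soliton \<kappa> t)\<^sup>2) has_real_derivative q' t) (at t)" .
  next
    have le: "\<bar>tanh (t / \<kappa>) * (soliton \<kappa> t)\<^sup>2\<bar> \<le> (soliton \<kappa> t)\<^sup>2" for t
      using mult_right_mono[OF abs_tanh_le_1, of "(soliton \<kappa> t)\<^sup>2" "t / \<kappa>"] by (simp add: abs_mult)
    show "((\<lambda>t. tanh (t / \<kappa>) * (soliton \<kappa> t)\<^sup>2) \<longlongrightarrow> 0) at_top"
      by (rule Lim_null_comparison[OF _ soliton_square_tendsto_0[OF \<kappa>]]) (use le in \<open>auto intro!: always_eventually\<close>)
    have "norm (tanh (- t / \<kappa>) * (soliton \<kappa> (- t))\<^sup>2) \<le> (soliton \<kappa> t)\<^sup>2" for t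
      using le[of "-t"] by (simp add: soliton_even)
    then show "((\<lambda>t. tanh (- t / \<kappa>) * (soliton \<kappa> (- t))\<^sup>2) \<longlongrightarrow> 0) at_top"
      by (intro Lim_null_comparison[OF _ soliton_square_tendsto_0[OF \<kappa>]] always_eventually allI)
  qed
  moreover have "(LINT t|lborel. q' t) = soliton_potential \<kappa> / \<kappa> - 2 * soliton_energy \<kappa>"
    unfolding q'_def soliton_potential_def soliton_energy_def
    using pi integrable_soliton_squares[OF \<kappa>] by simp
  ultimately show ?thesis using \<kappa> by (simp add: field_simps)
qed

lemma soliton_energy_pos:
  assumes \<kappa>: "\<kappa> > 0"
  shows "soliton_energy \<kappa> > 0" "soliton_mass \<kappa> > 0" "soliton_potential \<kappa> > 0"
proof -
  have "soliton_mass \<kappa> \<noteq> 0"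
  proof
    assume "soliton_mass \<kappa> = 0"
    then have "AE t in lborel. (soliton \<kappa> t)\<^sup>2 = 0"
      unfolding soliton_mass_def by (subst (asm) integral_nonneg_eq_0_iff_AE[OF integrable_soliton_squares(1)[OF \<kappa>]]) auto
    then have "AE t in (lborel :: real measure). False"
      by eventually_elim (use soliton_pos[THEN less_imp_neq] in auto)
    then show False by (simp add: eventually_False ae_filter_eq_bot_iff)
  qed
  moreover have "soliton_mass \<kappa> \<ge> 0" unfolding soliton_mass_def by (rule Bochner_Integration.integral_nonneg) simp
  ultimately show m: "soliton_mass \<kappa> > 0" by simp
  have "soliton_mass \<kappa> = (1 + 2 * \<kappa>) * soliton_energy \<kappa>"
    using soliton_mass_eq[OF \<kappa>] soliton_potential_eq[OF \<kappa>] by (simp add: algebra_simps)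
  then show e: "soliton_energy \<kappa> > 0" using m \<kappa> by (simp add: zero_less_mult_iff)
  show "soliton_potential \<kappa> > 0" using e \<kappa> soliton_potential_eq[OF \<kappa>] by simp
qed

lemma soliton_coeff_soliton:
  assumes "\<kappa> > 0"
  shows "soliton_coeff \<kappa> ((soliton \<kappa> t)\<^sup>2) = \<bar>tanh (t / \<kappa>)\<bar>"
proof -
  have "((soliton \<kappa> t)\<^sup>2) powr (1 / \<kappa>) = soliton \<kappa> t powr (2 / \<kappa>)"
    using soliton_pos[of \<kappa> t] by (simp add: powr_powr flip: powr_numeral)
  then show ?thesis
    by (simp add: soliton_coeff_def soliton_powr_tanh[OF assms])
qed

text \<open>The calibration applied to the soliton itself: there \<open>Y\<close> is minus the
  derivative, so the calibrated integral is minus the energy. This evaluates \<open>H 1\<close>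
  without an explicit antiderivative.\<close>

lemma soliton_antiderivative:
  assumes \<kappa>: "\<kappa> > 0"
    and H: "\<And>\<rho>. \<rho> \<ge> 0 \<Longrightarrow> (H has_real_derivative soliton_coeff \<kappa> \<rho> / 2) (at \<rho> within {0..})" "H 0 = 0"
  shows "2 * H 1 = soliton_energy \<kappa>"
proof -
  let ?v = "\<lambda>t. complex_of_real (soliton \<kappa> t)" and ?w = "\<lambda>t. complex_of_real (- tanh (t / \<kappa>) * soliton \<kappa> t)"
  have "sgn t * \<bar>tanh (t / \<kappa>)\<bar> = tanh (t / \<kappa>)" for t
    using \<kappa> by (auto simp: sgn_real_def abs_if divide_less_0_iff tanh_real_neg_iff not_less)
  then have "((sgn t * soliton_coeff \<kappa> ((norm (?v t))\<^sup>2)) *\<^sub>R ?v t) \<bullet> ?w t = - (tanh (t / \<kappa>) * soliton \<kappa> t)\<^sup>2" for t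
    using soliton_coeff_soliton[OF \<kappa>, of t] by (simp add: inner_complex_def power2_eq_square)
  moreover have "(LINT t|lborel. ((sgn t * soliton_coeff \<kappa> ((norm (?v t))\<^sup>2)) *\<^sub>R ?v t) \<bullet> ?w t) = - 2 * H ((norm (?v 0))\<^sup>2)"
    by (rule calibration(4)[OF soliton_H1_line[OF \<kappa>] soliton_coeff_props[OF \<kappa>] H])
  ultimately show ?thesis by (simp add: soliton_energy_def)
qed

text \<open>Strict concavity of \<open>ln\<close> between 1 and \<open>Y\<close>: with
  \<open>s\<close> the weighted mean, apply \<open>ln x \<le> x - 1\<close> at \<open>Y / s\<close>
  and at \<open>1 / s\<close>. The weighted right-hand sides add up to 0.\<close>

lemma ln_convex_combination:
  fixes Y \<alpha> :: real
  assumes "0 < \<alpha>" "\<alpha> < 1" "0 < Y"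
  shows "\<alpha> * ln Y \<le> ln (1 - \<alpha> + \<alpha> * Y)"
    and "\<alpha> * ln Y = ln (1 - \<alpha> + \<alpha> * Y) \<Longrightarrow> Y = 1"
proof -
  define s where "s = 1 - \<alpha> + \<alpha> * Y"
  have s: "s > 0" using assms by (simp add: s_def add_pos_pos)
  have 1: "ln (Y / s) \<le> Y / s - 1" "ln (1 / s) \<le> 1 / s - 1"
    using assms s by (auto intro!: ln_le_minus_one)
  have e: "\<alpha> * (Y / s - 1) + (1 - \<alpha>) * (1 / s - 1) = 0"
  proof -
    have "\<alpha> * (Y / s - 1) + (1 - \<alpha>) * (1 / s - 1) = (\<alpha> * Y + (1 - \<alpha>)) / s - 1"
      by (simp add: algebra_simps add_divide_distrib diff_divide_distrib)
    also have "\<alpha> * Y + (1 - \<alpha>) = s" by (simp add: s_def)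
    finally show ?thesis using s by simp
  qed
  have l: "ln (Y / s) = ln Y - ln s" "ln (1 / s) = - ln s" using assms s by (auto simp: ln_div)
  have m1: "\<alpha> * ln (Y / s) \<le> \<alpha> * (Y / s - 1)" using 1(1) assms(1) by simp
  have m2: "(1 - \<alpha>) * ln (1 / s) \<le> (1 - \<alpha>) * (1 / s - 1)" using 1(2) assms(2) by simp
  have sum: "\<alpha> * ln (Y / s) + (1 - \<alpha>) * ln (1 / s) = \<alpha> * ln Y - ln s"
    unfolding l by (simp add: algebra_simps)
  show "\<alpha> * ln Y \<le> ln (1 - \<alpha> + \<alpha> * Y)"
    using m1 m2 e sum unfolding s_def[symmetric] by linarith
  assume "\<alpha> * ln Y = ln (1 - \<alpha> + \<alpha> * Y)"
  then have "\<alpha> * ln Y - ln s = 0" by (simp add: s_def)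
  then have "(1 - \<alpha>) * ln (1 / s) = (1 - \<alpha>) * (1 / s - 1)" "\<alpha> * ln (Y / s) = \<alpha> * (Y / s - 1)"
    using m1 m2 e sum by linarith+
  then have "ln (1 / s) = 1 / s - 1" "ln (Y / s) = Y / s - 1" using assms by auto
  then have "1 / s = 1" "Y / s = 1" using ln_eq_minus_one assms s by (metis zero_less_divide_iff zero_less_one)+
  then show "Y = 1" using s by simp
qed

text \<open>With \<open>a\<close> the energy of the soliton, \<open>b\<close> and \<open>e\<close>
  are its mass and its potential, and the soliton gives equality in \<open>h\<close>. AM-GM with
  weights \<open>a / b\<close> and \<open>e / b\<close> bounds \<open>a\<^sup>2 + A * D\<close> from
  below by \<open>a * b * Y powr \<alpha>\<close>. Raising to the power \<open>1 - \<theta>\<close>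
  gives the claim, since \<open>(1 - \<theta>) * \<alpha> = r\<close> and
  \<open>1 - \<theta> - r = \<theta>\<close>.\<close>

lemma gn_interpolation:
  fixes A B D a \<kappa> :: real
  assumes pos: "\<kappa> > 0" "a > 0" "A > 0" "B > 0" "D > 0"
    and h: "a\<^sup>2 + A * D \<le> A * B"
  defines "b \<equiv> (1 + 2 * \<kappa>) * a" and "e \<equiv> 2 * \<kappa> * a"
    and "\<theta> \<equiv> 1 / (2 * \<kappa> + 2)" and "r \<equiv> \<kappa> / (\<kappa> + 1)"
  shows "a powr \<theta> * b powr (1 - \<theta>) / e powr r * D powr r \<le> A powr \<theta> * B powr (1 - \<theta>)"
    and "a powr \<theta> * b powr (1 - \<theta>) / e powr r * D powr r = A powr \<theta> * B powr (1 - \<theta>)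
      \<Longrightarrow> A * D = a * e \<and> A * B = a\<^sup>2 + A * D"
proof -
  define \<alpha> where "\<alpha> = 2 * \<kappa> / (1 + 2 * \<kappa>)"
  define Y where "Y = A * D / (a * e)"
  have be: "b > 0" "e > 0" using pos by (auto simp: b_def e_def)
  have \<alpha>: "0 < \<alpha>" "\<alpha> < 1" using pos by (auto simp: \<alpha>_def)
  have Y: "Y > 0" using pos be by (simp add: Y_def)
  have nz: "2 * \<kappa> + 2 \<noteq> 0" "1 + 2 * \<kappa> \<noteq> 0" "\<kappa> + 1 \<noteq> 0" using pos by auto
  have r: "r = 2 * \<kappa> / (2 * \<kappa> + 2)"
    using mult_divide_mult_cancel_left[of 2 \<kappa> "\<kappa> + 1"] by (simp add: r_def algebra_simps)
  have \<theta>1: "1 - \<theta> = (1 + 2 * \<kappa>) / (2 * \<kappa> + 2)"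
    using nz by (simp add: \<theta>_def eq_divide_eq left_diff_distrib)
  have \<theta>: "1 - \<theta> = (1 + 2 * \<kappa>) / (2 * \<kappa> + 2)" "1 - \<theta> > 0" "\<theta> = 1 - \<theta> - r"
      "(1 - \<theta>) * \<alpha> = r"
  proof -
    show "1 - \<theta> > 0" unfolding \<theta>1 using pos by simp
    show "\<theta> = 1 - \<theta> - r" unfolding \<theta>1 r by (simp add: \<theta>_def flip: diff_divide_distrib)
    show "(1 - \<theta>) * \<alpha> = r" unfolding \<theta>1 r \<alpha>_def using nz by simp
  qed (rule \<theta>1)
  have key: "a\<^sup>2 + A * D = (a * b) * (1 - \<alpha> + \<alpha> * Y)"
  proof -
    have 1: "1 - \<alpha> = 1 / (1 + 2 * \<kappa>)" using pos by (simp add: \<alpha>_def field_simps)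
    have "(a * b) * (1 - \<alpha>) = a\<^sup>2" unfolding 1 using pos by (simp add: b_def power2_eq_square)
    moreover have "(a * b) * (\<alpha> * Y) = A * D"
      using pos by (simp add: b_def \<alpha>_def Y_def e_def)
    ultimately show ?thesis by (simp add: algebra_simps)
  qed
  have s: "1 - \<alpha> + \<alpha> * Y > 0" using \<alpha> Y by (simp add: add_pos_pos)
  note lb = ln_convex_combination[OF \<alpha> Y]
  have AD: "0 < a\<^sup>2 + A * D" using pos by (simp add: add_pos_pos)
  have c1: "ln (a\<^sup>2 + A * D) \<le> ln (A * B)" using h AD by (subst ln_le_cancel_iff) (use pos in auto)
  have c2: "ln (a\<^sup>2 + A * D) = ln a + ln b + ln (1 - \<alpha> + \<alpha> * Y)"
    unfolding key using pos be s by (simp add: ln_mult)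
  have c3: "ln Y = ln A + ln D - ln a - ln e" unfolding Y_def using pos be by (simp add: ln_mult ln_div)
  have c4: "ln (A * B) = ln A + ln B" using pos by (simp add: ln_mult)
  define L where "L = \<theta> * ln a + (1 - \<theta>) * ln b - r * ln e + r * ln D"
  define R where "R = \<theta> * ln A + (1 - \<theta>) * ln B"
  have eL: "a powr \<theta> * b powr (1 - \<theta>) / e powr r * D powr r = exp L"
    using pos be by (simp add: L_def powr_def exp_add exp_diff)
  have eR: "A powr \<theta> * B powr (1 - \<theta>) = exp R"
    using pos by (simp add: R_def powr_def exp_add)
  \<comment> \<open>In logarithms the gap of the claim is a positive multiple of the sum of the gap
    in the hypothesis and the gap in AM-GM. Both are nonnegative, so equality in the claim forces
    equality in each.\<close>
  have RL: "R - L = (1 - \<theta>) * ((ln (A * B) - ln (a\<^sup>2 + A * D)) + (ln (1 - \<alpha> + \<alpha> * Y) - \<alpha> * ln Y))"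
  proof -
    have "(1 - \<theta>) * ((ln (A * B) - ln (a\<^sup>2 + A * D)) + (ln (1 - \<alpha> + \<alpha> * Y) - \<alpha> * ln Y))
      = (1 - \<theta>) * (ln A + ln B - ln a - ln b) - ((1 - \<theta>) * \<alpha>) * (ln A + ln D - ln a - ln e)"
      unfolding c2 c3 c4 by (simp add: algebra_simps)
    also have "\<dots> = (1 - \<theta>) * (ln A + ln B - ln a - ln b) - r * (ln A + ln D - ln a - ln e)"
      unfolding \<theta>(4) ..
    also have "\<dots> = (1 - \<theta> - r) * ln A + (1 - \<theta>) * ln B - ((1 - \<theta> - r) * ln a + (1 - \<theta>) * ln b - r * ln e + r * ln D)"
      by (simp add: algebra_simps)
    also have "\<dots> = R - L" unfolding R_def L_def \<theta>(3)[symmetric] ..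
    finally show ?thesis by simp
  qed
  have n: "ln (A * B) - ln (a\<^sup>2 + A * D) \<ge> 0" "ln (1 - \<alpha> + \<alpha> * Y) - \<alpha> * ln Y \<ge> 0" using c1 lb(1) by auto
  then have "R - L \<ge> 0" unfolding RL using \<theta>(2) by (intro mult_nonneg_nonneg) auto
  then show "a powr \<theta> * b powr (1 - \<theta>) / e powr r * D powr r \<le> A powr \<theta> * B powr (1 - \<theta>)"
    unfolding eL eR by simp
  assume "a powr \<theta> * b powr (1 - \<theta>) / e powr r * D powr r = A powr \<theta> * B powr (1 - \<theta>)"
  then have "R - L = 0" unfolding eL eR by simp
  then have z: "(ln (A * B) - ln (a\<^sup>2 + A * D)) + (ln (1 - \<alpha> + \<alpha> * Y) - \<alpha> * ln Y) = 0"
    unfolding RL using \<theta>(2) by (metis less_irrefl mult_eq_0_iff)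
  then have "\<alpha> * ln Y = ln (1 - \<alpha> + \<alpha> * Y)" "ln (A * B) = ln (a\<^sup>2 + A * D)" using n by linarith+
  then have "Y = 1" "A * B = a\<^sup>2 + A * D" using lb(2) AD pos by auto
  then show "A * D = a * e \<and> A * B = a\<^sup>2 + A * D" using pos be by (simp add: Y_def)
qed

lemma integral_deriv_within_nonneg:
  fixes f :: "real \<Rightarrow> real"
  assumes "continuous_on UNIV f" "t \<ge> 0"
  shows "((\<lambda>t. integral {0..t} f) has_real_derivative f t) (at t within {0..})"
proof -
  have "continuous_on {0..t + 1} f" by (rule continuous_on_subset[OF assms(1)]) simp
  then have "((\<lambda>t. integral {0..t} f) has_real_derivative f t) (at t within {0..t + 1})"
    by (rule integral_has_real_derivative) (use assms in auto)
  also have "at t within {0..t + 1} = at t within {0..}"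
    by (rule at_within_nhd[of _ "{..<t + 1}"]) (use assms in auto)
  finally show ?thesis .
qed

text \<open>The derivative of \<open>v\<close> is a real multiple of \<open>v\<close>, so the phase
  never turns: \<open>v\<close> stays positive, and its modulus solves the equation of
  \<open>soliton_comparison\<close>.\<close>

lemma soliton_flow_lower_bound:
  assumes \<kappa>: "\<kappa> > 0" and l: "l > 0" and vw: "weak_primitive v w" and v0: "v 0 = 1"
    and w: "AE t in lborel. t > 0 \<longrightarrow> w t = - ((l * soliton_coeff \<kappa> ((norm (v t))\<^sup>2)) *\<^sub>R v t)"
    and t: "t \<ge> 0"
  shows "v t = of_real (norm (v t))" "soliton \<kappa> (l * t) \<le> norm (v t)"
proof -
  define a where "a s = l * soliton_coeff \<kappa> ((norm (v s))\<^sup>2)" for s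
  have ac: "continuous_on UNIV a"
    unfolding a_def using soliton_coeff_props(1)[OF \<kappa>]
    by (intro continuous_intros continuous_on_compose2[OF soliton_coeff_props(1)[OF \<kappa>]] weak_primitive_continuous[OF vw]) auto
  have a0: "a s \<ge> 0" for s using l soliton_coeff_props(2)[OF \<kappa>] by (simp add: a_def)
  define m where "m s = exp (- integral {0..s} a)" for s
  have vm: "v s = of_real (m s)" if "s \<ge> 0" for s
    using weak_primitive_linear_ode[OF vw ac w[folded a_def] that] v0 by (simp add: m_def scaleR_conv_of_real)
  have nm: "norm (v s) = m s" if "s \<ge> 0" for s
    unfolding vm[OF that] by (simp add: m_def)
  have "soliton \<kappa> (l * t) \<le> m t"
  proof (rule soliton_comparison[OF \<kappa> l _ _ _ _ t])
    fix s :: real assume s: "s \<ge> 0"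
    have "((\<lambda>s. - integral {0..s} a) has_real_derivative - a s) (at s within {0..})"
      by (rule DERIV_minus[OF integral_deriv_within_nonneg[OF ac s]])
    from DERIV_chain2[OF DERIV_exp this]
    have "(m has_real_derivative m s * - a s) (at s within {0..})" unfolding m_def .
    moreover have "m s * - a s = - l * soliton_coeff \<kappa> ((m s)\<^sup>2) * m s"
      unfolding a_def nm[OF s] by simp
    ultimately show "(m has_real_derivative - l * soliton_coeff \<kappa> ((m s)\<^sup>2) * m s) (at s within {0..})" by (simp only:)
    show "0 < m s" by (simp add: m_def)
    have "integral {0..s} a \<ge> 0"
      by (rule Henstock_Kurzweil_Integration.integral_nonneg) (use a0 in \<open>auto intro!: integrable_continuous_real continuous_on_subset[OF ac]\<close>)
    then show "m s \<le> 1" by (simp add: m_def)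
  qed (simp add: m_def)
  then show "soliton \<kappa> (l * t) \<le> norm (v t)" unfolding nm[OF t] .
  show "v t = of_real (norm (v t))" unfolding nm[OF t] by (rule vm[OF t])
qed

lemma AE_lborel_reflect:
  assumes "AE t in lborel. P (t::real)"
  shows "AE t in lborel. P (- t)"
proof -
  have "AE t in distr lborel borel (uminus :: real \<Rightarrow> real). P t"
    unfolding lborel_distr_uminus using assms .
  from AE_distrD[OF _ this] show ?thesis by simp
qed

text \<open>For \<open>k = soliton_coeff \<kappa>\<close> and \<open>norm (v t) \<le> 1\<close> the
  square of \<open>norm (Y t)\<close> is
  \<open>(norm (v t))\<^sup>2 - norm (v t) powr (2 + 2 / \<kappa>)\<close> almost everywhere. Its
  integral is \<open>B - D\<close>, which turns the calibration inequality into the stated one. In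
  the equality case \<open>v\<close> lies above a rescaled soliton, and the second equation gives
  both the same integral \<open>D\<close>.\<close>

lemma gn_normalized:
  assumes \<kappa>: "\<kappa> > 0" and vw: "H1_line v w" and v0: "v 0 = 1" and v1: "\<And>t. norm (v t) \<le> 1"
  defines "A \<equiv> LINT t|lborel. (norm (w t))\<^sup>2" and "B \<equiv> LINT t|lborel. (norm (v t))\<^sup>2"
    and "D \<equiv> LINT t|lborel. norm (v t) powr (2 + 2 / \<kappa>)"
  shows "integrable lborel (\<lambda>t. norm (v t) powr (2 + 2 / \<kappa>))"
    and "(soliton_energy \<kappa>)\<^sup>2 + A * D \<le> A * B"
    and "A * B = (soliton_energy \<kappa>)\<^sup>2 + A * D \<Longrightarrow> A * D = soliton_energy \<kappa> * soliton_potential \<kappa> \<Longrightarrow>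
      \<exists>l>0. AE t in lborel. v t = of_real (soliton \<kappa> (l * t))"
proof -
  note HD = H1_lineD[OF vw]
  note [measurable] = HD(2,3)
  have split: "norm (v t) powr (2 + 2 / \<kappa>) = (norm (v t))\<^sup>2 * norm (v t) powr (2 / \<kappa>)" for t
    by (cases "v t = 0") (auto simp: powr_add)
  have le1: "norm (v t) powr (2 / \<kappa>) \<le> 1" for t
    using powr_mono2[of "2/\<kappa>" "norm (v t)" 1] \<kappa> v1[of t] by simp
  show pi: "integrable lborel (\<lambda>t. norm (v t) powr (2 + 2 / \<kappa>))"
  proof (rule Bochner_Integration.integrable_bound[OF HD(5)])
    show "AE t in lborel. norm (norm (v t) powr (2 + 2 / \<kappa>)) \<le> norm ((norm (v t))\<^sup>2)"
      unfolding split using le1 by (auto intro!: mult_left_le)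
  qed measurable
  obtain H where H: "\<And>\<rho>. \<rho> \<ge> 0 \<Longrightarrow> (H has_real_derivative soliton_coeff \<kappa> \<rho> / 2) (at \<rho> within {0..})" "H 0 = 0"
    using half_antiderivative[OF soliton_coeff_props(1)[OF \<kappa>]] by blast
  have H1: "2 * H 1 = soliton_energy \<kappa>" using soliton_antiderivative[OF \<kappa> H] by simp
  define Y where "Y t = (sgn t * soliton_coeff \<kappa> ((norm (v t))\<^sup>2)) *\<^sub>R v t" for t
  define E where "E = (LINT t|lborel. (norm (Y t))\<^sup>2)"
  have nv0: "H ((norm (v 0))\<^sup>2) = H 1" by (simp add: v0)
  note CI = calibration_inequality[OF vw soliton_coeff_props[OF \<kappa>] H, folded Y_def, folded A_def E_def, unfolded nv0]
  have "4 * (H 1)\<^sup>2 = (2 * H 1)\<^sup>2" by (simp add: power_mult_distrib)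
  then have H4: "4 * (H 1)\<^sup>2 = (soliton_energy \<kappa>)\<^sup>2" by (simp only: H1)
  have Y2: "AE t in lborel. (norm (Y t))\<^sup>2 = (norm (v t))\<^sup>2 - norm (v t) powr (2 + 2 / \<kappa>)"
    using AE_lborel_singleton[of 0]
  proof eventually_elim
    case (elim t)
    have "((norm (v t))\<^sup>2) powr (1 / \<kappa>) = norm (v t) powr (2 / \<kappa>)"
      by (simp add: powr_powr flip: powr_numeral)
    then have "(soliton_coeff \<kappa> ((norm (v t))\<^sup>2))\<^sup>2 = 1 - norm (v t) powr (2 / \<kappa>)"
      using le1[of t] by (simp add: soliton_coeff_def)
    moreover have "(sgn t)\<^sup>2 = 1" using elim by (auto simp: sgn_real_def)
    moreover have "(norm (Y t))\<^sup>2 = (sgn t)\<^sup>2 * (soliton_coeff \<kappa> ((norm (v t))\<^sup>2))\<^sup>2 * (norm (v t))\<^sup>2"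
      by (simp add: Y_def power_mult_distrib)
    ultimately show ?case unfolding split by (simp only:) (simp add: algebra_simps)
  qed
  have [measurable]: "soliton_coeff \<kappa> \<in> borel_measurable borel"
    by (rule borel_measurable_continuous_onI[OF soliton_coeff_props(1)[OF \<kappa>]])
  have [measurable]: "Y \<in> borel_measurable borel" unfolding Y_def by measurable
  have "E = (LINT t|lborel. (norm (v t))\<^sup>2 - norm (v t) powr (2 + 2 / \<kappa>))"
    unfolding E_def by (rule integral_cong_AE[OF _ _ Y2]) measurable
  then have E: "E = B - D" unfolding B_def D_def using pi HD(5) by simp
  show "(soliton_energy \<kappa>)\<^sup>2 + A * D \<le> A * B"
    using CI(1) unfolding H4 E by (simp add: algebra_simps)
  assume eq1: "A * B = (soliton_energy \<kappa>)\<^sup>2 + A * D" and eq2: "A * D = soliton_energy \<kappa> * soliton_potential \<kappa>"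
  note ep = soliton_energy_pos[OF \<kappa>]
  have AE: "A * E = (soliton_energy \<kappa>)\<^sup>2" unfolding E using eq1 by (simp add: algebra_simps)
  have "E \<ge> 0" unfolding E_def by (rule Bochner_Integration.integral_nonneg) simp
  moreover have "E \<noteq> 0" using AE ep(1) by auto
  ultimately have E0: "E > 0" by simp
  define l where "l = soliton_energy \<kappa> / E"
  have l: "l > 0" using ep E0 by (simp add: l_def)
  have wY: "AE t in lborel. w t = - (l *\<^sub>R Y t)"
    using CI(2) AE E0 unfolding H4 H1 l_def by simp
  have "A = l\<^sup>2 * E"
  proof -
    have "A = (LINT t|lborel. l\<^sup>2 * (norm (Y t))\<^sup>2)"
      unfolding A_def
    proof (rule integral_cong_AE)
      show "AE t in lborel. (norm (w t))\<^sup>2 = l\<^sup>2 * (norm (Y t))\<^sup>2"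
        using wY by eventually_elim (simp add: power_mult_distrib)
    qed measurable
    then show ?thesis by (simp add: E_def)
  qed
  then have A: "A = l * soliton_energy \<kappa>" using E0 by (simp add: l_def power2_eq_square)
  \<comment> \<open>\<open>soliton_potential \<kappa> / l\<close> is the integral that belongs to
    \<open>soliton \<kappa> (l * t)\<close>; this is the comparison of integrals that closes the
    argument.\<close>
  then have Dl: "D = soliton_potential \<kappa> / l" using eq2 l ep by (simp add: field_simps)
  have right: "v t = of_real (norm (v t)) \<and> soliton \<kappa> (l * t) \<le> norm (v t)" if "t \<ge> 0" for t
  proof -
    have "AE t in lborel. t > 0 \<longrightarrow> w t = - ((l * soliton_coeff \<kappa> ((norm (v t))\<^sup>2)) *\<^sub>R v t)"
      using wY by eventually_elim (simp add: Y_def)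
    from soliton_flow_lower_bound[OF \<kappa> l HD(1) v0 this that] show ?thesis by blast
  qed
  have left: "v (- t) = of_real (norm (v (- t))) \<and> soliton \<kappa> (l * t) \<le> norm (v (- t))" if "t \<ge> 0" for t
  proof -
    have "AE t in lborel. t > 0 \<longrightarrow> - w (- t) = - ((l * soliton_coeff \<kappa> ((norm (v (- t)))\<^sup>2)) *\<^sub>R v (- t))"
      using AE_lborel_reflect[OF wY] by eventually_elim (simp add: Y_def)
    from soliton_flow_lower_bound[OF \<kappa> l weak_primitive_reflect[OF HD(1)] _ this that] v0 show ?thesis by simp
  qed
  have all: "v t = of_real (norm (v t)) \<and> soliton \<kappa> (l * t) \<le> norm (v t)" for t
    using right[of t] left[of "-t"] soliton_even[of \<kappa> "l * t"] by (cases "t \<ge> 0") auto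
  have pp: "2 + 2 / \<kappa> > 0" using \<kappa> by (auto intro: add_pos_pos)
  have si: "integrable lborel (\<lambda>t. soliton \<kappa> (l * t) powr (2 + 2 / \<kappa>))"
    using lborel_integrable_real_affine[OF integrable_soliton_powr[OF \<kappa> pp], of l 0] l by simp
  have "(LINT t|lborel. soliton \<kappa> (l * t) powr (2 + 2 / \<kappa>)) = soliton_potential \<kappa> / l"
    using lborel_integral_real_affine[of l "\<lambda>t. soliton \<kappa> t powr (2 + 2 / \<kappa>)" 0] l
    by (simp add: soliton_potential_def)
  then have "(LINT t|lborel. norm (v t) powr (2 + 2 / \<kappa>) - soliton \<kappa> (l * t) powr (2 + 2 / \<kappa>)) = 0"
    using pi si Dl by (simp add: D_def)
  moreover have nn: "soliton \<kappa> (l * t) powr (2 + 2 / \<kappa>) \<le> norm (v t) powr (2 + 2 / \<kappa>)" for t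
    using all[of t] soliton_pos[of \<kappa> "l * t"] pp by (intro powr_mono2) auto
  ultimately have "AE t in lborel. norm (v t) powr (2 + 2 / \<kappa>) - soliton \<kappa> (l * t) powr (2 + 2 / \<kappa>) = 0"
    by (subst (asm) integral_nonneg_eq_0_iff_AE) (use pi si in auto)
  then have "AE t in lborel. v t = of_real (soliton \<kappa> (l * t))"
  proof eventually_elim
    case (elim t)
    then have "\<not> soliton \<kappa> (l * t) < norm (v t)"
      using powr_less_mono2[OF pp, of "soliton \<kappa> (l * t)" "norm (v t)"] soliton_pos[of \<kappa> "l * t"] by auto
    then have "norm (v t) = soliton \<kappa> (l * t)" using all[of t] by simp
    then show ?case using all[of t] by simp
  qed
  then show "\<exists>l>0. AE t in lborel. v t = of_real (soliton \<kappa> (l * t))" using l by blast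
qed

section \<open>The two sharp inequalities on the line\<close>

lemma lborel_integral_shift:
  fixes f :: "real \<Rightarrow> real"
  shows "(LINT t|lborel. f (t + s)) = (LINT t|lborel. f t)"
  using lborel_integral_real_affine[of 1 f s] by (simp add: add.commute)

text \<open>Unless \<open>v\<close> vanishes identically, decay at both ends confines the large
  values to a compact interval, where continuity gives a maximum.\<close>

lemma H1_line_attains_max:
  assumes vw: "H1_line v w"
  obtains t0 where "\<And>t. norm (v t) \<le> norm (v t0)"
proof (cases "\<forall>t. v t = 0")
  case True then show thesis by (intro that[of 0]) simp
next
  case False
  then obtain s where s: "v s \<noteq> 0" by blast
  then have p: "(norm (v s))\<^sup>2 > 0" by simp
  have "eventually (\<lambda>t. (norm (v t))\<^sup>2 < (norm (v s))\<^sup>2) at_top"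
    using order_tendstoD(2)[OF H1_line_tendsto_0_at_top[OF vw] p] .
  then obtain T1 where T1: "\<And>t. t \<ge> T1 \<Longrightarrow> (norm (v t))\<^sup>2 < (norm (v s))\<^sup>2"
    by (auto simp: eventually_at_top_linorder)
  have "eventually (\<lambda>t. (norm (v (- t)))\<^sup>2 < (norm (v s))\<^sup>2) at_top"
    using order_tendstoD(2)[OF H1_line_tendsto_0_at_top[OF H1_line_reflect[OF vw]] p] .
  then obtain T2 where T2: "\<And>t. t \<ge> T2 \<Longrightarrow> (norm (v (- t)))\<^sup>2 < (norm (v s))\<^sup>2"
    by (auto simp: eventually_at_top_linorder)
  define T where "T = max (max T1 T2) \<bar>s\<bar>"
  have "\<exists>x\<in>{-T..T}. \<forall>y\<in>{-T..T}. norm (v y) \<le> norm (v x)"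
    by (rule continuous_attains_sup) (auto simp: T_def intro!: continuous_on_norm H1_lineD(6)[OF vw])
  then obtain t0 where t0: "t0 \<in> {-T..T}" "\<And>y. y \<in> {-T..T} \<Longrightarrow> norm (v y) \<le> norm (v t0)" by blast
  have sT: "norm (v s) \<le> norm (v t0)" by (rule t0(2)) (auto simp: T_def)
  show thesis
  proof (rule that[of t0])
    fix t
    consider "t \<in> {-T..T}" | "t \<ge> T1" | "- t \<ge> T2" unfolding T_def by fastforce
    then show "norm (v t) \<le> norm (v t0)"
    proof cases
      case 1 then show ?thesis by (rule t0(2))
    next
      case 2
      then have "norm (v t) < norm (v s)" using T1[of t] by (simp add: power2_less_imp_less)
      with sT show ?thesis by simp
    next
      case 3
      then have "norm (v t) < norm (v s)" using T2[of "-t"] by (simp add: power2_less_imp_less)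
      with sT show ?thesis by simp
    qed
  qed
qed

text \<open>The Gagliardo-Nirenberg quotient of the soliton. With
  \<open>2 * \<kappa> + 2 = d\<close> the exponents are \<open>1 / d\<close>,
  \<open>1 - 1 / d\<close> and \<open>2 / p\<close>.\<close>

definition gn_const :: "real \<Rightarrow> real" where
  "gn_const \<kappa> = soliton_energy \<kappa> powr (1 / (2 * \<kappa> + 2)) * soliton_mass \<kappa> powr (1 - 1 / (2 * \<kappa> + 2)) /
     soliton_potential \<kappa> powr (\<kappa> / (\<kappa> + 1))"

text \<open>Translation moves the maximum to 0, and division by \<open>v t0\<close> makes the value
  there 1. Both sides are homogeneous of degree two in \<open>v\<close>, so the factor
  \<open>M\<^sup>2\<close> cancels from the normalized inequality.\<close>

theorem gagliardo_nirenberg_sharp: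
  assumes \<kappa>: "\<kappa> > 0" and vw: "H1_line v w"
  defines "A \<equiv> LINT t|lborel. (norm (w t))\<^sup>2" and "B \<equiv> LINT t|lborel. (norm (v t))\<^sup>2"
    and "D \<equiv> LINT t|lborel. norm (v t) powr (2 + 2 / \<kappa>)" and "\<theta> \<equiv> 1 / (2 * \<kappa> + 2)"
  shows "gn_const \<kappa> * D powr (\<kappa> / (\<kappa> + 1)) \<le> A powr \<theta> * B powr (1 - \<theta>)"
    and "gn_const \<kappa> * D powr (\<kappa> / (\<kappa> + 1)) = A powr \<theta> * B powr (1 - \<theta>) \<Longrightarrow>
      \<exists>c l t0. l > 0 \<and> (AE t in lborel. v t = c * of_real (soliton \<kappa> (l * (t - t0))))"
proof -
  have "gn_const \<kappa> * D powr (\<kappa> / (\<kappa> + 1)) \<le> A powr \<theta> * B powr (1 - \<theta>) \<and>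
    (gn_const \<kappa> * D powr (\<kappa> / (\<kappa> + 1)) = A powr \<theta> * B powr (1 - \<theta>) \<longrightarrow>
      (\<exists>c l t0. l > 0 \<and> (AE t in lborel. v t = c * of_real (soliton \<kappa> (l * (t - t0))))))"
  proof (cases "\<forall>t. v t = 0")
    case True
    then have "D = 0" by (simp add: D_def)
    \<comment> \<open>The zero function belongs to the family through \<open>c = 0\<close>.\<close>
    moreover have "\<exists>c l t0. (l::real) > 0 \<and> (AE t in lborel. v t = c * of_real (soliton \<kappa> (l * (t - t0))))"
      using True by (intro exI[of _ 0] exI[of _ 1]) simp
    ultimately show ?thesis by simp
  next
    case False
    obtain t0 where t0: "\<And>t. norm (v t) \<le> norm (v t0)" using H1_line_attains_max[OF vw] by blast
    define M where "M = norm (v t0)"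
    obtain s where "v s \<noteq> 0" using False by blast
    then have "0 < norm (v s)" by simp
    with t0[of s] have M: "M > 0" unfolding M_def by linarith
    have v0: "v t0 \<noteq> 0" using M by (simp add: M_def)
    define c where "c = 1 / v t0"
    have nc: "norm c = 1 / M" by (simp add: c_def M_def norm_divide)
    define A' where "A' = (LINT t|lborel. (norm (c * w (t + t0)))\<^sup>2)"
    define B' where "B' = (LINT t|lborel. (norm (c * v (t + t0)))\<^sup>2)"
    define D' where "D' = (LINT t|lborel. norm (c * v (t + t0)) powr (2 + 2 / \<kappa>))"
    define p where "p = 2 + 2 / \<kappa>"
    have A': "A' = A / M\<^sup>2"
      unfolding A'_def A_def using lborel_integral_shift[of "\<lambda>t. (norm (w t))\<^sup>2" t0]
      by (simp add: norm_mult nc power_divide)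
    have B': "B' = B / M\<^sup>2"
      unfolding B'_def B_def using lborel_integral_shift[of "\<lambda>t. (norm (v t))\<^sup>2" t0]
      by (simp add: norm_mult nc power_divide)
    have D': "D' = D / M powr p"
      unfolding D'_def D_def p_def[symmetric] using lborel_integral_shift[of "\<lambda>t. norm (v t) powr p" t0] M
      by (simp add: norm_mult nc powr_divide)
    have vw': "H1_line (\<lambda>t. c * v (t + t0)) (\<lambda>t. c * w (t + t0))"
      by (rule H1_line_shift_scale[OF vw])
    have n1: "norm (c * v (t + t0)) \<le> 1" for t
      using t0[of "t + t0"] M by (simp add: norm_mult nc M_def[symmetric])
    have n0: "c * v (0 + t0) = 1" using v0 by (simp add: c_def)
    note N = gn_normalized[OF \<kappa> vw' n0 n1, folded A'_def B'_def D'_def]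
    note ep = soliton_energy_pos[OF \<kappa>]
    have A'0: "A' \<ge> 0" and B'0: "B' \<ge> 0" and D'0: "D' \<ge> 0"
      unfolding A'_def B'_def D'_def by (rule Bochner_Integration.integral_nonneg; simp)+
    have "A' * B' > 0"
    proof -
      have "(soliton_energy \<kappa>)\<^sup>2 > 0" using ep(1) by simp
      moreover have "A' * D' \<ge> 0" using A'0 D'0 by simp
      ultimately show ?thesis using N(2) by linarith
    qed
    then have pos: "A' > 0" "B' > 0" using A'0 B'0 by (auto simp: zero_less_mult_iff)
    have "D' \<noteq> 0"
    proof
      assume "D' = 0"
      then have "AE t in lborel. norm (c * v (t + t0)) powr (2 + 2 / \<kappa>) = 0"
        unfolding D'_def by (subst (asm) integral_nonneg_eq_0_iff_AE[OF N(1)]) auto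
      then have "AE t in lborel. (norm (c * v (t + t0)))\<^sup>2 = 0" by eventually_elim auto
      then have "B' = 0" unfolding B'_def by (rule integral_eq_zero_AE)
      with pos show False by simp
    qed
    with D'0 have D'p: "D' > 0" by simp
    have mass: "(1 + 2 * \<kappa>) * soliton_energy \<kappa> = soliton_mass \<kappa>"
      using soliton_mass_eq[OF \<kappa>] soliton_potential_eq[OF \<kappa>] by (simp add: algebra_simps)
    note G = gn_interpolation[OF \<kappa> ep(1) pos D'p N(2), unfolded mass soliton_potential_eq[OF \<kappa>, symmetric],
        folded \<theta>_def gn_const_def]
    have G1: "gn_const \<kappa> * D' powr (\<kappa> / (\<kappa> + 1)) \<le> A' powr \<theta> * B' powr (1 - \<theta>)"
      using G(1) by (simp add: gn_const_def \<theta>_def)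
    have pr: "p * (\<kappa> / (\<kappa> + 1)) = 2"
    proof -
      have p: "p = 2 * ((\<kappa> + 1) / \<kappa>)" using \<kappa> by (simp add: p_def field_simps)
      have "2 * (q / \<kappa>) * (\<kappa> / q) = 2" if "q > 0" for q :: real using that \<kappa> by simp
      from this[of "\<kappa> + 1"] show ?thesis unfolding p using \<kappa> by simp
    qed
    have D'': "D' powr (\<kappa> / (\<kappa> + 1)) = D powr (\<kappa> / (\<kappa> + 1)) / M\<^sup>2"
    proof -
      have "D \<ge> 0" unfolding D_def by (rule Bochner_Integration.integral_nonneg) simp
      then have "D' powr (\<kappa> / (\<kappa> + 1)) = D powr (\<kappa> / (\<kappa> + 1)) / M powr (p * (\<kappa> / (\<kappa> + 1)))"
        unfolding D' using M by (simp add: powr_divide powr_powr)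
      then show ?thesis unfolding pr using M by simp
    qed
    have AB'': "A' powr \<theta> * B' powr (1 - \<theta>) = A powr \<theta> * B powr (1 - \<theta>) / M\<^sup>2"
    proof -
      have "A \<ge> 0" "B \<ge> 0" unfolding A_def B_def by (rule Bochner_Integration.integral_nonneg; simp)+
      then have "A' powr \<theta> * B' powr (1 - \<theta>) = A powr \<theta> * B powr (1 - \<theta>) / (M\<^sup>2 powr \<theta> * M\<^sup>2 powr (1 - \<theta>))"
        unfolding A' B' by (simp add: powr_divide)
      also have "M\<^sup>2 powr \<theta> * M\<^sup>2 powr (1 - \<theta>) = M\<^sup>2"
        using M by (simp flip: powr_add)
      finally show ?thesis .
    qed
    have M2: "M\<^sup>2 > 0" using M by simp
    have iff: "gn_const \<kappa> * D' powr (\<kappa> / (\<kappa> + 1)) = gn_const \<kappa> * D powr (\<kappa> / (\<kappa> + 1)) / M\<^sup>2"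
      unfolding D'' by simp
    have 1: "gn_const \<kappa> * D powr (\<kappa> / (\<kappa> + 1)) \<le> A powr \<theta> * B powr (1 - \<theta>)"
      using G1 unfolding iff AB'' using M2 by (simp add: divide_le_cancel)
    have 2: "\<exists>c l t0. l > 0 \<and> (AE t in lborel. v t = c * of_real (soliton \<kappa> (l * (t - t0))))"
      if "gn_const \<kappa> * D powr (\<kappa> / (\<kappa> + 1)) = A powr \<theta> * B powr (1 - \<theta>)"
    proof -
      have "gn_const \<kappa> * D' powr (\<kappa> / (\<kappa> + 1)) = A' powr \<theta> * B' powr (1 - \<theta>)"
        unfolding iff AB'' that ..
      then have "A' * D' = soliton_energy \<kappa> * soliton_potential \<kappa> \<and> A' * B' = (soliton_energy \<kappa>)\<^sup>2 + A' * D'"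
        using G(2) by (simp add: gn_const_def \<theta>_def)
      then obtain l where l: "l > 0" "AE t in lborel. c * v (t + t0) = of_real (soliton \<kappa> (l * t))"
        using N(3) by blast
      have "AE t in lborel. v t = v t0 * of_real (soliton \<kappa> (l * (t - t0)))"
      proof -
        have "AE t in distr lborel borel ((+) (- t0)). c * v (t + t0) = of_real (soliton \<kappa> (l * t))"
          unfolding lborel_distr_plus by (rule l(2))
        from AE_distrD[OF _ this] have "AE t in lborel. c * v t = of_real (soliton \<kappa> (l * (- t0 + t)))" by simp
        then show ?thesis by eventually_elim (use v0 in \<open>simp add: c_def field_simps\<close>)
      qed
      with l(1) show ?thesis by blast
    qed
    from 1 2 show ?thesis by blast
  qed
  then show "gn_const \<kappa> * D powr (\<kappa> / (\<kappa> + 1)) \<le> A powr \<theta> * B powr (1 - \<theta>)"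
    and "gn_const \<kappa> * D powr (\<kappa> / (\<kappa> + 1)) = A powr \<theta> * B powr (1 - \<theta>) \<Longrightarrow>
      \<exists>c l t0. l > 0 \<and> (AE t in lborel. v t = c * of_real (soliton \<kappa> (l * (t - t0))))" by blast+
qed

text \<open>For constant \<open>k\<close> the equation of the equality case is linear with constant
  coefficient, so it is solved outright on the two half lines starting at \<open>s\<close>. The
  decay rate is \<open>(norm (v s))\<^sup>2 / B\<close>.\<close>

theorem sup_inequality_sharp:
  assumes vw: "H1_line v w"
  defines "A \<equiv> LINT t|lborel. (norm (w t))\<^sup>2" and "B \<equiv> LINT t|lborel. (norm (v t))\<^sup>2"
  shows "(norm (v s)) ^ 4 \<le> A * B"
    and "A * B = (norm (v s)) ^ 4 \<Longrightarrow> v s \<noteq> 0 \<Longrightarrow> \<exists>l>0. \<forall>t. v t = v s * of_real (exp (- l * \<bar>t - s\<bar>))"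
proof -
  define v' where "v' t = v (t + s)" for t
  define w' where "w' t = w (t + s)" for t
  have vw': "H1_line v' w'"
    using H1_line_shift_scale[OF vw, of 1 s] unfolding v'_def w'_def by simp
  have v'0: "v' 0 = v s" by (simp add: v'_def)
  note HD = H1_lineD[OF vw']
  note [measurable] = HD(2,3)
  have A: "(LINT t|lborel. (norm (w' t))\<^sup>2) = A" unfolding A_def w'_def by (rule lborel_integral_shift)
  have B: "(LINT t|lborel. (norm (v' t))\<^sup>2) = B" unfolding B_def v'_def by (rule lborel_integral_shift)
  have k: "continuous_on UNIV (\<lambda>_::real. 1::real)" "(0::real) \<le> 1" "(1::real) \<le> 1" by auto
  have H: "((\<lambda>\<rho>. \<rho> / 2) has_real_derivative 1 / 2) (at \<rho> within {0..})" for \<rho> :: real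
    by (auto intro!: derivative_eq_intros)
  define Y where "Y t = (sgn t * 1) *\<^sub>R v' t" for t
  have [measurable]: "Y \<in> borel_measurable borel" unfolding Y_def by measurable
  define E where "E = (LINT t|lborel. (norm (Y t))\<^sup>2)"
  have CI: "4 * ((norm (v' 0))\<^sup>2 / 2)\<^sup>2 \<le> A * E"
    "A * E = 4 * ((norm (v' 0))\<^sup>2 / 2)\<^sup>2 \<Longrightarrow> E > 0 \<Longrightarrow> AE t in lborel. w' t = - ((2 * ((norm (v' 0))\<^sup>2 / 2) / E) *\<^sub>R Y t)"
    using calibration_inequality[OF vw' k H] unfolding A E_def Y_def by simp_all
  have "E = B"
    unfolding B[symmetric] E_def
  proof (rule integral_cong_AE)
    show "AE t in lborel. (norm (Y t))\<^sup>2 = (norm (v' t))\<^sup>2"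
      using AE_lborel_singleton[of 0] by eventually_elim (auto simp: Y_def sgn_real_def)
  qed measurable
  note CI = CI[unfolded this]
  have p4: "4 * (x\<^sup>2 / 2)\<^sup>2 = x ^ 4" for x :: real by (simp add: power_divide flip: power_mult)
  show "(norm (v s)) ^ 4 \<le> A * B" using CI(1) unfolding p4 v'0 .
  assume eq: "A * B = (norm (v s)) ^ 4" and nz: "v s \<noteq> 0"
  have "B \<ge> 0" unfolding B_def by (rule Bochner_Integration.integral_nonneg) simp
  moreover have "B \<noteq> 0" using eq nz by auto
  ultimately have B0: "B > 0" by simp
  define l where "l = (norm (v s))\<^sup>2 / B"
  have l: "l > 0" using B0 nz by (simp add: l_def)
  have w: "AE t in lborel. w' t = - (l *\<^sub>R Y t)"
    using CI(2) eq B0 unfolding p4 v'0 l_def by simp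
  have c: "continuous_on UNIV (\<lambda>_::real. l)" by simp
  have r: "v' t = exp (- (l * t)) *\<^sub>R v s" if "t \<ge> 0" for t
  proof -
    have "AE t in lborel. t > 0 \<longrightarrow> w' t = - (l *\<^sub>R v' t)"
      using w by eventually_elim (simp add: Y_def)
    from weak_primitive_linear_ode[OF HD(1) c this that] show ?thesis
      using that by (simp add: v'0 mult.commute)
  qed
  have lft: "v' (- t) = exp (- (l * t)) *\<^sub>R v s" if "t \<ge> 0" for t
  proof -
    have "AE t in lborel. t > 0 \<longrightarrow> - w' (- t) = - (l *\<^sub>R v' (- t))"
      using AE_lborel_reflect[OF w] by eventually_elim (simp add: Y_def)
    from weak_primitive_linear_ode[OF weak_primitive_reflect[OF HD(1)] c this that] show ?thesis
      using that by (simp add: v'0 mult.commute)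
  qed
  have "v t = v s * of_real (exp (- l * \<bar>t - s\<bar>))" for t
    using r[of "t - s"] lft[of "s - t"] by (cases "t \<ge> s") (auto simp: v'_def scaleR_conv_of_real)
  with l show "\<exists>l>0. \<forall>t. v t = v s * of_real (exp (- l * \<bar>t - s\<bar>))" by blast
qed

section \<open>Smooth functions, weak gradients and the homogeneous Sobolev space\<close>

text \<open>The one-variable counterpart of \<open>C_k\<close>, relative to a set because
  \<open>ln\<close> and real powers are smooth on \<open>{0<..}\<close> only.\<close>

primrec differentiable_order :: "nat \<Rightarrow> real set \<Rightarrow> (real \<Rightarrow> real) \<Rightarrow> bool" where
  "differentiable_order 0 S f \<longleftrightarrow> continuous_on S f"
| "differentiable_order (Suc k) S f \<longleftrightarrow>
    (\<forall>t\<in>S. f field_differentiable at t) \<and> differentiable_order k S (deriv f)"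

lemma differentiable_order_cong:
  assumes S: "open S"
  shows "differentiable_order k S f \<Longrightarrow> (\<And>t. t \<in> S \<Longrightarrow> f t = g t) \<Longrightarrow> differentiable_order k S g"
proof (induction k arbitrary: f g)
  case 0
  then show ?case using continuous_on_cong[of S S f g] by simp
next
  case (Suc k)
  have ev: "eventually (\<lambda>s. f s = g s) (nhds t)" if "t \<in> S" for t
    using eventually_nhds_in_open[OF S that] by eventually_elim (rule Suc.prems(2))
  have 1: "g field_differentiable at t" if t: "t \<in> S" for t
  proof -
    obtain D where "(f has_field_derivative D) (at t)"
      using Suc.prems(1) t by (auto simp: field_differentiable_def)
    then have "(g has_field_derivative D) (at t)"
      by (subst (asm) DERIV_cong_ev[OF refl ev[OF t] refl])
    then show ?thesis by (auto simp: field_differentiable_def)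
  qed
  have "differentiable_order k S (deriv g)"
  proof (rule Suc.IH)
    show "differentiable_order k S (deriv f)" using Suc.prems(1) by simp
    show "deriv f t = deriv g t" if "t \<in> S" for t by (rule deriv_cong_ev[OF ev[OF that] refl])
  qed
  with 1 show ?case by simp
qed

lemma differentiable_order_SucI:
  assumes "open S" "\<And>t. t \<in> S \<Longrightarrow> (f has_real_derivative f' t) (at t)" "differentiable_order k S f'"
  shows "differentiable_order (Suc k) S f"
proof -
  have "deriv f t = f' t" if "t \<in> S" for t using assms(2)[OF that] by (rule DERIV_imp_deriv)
  then have "differentiable_order k S (deriv f)"
    by (intro differentiable_order_cong[OF assms(1,3)]) simp
  moreover have "f field_differentiable at t" if "t \<in> S" for t
    using assms(2)[OF that] by (auto simp: field_differentiable_def)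
  ultimately show ?thesis by simp
qed

lemma differentiable_order_deriv:
  assumes "differentiable_order (Suc k) S f" "t \<in> S"
  shows "(f has_real_derivative deriv f t) (at t)"
  using assms by (simp add: field_differentiable_derivI)

lemma differentiable_order_continuous:
  "differentiable_order k S f \<Longrightarrow> continuous_on S f"
  by (cases k) (auto intro!: continuous_at_imp_continuous_on field_differentiable_imp_continuous_at)

lemma differentiable_order_SucD:
  "differentiable_order (Suc k) S f \<Longrightarrow> differentiable_order k S f"
proof (induction k arbitrary: f)
  case 0
  from differentiable_order_continuous[OF this] show ?case by simp
next
  case (Suc k)
  from Suc.prems Suc.IH[of "deriv f"] show ?case by simp
qed

lemma differentiable_order_Un:
  assumes "open S" "open T"
  shows "differentiable_order k S f \<Longrightarrow> differentiable_order k T f \<Longrightarrow> differentiable_order k (S \<union> T) f"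
proof (induction k arbitrary: f)
  case 0 then show ?case using assms by (simp add: continuous_on_open_Un)
next
  case (Suc k) then show ?case by auto
qed

lemma differentiable_order_const: "open S \<Longrightarrow> differentiable_order k S (\<lambda>_. c)"
proof (induction k arbitrary: c)
  case 0 then show ?case by simp
next
  case (Suc k)
  then show ?case by (intro differentiable_order_SucI[where f'="\<lambda>_. 0"]) auto
qed

lemma differentiable_order_ident: "open S \<Longrightarrow> differentiable_order k S (\<lambda>t. t)"
proof (cases k)
  case (Suc j)
  assume "open S"
  then show ?thesis unfolding Suc
    by (intro differentiable_order_SucI[where f'="\<lambda>_. 1"] differentiable_order_const) auto
qed simp

lemma differentiable_order_add:
  assumes S: "open S"
  shows "differentiable_order k S f \<Longrightarrow> differentiable_order k S g \<Longrightarrow> differentiable_order k S (\<lambda>t. f t + g t)"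
proof (induction k arbitrary: f g)
  case 0 then show ?case by (simp add: continuous_on_add)
next
  case (Suc k)
  show ?case
  proof (rule differentiable_order_SucI[OF S])
    show "differentiable_order k S (\<lambda>t. deriv f t + deriv g t)" using Suc by simp
    show "((\<lambda>t. f t + g t) has_real_derivative deriv f t + deriv g t) (at t)" if "t \<in> S" for t
      using differentiable_order_deriv[OF Suc.prems(1) that] differentiable_order_deriv[OF Suc.prems(2) that]
      by (rule DERIV_add)
  qed
qed

lemma differentiable_order_mult:
  assumes S: "open S"
  shows "differentiable_order k S f \<Longrightarrow> differentiable_order k S g \<Longrightarrow> differentiable_order k S (\<lambda>t. f t * g t)"
proof (induction k arbitrary: f g)
  case 0 then show ?case by (simp add: continuous_on_mult)
next
  case (Suc k)
  show ?case
  proof (rule differentiable_order_SucI[OF S])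
    show "differentiable_order k S (\<lambda>t. deriv f t * g t + deriv g t * f t)"
    proof (rule differentiable_order_add[OF S Suc.IH Suc.IH])
      show "differentiable_order k S f" by (rule differentiable_order_SucD[OF Suc.prems(1)])
      show "differentiable_order k S g" by (rule differentiable_order_SucD[OF Suc.prems(2)])
      show "differentiable_order k S (deriv f)" "differentiable_order k S (deriv g)"
        using Suc.prems by auto
    qed
    show "((\<lambda>t. f t * g t) has_real_derivative deriv f t * g t + deriv g t * f t) (at t)" if "t \<in> S" for t
      by (rule DERIV_mult[OF differentiable_order_deriv[OF Suc.prems(1) that] differentiable_order_deriv[OF Suc.prems(2) that]])
  qed
qed

lemma differentiable_order_compose:
  assumes S: "open S" and T: "open T" and sub: "\<And>t. t \<in> S \<Longrightarrow> g t \<in> T"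
  shows "differentiable_order k T f \<Longrightarrow> differentiable_order k S g \<Longrightarrow> differentiable_order k S (\<lambda>t. f (g t))"
proof (induction k arbitrary: f)
  case 0 then show ?case using sub by (auto intro!: continuous_on_compose2[of T f S g])
next
  case (Suc k)
  show ?case
  proof (rule differentiable_order_SucI[OF S])
    show "differentiable_order k S (\<lambda>t. deriv f (g t) * deriv g t)"
    proof (rule differentiable_order_mult[OF S Suc.IH])
      show "differentiable_order k S g" by (rule differentiable_order_SucD[OF Suc.prems(2)])
      show "differentiable_order k T (deriv f)" "differentiable_order k S (deriv g)"
        using Suc.prems by auto
    qed
    show "((\<lambda>t. f (g t)) has_real_derivative deriv f (g t) * deriv g t) (at t)" if "t \<in> S" for t
      by (rule DERIV_chain2[OF differentiable_order_deriv[OF Suc.prems(1) sub[OF that]] differentiable_order_deriv[OF Suc.prems(2) that]])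
  qed
qed

lemma differentiable_order_cmult:
  "open S \<Longrightarrow> differentiable_order k S f \<Longrightarrow> differentiable_order k S (\<lambda>t. c * f t)"
  by (rule differentiable_order_mult[OF _ differentiable_order_const])

lemma differentiable_order_exp: "differentiable_order k UNIV exp"
proof (induction k)
  case (Suc k)
  show ?case by (rule differentiable_order_SucI[OF _ _ Suc]) auto
qed (simp add: continuous_on_exp continuous_on_id)

lemma differentiable_order_inverse: "differentiable_order k {0<..} inverse"
proof (induction k)
  case 0 show ?case by (auto intro!: continuous_intros)
next
  case (Suc k)
  show ?case
  proof (rule differentiable_order_SucI)
    show "differentiable_order k {0<..} (\<lambda>t. -1 * (inverse t * inverse t))"
      by (intro differentiable_order_cmult differentiable_order_mult Suc) auto
    show "(inverse has_real_derivative -1 * (inverse t * inverse t)) (at t)" if "t \<in> {0<..}" for t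
      using that DERIV_inverse[of t] by (simp add: power2_eq_square)
  qed simp
qed

lemma differentiable_order_ln: "differentiable_order k {0<..} (\<lambda>t. ln t)"
proof (cases k)
  case 0 then show ?thesis by (auto intro!: continuous_intros)
next
  case (Suc j)
  show ?thesis unfolding Suc
    by (rule differentiable_order_SucI[OF _ _ differentiable_order_inverse]) (auto simp: DERIV_ln)
qed

lemma differentiable_order_powr:
  assumes "open S" "differentiable_order k S f" "\<And>t. t \<in> S \<Longrightarrow> f t > 0"
  shows "differentiable_order k S (\<lambda>t. f t powr a)"
proof -
  have "differentiable_order k S (\<lambda>t. exp (a * ln (f t)))"
    using assms
    by (intro differentiable_order_compose[OF _ open_UNIV _ differentiable_order_exp] differentiable_order_cmult
        differentiable_order_compose[OF _ open_greaterThan _ differentiable_order_ln]) auto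
  then show ?thesis
    by (rule differentiable_order_cong[OF assms(1)]) (use assms(3) in \<open>force simp: powr_def\<close>)
qed

text \<open>The standard flat function, with powers of \<open>inverse t\<close> carried along: up to
  linear combinations the family is closed under differentiation, so one induction over all
  \<open>n\<close> gives smoothness.\<close>

definition flat_exp :: "nat \<Rightarrow> real \<Rightarrow> real" where
  "flat_exp n t = (if t > 0 then inverse t ^ n * exp (- inverse t) else 0)"

lemma flat_exp_tendsto_0: "(flat_exp n \<longlongrightarrow> 0) (at 0)"
proof -
  have "((\<lambda>x::real. x ^ n / exp x) \<longlongrightarrow> 0) at_top" by (rule tendsto_power_div_exp_0)
  from filterlim_compose[OF this filterlim_inverse_at_top_right]
  have "((\<lambda>t::real. inverse t ^ n / exp (inverse t)) \<longlongrightarrow> 0) (at_right 0)" .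
  then have "(flat_exp n \<longlongrightarrow> 0) (at_right 0)"
    by (rule Lim_transform_eventually)
       (auto simp: eventually_at_right_less eventually_at_filter flat_exp_def exp_minus field_simps)
  moreover have "(flat_exp n \<longlongrightarrow> 0) (at_left 0)"
    by (rule tendsto_eventually) (auto simp: eventually_at_filter flat_exp_def)
  ultimately show ?thesis by (simp add: filterlim_split_at)
qed

lemma flat_exp_deriv:
  "(flat_exp n has_real_derivative - real n * flat_exp (n + 1) t + flat_exp (n + 2) t) (at t)"
proof -
  consider "t > 0" | "t < 0" | "t = 0" by linarith
  then show ?thesis
  proof cases
    case 1
    have ev: "eventually (\<lambda>s. flat_exp n s = inverse s ^ n * exp (- inverse s)) (nhds t)"
      using eventually_nhds_in_open[of "{0<..}" t] 1 by (auto elim!: eventually_mono simp: flat_exp_def)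
    have di: "(inverse has_real_derivative - (inverse t ^ 2)) (at t)"
      using DERIV_inverse[of t] 1 by (simp add: numeral_2_eq_2)
    have "((\<lambda>s. inverse s ^ n * exp (- inverse s)) has_real_derivative
       (of_nat n * (- (inverse t ^ 2) * inverse t ^ (n - Suc 0))) * exp (- inverse t) +
       (exp (- inverse t) * (- (- (inverse t ^ 2)))) * inverse t ^ n) (at t)"
      by (rule DERIV_mult[OF DERIV_power[OF di] DERIV_chain2[OF DERIV_exp DERIV_minus[OF di]]])
    moreover have "(of_nat n * (- (inverse t ^ 2) * inverse t ^ (n - Suc 0))) * exp (- inverse t) +
       (exp (- inverse t) * (- (- (inverse t ^ 2)))) * inverse t ^ n = - real n * flat_exp (n + 1) t + flat_exp (n + 2) t"
    proof -
      have e1: "real n * (inverse t ^ 2 * inverse t ^ (n - Suc 0)) = real n * inverse t ^ (n + 1)"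
      proof (cases n)
        case (Suc m)
        have "x ^ 2 * x ^ m = x ^ (Suc m + 1)" for x :: real by (simp add: power2_eq_square mult.assoc)
        from this[of "inverse t"] show ?thesis unfolding Suc by (simp only: diff_Suc_Suc diff_zero)
      qed simp
      have e2: "inverse t ^ 2 * inverse t ^ n = inverse t ^ (n + 2)" by (simp only: power_add mult.commute)
      have "(N * (- I * X)) * E + (E * (- (- I))) * P = - (N * (I * X)) * E + (I * P) * E" for N I X E P :: real
        by (simp add: algebra_simps)
      then have "(of_nat n * (- (inverse t ^ 2) * inverse t ^ (n - Suc 0))) * exp (- inverse t) +
          (exp (- inverse t) * (- (- (inverse t ^ 2)))) * inverse t ^ n =
          - (real n * inverse t ^ (n + 1)) * exp (- inverse t) + inverse t ^ (n + 2) * exp (- inverse t)"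
        unfolding e1[symmetric] e2[symmetric] by blast
      also have "\<dots> = - real n * flat_exp (n + 1) t + flat_exp (n + 2) t"
        using 1 unfolding flat_exp_def by simp
      finally show ?thesis .
    qed
    ultimately have "((\<lambda>s. inverse s ^ n * exp (- inverse s)) has_real_derivative - real n * flat_exp (n + 1) t + flat_exp (n + 2) t) (at t)"
      by (simp only:)
    then show ?thesis by (subst DERIV_cong_ev[OF refl ev refl])
  next
    case 2
    have ev: "eventually (\<lambda>s. flat_exp n s = 0) (nhds t)"
      using eventually_nhds_in_open[of "{..<0}" t] 2 by (auto elim!: eventually_mono simp: flat_exp_def)
    have "- real n * flat_exp (n + 1) t + flat_exp (n + 2) t = 0" using 2 by (simp add: flat_exp_def)
    then show ?thesis by (subst DERIV_cong_ev[OF refl ev refl]) simp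
  next
    case 3
    \<comment> \<open>At 0 the difference quotient of \<open>flat_exp n\<close> is
      \<open>flat_exp (n + 1)\<close>, also from the left, where both vanish.\<close>
    have "((\<lambda>h. (flat_exp n (0 + h) - flat_exp n 0) / h) \<longlongrightarrow> 0) (at 0)"
    proof (rule Lim_transform_eventually[OF flat_exp_tendsto_0[of "n + 1"]])
      show "\<forall>\<^sub>F h in at 0. flat_exp (n + 1) h = (flat_exp n (0 + h) - flat_exp n 0) / h"
        by (auto simp: eventually_at_filter flat_exp_def field_simps)
    qed
    then have "(flat_exp n has_real_derivative 0) (at 0)" by (simp add: DERIV_def)
    then show ?thesis using 3 by (simp add: flat_exp_def)
  qed
qed

lemma differentiable_order_flat_exp: "differentiable_order k UNIV (flat_exp n)"
proof (induction k arbitrary: n)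
  case 0
  show ?case by (auto intro!: continuous_at_imp_continuous_on DERIV_isCont[OF flat_exp_deriv])
next
  case (Suc k)
  show ?case
    by (rule differentiable_order_SucI[OF open_UNIV flat_exp_deriv
          differentiable_order_add[OF open_UNIV differentiable_order_cmult[OF open_UNIV Suc] Suc]])
qed

section \<open>Calculus of \<open>C_k\<close> functions of several variables\<close>

lemma C_k_SucI:
  assumes "\<And>x. (f has_derivative f' x) (at x)" "\<And>i. C_k k (\<lambda>x. f' x (axis i 1))"
  shows "C_k (Suc k) f"
proof -
  have "partial_deriv i f = (\<lambda>x. f' x (axis i 1))" for i
    by (rule ext) (simp add: partial_deriv_def frechet_derivative_at[OF assms(1), symmetric])
  moreover have "f differentiable_on UNIV"
    using assms(1) by (auto simp: differentiable_on_def differentiable_def)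
  ultimately show ?thesis using assms(2) by simp
qed

lemma C_k_SucE:
  assumes "C_k (Suc k) f"
  shows "(f has_derivative frechet_derivative f (at x)) (at x)"
    and "C_k k (\<lambda>x. frechet_derivative f (at x) (axis i 1))"
proof -
  show "(f has_derivative frechet_derivative f (at x)) (at x)"
    using assms by (simp add: differentiable_on_def flip: frechet_derivative_works)
  have eq: "partial_deriv i f = (\<lambda>x. frechet_derivative f (at x) (axis i 1))"
    by (rule ext) (rule partial_deriv_def)
  have "C_k k (partial_deriv i f)" using assms by simp
  then show "C_k k (\<lambda>x. frechet_derivative f (at x) (axis i 1))" unfolding eq .
qed

lemma C_k_continuous: "C_k k f \<Longrightarrow> continuous_on UNIV f"
  by (cases k) (auto intro: differentiable_imp_continuous_on)

lemma C_k_SucD: "C_k (Suc k) f \<Longrightarrow> C_k k f"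
proof (induction k arbitrary: f)
  case 0 then show ?case using C_k_continuous[of "Suc 0" f] by simp
next
  case (Suc k)
  from Suc.prems have "f differentiable_on UNIV" "\<And>i. C_k (Suc k) (partial_deriv i f)" by auto
  with Suc.IH show ?case by simp
qed

lemma C_k_const: "C_k k (\<lambda>_. c)"
proof (induction k arbitrary: c)
  case (Suc k)
  show ?case by (rule C_k_SucI[OF has_derivative_const]) (rule Suc)
qed simp

lemma C_k_coord: "C_k k (\<lambda>x :: real ^ 'n::finite. complex_of_real (x $ i))"
proof (cases k)
  case 0 then show ?thesis by (auto intro!: continuous_intros)
next
  case (Suc j)
  have d: "((\<lambda>x :: real ^ 'n. complex_of_real (x $ i)) has_derivative (\<lambda>h. complex_of_real (h $ i))) (at x)" for x
    by (intro bounded_linear_imp_has_derivative bounded_linear_compose[OF bounded_linear_of_real bounded_linear_vec_nth])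
  show ?thesis unfolding Suc by (rule C_k_SucI[OF d]) (rule C_k_const)
qed

lemma C_k_add: "C_k k f \<Longrightarrow> C_k k g \<Longrightarrow> C_k k (\<lambda>x. f x + g x)"
proof (induction k arbitrary: f g)
  case 0 then show ?case by (simp add: continuous_on_add)
next
  case (Suc k)
  show ?case
    by (rule C_k_SucI[OF has_derivative_add[OF C_k_SucE(1)[OF Suc.prems(1)] C_k_SucE(1)[OF Suc.prems(2)]]])
       (rule Suc.IH[OF C_k_SucE(2)[OF Suc.prems(1)] C_k_SucE(2)[OF Suc.prems(2)]])
qed

lemma C_k_mult: "C_k k f \<Longrightarrow> C_k k g \<Longrightarrow> C_k k (\<lambda>x. f x * g x)"
proof (induction k arbitrary: f g)
  case 0 then show ?case by (simp add: continuous_on_mult)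
next
  case (Suc k)
  show ?case
    by (rule C_k_SucI[OF has_derivative_mult[OF C_k_SucE(1)[OF Suc.prems(1)] C_k_SucE(1)[OF Suc.prems(2)]]])
       (rule C_k_add[OF Suc.IH[OF C_k_SucD[OF Suc.prems(1)] C_k_SucE(2)[OF Suc.prems(2)]]
          Suc.IH[OF C_k_SucE(2)[OF Suc.prems(1)] C_k_SucD[OF Suc.prems(2)]]])
qed

lemma C_k_sum: "finite I \<Longrightarrow> (\<And>i. i \<in> I \<Longrightarrow> C_k k (f i)) \<Longrightarrow> C_k k (\<lambda>x. \<Sum>i\<in>I. f i x)"
  by (induction I rule: finite_induct) (auto intro: C_k_const C_k_add)

lemma C_k_prod: "finite I \<Longrightarrow> (\<And>i. i \<in> I \<Longrightarrow> C_k k (f i)) \<Longrightarrow> C_k k (\<lambda>x. \<Prod>i\<in>I. f i x)"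
  by (induction I rule: finite_induct) (auto intro: C_k_const C_k_mult)

lemma C_k_compose:
  fixes g :: "real ^ 'n::finite \<Rightarrow> real"
  shows "differentiable_order k UNIV F \<Longrightarrow> C_k k (\<lambda>x. complex_of_real (g x)) \<Longrightarrow> C_k k (\<lambda>x. complex_of_real (F (g x)))"
proof (induction k arbitrary: F)
  case 0
  have "continuous_on UNIV (\<lambda>x. Re (complex_of_real (g x)))"
    by (rule continuous_on_Re) (use 0 in simp)
  then have "continuous_on UNIV g" by simp
  then show ?case using 0 by (auto intro!: continuous_on_of_real continuous_on_compose2[of UNIV F UNIV g])
next
  case (Suc k)
  define G where "G x = frechet_derivative (\<lambda>x. complex_of_real (g x)) (at x)" for x
  have dG: "((\<lambda>x. complex_of_real (g x)) has_derivative G x) (at x)" for x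
    unfolding G_def by (rule C_k_SucE(1)[OF Suc.prems(2)])
  \<comment> \<open>The derivative of a real function embedded in the complex numbers takes real
    values; only then does the chain rule for the real function \<open>F\<close> apply.\<close>
  have GR: "G x h = of_real (Re (G x h))" for x h
  proof -
    have 1: "(g has_derivative (\<lambda>h. Re (G x h))) (at x)"
      using bounded_linear.has_derivative[OF bounded_linear_Re dG[of x]] by simp
    have "((\<lambda>x. complex_of_real (g x)) has_derivative (\<lambda>h. of_real (Re (G x h)))) (at x)"
      by (rule bounded_linear.has_derivative[OF bounded_linear_of_real 1])
    with dG[of x] have "G x = (\<lambda>h. of_real (Re (G x h)))" by (rule has_derivative_unique)
    then show ?thesis by (rule fun_cong)
  qed
  have "((\<lambda>x. complex_of_real (F (g x))) has_derivative (\<lambda>h. complex_of_real (deriv F (g x)) * G x h)) (at x)" for x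
  proof -
    have 1: "(g has_derivative (\<lambda>h. Re (G x h))) (at x)"
      using bounded_linear.has_derivative[OF bounded_linear_Re dG[of x]] by simp
    have "(F has_derivative (\<lambda>h. deriv F (g x) * h)) (at (g x))"
      using differentiable_order_deriv[OF Suc.prems(1), of "g x"] by (simp add: has_field_derivative_def)
    from has_derivative_compose[OF 1 this]
    have "((\<lambda>x. F (g x)) has_derivative (\<lambda>h. deriv F (g x) * Re (G x h))) (at x)" .
    from bounded_linear.has_derivative[OF bounded_linear_of_real this]
    have "((\<lambda>x. complex_of_real (F (g x))) has_derivative (\<lambda>h. complex_of_real (deriv F (g x) * Re (G x h)))) (at x)" .
    moreover have "complex_of_real (deriv F (g x) * Re (G x h)) = complex_of_real (deriv F (g x)) * G x h" for h
      unfolding of_real_mult GR[of x h, symmetric] ..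
    ultimately show ?thesis by (simp only:)
  qed
  then show ?case
  proof (rule C_k_SucI)
    fix i
    have "C_k k (\<lambda>x. G x (axis i 1))" unfolding G_def by (rule C_k_SucE(2)[OF Suc.prems(2)])
    then show "C_k k (\<lambda>x. complex_of_real (deriv F (g x)) * G x (axis i 1))"
      using Suc.IH[of "deriv F"] Suc.prems C_k_SucD[OF Suc.prems(2)] by (simp add: C_k_mult)
  qed
qed

lemma test_functionsI:
  fixes f :: "real ^ 'n::finite \<Rightarrow> complex"
  assumes "\<And>k. C_k k f" "compact K" "\<And>x. x \<notin> K \<Longrightarrow> f x = 0"
  shows "f \<in> test_functions"
proof -
  have "{x. f x \<noteq> 0} \<subseteq> K" using assms(3) by blast
  then have "bounded {x. f x \<noteq> 0}" using assms(2) compact_imp_bounded bounded_subset by blast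
  then show ?thesis using assms(1) by (simp add: test_functions_def)
qed

lemma test_function_continuous:
  "f \<in> test_functions \<Longrightarrow> continuous_on UNIV f"
  using C_k_continuous[of 0 f] by (auto simp: test_functions_def)

lemma test_function_measurable [measurable_dest]:
  "f \<in> test_functions \<Longrightarrow> f \<in> borel_measurable borel"
  by (rule borel_measurable_continuous_onI[OF test_function_continuous])

section \<open>Bump functions and the fundamental lemma of the calculus of variations\<close>

lemma flat_exp_0_bounds: "0 \<le> flat_exp 0 t" "flat_exp 0 t \<le> 1"
  by (auto simp: flat_exp_def)

lemma flat_exp_0_scaled_tendsto:
  "(\<lambda>m. flat_exp 0 (real (Suc m) * t)) \<longlonglongrightarrow> (if t > 0 then 1 else 0)"
proof (cases "t > 0")
  case True
  have "(\<lambda>m. exp (- (inverse t * inverse (real (Suc m))))) \<longlonglongrightarrow> exp (- (inverse t * 0))"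
    by (intro tendsto_intros LIMSEQ_inverse_real_of_nat)
  moreover have "exp (- (inverse t * inverse (real (Suc m)))) = flat_exp 0 (real (Suc m) * t)" for m
    using True by (simp add: flat_exp_def mult.commute)
  ultimately show ?thesis using True by simp
next
  case False
  then have "flat_exp 0 (real (Suc m) * t) = 0" for m
    by (auto simp: flat_exp_def zero_less_mult_iff)
  then show ?thesis using False by simp
qed

text \<open>Smooth substitutes for the indicator of an open box, to which they converge as
  \<open>m\<close> grows: \<open>exp (- 1 / (m * t))\<close> tends to 1 for every positive
  \<open>t\<close>. They transfer tests against smooth functions to boxes.\<close>

definition box_bump :: "nat \<Rightarrow> real ^ 'n::finite \<Rightarrow> real ^ 'n \<Rightarrow> real ^ 'n \<Rightarrow> real" where
  "box_bump m a b x = (\<Prod>i\<in>UNIV. flat_exp 0 (real (Suc m) * (x $ i - a $ i)) * flat_exp 0 (real (Suc m) * (b $ i - x $ i)))"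

lemma box_bump_bounds: "0 \<le> box_bump m a b x" "box_bump m a b x \<le> 1"
  unfolding box_bump_def
  by (auto intro!: prod_nonneg prod_le_1 mult_nonneg_nonneg mult_le_one flat_exp_0_bounds)

lemma box_bump_outside: "x \<notin> cbox a b \<Longrightarrow> box_bump m a b x = 0"
proof -
  assume "x \<notin> cbox a b"
  then obtain i where "x $ i < a $ i \<or> b $ i < x $ i" by (auto simp: mem_box_cart not_le)
  then have "flat_exp 0 (real (Suc m) * (x $ i - a $ i)) * flat_exp 0 (real (Suc m) * (b $ i - x $ i)) = 0"
    by (auto simp: flat_exp_def zero_less_mult_iff)
  then show ?thesis unfolding box_bump_def by (intro prod_zero) auto
qed

lemma box_bump_tendsto: "(\<lambda>m. box_bump m a b x) \<longlonglongrightarrow> indicator (box a b) x"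
proof -
  have "(\<lambda>m. box_bump m a b x) \<longlonglongrightarrow>
      (\<Prod>i\<in>UNIV. (if x $ i - a $ i > 0 then 1 else 0) * (if b $ i - x $ i > 0 then 1 else 0))"
    unfolding box_bump_def by (intro tendsto_prod tendsto_mult flat_exp_0_scaled_tendsto)
  also have "(\<Prod>i\<in>UNIV. (if x $ i - a $ i > 0 then 1 else 0) * (if b $ i - x $ i > 0 then 1 else 0)) = (indicator (box a b) x :: real)"
  proof (cases "x \<in> box a b")
    case True
    then show ?thesis by (simp add: mem_box_cart)
  next
    case False
    then obtain i where "\<not> (a $ i < x $ i \<and> x $ i < b $ i)" by (auto simp: mem_box_cart)
    then show ?thesis using False by (auto intro!: prod_zero)
  qed
  finally show ?thesis .
qed

lemma box_bump_test: "(\<lambda>x. complex_of_real (box_bump m a b x)) \<in> test_functions"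
proof (rule test_functionsI[where K="cbox a b"])
  fix k
  have 1: "C_k k (\<lambda>x :: real ^ 'a. complex_of_real (c * (x $ i) + e))" for c e i
    using C_k_add[OF C_k_mult[OF C_k_const C_k_coord] C_k_const, of k "of_real c" i "of_real e"] by simp
  have 2: "C_k k (\<lambda>x :: real ^ 'a. complex_of_real (flat_exp 0 (c * (x $ i) + e)))" for c e i
    by (rule C_k_compose[OF differentiable_order_flat_exp 1])
  have 3: "C_k k (\<lambda>x. complex_of_real (flat_exp 0 (real (Suc m) * (x $ i - a $ i)) * flat_exp 0 (real (Suc m) * (b $ i - x $ i))))" for i
  proof -
    have e: "real (Suc m) * (x $ i - a $ i) = real (Suc m) * (x $ i) + - (real (Suc m) * a $ i)"
      "real (Suc m) * (b $ i - x $ i) = - real (Suc m) * (x $ i) + real (Suc m) * b $ i" for x :: "real ^ 'a"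
      by (simp_all add: algebra_simps)
    show ?thesis unfolding e of_real_mult[of "flat_exp _ _"] by (rule C_k_mult[OF 2 2])
  qed
  show "C_k k (\<lambda>x. complex_of_real (box_bump m a b x))"
    unfolding box_bump_def of_real_prod by (rule C_k_prod[OF _ 3]) simp
qed (auto simp: box_bump_outside)

text \<open>Boxes form an intersection-stable generator of the Borel sets, so a Dynkin argument
  extends the vanishing of the integral to all Borel sets. The whole space is reached as an
  increasing union of boxes.\<close>

lemma AE_zero_if_box_integrals_zero:
  fixes f :: "'a::euclidean_space \<Rightarrow> real"
  assumes f: "integrable lborel f" and box: "\<And>a b. (LINT x|lborel. indicator (box a b) x * f x) = 0"
  shows "AE x in lborel. f x = 0"
proof (rule sigma_finite_measure.density_zero[OF sigma_finite_lborel f])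
  fix A :: "'a set" assume "A \<in> sets lborel"
  then have A: "A \<in> sigma_sets UNIV (range (\<lambda>(a, b). box a b))"
    by (simp add: borel_eq_box)
  have [measurable]: "f \<in> borel_measurable borel" using f by auto
  have sets: "B \<in> sets lborel" if "B \<in> sigma_sets UNIV (range (\<lambda>(a::'a, b). box a b))" for B
    using that by (simp add: borel_eq_box)
  have si: "set_integrable lborel B f" if "B \<in> sets lborel" for B
    unfolding set_integrable_def by (rule integrable_mult_indicator[OF that f])
  define P where "P B \<longleftrightarrow> set_lebesgue_integral lborel B f = 0" for B
  have boxz: "P (box a b)" for a b using box by (simp add: P_def set_lebesgue_integral_def)
  have whole: "P UNIV"
  proof -
    define K where "K n = box (- (real n *\<^sub>R One)) (real n *\<^sub>R One :: 'a)" for n :: nat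
    have "(\<lambda>n. set_lebesgue_integral lborel (K n) f) \<longlonglongrightarrow> set_lebesgue_integral lborel (\<Union>n. K n) f"
    proof (rule set_integral_cont_up)
      show "K n \<in> sets lborel" for n by (simp add: K_def)
      show "incseq K"
        unfolding incseq_def
      proof (intro allI impI subsetI)
        fix m n :: nat and x assume mn: "m \<le> n" and x: "x \<in> K m"
        have r: "real m \<le> real n" using mn by simp
        have "- real n < x \<bullet> i \<and> x \<bullet> i < real n" if "i \<in> Basis" for i
        proof -
          have "- real m < x \<bullet> i \<and> x \<bullet> i < real m" using x that by (simp add: K_def mem_box)
          with r show ?thesis by linarith
        qed
        then show "x \<in> K n" by (simp add: K_def mem_box)
      qed
      show "set_integrable lborel (\<Union>n. K n) f" by (rule si) (auto simp: K_def)
    qed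
    moreover have "(\<Union>n. K n) = UNIV" unfolding K_def by (rule UN_box_eq_UNIV)
    moreover have "set_lebesgue_integral lborel (K n) f = 0" for n using boxz by (simp add: P_def K_def)
    ultimately show ?thesis by (simp add: P_def LIMSEQ_const_iff)
  qed
  have stable: "Int_stable (range (\<lambda>(a::'a, b). box a b))"
    by (auto simp: Int_stable_def box_Int_box)
  have sub: "range (\<lambda>(a::'a, b). box a b) \<subseteq> Pow UNIV" by simp
  from stable sub A have "P A"
  proof (induction rule: sigma_sets_induct_disjoint)
    case (basic B) then show ?case using boxz by auto
  next
    case empty then show ?case by (simp add: P_def set_lebesgue_integral_def)
  next
    case (compl B)
    have "B \<in> sets lborel" by (rule sets[OF compl(1)])
    have "UNIV = B \<union> (UNIV - B)" by auto
    then have "set_lebesgue_integral lborel UNIV f = set_lebesgue_integral lborel B f + set_lebesgue_integral lborel (UNIV - B) f"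
      using set_integral_Un[of B "UNIV - B" lborel f] si \<open>B \<in> sets lborel\<close> by auto
    then show ?case using whole compl(2) by (simp add: P_def)
  next
    case (union B)
    have s: "B i \<in> sets lborel" for i using sets union(2) by blast
    have "set_lebesgue_integral lborel (\<Union>i. B i) f = (\<Sum>i. set_lebesgue_integral lborel (B i) f)"
    proof (rule lebesgue_integral_countable_add)
      show "\<And>i. B i \<in> sets lborel" by (rule s)
      show "\<And>i j. i \<noteq> j \<Longrightarrow> B i \<inter> B j = {}" using union(1) by (auto simp: disjoint_family_on_def)
      show "set_integrable lborel (\<Union>i. B i) f" by (rule si) (use s in auto)
    qed
    then show ?case using union(3) by (simp add: P_def)
  qed
  then show "set_lebesgue_integral lborel A f = 0" by (simp add: P_def)
qed

lemma AE_zero_if_box_integrals_zero_lebesgue: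
  fixes f :: "'a::euclidean_space \<Rightarrow> real"
  assumes f: "integrable lebesgue f" and box: "\<And>a b. (LINT x|lebesgue. indicator (box a b) x * f x) = 0"
  shows "AE x in lebesgue. f x = 0"
proof -
  obtain g where g[measurable]: "g \<in> borel_measurable lborel" and eq: "AE x in lborel. f x = g x"
    using completion_ex_borel_measurable_real[of f lborel] f by auto
  have eq': "AE x in lebesgue. f x = g x" using eq by (rule AE_completion)
  have gl[measurable]: "g \<in> borel_measurable lebesgue" using g by (rule measurable_completion)
  have [measurable]: "f \<in> borel_measurable lebesgue" using f by auto
  have "integrable lebesgue g"
    by (rule integrable_cong_AE_imp[OF f gl]) (use eq' in \<open>eventually_elim, simp\<close>)
  then have gi: "integrable lborel g" using integrable_completion[OF g] by simp
  have "(LINT x|lborel. indicator (box a b) x * g x) = 0" for a b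
  proof -
    have "(LINT x|lborel. indicator (box a b) x * g x) = (LINT x|lebesgue. indicator (box a b) x * g x)"
      by (rule integral_completion[symmetric]) simp
    also have "\<dots> = (LINT x|lebesgue. indicator (box a b) x * f x)"
    proof (rule integral_cong_AE)
      show "AE x in lebesgue. indicator (box a b) x * g x = indicator (box a b) x * f x"
        using eq' by eventually_elim simp
    qed (intro borel_measurable_times borel_measurable_indicator gl \<open>f \<in> borel_measurable lebesgue\<close>, simp)+
    finally show ?thesis using box by simp
  qed
  from AE_completion[OF AE_zero_if_box_integrals_zero[OF gi this]] eq'
  show ?thesis by eventually_elim simp
qed

text \<open>Testing with box bumps gives, by dominated convergence, vanishing integrals over all
  boxes. Cutting \<open>g\<close> off to the boxes \<open>K n\<close> makes it integrable, and real
  and imaginary parts are treated separately.\<close>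

lemma fundamental_lemma_calculus_of_variations:
  fixes g :: "real ^ 'n::finite \<Rightarrow> complex"
  assumes g: "locally_integrable g" and test: "\<And>\<psi>. \<psi> \<in> test_functions \<Longrightarrow> (LINT x|lebesgue. g x * \<psi> x) = 0"
  shows "AE x in lebesgue. g x = 0"
proof -
  have si: "integrable lebesgue (\<lambda>x. indicator K x *\<^sub>R g x)" if "compact K" for K
    using g that by (simp add: locally_integrable_def set_integrable_def)
  have sib: "integrable lebesgue (\<lambda>x. indicator (box a b) x *\<^sub>R g x)" for a b
  proof -
    have "integrable lebesgue (\<lambda>x. indicator (box a b) x *\<^sub>R (indicator (cbox a b) x *\<^sub>R g x))"
      by (rule integrable_mult_indicator[OF _ si]) auto
    also have "(\<lambda>x. indicator (box a b) x *\<^sub>R (indicator (cbox a b) x *\<^sub>R g x)) = (\<lambda>x. indicator (box a b) x *\<^sub>R g x)"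
      using box_subset_cbox by (auto simp: fun_eq_iff split: split_indicator)
    finally show ?thesis .
  qed
  have boxz: "(LINT x|lebesgue. indicator (box a b) x *\<^sub>R g x) = 0" for a b
  proof -
    have "(\<lambda>m. LINT x|lebesgue. of_real (box_bump m a b x) * (indicator (cbox a b) x *\<^sub>R g x)) \<longlonglongrightarrow>
        (LINT x|lebesgue. indicator (box a b) x *\<^sub>R g x)"
    proof (rule integral_dominated_convergence)
      show "integrable lebesgue (\<lambda>x. norm (indicator (cbox a b) x *\<^sub>R g x))" by (intro integrable_norm si) simp
      show "(\<lambda>x. indicator (box a b) x *\<^sub>R g x) \<in> borel_measurable lebesgue" using sib by auto
      fix m
      have "(\<lambda>x. complex_of_real (box_bump m a b x)) \<in> borel_measurable lborel"
        using test_function_measurable[OF box_bump_test[of m a b]] by simp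
      then have "(\<lambda>x. complex_of_real (box_bump m a b x)) \<in> borel_measurable lebesgue"
        by (rule measurable_completion)
      moreover have "(\<lambda>x. indicator (cbox a b) x *\<^sub>R g x) \<in> borel_measurable lebesgue"
        by (rule borel_measurable_integrable[OF si]) simp
      ultimately show "(\<lambda>x. of_real (box_bump m a b x) * (indicator (cbox a b) x *\<^sub>R g x)) \<in> borel_measurable lebesgue"
        by (rule borel_measurable_times)
      show "AE x in lebesgue. norm (of_real (box_bump m a b x) * (indicator (cbox a b) x *\<^sub>R g x)) \<le> norm (indicator (cbox a b) x *\<^sub>R g x)"
        by (intro AE_I2) (auto simp: norm_mult box_bump_bounds intro!: mult_left_le_one_le split: split_indicator)
    next
      have "(\<lambda>m. of_real (box_bump m a b x) * (indicator (cbox a b) x *\<^sub>R g x)) \<longlonglongrightarrow>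
          of_real (indicator (box a b) x) * (indicator (cbox a b) x *\<^sub>R g x)" for x
        by (intro tendsto_mult tendsto_of_real box_bump_tendsto tendsto_const)
      moreover have "of_real (indicator (box a b) x) * (indicator (cbox a b) x *\<^sub>R g x) = indicator (box a b) x *\<^sub>R g x" for x
        using box_subset_cbox[of a b] by (auto split: split_indicator)
      ultimately show "AE x in lebesgue. (\<lambda>m. of_real (box_bump m a b x) * (indicator (cbox a b) x *\<^sub>R g x)) \<longlonglongrightarrow> indicator (box a b) x *\<^sub>R g x"
        by simp
    qed
    moreover have "(LINT x|lebesgue. of_real (box_bump m a b x) * (indicator (cbox a b) x *\<^sub>R g x)) = 0" for m
    proof -
      have "of_real (box_bump m a b x) * (indicator (cbox a b) x *\<^sub>R g x) = g x * of_real (box_bump m a b x)" for x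
        by (cases "x \<in> cbox a b") (auto simp: box_bump_outside)
      then show ?thesis using test[OF box_bump_test[of m a b]] by simp
    qed
    ultimately show ?thesis by (simp add: LIMSEQ_const_iff)
  qed
  define K where "K n = box (- (real n *\<^sub>R One)) (real n *\<^sub>R One :: real ^ 'n)" for n :: nat
  have z: "AE x in lebesgue. indicator (K n) x *\<^sub>R g x = 0" for n
  proof -
    have int: "(LINT x|lebesgue. indicator (box a b) x *\<^sub>R (indicator (K n) x *\<^sub>R g x)) = 0" for a b
    proof -
      obtain c e where ce: "box a b \<inter> K n = box c e" unfolding K_def box_Int_box by blast
      have eq: "indicator (box a b) x *\<^sub>R (indicator (K n) x *\<^sub>R g x) = indicator (box c e) x *\<^sub>R g x" for x
        unfolding ce[symmetric] by (simp split: split_indicator)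
      show ?thesis unfolding eq by (rule boxz)
    qed
    have i: "integrable lebesgue (\<lambda>x. indicator (K n) x *\<^sub>R g x)" unfolding K_def by (rule sib)
    have ii: "integrable lebesgue (\<lambda>x. indicator (box a b) x *\<^sub>R (indicator (K n) x *\<^sub>R g x))" for a b
      by (rule integrable_mult_indicator[OF _ i]) simp
    have "AE x in lebesgue. Re (indicator (K n) x *\<^sub>R g x) = 0"
    proof (rule AE_zero_if_box_integrals_zero_lebesgue)
      show "integrable lebesgue (\<lambda>x. Re (indicator (K n) x *\<^sub>R g x))" by (rule integrable_Re[OF i])
      show "(LINT x|lebesgue. indicator (box a b) x * Re (indicator (K n) x *\<^sub>R g x)) = 0" for a b
        using integral_Re[OF ii, of a b] unfolding int by (simp add: mult.assoc)
    qed
    moreover have "AE x in lebesgue. Im (indicator (K n) x *\<^sub>R g x) = 0"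
    proof (rule AE_zero_if_box_integrals_zero_lebesgue)
      show "integrable lebesgue (\<lambda>x. Im (indicator (K n) x *\<^sub>R g x))" by (rule integrable_Im[OF i])
      show "(LINT x|lebesgue. indicator (box a b) x * Im (indicator (K n) x *\<^sub>R g x)) = 0" for a b
        using integral_Im[OF ii, of a b] unfolding int by (simp add: mult.assoc)
    qed
    ultimately show ?thesis by eventually_elim (simp add: complex_eq_iff)
  qed
  have "AE x in lebesgue. \<forall>n. indicator (K n) x *\<^sub>R g x = 0"
    unfolding AE_all_countable by (rule allI) (rule z)
  then show ?thesis
  proof eventually_elim
    case (elim x)
    have "x \<in> (\<Union>n. K n)" unfolding K_def UN_box_eq_UNIV by simp
    then obtain n where "x \<in> K n" by blast
    with elim show ?case by (auto dest: spec[of _ n])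
  qed
qed

section \<open>Test functions, uniqueness of weak gradients and integration by parts\<close>

lemma locally_integrable_diff:
  assumes "locally_integrable f" "locally_integrable g"
  shows "locally_integrable (\<lambda>x. f x - g x)"
  using assms unfolding locally_integrable_def by (auto intro: set_integral_diff)

lemma locally_integrable_component:
  fixes G :: "real ^ 'n::finite \<Rightarrow> complex ^ 'n"
  assumes "locally_integrable G"
  shows "locally_integrable (\<lambda>x. G x $ i)"
  unfolding locally_integrable_def
proof (intro allI impI)
  fix K :: "(real ^ 'n) set" assume "compact K"
  then have "integrable lebesgue (\<lambda>x. indicator K x *\<^sub>R G x)"
    using assms by (simp add: locally_integrable_def set_integrable_def)
  from integrable_bounded_linear[OF bounded_linear_vec_nth[of i] this]
  show "set_integrable lebesgue K (\<lambda>x. G x $ i)" by (simp add: set_integrable_def)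
qed

lemma test_function_support:
  fixes f :: "real ^ 'n::finite \<Rightarrow> complex"
  assumes "f \<in> test_functions"
  obtains R where "R > 0" "\<And>x. norm x \<ge> R \<Longrightarrow> f x = 0"
proof -
  have "bounded (closure {x. f x \<noteq> 0})" using assms by (auto simp: test_functions_def intro: compact_imp_bounded)
  then have "bounded {x. f x \<noteq> 0}" by (rule bounded_subset[OF _ closure_subset])
  then obtain R where "R > 0" "\<And>x. f x \<noteq> 0 \<Longrightarrow> norm x \<le> R" by (auto simp: bounded_pos)
  then show thesis by (intro that[of "R + 1"]) force+
qed

lemma test_function_bounded:
  fixes f :: "real ^ 'n::finite \<Rightarrow> complex"
  assumes "f \<in> test_functions"
  obtains B where "B > 0" "\<And>x. norm (f x) \<le> B"
proof -
  obtain R where R: "R > 0" "\<And>x. norm x \<ge> R \<Longrightarrow> f x = 0" using test_function_support[OF assms] by blast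
  have "bounded (f ` cball 0 R)"
    by (intro compact_imp_bounded compact_continuous_image continuous_on_subset[OF test_function_continuous[OF assms]]) auto
  then obtain B where B: "B > 0" "\<And>x. norm x \<le> R \<Longrightarrow> norm (f x) \<le> B" by (auto simp: bounded_pos)
  have "norm (f x) \<le> B" for x using B(1) B(2)[of x] R(2)[of x] by (cases "norm x \<le> R") auto
  with B(1) show thesis by (rule that)
qed

lemma integrable_mult_test_function:
  assumes g: "locally_integrable g" and f: "f \<in> test_functions"
  shows "integrable lebesgue (\<lambda>x. g x * f x)"
proof -
  obtain R where R: "R > 0" "\<And>x. norm x \<ge> R \<Longrightarrow> f x = 0" using test_function_support[OF f] by blast
  obtain B where B: "B > 0" "\<And>x. norm (f x) \<le> B" using test_function_bounded[OF f] by blast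
  have gi: "integrable lebesgue (\<lambda>x. indicator (cball 0 R) x *\<^sub>R g x)"
    using g by (simp add: locally_integrable_def set_integrable_def)
  have fm: "f \<in> borel_measurable lebesgue"
    by (rule measurable_completion) (use test_function_measurable[OF f] in simp)
  have eq: "g x * f x = (indicator (cball 0 R) x *\<^sub>R g x) * f x" for x
    using R(2)[of x] by (auto split: split_indicator)
  show ?thesis
    unfolding eq
  proof (rule Bochner_Integration.integrable_bound)
    show "integrable lebesgue (\<lambda>x. B *\<^sub>R norm (indicator (cball 0 R) x *\<^sub>R g x))"
      by (intro integrable_scaleR_right integrable_norm gi)
    show "(\<lambda>x. (indicator (cball 0 R) x *\<^sub>R g x) * f x) \<in> borel_measurable lebesgue"
      by (rule borel_measurable_times[OF borel_measurable_integrable[OF gi] fm])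
    show "AE x in lebesgue. norm ((indicator (cball 0 R) x *\<^sub>R g x) * f x) \<le> norm (B *\<^sub>R norm (indicator (cball 0 R) x *\<^sub>R g x))"
      using B by (intro AE_I2) (simp add: norm_mult mult.commute mult_right_mono split: split_indicator)
  qed
qed

text \<open>Each component of the difference integrates to 0 against every test function.\<close>

lemma weak_gradient_unique:
  fixes u :: "real ^ 'n::finite \<Rightarrow> complex"
  assumes "is_weak_gradient u G" "is_weak_gradient u G'"
  shows "AE x in lebesgue. G x = G' x"
proof -
  have li: "locally_integrable (\<lambda>x. G x $ i)" "locally_integrable (\<lambda>x. G' x $ i)" for i
    using assms by (auto simp: is_weak_gradient_def intro: locally_integrable_component)
  have "AE x in lebesgue. G x $ i - G' x $ i = 0" for i
  proof (rule fundamental_lemma_calculus_of_variations)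
    show "locally_integrable (\<lambda>x. G x $ i - G' x $ i)" by (rule locally_integrable_diff[OF li])
    fix \<psi> :: "real ^ 'n \<Rightarrow> complex" assume \<psi>: "\<psi> \<in> test_functions"
    have "(LINT x|lebesgue. u x * partial_deriv i \<psi> x) = - (LINT x|lebesgue. G x $ i * \<psi> x)"
      using assms(1) \<psi> unfolding is_weak_gradient_def by blast
    moreover have "(LINT x|lebesgue. u x * partial_deriv i \<psi> x) = - (LINT x|lebesgue. G' x $ i * \<psi> x)"
      using assms(2) \<psi> unfolding is_weak_gradient_def by blast
    ultimately have "(LINT x|lebesgue. G x $ i * \<psi> x) = (LINT x|lebesgue. G' x $ i * \<psi> x)" by simp
    then show "(LINT x|lebesgue. (G x $ i - G' x $ i) * \<psi> x) = 0"
      using integrable_mult_test_function[OF li(1)[of i] \<psi>] integrable_mult_test_function[OF li(2)[of i] \<psi>]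
      by (simp add: left_diff_distrib)
  qed
  then have "AE x in lebesgue. \<forall>i\<in>UNIV. G x $ i - G' x $ i = 0"
    by (subst AE_finite_all) (simp_all del: right_minus_eq)
  then show ?thesis by eventually_elim (simp add: vec_eq_iff)
qed

lemma weak_gradient_eq:
  assumes "is_weak_gradient u G"
  shows "AE x in lebesgue. weak_gradient u x = G x"
  by (rule weak_gradient_unique[OF _ assms]) (use someI[of "is_weak_gradient u" G, OF assms] in \<open>simp add: weak_gradient_def\<close>)

lemma emeasure_lborel_cball_less_top [simp]: "emeasure lborel (cball (x :: 'a::euclidean_space) R) < top"
  using emeasure_bounded_finite[OF bounded_cball, of x R] by simp

lemma test_function_C_k: "f \<in> test_functions \<Longrightarrow> C_k k f"
  by (simp add: test_functions_def)

lemma test_function_has_derivative: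
  "f \<in> test_functions \<Longrightarrow> (f has_derivative frechet_derivative f (at x)) (at x)"
  by (rule C_k_SucE(1)[OF test_function_C_k[of f "Suc 0"]])

lemma partial_deriv_eqI:
  "(f has_derivative f') (at x) \<Longrightarrow> partial_deriv i f x = f' (axis i 1)"
  by (simp add: partial_deriv_def frechet_derivative_at[symmetric])

lemma partial_deriv_test_function:
  fixes f :: "real ^ 'n::finite \<Rightarrow> complex"
  assumes f: "f \<in> test_functions"
  shows "partial_deriv i f \<in> test_functions"
proof -
  obtain R where R: "R > 0" "\<And>x. norm x \<ge> R \<Longrightarrow> f x = 0" using test_function_support[OF f] by blast
  show ?thesis
  proof (rule test_functionsI[where K="cball 0 R"])
    show "C_k k (partial_deriv i f)" for k using test_function_C_k[OF f, of "Suc k"] by simp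
    fix x :: "real ^ 'n" assume "x \<notin> cball 0 R"
    then have x: "x \<in> - cball 0 R" by simp
    have "(f has_derivative (\<lambda>_. 0)) (at x)"
      by (rule has_derivative_transform_within_open[OF has_derivative_const[of 0] _ x]) (use R(2) in auto)
    then show "partial_deriv i f x = 0" by (rule partial_deriv_eqI[where f'="\<lambda>_. 0"])
  qed simp
qed

lemma test_function_mult:
  fixes f g :: "real ^ 'n::finite \<Rightarrow> complex"
  assumes f: "f \<in> test_functions" and g: "g \<in> test_functions"
  shows "(\<lambda>x. f x * g x) \<in> test_functions"
proof -
  obtain R where R: "R > 0" "\<And>x. norm x \<ge> R \<Longrightarrow> f x = 0" using test_function_support[OF f] by blast
  show ?thesis
  proof (rule test_functionsI[where K="cball 0 R"])
    show "C_k k (\<lambda>x. f x * g x)" for k by (rule C_k_mult[OF test_function_C_k[OF f] test_function_C_k[OF g]])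
    show "f x * g x = 0" if "x \<notin> cball 0 R" for x using R(2)[of x] that by simp
  qed simp
qed

lemma partial_deriv_mult:
  assumes "f \<in> test_functions" "g \<in> test_functions"
  shows "partial_deriv i (\<lambda>x. f x * g x) x = f x * partial_deriv i g x + partial_deriv i f x * g x"
  using partial_deriv_eqI[OF has_derivative_mult[OF test_function_has_derivative[OF assms(1)] test_function_has_derivative[OF assms(2)]]]
  by (simp add: partial_deriv_def)

lemma integrable_test_function:
  fixes f :: "real ^ 'n::finite \<Rightarrow> complex"
  assumes f: "f \<in> test_functions"
  shows "integrable lborel f"
proof -
  obtain R where R: "R > 0" "\<And>x. norm x \<ge> R \<Longrightarrow> f x = 0" using test_function_support[OF f] by blast
  have "integrable lborel (\<lambda>x. indicator (cball 0 R) x *\<^sub>R f x)"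
    by (rule borel_integrable_compact) (auto intro: continuous_on_subset[OF test_function_continuous[OF f]])
  moreover have "(\<lambda>x. indicator (cball 0 R) x *\<^sub>R f x) = f"
    using R(2) by (auto simp: fun_eq_iff split: split_indicator)
  ultimately show ?thesis by simp
qed

lemma lborel_integral_translation:
  fixes f :: "'a::euclidean_space \<Rightarrow> 'b::{banach, second_countable_topology}"
  assumes [measurable]: "f \<in> borel_measurable borel"
  shows "(LINT x|lborel. f (c + x)) = (LINT x|lborel. f x)"
proof -
  have "(LINT x|lborel. f x) = (LINT x|distr lborel borel ((+) c). f x)" unfolding lborel_distr_plus ..
  also have "\<dots> = (LINT x|lborel. f (c + x))" by (rule integral_distr) auto
  finally show ?thesis by simp
qed

text \<open>Difference quotients of \<open>f\<close> have integral 0 by translation invariance. They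
  converge to the partial derivative, uniformly bounded and supported in one ball.\<close>

lemma integral_partial_deriv:
  fixes f :: "real ^ 'n::finite \<Rightarrow> complex"
  assumes f: "f \<in> test_functions"
  shows "(LINT x|lborel. partial_deriv i f x) = 0"
proof -
  define e where "e = (axis i 1 :: real ^ 'n)"
  have ne: "norm e = 1" by (simp add: e_def)
  define D where "D = partial_deriv i f"
  have Dt: "D \<in> test_functions" unfolding D_def by (rule partial_deriv_test_function[OF f])
  obtain B where B: "B > 0" "\<And>x. norm (D x) \<le> B" using test_function_bounded[OF Dt] by blast
  obtain R where R: "R > 0" "\<And>x. norm x \<ge> R \<Longrightarrow> f x = 0" using test_function_support[OF f] by blast
  have [measurable]: "f \<in> borel_measurable borel" "D \<in> borel_measurable borel"
    using f Dt by (auto intro: test_function_measurable)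
  have dv: "((\<lambda>r. f (x + r *\<^sub>R e)) has_vector_derivative D (x + r *\<^sub>R e)) (at r)" for x r
  proof -
    have 1: "((\<lambda>r. x + r *\<^sub>R e) has_derivative (\<lambda>h. h *\<^sub>R e)) (at r)"
      by (auto intro!: derivative_eq_intros)
    have "((\<lambda>r. f (x + r *\<^sub>R e)) has_derivative (\<lambda>h. frechet_derivative f (at (x + r *\<^sub>R e)) (h *\<^sub>R e))) (at r)"
      by (rule has_derivative_compose[OF 1 test_function_has_derivative[OF f]])
    moreover have "frechet_derivative f (at (x + r *\<^sub>R e)) (h *\<^sub>R e) = h *\<^sub>R D (x + r *\<^sub>R e)" for h
      unfolding D_def partial_deriv_def e_def[symmetric]
      by (rule linear_scale[OF has_derivative_linear[OF test_function_has_derivative[OF f]]])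
    ultimately show ?thesis by (simp add: has_vector_derivative_def)
  qed
  \<comment> \<open>Step lengths are at most 1, which keeps all quotients inside the ball of radius
    \<open>R + 1\<close>.\<close>
  define q where "q n x = real (Suc n) *\<^sub>R (f (x + inverse (real (Suc n)) *\<^sub>R e) - f x)" for n :: nat and x
  have qb: "norm (q n x) \<le> B" for n x
  proof -
    let ?s = "inverse (real (Suc n))"
    have "((\<lambda>r. D (x + r *\<^sub>R e)) has_integral f (x + ?s *\<^sub>R e) - f (x + 0 *\<^sub>R e)) {0..?s}"
      by (rule fundamental_theorem_of_calculus) (auto intro: has_vector_derivative_at_within[OF dv])
    then have "norm (f (x + ?s *\<^sub>R e) - f (x + 0 *\<^sub>R e)) \<le> B * measure lborel {0..?s}"
      by (rule has_integral_bound_real[where S="{}", rotated 2]) (use B in auto)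
    also have "measure lborel {0..?s} = ?s" by simp
    finally have "real (Suc n) * norm (f (x + ?s *\<^sub>R e) - f x) \<le> real (Suc n) * (B * ?s)"
      by (intro mult_left_mono) auto
    also have "\<dots> = B" by (simp add: mult.left_commute del: of_nat_Suc)
    finally show ?thesis by (simp add: q_def del: of_nat_Suc)
  qed
  have qz: "q n x = 0" if "norm x \<ge> R + 1" for n x
  proof -
    have "norm (inverse (real (Suc n)) *\<^sub>R e) \<le> 1" by (simp add: ne divide_simps)
    then have "norm (x + inverse (real (Suc n)) *\<^sub>R e) \<ge> R"
      using that norm_diff_ineq[of x "inverse (real (Suc n)) *\<^sub>R e"] by linarith
    then show ?thesis using R(2) that by (simp add: q_def)
  qed
  have "(\<lambda>n. LINT x|lborel. q n x) \<longlonglongrightarrow> (LINT x|lborel. D x)"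
  proof (rule integral_dominated_convergence)
    show "integrable lborel (\<lambda>x::real^'n. B * indicator (cball 0 (R + 1)) x)"
      by (intro integrable_mult_right integrable_real_indicator) auto
    show "AE x in lborel. norm (q n x) \<le> B * indicator (cball 0 (R + 1)) x" for n
      using qb qz[of _ n] by (intro AE_I2) (auto split: split_indicator simp: not_le less_imp_le)
    show "q n \<in> borel_measurable lborel" for n unfolding q_def by measurable
    have "(\<lambda>n. q n x) \<longlonglongrightarrow> D x" for x
    proof -
      have "((\<lambda>r. (1 / norm (r - 0)) *\<^sub>R (f (x + r *\<^sub>R e) - (f (x + 0 *\<^sub>R e) + (r - 0) *\<^sub>R D (x + 0 *\<^sub>R e)))) \<longlongrightarrow> 0) (at 0)"
        using dv[of x 0] unfolding has_vector_derivative_def has_derivative_at2 by blast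
      moreover have "filterlim (\<lambda>n. inverse (real (Suc n))) (at 0) sequentially"
        unfolding filterlim_at using LIMSEQ_inverse_real_of_nat by (auto simp del: of_nat_Suc)
      ultimately have "((\<lambda>n. (1 / norm (inverse (real (Suc n)) - 0)) *\<^sub>R (f (x + inverse (real (Suc n)) *\<^sub>R e) -
          (f (x + 0 *\<^sub>R e) + (inverse (real (Suc n)) - 0) *\<^sub>R D (x + 0 *\<^sub>R e)))) \<longlongrightarrow> 0) sequentially"
        by (rule filterlim_compose)
      moreover have "(1 / norm (inverse (real (Suc n)) - 0)) *\<^sub>R (f (x + inverse (real (Suc n)) *\<^sub>R e) -
          (f (x + 0 *\<^sub>R e) + (inverse (real (Suc n)) - 0) *\<^sub>R D (x + 0 *\<^sub>R e))) = q n x - D x" for n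
        by (simp add: q_def scaleR_diff_right scaleR_add_right divide_inverse del: of_nat_Suc)
      ultimately have "(\<lambda>n. q n x - D x) \<longlonglongrightarrow> 0" by (simp only:)
      then show ?thesis by (simp only: LIM_zero_iff)
    qed
    then show "AE x in lborel. (\<lambda>n. q n x) \<longlonglongrightarrow> D x" by simp
  qed simp
  moreover have "(LINT x|lborel. q n x) = 0" for n
  proof -
    have 1: "integrable lborel f" by (rule integrable_test_function[OF f])
    have "integrable lborel (\<lambda>x. f (inverse (real (Suc n)) *\<^sub>R e + x))"
    proof -
      have "integrable (distr lborel borel ((+) (inverse (real (Suc n)) *\<^sub>R e))) f"
        unfolding lborel_distr_plus by (rule 1)
      then show ?thesis by (subst (asm) integrable_distr_eq) auto
    qed
    then show ?thesis
      using 1 lborel_integral_translation[of f "inverse (real (Suc n)) *\<^sub>R e"]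
      by (simp add: q_def add.commute)
  qed
  ultimately show ?thesis by (simp add: D_def LIMSEQ_const_iff)
qed

lemma test_functions_by_parts:
  fixes f g :: "real ^ 'n::finite \<Rightarrow> complex"
  assumes f: "f \<in> test_functions" and g: "g \<in> test_functions"
  shows "(LINT x|lebesgue. f x * partial_deriv i g x) = - (LINT x|lebesgue. partial_deriv i f x * g x)"
proof -
  have m: "(LINT x|lebesgue. h x) = (LINT x|lborel. h x)" if "h \<in> test_functions" for h :: "real ^ 'n \<Rightarrow> complex"
    by (rule integral_completion) (use test_function_measurable[OF that] in simp)
  have t: "(\<lambda>x. f x * partial_deriv i g x) \<in> test_functions" "(\<lambda>x. partial_deriv i f x * g x) \<in> test_functions"
    by (intro test_function_mult partial_deriv_test_function f g)+
  have "(LINT x|lborel. f x * partial_deriv i g x + partial_deriv i f x * g x) = 0"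
    using integral_partial_deriv[OF test_function_mult[OF f g], of i]
    by (simp add: partial_deriv_mult[OF f g] cong: Bochner_Integration.integral_cong)
  then have "(LINT x|lborel. f x * partial_deriv i g x) + (LINT x|lborel. partial_deriv i f x * g x) = 0"
    using integrable_test_function[OF t(1)] integrable_test_function[OF t(2)] by simp
  then show ?thesis unfolding m[OF t(1)] m[OF t(2)] by (simp add: eq_neg_iff_add_eq_0)
qed

text \<open>Either \<open>x \<le> \<delta>\<close>, or \<open>(x / \<delta>) powr (p - 1)\<close> is
  at least 1. Integrated over a ball this replaces Hoelder's inequality: with
  \<open>\<delta>\<close> small, smallness of the p-th power carries over to the first
  power.\<close>

lemma le_young:
  fixes x :: real
  assumes "x \<ge> 0" "\<delta> > 0" "p \<ge> 1"
  shows "x \<le> \<delta> + \<delta> powr (1 - p) * x powr p"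
proof (cases "x \<le> \<delta>")
  case True then show ?thesis by (simp add: add_increasing2)
next
  case False
  then have x: "x > \<delta>" "x > 0" using assms by auto
  have "\<delta> powr (1 - p) * x powr p = x * (x / \<delta>) powr (p - 1)"
  proof -
    have "x powr p = x * x powr (p - 1)" using x by (simp add: powr_diff)
    moreover have "\<delta> powr (1 - p) = 1 / \<delta> powr (p - 1)" using powr_minus_divide[of \<delta> "p - 1"] by simp
    ultimately show ?thesis using x assms by (simp add: powr_divide)
  qed
  moreover have "(x / \<delta>) powr (p - 1) \<ge> 1"
    using x assms by (intro ge_one_powr_ge_zero) auto
  then have "x * 1 \<le> x * (x / \<delta>) powr (p - 1)" using x by (intro mult_left_mono) auto
  ultimately show ?thesis using assms(2) by linarith
qed

lemma powr_integrable_mult_test_bound: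
  fixes e :: "real ^ 'n::finite \<Rightarrow> complex"
  assumes e[measurable]: "e \<in> borel_measurable lebesgue" and p: "p \<ge> 1"
    and ie: "integrable lebesgue (\<lambda>x. norm (e x) powr p)" and \<psi>: "\<psi> \<in> test_functions"
  shows "integrable lebesgue (\<lambda>x. e x * \<psi> x)"
    and "\<And>B R \<delta>. \<delta> > 0 \<Longrightarrow> B > 0 \<Longrightarrow> (\<And>x. norm (\<psi> x) \<le> B) \<Longrightarrow> (\<And>x. norm x \<ge> R \<Longrightarrow> \<psi> x = 0) \<Longrightarrow>
      norm (LINT x|lebesgue. e x * \<psi> x) \<le>
        B * (\<delta> * measure lebesgue (cball (0 :: real ^ 'n) R) + \<delta> powr (1 - p) * (LINT x|lebesgue. norm (e x) powr p))"
proof -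
  have \<psi>m: "\<psi> \<in> borel_measurable lebesgue"
    by (rule measurable_completion) (use test_function_measurable[OF \<psi>] in simp)
  have meas: "(\<lambda>x. e x * \<psi> x) \<in> borel_measurable lebesgue" by (rule borel_measurable_times[OF e \<psi>m])
  have b: "norm (e x * \<psi> x) \<le> B * (\<delta> * indicator (cball 0 R) x + \<delta> powr (1 - p) * norm (e x) powr p)"
    if \<delta>: "\<delta> > 0" and B: "B > 0" "\<And>x. norm (\<psi> x) \<le> B" and R: "\<And>x. norm x \<ge> R \<Longrightarrow> \<psi> x = 0" for B R \<delta> x
  proof (cases "norm x \<le> R")
    case True
    have "norm (e x * \<psi> x) \<le> norm (e x) * B" using B by (simp add: norm_mult mult_left_mono)
    also have "\<dots> \<le> (\<delta> + \<delta> powr (1 - p) * norm (e x) powr p) * B"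
      using le_young[OF norm_ge_zero \<delta> p] B by (intro mult_right_mono) auto
    finally show ?thesis using True by (simp add: mult.commute)
  next
    case False
    then show ?thesis using R[of x] B \<delta> by simp
  qed
  have ci: "integrable lebesgue (\<lambda>x. B * (\<delta> * indicator (cball (0 :: real ^ 'n) R) x + \<delta> powr (1 - p) * norm (e x) powr p))" for B \<delta> R
  proof -
    have "integrable lebesgue (indicator (cball (0 :: real ^ 'n) R) :: _ \<Rightarrow> real)"
      by (intro integrable_real_indicator) auto
    then show ?thesis using ie by simp
  qed
  obtain R where R: "R > 0" "\<And>x. norm x \<ge> R \<Longrightarrow> \<psi> x = 0" using test_function_support[OF \<psi>] by blast
  obtain B where B: "B > 0" "\<And>x. norm (\<psi> x) \<le> B" using test_function_bounded[OF \<psi>] by blast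
  show i: "integrable lebesgue (\<lambda>x. e x * \<psi> x)"
  proof (rule Bochner_Integration.integrable_bound[OF ci meas])
    show "AE x in lebesgue. norm (e x * \<psi> x) \<le> norm (B * (1 * indicator (cball (0 :: real ^ 'n) R) x + 1 powr (1 - p) * norm (e x) powr p))"
      using b[of 1 B R] B R by (intro AE_I2) (auto intro: order_trans[OF _ abs_ge_self])
  qed
  fix B R \<delta> :: real
  assume *: "\<delta> > 0" "B > 0" "\<And>x. norm (\<psi> x) \<le> B" "\<And>x. norm x \<ge> R \<Longrightarrow> \<psi> x = 0"
  have fin: "emeasure lebesgue (cball (0 :: real ^ 'n) R) < \<infinity>"
    by simp
  have "norm (LINT x|lebesgue. e x * \<psi> x) \<le> (LINT x|lebesgue. norm (e x * \<psi> x))"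
    by (rule integral_norm_bound)
  also have "\<dots> \<le> (LINT x|lebesgue. B * (\<delta> * indicator (cball 0 R) x + \<delta> powr (1 - p) * norm (e x) powr p))"
    by (rule integral_mono[OF integrable_norm[OF i] ci b[OF *]])
  also have "\<dots> = B * (\<delta> * measure lebesgue (cball (0 :: real ^ 'n) R) + \<delta> powr (1 - p) * (LINT x|lebesgue. norm (e x) powr p))"
  proof -
    have "integrable lebesgue (indicator (cball (0 :: real ^ 'n) R) :: _ \<Rightarrow> real)"
      by (intro integrable_real_indicator) (auto simp: fin)
    then show ?thesis using ie by simp
  qed
  finally show "norm (LINT x|lebesgue. e x * \<psi> x) \<le>
        B * (\<delta> * measure lebesgue (cball (0 :: real ^ 'n) R) + \<delta> powr (1 - p) * (LINT x|lebesgue. norm (e x) powr p))" .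
qed

lemma tendsto_integral_mult_test:
  fixes e :: "nat \<Rightarrow> real ^ 'n::finite \<Rightarrow> complex"
  assumes e: "\<And>k. e k \<in> borel_measurable lebesgue" and p: "p \<ge> 1"
    and ie: "\<And>k. integrable lebesgue (\<lambda>x. norm (e k x) powr p)"
    and lim: "(\<lambda>k. LINT x|lebesgue. norm (e k x) powr p) \<longlonglongrightarrow> 0"
    and \<psi>: "\<psi> \<in> test_functions"
  shows "(\<lambda>k. LINT x|lebesgue. e k x * \<psi> x) \<longlonglongrightarrow> 0"
proof (rule LIMSEQ_I)
  fix r :: real assume r: "r > 0"
  obtain R where R: "R > 0" "\<And>x. norm x \<ge> R \<Longrightarrow> \<psi> x = 0" using test_function_support[OF \<psi>] by blast
  obtain B where B: "B > 0" "\<And>x. norm (\<psi> x) \<le> B" using test_function_bounded[OF \<psi>] by blast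
  define V where "V = measure lebesgue (cball (0 :: real ^ 'n) R)"
  have V: "V \<ge> 0" by (simp add: V_def)
  \<comment> \<open>Chosen so that the term with the volume stays below \<open>r / 2\<close>;
    \<open>V + 1\<close> keeps the denominator positive.\<close>
  define \<delta> where "\<delta> = r / (2 * B * (V + 1))"
  have \<delta>: "\<delta> > 0" using r B V by (simp add: \<delta>_def)
  define c where "c = B * \<delta> powr (1 - p)"
  have c: "c > 0" using B \<delta> by (simp add: c_def)
  have half: "B * (\<delta> * V) < r / 2"
  proof -
    have "B * (\<delta> * V) < B * (\<delta> * (V + 1))" using B \<delta> by (simp add: mult_strict_left_mono)
    also have "\<dots> = r / 2"
    proof -
      have "B * (r / (2 * B * W) * W) = r / 2" if "W > 0" for W using that B(1) by simp
      from this[of "V + 1"] V show ?thesis unfolding \<delta>_def by simp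
    qed
    finally show ?thesis .
  qed
  obtain N where N: "\<And>k. k \<ge> N \<Longrightarrow> \<bar>LINT x|lebesgue. norm (e k x) powr p\<bar> < r / (2 * c)"
    using LIMSEQ_D[OF lim, of "r / (2 * c)"] r c by auto
  show "\<exists>no. \<forall>n\<ge>no. norm ((LINT x|lebesgue. e n x * \<psi> x) - 0) < r"
  proof (intro exI allI impI)
    fix k assume k: "k \<ge> N"
    have "norm (LINT x|lebesgue. e k x * \<psi> x) \<le> B * (\<delta> * V + \<delta> powr (1 - p) * (LINT x|lebesgue. norm (e k x) powr p))"
      unfolding V_def by (rule powr_integrable_mult_test_bound(2)[OF e p ie \<psi> \<delta> B R(2)])
    also have "\<dots> = B * (\<delta> * V) + c * (LINT x|lebesgue. norm (e k x) powr p)" by (simp add: c_def algebra_simps)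
    also have "c * (LINT x|lebesgue. norm (e k x) powr p) < r / 2"
      using N[OF k] c by (simp add: field_simps abs_less_iff)
    finally show "norm ((LINT x|lebesgue. e k x * \<psi> x) - 0) < r" using half by simp
  qed
qed

section \<open>Completeness of the square-integrable functions\<close>

lemma summable_half_power: "summable (\<lambda>k. c * (1 / 2) ^ k :: real)"
  by (intro summable_mult summable_geometric) simp

text \<open>Riesz-Fischer: a fast subsequence converges almost everywhere, and Fatou's lemma turns
  the pointwise limit into mean square convergence of the whole sequence.\<close>

lemma L2_complete:
  fixes f :: "nat \<Rightarrow> 'a \<Rightarrow> 'b::euclidean_space"
  assumes f[measurable]: "\<And>k. f k \<in> borel_measurable M"
    and int: "\<And>m n. integrable M (\<lambda>x. (norm (f m x - f n x))\<^sup>2)" "\<And>k. integrable M (\<lambda>x. (norm (f k x))\<^sup>2)"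
    and cauchy: "\<And>e. e > 0 \<Longrightarrow> \<exists>N. \<forall>m\<ge>N. \<forall>n\<ge>N. (LINT x|M. (norm (f m x - f n x))\<^sup>2) < e"
  obtains g where "g \<in> borel_measurable M" "integrable M (\<lambda>x. (norm (g x))\<^sup>2)"
    "\<And>k. integrable M (\<lambda>x. (norm (f k x - g x))\<^sup>2)"
    "(\<lambda>k. LINT x|M. (norm (f k x - g x))\<^sup>2) \<longlonglongrightarrow> 0"
proof -
  \<comment> \<open>Squared distances below \<open>(1 / 8) ^ k\<close> remain summable after
    weighting with \<open>4 ^ k\<close>, and finiteness of the weighted sum makes consecutive terms
    differ by at most a constant times \<open>(1 / 2) ^ k\<close> at almost every point.\<close>
  have "\<forall>k. \<exists>N. \<forall>m\<ge>N. \<forall>n\<ge>N. (LINT x|M. (norm (f m x - f n x))\<^sup>2) < (1 / 8) ^ k"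
    by (intro allI cauchy) simp
  then obtain N where N: "\<And>k m n. m \<ge> N k \<Longrightarrow> n \<ge> N k \<Longrightarrow> (LINT x|M. (norm (f m x - f n x))\<^sup>2) < (1 / 8) ^ k"
    by metis
  \<comment> \<open>A sum of all earlier thresholds dominates \<open>N k\<close> from the index
    \<open>k\<close> on.\<close>
  define r where "r k = (\<Sum>j\<le>k. N j)" for k
  have rN: "r j \<ge> N k" if "j \<ge> k" for j k
    unfolding r_def using that by (intro member_le_sum[of k "{..j}" N]) auto
  define h where "h k = f (r k)" for k
  have [measurable]: "h k \<in> borel_measurable M" for k by (simp add: h_def)
  have nnf: "(\<integral>\<^sup>+x. ennreal ((norm (f m x - f n x))\<^sup>2) \<partial>M) = ennreal (LINT x|M. (norm (f m x - f n x))\<^sup>2)" for m n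
    by (rule nn_integral_eq_integral[OF int(1)]) simp
  have step: "(\<integral>\<^sup>+x. ennreal (4 ^ k * (norm (h (Suc k) x - h k x))\<^sup>2) \<partial>M) \<le> ennreal ((1 / 2) ^ k)" for k
  proof -
    have "(\<integral>\<^sup>+x. ennreal (4 ^ k * (norm (h (Suc k) x - h k x))\<^sup>2) \<partial>M) =
        ennreal (4 ^ k * (LINT x|M. (norm (h (Suc k) x - h k x))\<^sup>2))"
      unfolding h_def by (subst nn_integral_eq_integral) (auto intro!: int)
    also have "4 ^ k * (LINT x|M. (norm (h (Suc k) x - h k x))\<^sup>2) \<le> 4 ^ k * (1 / 8) ^ k"
      unfolding h_def by (intro mult_left_mono less_imp_le[OF N] rN) auto
    also have "(4::real) ^ k * (1 / 8) ^ k = (1 / 2) ^ k" by (simp flip: power_mult_distrib)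
    finally show ?thesis by (simp add: ennreal_leI)
  qed
  have "(\<integral>\<^sup>+x. (\<Sum>k. ennreal (4 ^ k * (norm (h (Suc k) x - h k x))\<^sup>2)) \<partial>M) =
      (\<Sum>k. \<integral>\<^sup>+x. ennreal (4 ^ k * (norm (h (Suc k) x - h k x))\<^sup>2) \<partial>M)"
    by (rule nn_integral_suminf) measurable
  also have "\<dots> \<le> (\<Sum>k. ennreal ((1 / 2) ^ k))" by (intro suminf_le step) auto
  also have "\<dots> = ennreal (\<Sum>k. (1 / 2) ^ k)"
    using summable_half_power[of 1] by (intro suminf_ennreal2) auto
  finally have fin: "(\<integral>\<^sup>+x. (\<Sum>k. ennreal (4 ^ k * (norm (h (Suc k) x - h k x))\<^sup>2)) \<partial>M) \<noteq> \<infinity>"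
    by (auto simp: top_unique)
  have "AE x in M. (\<Sum>k. ennreal (4 ^ k * (norm (h (Suc k) x - h k x))\<^sup>2)) \<noteq> \<infinity>"
    by (rule nn_integral_noteq_infinite[OF _ fin]) measurable
  then have conv: "AE x in M. convergent (\<lambda>k. h k x)"
  proof eventually_elim
    case (elim x)
    define C where "C = enn2real (\<Sum>k. ennreal (4 ^ k * (norm (h (Suc k) x - h k x))\<^sup>2))"
    have C: "C \<ge> 0" "(\<Sum>k. ennreal (4 ^ k * (norm (h (Suc k) x - h k x))\<^sup>2)) = ennreal C"
      using elim by (simp_all add: C_def less_top[symmetric])
    have "norm (h (Suc k) x - h k x) \<le> sqrt C * (1 / 2) ^ k" for k
    proof -
      have "(\<Sum>j\<in>{k}. ennreal (4 ^ j * (norm (h (Suc j) x - h j x))\<^sup>2)) \<le> (\<Sum>j. ennreal (4 ^ j * (norm (h (Suc j) x - h j x))\<^sup>2))"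
        by (rule sum_le_suminf[OF summableI]) auto
      then have "ennreal (4 ^ k * (norm (h (Suc k) x - h k x))\<^sup>2) \<le> ennreal C" unfolding C(2) by simp
      then have "4 ^ k * (norm (h (Suc k) x - h k x))\<^sup>2 \<le> C" using C(1) by simp
      then have "sqrt (4 ^ k * (norm (h (Suc k) x - h k x))\<^sup>2) \<le> sqrt C" by simp
      moreover have "sqrt (4 ^ k * (norm (h (Suc k) x - h k x))\<^sup>2) = 2 ^ k * norm (h (Suc k) x - h k x)"
        by (simp add: real_sqrt_mult real_sqrt_power)
      ultimately show ?thesis by (simp add: power_one_over field_simps)
    qed
    then have "summable (\<lambda>k. h (Suc k) x - h k x)"
      by (intro summable_comparison_test[OF _ summable_half_power[of "sqrt C"]]) auto
    then have "convergent (\<lambda>n. \<Sum>k<n. h (Suc k) x - h k x)" by (simp add: summable_iff_convergent)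
    then have "convergent (\<lambda>n. h n x - h 0 x)" unfolding sum_lessThan_telescope[of "\<lambda>n. h n x"] .
    then have "convergent (\<lambda>n. (h n x - h 0 x) + h 0 x)" by (rule convergent_add[OF _ convergent_const])
    then show ?case by simp
  qed
  define g where "g x = lim (\<lambda>k. h k x)" for x
  have gm[measurable]: "g \<in> borel_measurable M" unfolding g_def by (rule borel_measurable_lim_metric) simp
  have lim: "AE x in M. (\<lambda>k. h k x) \<longlonglongrightarrow> g x"
    using conv by eventually_elim (simp add: g_def convergent_LIMSEQ_iff)
  have fatou: "(\<integral>\<^sup>+x. ennreal ((norm (f m x - g x))\<^sup>2) \<partial>M) \<le> ennreal ((1 / 8) ^ k)" if m: "m \<ge> N k" for m k
  proof -
    have "(\<integral>\<^sup>+x. ennreal ((norm (f m x - g x))\<^sup>2) \<partial>M) = (\<integral>\<^sup>+x. liminf (\<lambda>j. ennreal ((norm (f m x - h j x))\<^sup>2)) \<partial>M)"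
    proof (rule nn_integral_cong_AE)
      show "AE x in M. ennreal ((norm (f m x - g x))\<^sup>2) = liminf (\<lambda>j. ennreal ((norm (f m x - h j x))\<^sup>2))"
        using lim
      proof eventually_elim
        case (elim x)
        then have "(\<lambda>j. ennreal ((norm (f m x - h j x))\<^sup>2)) \<longlonglongrightarrow> ennreal ((norm (f m x - g x))\<^sup>2)"
          by (intro tendsto_ennrealI tendsto_intros)
        then show ?case by (rule lim_imp_Liminf[OF trivial_limit_sequentially, symmetric])
      qed
    qed
    also have "\<dots> \<le> liminf (\<lambda>j. \<integral>\<^sup>+x. ennreal ((norm (f m x - h j x))\<^sup>2) \<partial>M)"
      by (rule nn_integral_liminf) measurable
    also have "\<dots> \<le> ennreal ((1 / 8) ^ k)"
    proof (rule Liminf_le)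
      show "\<forall>\<^sub>F j in sequentially. (\<integral>\<^sup>+x. ennreal ((norm (f m x - h j x))\<^sup>2) \<partial>M) \<le> ennreal ((1 / 8) ^ k)"
        using eventually_ge_at_top[of k]
        by eventually_elim (auto simp: h_def nnf intro!: ennreal_leI less_imp_le[OF N] m rN)
    qed simp
    finally show ?thesis .
  qed
  have ib: "integrable M (\<lambda>x. (norm (f m x - g x))\<^sup>2)" if "m \<ge> N 0" for m
    using fatou[OF that] by (intro integrableI_bounded) (auto simp: top_unique less_top[symmetric] intro: le_less_trans)
  have sq: "(norm (a + b))\<^sup>2 \<le> 2 * (norm a)\<^sup>2 + 2 * (norm b)\<^sup>2" for a b :: 'b
  proof -
    have "(norm (a + b))\<^sup>2 \<le> (norm a + norm b)\<^sup>2" by (intro power_mono norm_triangle_ineq) simp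
    also have "\<dots> \<le> 2 * (norm a)\<^sup>2 + 2 * (norm b)\<^sup>2"
      using sum_squares_bound[of "norm a" "norm b"] by (simp add: power2_sum)
    finally show ?thesis .
  qed
  have g2: "integrable M (\<lambda>x. (norm (g x))\<^sup>2)"
  proof (rule Bochner_Integration.integrable_bound)
    show "integrable M (\<lambda>x. 2 * (norm (f (N 0) x))\<^sup>2 + 2 * (norm (f (N 0) x - g x))\<^sup>2)"
      using ib[of "N 0"] int(2) by simp
    show "AE x in M. norm ((norm (g x))\<^sup>2) \<le> norm (2 * (norm (f (N 0) x))\<^sup>2 + 2 * (norm (f (N 0) x - g x))\<^sup>2)"
      using sq[of "f (N 0) x" "- (f (N 0) x - g x)" for x] by (intro AE_I2) (simp add: norm_minus_commute)
  qed measurable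
  have ia: "integrable M (\<lambda>x. (norm (f k x - g x))\<^sup>2)" for k
  proof (rule Bochner_Integration.integrable_bound)
    show "integrable M (\<lambda>x. 2 * (norm (f k x))\<^sup>2 + 2 * (norm (g x))\<^sup>2)" using g2 int(2) by simp
    show "AE x in M. norm ((norm (f k x - g x))\<^sup>2) \<le> norm (2 * (norm (f k x))\<^sup>2 + 2 * (norm (g x))\<^sup>2)"
      using sq[of "f k x" "- g x" for x] by (intro AE_I2) simp
  qed measurable
  have "(\<lambda>k. LINT x|M. (norm (f k x - g x))\<^sup>2) \<longlonglongrightarrow> 0"
  proof (rule LIMSEQ_I)
    fix e :: real assume e: "e > 0"
    obtain k where k: "(1 / 8 :: real) ^ k < e" using real_arch_pow_inv[OF e, of "1/8"] by auto
    have "norm ((LINT x|M. (norm (f m x - g x))\<^sup>2) - 0) < e" if m: "m \<ge> N k" for m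
    proof -
      have "ennreal (LINT x|M. (norm (f m x - g x))\<^sup>2) \<le> ennreal ((1 / 8) ^ k)"
        using fatou[OF m] by (subst (asm) nn_integral_eq_integral[OF ia]) auto
      then have "(LINT x|M. (norm (f m x - g x))\<^sup>2) \<le> (1 / 8) ^ k" by simp
      moreover have "(LINT x|M. (norm (f m x - g x))\<^sup>2) \<ge> 0" by (rule Bochner_Integration.integral_nonneg) simp
      ultimately show ?thesis using k by simp
    qed
    then show "\<exists>no. \<forall>n\<ge>no. norm ((LINT x|M. (norm (f n x - g x))\<^sup>2) - 0) < e" by blast
  qed
  with gm g2 ia show thesis by (rule that)
qed

section \<open>Limits of test functions and membership in \<open>homogeneous_H1\<close>\<close>

lemma gradient_test_function_continuous:
  fixes f :: "real ^ 'n::finite \<Rightarrow> complex"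
  assumes "f \<in> test_functions"
  shows "continuous_on UNIV (classical_gradient f)"
  unfolding classical_gradient_def[abs_def]
  by (intro continuous_on_vec_lambda test_function_continuous partial_deriv_test_function assms)

lemma gradient_test_function_support:
  fixes f :: "real ^ 'n::finite \<Rightarrow> complex"
  assumes f: "f \<in> test_functions"
  obtains R where "\<And>x. norm x \<ge> R \<Longrightarrow> classical_gradient f x = 0"
proof -
  have "\<exists>R. \<forall>x. norm x \<ge> R \<longrightarrow> partial_deriv i f x = 0" for i
    using test_function_support[OF partial_deriv_test_function[OF f, of i]] by metis
  then obtain R where R: "\<And>i x. norm x \<ge> R i \<Longrightarrow> partial_deriv i f x = 0" by metis
  show thesis
  proof (rule that[of "Max (range R)"])
    fix x :: "real ^ 'n" assume "norm x \<ge> Max (range R)"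
    then have "norm x \<ge> R i" for i by (meson Max_ge finite_imageI finite_class.finite_UNIV order_trans rangeI)
    then show "classical_gradient f x = 0" using R by (simp add: classical_gradient_def vec_eq_iff)
  qed
qed

lemma integrable_continuous_compact_support:
  fixes f :: "'a::euclidean_space \<Rightarrow> real"
  assumes c: "continuous_on UNIV f" and z: "\<And>x. norm x \<ge> R \<Longrightarrow> f x = 0"
  shows "integrable lborel f"
proof -
  have "integrable lborel (\<lambda>x. indicator (cball 0 R) x *\<^sub>R f x)"
    by (rule borel_integrable_compact) (auto intro: continuous_on_subset[OF c])
  moreover have "(\<lambda>x. indicator (cball 0 R) x *\<^sub>R f x) = f"
    using z by (auto simp: fun_eq_iff split: split_indicator)
  ultimately show ?thesis by simp
qed

lemma Lp_norm_tendsto_0D: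
  fixes f :: "nat \<Rightarrow> real ^ 'n::finite \<Rightarrow> 'b::real_normed_vector"
  assumes lim: "(\<lambda>k. Lp_norm p (f k)) \<longlonglongrightarrow> 0" and p: "p > 0"
  shows "(\<lambda>k. LINT x|lebesgue. norm (f k x) powr p) \<longlonglongrightarrow> 0"
proof -
  have nn: "(LINT x|lebesgue. norm (f k x) powr p) \<ge> 0" for k by (rule Bochner_Integration.integral_nonneg) simp
  have "(\<lambda>k. Lp_norm p (f k) powr p) \<longlonglongrightarrow> 0 powr p"
    by (rule tendsto_powr'[OF lim tendsto_const]) (use p in \<open>auto simp: Lp_norm_def intro!: always_eventually\<close>)
  then show ?thesis using p nn by (simp add: Lp_norm_def powr_powr)
qed

text \<open>The error of \<open>\<phi> k\<close> tested against
  \<open>partial_deriv i \<psi>\<close> plus the error of its derivative tested against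
  \<open>\<psi>\<close> tends to 0. Integration by parts for \<open>\<phi> k\<close> makes this sum
  independent of \<open>k\<close>, so it is 0, which is the identity for \<open>u\<close> and
  \<open>G\<close>.\<close>

lemma is_weak_gradient_limit:
  fixes \<phi> :: "nat \<Rightarrow> real ^ 'n::finite \<Rightarrow> complex"
  assumes \<phi>: "\<And>k. \<phi> k \<in> test_functions" and p: "p \<ge> 1"
    and u[measurable]: "u \<in> borel_measurable lebesgue" and up: "integrable lebesgue (\<lambda>x. norm (u x) powr p)"
    and ip: "\<And>k. integrable lebesgue (\<lambda>x. norm (\<phi> k x - u x) powr p)"
    and lim: "(\<lambda>k. LINT x|lebesgue. norm (\<phi> k x - u x) powr p) \<longlonglongrightarrow> 0"
    and G[measurable]: "G \<in> borel_measurable lebesgue" and G2: "integrable lebesgue (\<lambda>x. (norm (G x))\<^sup>2)"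
    and iG: "\<And>k. integrable lebesgue (\<lambda>x. (norm (classical_gradient (\<phi> k) x - G x))\<^sup>2)"
    and limG: "(\<lambda>k. LINT x|lebesgue. (norm (classical_gradient (\<phi> k) x - G x))\<^sup>2) \<longlonglongrightarrow> 0"
  shows "is_weak_gradient u G"
proof -
  have loc: "locally_integrable v" if v: "v \<in> borel_measurable lebesgue" "integrable lebesgue (\<lambda>x. norm (v x) powr q)" "q \<ge> 1"
    for v :: "real ^ 'n \<Rightarrow> 'c::{banach, second_countable_topology}" and q
    unfolding locally_integrable_def set_integrable_def
  proof (intro allI impI)
    fix K :: "(real ^ 'n) set" assume K: "compact K"
    have Ks: "K \<in> sets lebesgue" using K by (simp add: compact_imp_closed)
    have "emeasure lebesgue K < \<infinity>"
      using emeasure_compact_finite[OF K] K by (simp add: compact_imp_closed)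
    then have "integrable lebesgue (indicator K :: _ \<Rightarrow> real)" using Ks by (intro integrable_real_indicator)
    then have i: "integrable lebesgue (\<lambda>x. indicator K x + norm (v x) powr q)" using v(2) by simp
    show "integrable lebesgue (\<lambda>x. indicator K x *\<^sub>R v x)"
    proof (rule Bochner_Integration.integrable_bound[OF i])
      show "(\<lambda>x. indicator K x *\<^sub>R v x) \<in> borel_measurable lebesgue"
        using v(1) Ks by (intro borel_measurable_scaleR borel_measurable_indicator) auto
      show "AE x in lebesgue. norm (indicator K x *\<^sub>R v x) \<le> norm (indicator K x + norm (v x) powr q)"
        using le_young[OF norm_ge_zero, of 1 q "v x" for x] v(3) by (intro AE_I2) (auto split: split_indicator)
    qed
  qed
  have lu: "locally_integrable u" by (rule loc[OF u up p])
  have lG: "locally_integrable G" by (rule loc[of G 2]) (use G2 in auto)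
  have \<phi>m: "\<phi> k \<in> borel_measurable lebesgue" "(\<lambda>x. partial_deriv i (\<phi> k) x) \<in> borel_measurable lebesgue" for k i
    using test_function_measurable[OF \<phi>[of k]] test_function_measurable[OF partial_deriv_test_function[OF \<phi>[of k], of i]]
    by (auto intro: measurable_completion)
  have "(LINT x|lebesgue. u x * partial_deriv i \<psi> x) = - (LINT x|lebesgue. G x $ i * \<psi> x)"
    if \<psi>: "\<psi> \<in> test_functions" for \<psi> i
  proof -
    have d\<psi>: "partial_deriv i \<psi> \<in> test_functions" by (rule partial_deriv_test_function[OF \<psi>])
    have d\<phi>: "partial_deriv i (\<phi> k) \<in> test_functions" for k by (rule partial_deriv_test_function[OF \<phi>])
    have li: "locally_integrable h" if "h \<in> test_functions" for h :: "real ^ 'n \<Rightarrow> complex"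
      unfolding locally_integrable_def set_integrable_def
    proof (intro allI impI integrable_mult_indicator)
      show "integrable lebesgue h"
        using integrable_test_function[OF that] test_function_measurable[OF that] by (subst integrable_completion) auto
    qed (simp add: compact_imp_closed)
    have gm: "(\<lambda>x. G x $ i) \<in> borel_measurable lebesgue"
      by (rule measurable_compose[OF G borel_measurable_continuous_onI]) (intro continuous_intros)
    define e1 where "e1 k x = \<phi> k x - u x" for k x
    define e2 where "e2 k x = partial_deriv i (\<phi> k) x - G x $ i" for k x
    have m1: "e1 k \<in> borel_measurable lebesgue" "e2 k \<in> borel_measurable lebesgue" for k
      unfolding e1_def e2_def using \<phi>m u gm by (auto intro!: borel_measurable_diff)
    have "(\<lambda>k. LINT x|lebesgue. e1 k x * partial_deriv i \<psi> x) \<longlonglongrightarrow> 0"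
      by (rule tendsto_integral_mult_test[OF m1(1) p _ _ d\<psi>]) (use ip lim in \<open>simp_all add: e1_def\<close>)
    have b2: "norm (e2 k x) powr 2 \<le> (norm (classical_gradient (\<phi> k) x - G x))\<^sup>2" for k x
    proof -
      have "e2 k x = (classical_gradient (\<phi> k) x - G x) $ i" by (simp add: e2_def classical_gradient_def)
      then have "norm (e2 k x) \<le> norm (classical_gradient (\<phi> k) x - G x)"
        using Finite_Cartesian_Product.norm_nth_le[of "classical_gradient (\<phi> k) x - G x" i] by (simp only:)
      then show ?thesis by (simp add: power_mono)
    qed
    have i2: "integrable lebesgue (\<lambda>x. norm (e2 k x) powr 2)" for k
    proof (rule Bochner_Integration.integrable_bound[OF iG[of k]])
      show "AE x in lebesgue. norm (norm (e2 k x) powr 2) \<le> norm ((norm (classical_gradient (\<phi> k) x - G x))\<^sup>2)"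
        using b2 by (intro AE_I2) simp
    qed (use m1(2)[of k] in measurable)
    have l2: "(\<lambda>k. LINT x|lebesgue. norm (e2 k x) powr 2) \<longlonglongrightarrow> 0"
    proof (rule tendsto_sandwich[OF _ _ tendsto_const limG])
      show "\<forall>\<^sub>F k in sequentially. 0 \<le> (LINT x|lebesgue. norm (e2 k x) powr 2)"
        by (intro always_eventually allI Bochner_Integration.integral_nonneg) simp
      show "\<forall>\<^sub>F k in sequentially. (LINT x|lebesgue. norm (e2 k x) powr 2) \<le> (LINT x|lebesgue. (norm (classical_gradient (\<phi> k) x - G x))\<^sup>2)"
        by (intro always_eventually allI integral_mono i2 iG b2)
    qed
    have "(\<lambda>k. LINT x|lebesgue. e2 k x * \<psi> x) \<longlonglongrightarrow> 0"
      by (rule tendsto_integral_mult_test[OF m1(2) _ i2 l2 \<psi>]) simp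
    from tendsto_add[OF \<open>(\<lambda>k. LINT x|lebesgue. e1 k x * partial_deriv i \<psi> x) \<longlonglongrightarrow> 0\<close> this]
    have L: "(\<lambda>k. (LINT x|lebesgue. e1 k x * partial_deriv i \<psi> x) + (LINT x|lebesgue. e2 k x * \<psi> x)) \<longlonglongrightarrow> 0" by simp
    have "(LINT x|lebesgue. e1 k x * partial_deriv i \<psi> x) + (LINT x|lebesgue. e2 k x * \<psi> x) =
       - ((LINT x|lebesgue. u x * partial_deriv i \<psi> x) + (LINT x|lebesgue. G x $ i * \<psi> x))" for k
    proof -
      have "(LINT x|lebesgue. e1 k x * partial_deriv i \<psi> x) = (LINT x|lebesgue. \<phi> k x * partial_deriv i \<psi> x) - (LINT x|lebesgue. u x * partial_deriv i \<psi> x)"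
        unfolding e1_def left_diff_distrib
        by (rule Bochner_Integration.integral_diff[OF integrable_mult_test_function[OF li[OF \<phi>] d\<psi>] integrable_mult_test_function[OF lu d\<psi>]])
      moreover have "(LINT x|lebesgue. e2 k x * \<psi> x) = (LINT x|lebesgue. partial_deriv i (\<phi> k) x * \<psi> x) - (LINT x|lebesgue. G x $ i * \<psi> x)"
        unfolding e2_def left_diff_distrib
        by (rule Bochner_Integration.integral_diff[OF integrable_mult_test_function[OF li[OF d\<phi>] \<psi>]
              integrable_mult_test_function[OF locally_integrable_component[OF lG] \<psi>]])
      ultimately show ?thesis using test_functions_by_parts[OF \<phi>[of k] \<psi>, of i] by simp
    qed
    with L have "- ((LINT x|lebesgue. u x * partial_deriv i \<psi> x) + (LINT x|lebesgue. G x $ i * \<psi> x)) = 0"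
      by (simp only: LIMSEQ_const_iff)
    then have "(LINT x|lebesgue. u x * partial_deriv i \<psi> x) + (LINT x|lebesgue. G x $ i * \<psi> x) = 0"
      by (simp only: neg_equal_0_iff_equal)
    then show ?thesis by (simp only: eq_neg_iff_add_eq_0)
  qed
  with lu lG show ?thesis by (simp add: is_weak_gradient_def)
qed

lemma norm_diff_square_le:
  fixes a b :: "'a::real_normed_vector"
  shows "(norm (a - b))\<^sup>2 \<le> 2 * (norm a)\<^sup>2 + 2 * (norm b)\<^sup>2"
proof -
  have "(norm (a - b))\<^sup>2 \<le> (norm a + norm b)\<^sup>2" by (intro power_mono norm_triangle_ineq4) simp
  also have "\<dots> \<le> 2 * (norm a)\<^sup>2 + 2 * (norm b)\<^sup>2"
    using sum_squares_bound[of "norm a" "norm b"] by (simp add: power2_sum)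
  finally show ?thesis .
qed

lemma norm_diff_powr_le:
  fixes a b :: "'a::real_normed_vector"
  assumes p: "p \<ge> 0"
  shows "norm (a - b) powr p \<le> 2 powr p * (norm a powr p + norm b powr p)"
proof -
  have "norm (a - b) \<le> 2 * max (norm a) (norm b)" using norm_triangle_ineq4[of a b] by simp
  then have "norm (a - b) powr p \<le> (2 * max (norm a) (norm b)) powr p" by (intro powr_mono2 p) auto
  also have "\<dots> = 2 powr p * (max (norm a) (norm b)) powr p" by (simp add: powr_mult)
  also have "(max (norm a) (norm b)) powr p \<le> norm a powr p + norm b powr p" by (simp add: max_def)
  finally show ?thesis by simp
qed

lemma integrable_norm_diff_powr:
  fixes f g :: "'a \<Rightarrow> complex"
  assumes [measurable]: "f \<in> borel_measurable M" "g \<in> borel_measurable M" and p: "p \<ge> 0"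
    and "integrable M (\<lambda>x. norm (f x) powr p)" "integrable M (\<lambda>x. norm (g x) powr p)"
  shows "integrable M (\<lambda>x. norm (f x - g x) powr p)"
proof (rule Bochner_Integration.integrable_bound)
  show "integrable M (\<lambda>x. 2 powr p * (norm (f x) powr p + norm (g x) powr p))" using assms by simp
  show "AE x in M. norm (norm (f x - g x) powr p) \<le> norm (2 powr p * (norm (f x) powr p + norm (g x) powr p))"
    using norm_diff_powr_le[OF p] by (intro AE_I2) simp
qed measurable

lemma integrable_norm_diff_square:
  fixes f g :: "'a \<Rightarrow> 'b::euclidean_space"
  assumes [measurable]: "f \<in> borel_measurable M" "g \<in> borel_measurable M"
    and "integrable M (\<lambda>x. (norm (f x))\<^sup>2)" "integrable M (\<lambda>x. (norm (g x))\<^sup>2)"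
  shows "integrable M (\<lambda>x. (norm (f x - g x))\<^sup>2)"
proof (rule Bochner_Integration.integrable_bound)
  show "integrable M (\<lambda>x. 2 * (norm (f x))\<^sup>2 + 2 * (norm (g x))\<^sup>2)" using assms by simp
  show "AE x in M. norm ((norm (f x - g x))\<^sup>2) \<le> norm (2 * (norm (f x))\<^sup>2 + 2 * (norm (g x))\<^sup>2)"
    using norm_diff_square_le by (intro AE_I2) simp
qed measurable

lemma test_function_powr_integrable:
  fixes f :: "real ^ 'n::finite \<Rightarrow> complex"
  assumes f: "f \<in> test_functions" and p: "p > 0"
  shows "integrable lborel (\<lambda>x. norm (f x) powr p)"
proof -
  obtain R where R: "\<And>x. norm x \<ge> R \<Longrightarrow> f x = 0" using test_function_support[OF f] by blast
  show ?thesis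
  proof (rule integrable_continuous_compact_support)
    show "continuous_on UNIV (\<lambda>x. norm (f x) powr p)"
      by (intro continuous_on_powr' continuous_on_norm test_function_continuous[OF f] continuous_on_const) (use p in auto)
    show "norm (f x) powr p = 0" if "norm x \<ge> R" for x using R[OF that] by simp
  qed
qed

lemma gradient_test_function_square_integrable:
  fixes f :: "real ^ 'n::finite \<Rightarrow> complex"
  assumes f: "f \<in> test_functions"
  shows "integrable lborel (\<lambda>x. (norm (classical_gradient f x))\<^sup>2)"
proof -
  obtain R where R: "\<And>x. norm x \<ge> R \<Longrightarrow> classical_gradient f x = 0" using gradient_test_function_support[OF f] by blast
  show ?thesis
    by (rule integrable_continuous_compact_support)
       (use R in \<open>auto intro!: continuous_on_power continuous_on_norm gradient_test_function_continuous[OF f]\<close>)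
qed

lemma gradient_test_function_measurable:
  fixes f :: "real ^ 'n::finite \<Rightarrow> complex"
  assumes "f \<in> test_functions"
  shows "classical_gradient f \<in> borel_measurable borel"
  by (rule borel_measurable_continuous_onI[OF gradient_test_function_continuous[OF assms]])

lemma lebesgue_ex_borel_complex:
  fixes u :: "'a::euclidean_space \<Rightarrow> complex"
  assumes u: "u \<in> borel_measurable lebesgue"
  obtains u' where "u' \<in> borel_measurable borel" "AE x in lborel. u x = u' x"
proof -
  obtain a where a: "a \<in> borel_measurable lborel" "AE x in lborel. Re (u x) = a x"
    using completion_ex_borel_measurable_real[OF measurable_compose[OF u borel_measurable_Re]] by blast
  obtain b where b: "b \<in> borel_measurable lborel" "AE x in lborel. Im (u x) = b x"
    using completion_ex_borel_measurable_real[OF measurable_compose[OF u borel_measurable_Im]] by blast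
  show thesis
  proof (rule that[of "\<lambda>x. complex_of_real (a x) + \<i> * complex_of_real (b x)"])
    have [measurable]: "a \<in> borel_measurable borel" "b \<in> borel_measurable borel" using a(1) b(1) by simp_all
    show "(\<lambda>x. complex_of_real (a x) + \<i> * complex_of_real (b x)) \<in> borel_measurable borel" by measurable
    show "AE x in lborel. u x = complex_of_real (a x) + \<i> * complex_of_real (b x)"
      using a(2) b(2) by eventually_elim (simp add: complex_eq_iff)
  qed
qed

lemma sobolev_exponent_gt_2:
  assumes "d \<ge> 3"
  shows "sobolev_exponent d > 2"
  using assms by (simp add: sobolev_exponent_def field_simps)

text \<open>Dilation orbits are null sets, and the Fubini argument along them is carried out with
  Borel functions; hence the representative \<open>u'\<close> and the passage from
  \<open>lebesgue\<close> to \<open>lborel\<close>. The limit \<open>G\<close> of the gradients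
  comes from \<open>L2_complete\<close>.\<close>

lemma homogeneous_H1E:
  fixes u :: "real ^ 'n::finite \<Rightarrow> complex"
  assumes u: "u \<in> homogeneous_H1" and d: "CARD('n) \<ge> 3"
  defines "p \<equiv> sobolev_exponent CARD('n)"
  obtains \<phi> G u' where "\<And>k. \<phi> k \<in> test_functions" "u' \<in> borel_measurable borel" "AE x in lborel. u x = u' x"
    "integrable lborel (\<lambda>x. norm (u' x) powr p)" "\<And>k. integrable lborel (\<lambda>x. norm (\<phi> k x - u' x) powr p)"
    "(\<lambda>k. LINT x|lborel. norm (\<phi> k x - u' x) powr p) \<longlonglongrightarrow> 0"
    "G \<in> borel_measurable borel" "integrable lborel (\<lambda>x. (norm (G x))\<^sup>2)"
    "\<And>k. integrable lborel (\<lambda>x. (norm (classical_gradient (\<phi> k) x - G x))\<^sup>2)"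
    "(\<lambda>k. LINT x|lborel. (norm (classical_gradient (\<phi> k) x - G x))\<^sup>2) \<longlonglongrightarrow> 0"
    "is_weak_gradient u G"
proof -
  have p: "p > 2" unfolding p_def by (rule sobolev_exponent_gt_2[OF d])
  have um: "u \<in> borel_measurable lebesgue" and ui: "integrable lebesgue (\<lambda>x. norm (u x) powr p)"
    using u by (auto simp: homogeneous_H1_def p_def Let_def)
  obtain \<phi> where \<phi>: "\<And>k. \<phi> k \<in> test_functions"
    and cau: "\<And>e. e > 0 \<Longrightarrow> \<exists>N. \<forall>m\<ge>N. \<forall>n\<ge>N. Lp_norm 2 (\<lambda>x. classical_gradient (\<phi> m) x - classical_gradient (\<phi> n) x) < e"
    and lim: "(\<lambda>k. Lp_norm p (\<lambda>x. \<phi> k x - u x)) \<longlonglongrightarrow> 0"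
    using u unfolding homogeneous_H1_def p_def Let_def by blast
  obtain u' where u'[measurable]: "u' \<in> borel_measurable borel" and uu': "AE x in lborel. u x = u' x"
    using lebesgue_ex_borel_complex[OF um] by blast
  have uuL: "AE x in lebesgue. u x = u' x" by (rule AE_completion[OF uu'])
  have u'L: "u' \<in> borel_measurable lebesgue" by (rule measurable_completion) simp
  have \<phi>m[measurable]: "\<phi> k \<in> borel_measurable borel" for k by (rule test_function_measurable[OF \<phi>])
  have \<phi>L: "\<phi> k \<in> borel_measurable lebesgue" for k by (rule measurable_completion) simp
  have gm[measurable]: "classical_gradient (\<phi> k) \<in> borel_measurable borel" for k by (rule gradient_test_function_measurable[OF \<phi>])
  have "integrable lebesgue (\<lambda>x. norm (u' x) powr p)"
    by (rule integrable_cong_AE_imp[OF ui]) (use uuL u'L in \<open>auto elim!: eventually_mono\<close>)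
  then have ui': "integrable lborel (\<lambda>x. norm (u' x) powr p)" by (subst (asm) integrable_completion) auto
  have id: "integrable lborel (\<lambda>x. norm (\<phi> k x - u' x) powr p)" for k
    by (rule integrable_norm_diff_powr) (use p ui' test_function_powr_integrable[OF \<phi>, of p] in auto)
  have lim': "(\<lambda>k. LINT x|lborel. norm (\<phi> k x - u' x) powr p) \<longlonglongrightarrow> 0"
  proof -
    have "(LINT x|lebesgue. norm (\<phi> k x - u x) powr p) = (LINT x|lborel. norm (\<phi> k x - u' x) powr p)" for k
    proof -
      have "(LINT x|lebesgue. norm (\<phi> k x - u x) powr p) = (LINT x|lebesgue. norm (\<phi> k x - u' x) powr p)"
      proof (rule integral_cong_AE)
        show "AE x in lebesgue. norm (\<phi> k x - u x) powr p = norm (\<phi> k x - u' x) powr p"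
          using uuL by eventually_elim simp
        show "(\<lambda>x. norm (\<phi> k x - u x) powr p) \<in> borel_measurable lebesgue"
          using borel_measurable_diff[OF \<phi>L um] by simp
        show "(\<lambda>x. norm (\<phi> k x - u' x) powr p) \<in> borel_measurable lebesgue"
          using borel_measurable_diff[OF \<phi>L u'L] by simp
      qed
      then show ?thesis by (subst (asm) (2) integral_completion) auto
    qed
    moreover have "p > 0" using p by simp
    ultimately show ?thesis using Lp_norm_tendsto_0D[OF lim] by simp
  qed
  have gi: "integrable lborel (\<lambda>x. (norm (classical_gradient (\<phi> m) x - classical_gradient (\<phi> n) x))\<^sup>2)" for m n
    by (rule integrable_norm_diff_square) (auto intro: gradient_test_function_square_integrable[OF \<phi>])
  have cau': "\<exists>N. \<forall>m\<ge>N. \<forall>n\<ge>N. (LINT x|lborel. (norm (classical_gradient (\<phi> m) x - classical_gradient (\<phi> n) x))\<^sup>2) < e"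
    if e: "e > 0" for e
  proof -
    obtain N where N: "\<And>m n. m \<ge> N \<Longrightarrow> n \<ge> N \<Longrightarrow> Lp_norm 2 (\<lambda>x. classical_gradient (\<phi> m) x - classical_gradient (\<phi> n) x) < sqrt e"
      using cau[of "sqrt e"] e by auto
    have "(LINT x|lborel. (norm (classical_gradient (\<phi> m) x - classical_gradient (\<phi> n) x))\<^sup>2) < e" if "m \<ge> N" "n \<ge> N" for m n
    proof -
      let ?I = "LINT x|lborel. (norm (classical_gradient (\<phi> m) x - classical_gradient (\<phi> n) x))\<^sup>2"
      have nn: "?I \<ge> 0" by (rule Bochner_Integration.integral_nonneg) simp
      have "(LINT x|lebesgue. norm (classical_gradient (\<phi> m) x - classical_gradient (\<phi> n) x) powr 2) = ?I"
        by (subst integral_completion) auto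
      then have "Lp_norm 2 (\<lambda>x. classical_gradient (\<phi> m) x - classical_gradient (\<phi> n) x) = sqrt ?I"
        using nn by (simp add: Lp_norm_def powr_half_sqrt)
      with N[OF that] show ?thesis by simp
    qed
    then show ?thesis by blast
  qed
  obtain G where G: "G \<in> borel_measurable lborel" "integrable lborel (\<lambda>x. (norm (G x))\<^sup>2)"
    "\<And>k. integrable lborel (\<lambda>x. (norm (classical_gradient (\<phi> k) x - G x))\<^sup>2)"
    "(\<lambda>k. LINT x|lborel. (norm (classical_gradient (\<phi> k) x - G x))\<^sup>2) \<longlonglongrightarrow> 0"
    using L2_complete[of "\<lambda>k. classical_gradient (\<phi> k)" lborel, OF _ gi gradient_test_function_square_integrable[OF \<phi>] cau'] gm
    by auto
  have [measurable]: "G \<in> borel_measurable borel" using G(1) by simp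
  have wg: "is_weak_gradient u G"
  proof (rule is_weak_gradient_limit[OF \<phi> _ um ui])
    show "1 \<le> p" using p by simp
    show "integrable lebesgue (\<lambda>x. norm (\<phi> k x - u x) powr p)" for k
      by (rule integrable_norm_diff_powr[OF \<phi>L um _ _ ui])
         (use p test_function_powr_integrable[OF \<phi>[of k], of p] in \<open>auto simp: integrable_completion\<close>)
    show "(\<lambda>k. LINT x|lebesgue. norm (\<phi> k x - u x) powr p) \<longlonglongrightarrow> 0"
      using Lp_norm_tendsto_0D[OF lim] p by simp
    show "G \<in> borel_measurable lebesgue" by (rule measurable_completion) simp
    show "integrable lebesgue (\<lambda>x. (norm (G x))\<^sup>2)" using G(2) by (subst integrable_completion) auto
    show "integrable lebesgue (\<lambda>x. (norm (classical_gradient (\<phi> k) x - G x))\<^sup>2)" for k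
      using G(3) by (subst integrable_completion) auto
    show "(\<lambda>k. LINT x|lebesgue. (norm (classical_gradient (\<phi> k) x - G x))\<^sup>2) \<longlonglongrightarrow> 0"
      using G(4) by (subst integral_completion) auto
  qed
  show thesis
    by (rule that[OF \<phi> u' uu' ui' id lim' _ G(2-4) wg]) simp
qed

lemma homogeneous_H1I:
  fixes u :: "real ^ 'n::finite \<Rightarrow> complex"
  assumes \<phi>: "\<And>k. \<phi> k \<in> test_functions" and d: "CARD('n) \<ge> 3"
  defines "p \<equiv> sobolev_exponent CARD('n)"
  assumes u[measurable]: "u \<in> borel_measurable borel" and up: "integrable lborel (\<lambda>x. norm (u x) powr p)"
    and lim: "(\<lambda>k. LINT x|lborel. norm (\<phi> k x - u x) powr p) \<longlonglongrightarrow> 0"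
    and G[measurable]: "G \<in> borel_measurable borel" and G2: "integrable lborel (\<lambda>x. (norm (G x))\<^sup>2)"
    and limG: "(\<lambda>k. LINT x|lborel. (norm (classical_gradient (\<phi> k) x - G x))\<^sup>2) \<longlonglongrightarrow> 0"
  shows "u \<in> homogeneous_H1" "is_weak_gradient u G"
proof -
  have p: "p > 2" unfolding p_def by (rule sobolev_exponent_gt_2[OF d])
  have uL: "u \<in> borel_measurable lebesgue" by (rule measurable_completion) simp
  have upL: "integrable lebesgue (\<lambda>x. norm (u x) powr p)" using up by (subst integrable_completion) auto
  have \<phi>m[measurable]: "\<phi> k \<in> borel_measurable borel" for k by (rule test_function_measurable[OF \<phi>])
  have gm[measurable]: "classical_gradient (\<phi> k) \<in> borel_measurable borel" for k by (rule gradient_test_function_measurable[OF \<phi>])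
  have id: "integrable lborel (\<lambda>x. norm (\<phi> k x - u x) powr p)" for k
    by (rule integrable_norm_diff_powr) (use p up test_function_powr_integrable[OF \<phi>, of p] in auto)
  have iG: "integrable lborel (\<lambda>x. (norm (classical_gradient (\<phi> k) x - G x))\<^sup>2)" for k
    by (rule integrable_norm_diff_square) (auto intro: gradient_test_function_square_integrable[OF \<phi>] G2)
  have limL: "(\<lambda>k. LINT x|lebesgue. norm (\<phi> k x - u x) powr p) \<longlonglongrightarrow> 0"
    using lim by (subst integral_completion) auto
  have limGL: "(\<lambda>k. LINT x|lebesgue. (norm (classical_gradient (\<phi> k) x - G x))\<^sup>2) \<longlonglongrightarrow> 0"
    using limG by (subst integral_completion) auto
  show "is_weak_gradient u G"
  proof (rule is_weak_gradient_limit[OF \<phi> _ uL upL _ limL _ _ _ limGL])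
    show "1 \<le> p" using p by simp
    show "integrable lebesgue (\<lambda>x. norm (\<phi> k x - u x) powr p)" for k using id by (subst integrable_completion) auto
    show "G \<in> borel_measurable lebesgue" by (rule measurable_completion) simp
    show "integrable lebesgue (\<lambda>x. (norm (G x))\<^sup>2)" using G2 by (subst integrable_completion) auto
    show "integrable lebesgue (\<lambda>x. (norm (classical_gradient (\<phi> k) x - G x))\<^sup>2)" for k
      using iG by (subst integrable_completion) auto
  qed
  have lp: "(\<lambda>k. Lp_norm p (\<lambda>x. \<phi> k x - u x)) \<longlonglongrightarrow> 0"
  proof -
    have "(\<lambda>k. (LINT x|lebesgue. norm (\<phi> k x - u x) powr p) powr (1 / p)) \<longlonglongrightarrow> 0 powr (1 / p)"
      by (rule tendsto_powr'[OF limL tendsto_const]) (use p in \<open>auto intro!: always_eventually Bochner_Integration.integral_nonneg\<close>)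
    then show ?thesis by (simp add: Lp_norm_def)
  qed
  have "\<exists>N. \<forall>m\<ge>N. \<forall>n\<ge>N. Lp_norm 2 (\<lambda>x. classical_gradient (\<phi> m) x - classical_gradient (\<phi> n) x) < e"
    if e: "e > 0" for e
  proof -
    let ?J = "\<lambda>k. LINT x|lborel. (norm (classical_gradient (\<phi> k) x - G x))\<^sup>2"
    \<comment> \<open>The quarter pays for the two factors 2 of
      \<open>norm_diff_square_le\<close>.\<close>
    obtain N where N: "\<And>m. m \<ge> N \<Longrightarrow> \<bar>?J m\<bar> < e\<^sup>2 / 4"
      using LIMSEQ_D[OF limG, of "e\<^sup>2 / 4"] e by auto
    have "Lp_norm 2 (\<lambda>x. classical_gradient (\<phi> m) x - classical_gradient (\<phi> n) x) < e" if "m \<ge> N" "n \<ge> N" for m n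
    proof -
      let ?I = "LINT x|lborel. (norm (classical_gradient (\<phi> m) x - classical_gradient (\<phi> n) x))\<^sup>2"
      have nn: "?I \<ge> 0" by (rule Bochner_Integration.integral_nonneg) simp
      have "?I \<le> (LINT x|lborel. 2 * (norm (classical_gradient (\<phi> m) x - G x))\<^sup>2 + 2 * (norm (classical_gradient (\<phi> n) x - G x))\<^sup>2)"
      proof (rule integral_mono)
        show "integrable lborel (\<lambda>x. (norm (classical_gradient (\<phi> m) x - classical_gradient (\<phi> n) x))\<^sup>2)"
          by (rule integrable_norm_diff_square) (auto intro: gradient_test_function_square_integrable[OF \<phi>])
        show "integrable lborel (\<lambda>x. 2 * (norm (classical_gradient (\<phi> m) x - G x))\<^sup>2 + 2 * (norm (classical_gradient (\<phi> n) x - G x))\<^sup>2)"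
          using iG by simp
        show "(norm (classical_gradient (\<phi> m) x - classical_gradient (\<phi> n) x))\<^sup>2 \<le> 2 * (norm (classical_gradient (\<phi> m) x - G x))\<^sup>2 + 2 * (norm (classical_gradient (\<phi> n) x - G x))\<^sup>2" for x
          using norm_diff_square_le[of "classical_gradient (\<phi> m) x - G x" "classical_gradient (\<phi> n) x - G x"] by simp
      qed
      also have "\<dots> = 2 * ?J m + 2 * ?J n" using iG by simp
      also have "\<dots> < e\<^sup>2" using N[OF that(1)] N[OF that(2)] by (simp add: abs_less_iff)
      finally have "sqrt ?I < sqrt (e\<^sup>2)" by (simp only: real_sqrt_less_iff)
      then have "sqrt ?I < e" using e by simp
      moreover have "(LINT x|lebesgue. norm (classical_gradient (\<phi> m) x - classical_gradient (\<phi> n) x) powr 2) = ?I"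
        by (subst integral_completion) auto
      ultimately show ?thesis using nn by (simp add: Lp_norm_def powr_half_sqrt)
    qed
    then show ?thesis by blast
  qed
  with \<phi> lp uL upL show "u \<in> homogeneous_H1" unfolding homogeneous_H1_def p_def Let_def by blast
qed

section \<open>Polar coordinates\<close>

lemma nn_integral_lborel_scale:
  fixes f :: "'a::euclidean_space \<Rightarrow> ennreal"
  assumes [measurable]: "f \<in> borel_measurable borel" and c: "c > 0"
  shows "(\<integral>\<^sup>+x. f x \<partial>lborel) = (\<integral>\<^sup>+x. ennreal (c ^ DIM('a)) * f (c *\<^sub>R x) \<partial>lborel)"
proof -
  have l: "lborel = density (distr lborel borel (\<lambda>x::'a. 0 + c *\<^sub>R x)) (\<lambda>_. ennreal (\<bar>c\<bar> ^ DIM('a)))"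
    by (rule lborel_affine) (use c in auto)
  have "(\<integral>\<^sup>+x. f x \<partial>lborel) = (\<integral>\<^sup>+x. ennreal (\<bar>c\<bar> ^ DIM('a)) * f x \<partial>distr lborel borel (\<lambda>x::'a. 0 + c *\<^sub>R x))"
    by (subst l, subst nn_integral_density) auto
  also have "\<dots> = (\<integral>\<^sup>+x. ennreal (\<bar>c\<bar> ^ DIM('a)) * f (0 + c *\<^sub>R x) \<partial>lborel)"
    by (rule nn_integral_distr) auto
  finally show ?thesis using c by simp
qed

definition unit_shell :: "'a::euclidean_space set" where
  "unit_shell = {x. 1 \<le> norm x \<and> norm x < exp 1}"

lemma unit_shell_measurable [measurable]: "unit_shell \<in> sets borel"
proof -
  have "unit_shell = {x::'a. 1 \<le> norm x} \<inter> {x. norm x < exp 1}" by (auto simp: unit_shell_def)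
  also have "\<dots> \<in> sets borel" by measurable
  finally show ?thesis .
qed

lemma unit_shell_nonzero: "x \<in> unit_shell \<Longrightarrow> x \<noteq> 0"
  by (auto simp: unit_shell_def)

text \<open>Polar coordinates with the dilation orbits of the points of a shell in place of rays:
  the weight \<open>indicator unit_shell\<close> integrates to \<open>1\<close> along every orbit.\<close>

lemma nn_integral_dilation_orbits:
  fixes F :: "'a::euclidean_space \<Rightarrow> ennreal"
  assumes F[measurable]: "F \<in> borel_measurable borel"
  shows "(\<integral>\<^sup>+x. indicator unit_shell x * (\<integral>\<^sup>+t. ennreal (exp (real DIM('a) * t)) * F (exp t *\<^sub>R x) \<partial>lborel) \<partial>lborel)
    = (\<integral>\<^sup>+x. F x \<partial>lborel)"
proof -
  have "(\<integral>\<^sup>+x. indicator unit_shell x * (\<integral>\<^sup>+t. ennreal (exp (real DIM('a) * t)) * F (exp t *\<^sub>R x) \<partial>lborel) \<partial>lborel)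
     = (\<integral>\<^sup>+x. \<integral>\<^sup>+t. indicator unit_shell x * (ennreal (exp (real DIM('a) * t)) * F (exp t *\<^sub>R x)) \<partial>lborel \<partial>lborel)"
    by (intro nn_integral_cong nn_integral_cmult[symmetric]) measurable
  also have "\<dots> = (\<integral>\<^sup>+t. \<integral>\<^sup>+x. indicator unit_shell x * (ennreal (exp (real DIM('a) * t)) * F (exp t *\<^sub>R x)) \<partial>lborel \<partial>lborel)"
    by (rule lborel_pair.Fubini'[symmetric]) measurable
  \<comment> \<open>Dilating the inner variable by \<open>exp t\<close> absorbs the exponential
    weight as the Jacobian.\<close>
  also have "\<dots> = (\<integral>\<^sup>+t. \<integral>\<^sup>+y. indicator unit_shell (exp (- t) *\<^sub>R y) * F y \<partial>lborel \<partial>lborel)"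
  proof (rule nn_integral_cong)
    fix t :: real
    have "(\<integral>\<^sup>+y. indicator unit_shell (exp (- t) *\<^sub>R y) * F y \<partial>lborel) =
      (\<integral>\<^sup>+x. ennreal (exp t ^ DIM('a)) * (indicator unit_shell (exp (- t) *\<^sub>R (exp t *\<^sub>R x)) * F (exp t *\<^sub>R x)) \<partial>lborel)"
      by (rule nn_integral_lborel_scale) auto
    then show "(\<integral>\<^sup>+x. indicator unit_shell x * (ennreal (exp (real DIM('a) * t)) * F (exp t *\<^sub>R x)) \<partial>lborel) =
       (\<integral>\<^sup>+y. indicator unit_shell (exp (- t) *\<^sub>R y) * F y \<partial>lborel)"
      unfolding exp_of_nat_mult by (simp add: mult_ac flip: exp_add)
  qed
  also have "\<dots> = (\<integral>\<^sup>+y. \<integral>\<^sup>+t. indicator unit_shell (exp (- t) *\<^sub>R y) * F y \<partial>lborel \<partial>lborel)"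
    by (rule lborel_pair.Fubini'[symmetric]) measurable
  also have "\<dots> = (\<integral>\<^sup>+y. F y \<partial>lborel)"
  proof (rule nn_integral_cong_AE)
    show "AE y in lborel. (\<integral>\<^sup>+t. indicator unit_shell (exp (- t) *\<^sub>R y) * F y \<partial>lborel) = F y"
      using AE_lborel_singleton[of "0::'a"]
    proof eventually_elim
      case (elim y)
      \<comment> \<open>The times at which the orbit of \<open>y\<close> lies in the shell form a
        half-open interval of length 1, because the ratio of the two radii is
        \<open>exp 1\<close>.\<close>
      have iff: "exp (- t) *\<^sub>R y \<in> unit_shell \<longleftrightarrow> t \<in> {ln (norm y) - 1<..ln (norm y)}" for t
      proof -
        have n: "norm (exp (- t) *\<^sub>R y) = exp (ln (norm y) - t)" using elim by (simp add: exp_diff exp_minus field_simps)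
        show ?thesis unfolding unit_shell_def mem_Collect_eq n by auto
      qed
      have "(\<integral>\<^sup>+t. indicator unit_shell (exp (- t) *\<^sub>R y) * F y \<partial>lborel) = (\<integral>\<^sup>+t. indicator {ln (norm y) - 1<..ln (norm y)} t * F y \<partial>lborel)"
        by (intro nn_integral_cong) (simp add: indicator_def iff del: greaterThanAtMost_iff)
      also have "\<dots> = F y" by (subst nn_integral_multc) auto
      finally show ?case .
    qed
  qed
  finally show ?thesis .
qed

definition sphere_area :: "'a::euclidean_space itself \<Rightarrow> real" where
  "sphere_area _ = real DIM('a) * measure lborel (ball (0::'a) 1)"

lemma nn_integral_exp_neg:
  assumes "a > (0::real)"
  shows "(\<integral>\<^sup>+t. ennreal (exp (a * t)) * indicator {..<0} t \<partial>lborel) = ennreal (1 / a)"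
proof -
  have "(\<integral>\<^sup>+t. ennreal (exp (a * t)) * indicator {..<0} t \<partial>lborel) =
      (\<integral>\<^sup>+t. ennreal (exp (a * (- t))) * indicator {..<0} (- t) \<partial>lborel)"
    using nn_integral_real_affine[of "\<lambda>t. ennreal (exp (a * t)) * indicator {..<0} t" "-1" 0] by simp
  also have "\<dots> = (\<integral>\<^sup>+t. ennreal (exp (- a * t)) * indicator {0..} t \<partial>lborel)"
    by (rule nn_integral_cong_AE) (use AE_lborel_singleton[of 0] in \<open>eventually_elim, auto split: split_indicator\<close>)
  also have "\<dots> = (\<integral>\<^sup>+t. ennreal (indicator {0..} t * exp (- a * t)) \<partial>lborel)"
    by (rule nn_integral_cong) (auto split: split_indicator)
  also have "\<dots> = ennreal (exp (- a * 0) / a)"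
    by (rule nn_integral_has_integral_lebesgue[OF _ has_integral_exp_minus_to_infinity[OF assms]]) simp
  finally show ?thesis by simp
qed

text \<open>A time shift by \<open>ln (norm x)\<close> removes the dependence on the base point
  \<open>x\<close> of an orbit up to the factor \<open>1 / norm x ^ DIM('a)\<close>, so the orbit
  formula factorizes. The constant, the shell integral \<open>N\<close>, is identified by inserting
  the indicator of the unit ball.\<close>

lemma nn_integral_radial:
  fixes f :: "real \<Rightarrow> ennreal"
  assumes f[measurable]: "f \<in> borel_measurable borel"
  shows "(\<integral>\<^sup>+x. f (ln (norm (x::'a::euclidean_space))) \<partial>lborel) =
    ennreal (sphere_area TYPE('a)) * (\<integral>\<^sup>+t. ennreal (exp (real DIM('a) * t)) * f t \<partial>lborel)"
    and "(\<integral>\<^sup>+x. indicator unit_shell x * ennreal (1 / norm (x::'a) ^ DIM('a)) \<partial>lborel) = ennreal (sphere_area TYPE('a))"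
proof -
  let ?n = "real DIM('a)"
  define N where "N = (\<integral>\<^sup>+x. indicator unit_shell x * ennreal (1 / norm (x::'a) ^ DIM('a)) \<partial>lborel)"
  have main: "(\<integral>\<^sup>+x. g (ln (norm (x::'a))) \<partial>lborel) = N * (\<integral>\<^sup>+t. ennreal (exp (?n * t)) * g t \<partial>lborel)"
    if [measurable]: "g \<in> borel_measurable borel" for g :: "real \<Rightarrow> ennreal"
  proof -
    have "(\<integral>\<^sup>+x. g (ln (norm (x::'a))) \<partial>lborel) =
      (\<integral>\<^sup>+x. indicator unit_shell (x::'a) * (\<integral>\<^sup>+t. ennreal (exp (?n * t)) * g (ln (norm (exp t *\<^sub>R x))) \<partial>lborel) \<partial>lborel)"
      by (rule nn_integral_dilation_orbits[where F="\<lambda>x. g (ln (norm x))", symmetric]) measurable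
    also have "\<dots> = (\<integral>\<^sup>+x. indicator unit_shell (x::'a) * ennreal (1 / norm x ^ DIM('a)) * (\<integral>\<^sup>+t. ennreal (exp (?n * t)) * g t \<partial>lborel) \<partial>lborel)"
    proof (rule nn_integral_cong)
      fix x :: 'a
      show "indicator unit_shell x * (\<integral>\<^sup>+t. ennreal (exp (?n * t)) * g (ln (norm (exp t *\<^sub>R x))) \<partial>lborel) =
        indicator unit_shell x * ennreal (1 / norm x ^ DIM('a)) * (\<integral>\<^sup>+t. ennreal (exp (?n * t)) * g t \<partial>lborel)"
      proof (cases "x \<in> unit_shell")
        case True
        then have x: "norm x > 0" using unit_shell_nonzero by auto
        have "(\<integral>\<^sup>+t. ennreal (exp (?n * t)) * g t \<partial>lborel) =
            (\<integral>\<^sup>+t. ennreal (exp (?n * (ln (norm x) + t))) * g (ln (norm x) + t) \<partial>lborel)"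
          using nn_integral_real_affine[of "\<lambda>t. ennreal (exp (?n * t)) * g t" 1 "ln (norm x)"] by simp
        also have "\<dots> = (\<integral>\<^sup>+t. ennreal (norm x ^ DIM('a)) * (ennreal (exp (?n * t)) * g (ln (norm (exp t *\<^sub>R x)))) \<partial>lborel)"
        proof (rule nn_integral_cong)
          fix t
          have "exp (?n * (ln (norm x) + t)) = norm x ^ DIM('a) * exp (?n * t)"
            using x by (simp add: distrib_left exp_add exp_of_nat_mult)
          moreover have "ln (norm (exp t *\<^sub>R x)) = ln (norm x) + t" using x by (simp add: ln_mult)
          ultimately show "ennreal (exp (?n * (ln (norm x) + t))) * g (ln (norm x) + t) =
             ennreal (norm x ^ DIM('a)) * (ennreal (exp (?n * t)) * g (ln (norm (exp t *\<^sub>R x))))"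
            by (simp only: ennreal_mult' zero_le_power norm_ge_zero exp_ge_zero mult.assoc)
        qed
        also have "\<dots> = ennreal (norm x ^ DIM('a)) * (\<integral>\<^sup>+t. ennreal (exp (?n * t)) * g (ln (norm (exp t *\<^sub>R x))) \<partial>lborel)"
          by (rule nn_integral_cmult) measurable
        finally have "ennreal (1 / norm x ^ DIM('a)) * (\<integral>\<^sup>+t. ennreal (exp (?n * t)) * g t \<partial>lborel) =
          (ennreal (1 / norm x ^ DIM('a)) * ennreal (norm x ^ DIM('a))) * (\<integral>\<^sup>+t. ennreal (exp (?n * t)) * g (ln (norm (exp t *\<^sub>R x))) \<partial>lborel)"
          by (simp only: mult.assoc)
        also have "ennreal (1 / norm x ^ DIM('a)) * ennreal (norm x ^ DIM('a)) = 1"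
          using x by (simp flip: ennreal_mult')
        finally show ?thesis using True by simp
      qed simp
    qed
    also have "\<dots> = N * (\<integral>\<^sup>+t. ennreal (exp (?n * t)) * g t \<partial>lborel)"
      unfolding N_def by (rule nn_integral_multc) measurable
    finally show ?thesis .
  qed
  have "(\<integral>\<^sup>+x. indicator {..<0} (ln (norm (x::'a))) \<partial>lborel) = emeasure lborel (ball (0::'a) 1)"
  proof -
    have "(\<integral>\<^sup>+x. indicator {..<0} (ln (norm (x::'a))) \<partial>lborel) = (\<integral>\<^sup>+x. indicator (ball (0::'a) 1) x \<partial>lborel)"
    proof (rule nn_integral_cong_AE)
      show "AE x in lborel. indicator {..<0} (ln (norm (x::'a))) = (indicator (ball 0 1) x :: ennreal)"
        using AE_lborel_singleton[of "0::'a"] by eventually_elim (auto split: split_indicator)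
    qed
    then show ?thesis by simp
  qed
  then have "emeasure lborel (ball (0::'a) 1) = N * (\<integral>\<^sup>+t. ennreal (exp (?n * t)) * indicator {..<0} t \<partial>lborel)"
    using main[of "indicator {..<0}"] by simp
  also have "\<dots> = N * ennreal (1 / ?n)" by (subst nn_integral_exp_neg) auto
  finally have e: "emeasure lborel (ball (0::'a) 1) = N * ennreal (1 / ?n)" .
  have b: "emeasure lborel (ball (0::'a) 1) = ennreal (measure lborel (ball (0::'a) 1))"
    using emeasure_bounded_finite[OF bounded_ball, of "0::'a" 1] by (intro emeasure_eq_ennreal_measure) auto
  have "ennreal (sphere_area TYPE('a)) = ennreal (measure lborel (ball (0::'a) 1)) * ennreal ?n"
    by (simp add: sphere_area_def mult.commute flip: ennreal_mult')
  also have "\<dots> = N * (ennreal (1 / ?n) * ennreal ?n)" unfolding b[symmetric] e by (simp only: mult.assoc)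
  also have "ennreal (1 / ?n) * ennreal ?n = 1" by (simp flip: ennreal_mult')
  finally have N: "ennreal (sphere_area TYPE('a)) = N" by simp
  show "(\<integral>\<^sup>+x. f (ln (norm (x::'a))) \<partial>lborel) = ennreal (sphere_area TYPE('a)) * (\<integral>\<^sup>+t. ennreal (exp (?n * t)) * f t \<partial>lborel)"
    unfolding N by (rule main[OF f])
  show "(\<integral>\<^sup>+x. indicator unit_shell x * ennreal (1 / norm (x::'a) ^ DIM('a)) \<partial>lborel) = ennreal (sphere_area TYPE('a))"
    unfolding N N_def ..
qed

lemma sphere_area_pos: "sphere_area TYPE('a::euclidean_space) > 0"
  unfolding sphere_area_def using content_ball_pos[of 1 "0::'a"] by simp

text \<open>Polar coordinates as an image measure: integrability, integrals and null sets of radial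
  functions then transfer together.\<close>

lemma distr_ln_norm:
  "distr lborel borel (\<lambda>x::'a::euclidean_space. ln (norm x)) =
    density lborel (\<lambda>t. ennreal (sphere_area TYPE('a) * exp (real DIM('a) * t)))"
proof (rule measure_eqI)
  fix A assume "A \<in> sets (distr lborel borel (\<lambda>x::'a. ln (norm x)))"
  then have [measurable]: "A \<in> sets borel" by simp
  have "emeasure (distr lborel borel (\<lambda>x::'a. ln (norm x))) A = (\<integral>\<^sup>+x. indicator A (ln (norm (x::'a))) \<partial>lborel)"
    by (subst nn_integral_indicator[symmetric], simp, subst nn_integral_distr) auto
  also have "\<dots> = (\<integral>\<^sup>+t. ennreal (sphere_area TYPE('a)) * (ennreal (exp (real DIM('a) * t)) * indicator A t) \<partial>lborel)"
    by (subst nn_integral_radial(1)) (auto simp: nn_integral_cmult)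
  also have "\<dots> = emeasure (density lborel (\<lambda>t. ennreal (sphere_area TYPE('a) * exp (real DIM('a) * t)))) A"
    by (subst emeasure_density) (auto simp: ennreal_mult' mult.assoc sphere_area_pos less_imp_le)
  finally show "emeasure (distr lborel borel (\<lambda>x::'a. ln (norm x))) A =
    emeasure (density lborel (\<lambda>t. ennreal (sphere_area TYPE('a) * exp (real DIM('a) * t)))) A" .
qed simp

lemma integral_radial:
  fixes f :: "real \<Rightarrow> real"
  assumes [measurable]: "f \<in> borel_measurable borel"
  shows "integrable lborel (\<lambda>x::'a::euclidean_space. f (ln (norm x))) \<longleftrightarrow> integrable lborel (\<lambda>t. exp (real DIM('a) * t) * f t)"
    and "(LINT x|lborel. f (ln (norm (x::'a)))) = sphere_area TYPE('a) * (LINT t|lborel. exp (real DIM('a) * t) * f t)"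
proof -
  have nn: "0 \<le> sphere_area TYPE('a) * exp (real DIM('a) * t)" for t
    using sphere_area_pos[where 'a='a] by (simp add: less_imp_le)
  have "integrable lborel (\<lambda>x::'a. f (ln (norm x))) \<longleftrightarrow> integrable (distr lborel borel (\<lambda>x::'a. ln (norm x))) f"
    by (subst integrable_distr_eq) auto
  also have "\<dots> \<longleftrightarrow> integrable lborel (\<lambda>t. (sphere_area TYPE('a) * exp (real DIM('a) * t)) * f t)"
    unfolding distr_ln_norm by (subst integrable_real_density) (auto simp: nn)
  also have "\<dots> \<longleftrightarrow> integrable lborel (\<lambda>t. exp (real DIM('a) * t) * f t)"
    using sphere_area_pos[where 'a='a] by (simp add: mult.assoc)
  finally show "integrable lborel (\<lambda>x::'a. f (ln (norm x))) \<longleftrightarrow> integrable lborel (\<lambda>t. exp (real DIM('a) * t) * f t)" .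
  have "(LINT x|lborel. f (ln (norm (x::'a)))) = (LINT t|distr lborel borel (\<lambda>x::'a. ln (norm x)). f t)"
    by (subst integral_distr) auto
  also have "\<dots> = (LINT t|lborel. (sphere_area TYPE('a) * exp (real DIM('a) * t)) * f t)"
    unfolding distr_ln_norm by (subst integral_real_density) (auto simp: nn)
  also have "\<dots> = sphere_area TYPE('a) * (LINT t|lborel. exp (real DIM('a) * t) * f t)"
    by (simp add: mult.assoc)
  finally show "(LINT x|lborel. f (ln (norm (x::'a)))) = sphere_area TYPE('a) * (LINT t|lborel. exp (real DIM('a) * t) * f t)" .
qed

lemma AE_radial:
  assumes "AE t in lborel. P (t::real)"
  shows "AE x::'a::euclidean_space in lborel. P (ln (norm x))"
proof -
  have "AE t in density lborel (\<lambda>t. ennreal (sphere_area TYPE('a) * exp (real DIM('a) * t))). P t"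
    by (subst AE_density) (use assms in \<open>auto elim!: eventually_mono\<close>)
  then have "AE t in distr lborel borel (\<lambda>x::'a. ln (norm x)). P t" unfolding distr_ln_norm .
  from AE_distrD[OF _ this] show ?thesis by simp
qed

section \<open>The profile of a radial Sobolev function\<close>

text \<open>Hardy's inequality in logarithmic variables. In the square of
  \<open>norm (w t - \<kappa> *\<^sub>R v t)\<close> the cross term is \<open>- \<kappa>\<close>
  times the derivative of \<open>(norm (v t))\<^sup>2\<close>. On a bounded interval the left
  boundary value has the favourable sign. The right one is sent to 0 along points supplied by the
  integrability of \<open>norm (v t) powr p\<close>, as square integrability of \<open>v\<close> is
  only part of the conclusion.\<close>

lemma hardy_half_line_bound:
  assumes vw: "weak_primitive v w" and w: "\<And>t. w t = of_real \<kappa> * v t + z t" and \<kappa>: "\<kappa> > 0"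
    and z[measurable]: "z \<in> borel_measurable borel" and z2: "integrable lborel (\<lambda>t. (norm (z t))\<^sup>2)"
    and vp: "integrable lborel (\<lambda>t. norm (v t) powr p)" and p: "p > 0"
  shows "H1_line v w"
    and "(LINT t|lborel. (norm (w t))\<^sup>2) + \<kappa>\<^sup>2 * (LINT t|lborel. (norm (v t))\<^sup>2) \<le> (LINT t|lborel. (norm (z t))\<^sup>2)"
proof -
  have vc: "continuous_on S v" for S using vw by (rule weak_primitive_continuous)
  have [measurable]: "v \<in> borel_measurable borel" using vc by (rule borel_measurable_continuous_onI)
  have weq: "w = (\<lambda>t. of_real \<kappa> * v t + z t)" using w by blast
  have [measurable]: "w \<in> borel_measurable borel" unfolding weq by measurable
  define Iz where "Iz = (LINT t|lborel. (norm (z t))\<^sup>2)"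
  define f1 where "f1 t = (norm (w t))\<^sup>2 + \<kappa>\<^sup>2 * (norm (v t))\<^sup>2" for t
  have [measurable]: "f1 \<in> borel_measurable borel" unfolding f1_def by measurable
  have f1nn: "f1 t \<ge> 0" for t by (simp add: f1_def)
  have f1: "f1 t = (norm (z t))\<^sup>2 + \<kappa> * ((2 *\<^sub>R v t) \<bullet> w t)" for t
  proof -
    have zt: "z t = w t - \<kappa> *\<^sub>R v t" unfolding w by (simp add: scaleR_conv_of_real)
    have "z t \<bullet> z t = w t \<bullet> w t - 2 * \<kappa> * (v t \<bullet> w t) + \<kappa> * \<kappa> * (v t \<bullet> v t)"
      unfolding zt by (simp add: inner_diff_left inner_diff_right inner_commute algebra_simps)
    then show ?thesis
      unfolding f1_def power2_norm_eq_inner by (simp add: power2_eq_square)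
  qed
  have der: "((\<lambda>z::complex. (norm z)\<^sup>2) has_derivative (\<lambda>h. (2 *\<^sub>R z) \<bullet> h)) (at z)" for z
    using has_derivative_norm_square_compose[of "\<lambda>\<rho>. \<rho>" "\<lambda>_. 2"] by simp
  have gc: "continuous_on UNIV (\<lambda>z::complex. 2 *\<^sub>R z)" by (intro continuous_intros)
  have bound: "(\<integral>\<^sup>+t. ennreal (indicator {a..b} t * f1 t) \<partial>lborel) \<le> ennreal (Iz + \<kappa> * (norm (v b))\<^sup>2)" if ab: "a \<le> b" for a b
  proof -
    note ch = weak_primitive_chain_rule[OF vw der gc ab]
    let ?g = "\<lambda>t. (2 *\<^sub>R v t) \<bullet> w t"
    have gi: "integrable lborel (\<lambda>t. indicator {a..b} t * ?g t)"
      using ch(1) unfolding set_integrable_def by (subst (asm) integrable_completion) auto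
    have gv: "(LINT t|lborel. indicator {a..b} t * ?g t) = (norm (v b))\<^sup>2 - (norm (v a))\<^sup>2"
    proof -
      have "set_integrable lborel {a..b} ?g" using gi by (simp only: set_integrable_def real_scaleR_def)
      from set_borel_integral_eq_integral(2)[OF this] show ?thesis
        unfolding ch(2)[symmetric] set_lebesgue_integral_def real_scaleR_def .
    qed
    have zi: "integrable lborel (\<lambda>t. indicator {a..b} t * (norm (z t))\<^sup>2)"
      using integrable_real_mult_indicator[of "{a..b}" lborel, OF _ z2] by (simp add: mult.commute)
    have eq: "indicator {a..b} t * f1 t = indicator {a..b} t * (norm (z t))\<^sup>2 + \<kappa> * (indicator {a..b} t * ?g t)" for t
      unfolding f1 by (simp split: split_indicator)
    have fi: "integrable lborel (\<lambda>t. indicator {a..b} t * f1 t)" unfolding eq using zi gi by simp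
    have "(LINT t|lborel. indicator {a..b} t * f1 t) =
       (LINT t|lborel. indicator {a..b} t * (norm (z t))\<^sup>2) + \<kappa> * (LINT t|lborel. indicator {a..b} t * ?g t)"
      unfolding eq by (subst Bochner_Integration.integral_add[OF zi integrable_mult_right[OF gi]]) simp
    also have "(LINT t|lborel. indicator {a..b} t * (norm (z t))\<^sup>2) \<le> Iz"
      unfolding Iz_def by (rule integral_mono[OF zi z2]) (auto split: split_indicator)
    also have "\<kappa> * (LINT t|lborel. indicator {a..b} t * ?g t) \<le> \<kappa> * (norm (v b))\<^sup>2"
      unfolding gv using \<kappa> by (intro mult_left_mono) auto
    finally have "(LINT t|lborel. indicator {a..b} t * f1 t) \<le> Iz + \<kappa> * (norm (v b))\<^sup>2" by simp
    then show ?thesis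
      by (subst nn_integral_eq_integral[OF fi]) (auto intro!: ennreal_leI simp: f1nn)
  qed
  have "\<forall>n::nat. \<exists>t\<ge>real n. \<bar>norm (v t) powr p\<bar> < (1 / real (Suc n)) powr p"
    by (intro allI integrable_small_value_at_top[OF vp]) simp
  then obtain b where b: "\<And>n. b n \<ge> real n" "\<And>n. \<bar>norm (v (b n)) powr p\<bar> < (1 / real (Suc n)) powr p" by metis
  have vb: "norm (v (b n)) \<le> 1 / real (Suc n)" for n
  proof (rule ccontr)
    assume "\<not> ?thesis"
    then have "(1 / real (Suc n)) powr p \<le> norm (v (b n)) powr p" using p by (intro powr_mono2) auto
    with b(2)[of n] show False by simp
  qed
  have vb0: "(\<lambda>n. norm (v (b n))) \<longlonglongrightarrow> 0"
  proof (rule tendsto_sandwich[OF _ _ tendsto_const])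
    show "(\<lambda>n. 1 / real (Suc n)) \<longlonglongrightarrow> 0" using LIMSEQ_inverse_real_of_nat by (simp add: inverse_eq_divide)
    show "\<forall>\<^sub>F n in sequentially. norm (v (b n)) \<le> 1 / real (Suc n)" using vb by (intro always_eventually allI)
  qed simp
  have "(\<integral>\<^sup>+t. ennreal (f1 t) \<partial>lborel) \<le> liminf (\<lambda>n. \<integral>\<^sup>+t. ennreal (indicator {- real n..b n} t * f1 t) \<partial>lborel)"
  proof -
    have "(\<integral>\<^sup>+t. ennreal (f1 t) \<partial>lborel) = (\<integral>\<^sup>+t. liminf (\<lambda>n. ennreal (indicator {- real n..b n} t * f1 t)) \<partial>lborel)"
    proof (rule nn_integral_cong)
      fix t :: real
      obtain N :: nat where N: "\<bar>t\<bar> \<le> real N" using real_arch_simple by blast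
      have "eventually (\<lambda>n. ennreal (indicator {- real n..b n} t * f1 t) = ennreal (f1 t)) sequentially"
        using eventually_ge_at_top[of N]
      proof eventually_elim
        case (elim n)
        then have "t \<in> {- real n..b n}" using N b(1)[of n] by (auto simp: abs_le_iff)
        then show ?case by simp
      qed
      then have "(\<lambda>n. ennreal (indicator {- real n..b n} t * f1 t)) \<longlonglongrightarrow> ennreal (f1 t)"
        by (rule tendsto_eventually)
      then show "ennreal (f1 t) = liminf (\<lambda>n. ennreal (indicator {- real n..b n} t * f1 t))"
        by (rule lim_imp_Liminf[OF trivial_limit_sequentially, symmetric])
    qed
    also have "\<dots> \<le> liminf (\<lambda>n. \<integral>\<^sup>+t. ennreal (indicator {- real n..b n} t * f1 t) \<partial>lborel)"
      by (rule nn_integral_liminf) measurable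
    finally show ?thesis .
  qed
  also have "\<dots> \<le> liminf (\<lambda>n. ennreal (Iz + \<kappa> * (norm (v (b n)))\<^sup>2))"
  proof (rule Liminf_mono, rule always_eventually, rule allI)
    fix n :: nat
    show "(\<integral>\<^sup>+t. ennreal (indicator {- real n..b n} t * f1 t) \<partial>lborel) \<le> ennreal (Iz + \<kappa> * (norm (v (b n)))\<^sup>2)"
      by (rule bound) (use b(1)[of n] of_nat_0_le_iff[of n] in linarith)
  qed
  also have "\<dots> = ennreal Iz"
  proof (rule lim_imp_Liminf[OF trivial_limit_sequentially])
    have "(\<lambda>n. Iz + \<kappa> * (norm (v (b n)))\<^sup>2) \<longlonglongrightarrow> Iz + \<kappa> * 0\<^sup>2" by (intro tendsto_intros vb0)
    then show "(\<lambda>n. ennreal (Iz + \<kappa> * (norm (v (b n)))\<^sup>2)) \<longlonglongrightarrow> ennreal Iz" by (intro tendsto_ennrealI) simp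
  qed
  finally have fin: "(\<integral>\<^sup>+t. ennreal (f1 t) \<partial>lborel) \<le> ennreal Iz" .
  have f1i: "integrable lborel f1"
  proof (rule integrableI_nonneg)
    show "(\<integral>\<^sup>+t. ennreal (f1 t) \<partial>lborel) < \<infinity>" using fin by (rule le_less_trans) simp
  qed (auto simp: f1nn)
  have wi: "integrable lborel (\<lambda>t. (norm (w t))\<^sup>2)"
    by (rule Bochner_Integration.integrable_bound[OF f1i]) (auto simp: f1_def)
  have "integrable lborel (\<lambda>t. \<kappa>\<^sup>2 * (norm (v t))\<^sup>2)"
    by (rule Bochner_Integration.integrable_bound[OF f1i]) (auto simp: f1_def)
  then have vi: "integrable lborel (\<lambda>t. (norm (v t))\<^sup>2)" using \<kappa> by simp
  show "H1_line v w" using vw wi vi by (simp add: H1_line_def)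
  have "(LINT t|lborel. f1 t) \<le> Iz"
  proof -
    have "ennreal (LINT t|lborel. f1 t) \<le> ennreal Iz"
      using fin by (subst (asm) nn_integral_eq_integral[OF f1i]) (auto simp: f1nn)
    moreover have "Iz \<ge> 0" unfolding Iz_def by (rule Bochner_Integration.integral_nonneg) simp
    ultimately show ?thesis by simp
  qed
  then show "(LINT t|lborel. (norm (w t))\<^sup>2) + \<kappa>\<^sup>2 * (LINT t|lborel. (norm (v t))\<^sup>2) \<le> (LINT t|lborel. (norm (z t))\<^sup>2)"
    unfolding f1_def Iz_def using wi vi by simp
qed

text \<open>Summability of the errors gives both convergence almost everywhere and the integrable
  majorant \<open>S\<close> for dominated convergence. The integrated equation of \<open>V k\<close>
  passes to the limit between points of convergence, and integrating the limit from one such point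
  produces the continuous representative of \<open>v0\<close>.\<close>

lemma weak_primitive_of_limit:
  fixes V Z :: "nat \<Rightarrow> real \<Rightarrow> complex"
  assumes dV: "\<And>k t. (V k has_vector_derivative of_real \<kappa> * V k t + Z k t) (at t)"
    and Zc: "\<And>k. continuous_on UNIV (Z k)"
    and v0[measurable]: "v0 \<in> borel_measurable borel" and z[measurable]: "z \<in> borel_measurable borel" and p: "p \<ge> 1"
    and fin: "(\<integral>\<^sup>+t. (\<Sum>k. ennreal ((norm (Z k t - z t))\<^sup>2 + norm (V k t - v0 t) powr p)) \<partial>lborel) < \<infinity>"
  obtains v where "weak_primitive v (\<lambda>t. of_real \<kappa> * v t + z t)" "AE t in lborel. v t = v0 t"
proof -
  have Vc: "continuous_on S (V k)" for S k
    using dV by (intro continuous_at_imp_continuous_on ballI has_vector_derivative_continuous)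
  have Zc': "continuous_on S (Z k)" for S k using Zc by (rule continuous_on_subset) simp
  have [measurable]: "V k \<in> borel_measurable borel" "Z k \<in> borel_measurable borel" for k
    using Vc Zc by (auto intro: borel_measurable_continuous_onI)
  define T where "T k t = (norm (Z k t - z t))\<^sup>2 + norm (V k t - v0 t) powr p" for k t
  have Tnn: "T k t \<ge> 0" for k t by (simp add: T_def)
  have [measurable]: "T k \<in> borel_measurable borel" for k unfolding T_def by measurable
  define S where "S t = enn2real (\<Sum>k. ennreal (T k t))" for t
  have [measurable]: "S \<in> borel_measurable borel" unfolding S_def by measurable
  have AEf: "AE t in lborel. (\<Sum>k. ennreal (T k t)) \<noteq> \<infinity>"
    by (rule nn_integral_noteq_infinite) (use fin in \<open>auto simp: T_def\<close>)
  then have S: "AE t in lborel. ennreal (S t) = (\<Sum>k. ennreal (T k t))"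
    by eventually_elim (simp add: S_def less_top)
  have Si: "integrable lborel S"
  proof (rule integrableI_nonneg)
    have "(\<integral>\<^sup>+t. ennreal (S t) \<partial>lborel) = (\<integral>\<^sup>+t. (\<Sum>k. ennreal (T k t)) \<partial>lborel)" by (rule nn_integral_cong_AE[OF S])
    then show "(\<integral>\<^sup>+t. ennreal (S t) \<partial>lborel) < \<infinity>" using fin by (simp add: T_def)
  qed (auto simp: S_def)
  have TS: "AE t in lborel. (\<forall>k. T k t \<le> S t) \<and> (\<lambda>k. T k t) \<longlonglongrightarrow> 0"
    using S AEf
  proof eventually_elim
    case (elim t)
    have "ennreal (T k t) \<le> ennreal (S t)" for k
    proof -
      have "(\<Sum>j\<in>{k}. ennreal (T j t)) \<le> (\<Sum>j. ennreal (T j t))" by (rule sum_le_suminf[OF summableI]) auto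
      then show ?thesis unfolding elim(1) by simp
    qed
    then have "T k t \<le> S t" for k by (simp add: S_def)
    moreover have "summable (\<lambda>k. T k t)" by (rule summable_suminf_not_top) (use Tnn elim(2) in auto)
    ultimately show ?case using summable_LIMSEQ_zero by blast
  qed
  \<comment> \<open>A power of order at least 1 controls the first power up to a constant, so
    \<open>1 + T k t\<close> bounds both errors to first order, for the square and for the p-th
    power alike.\<close>
  have yng: "x \<le> 1 + x powr q" if "x \<ge> 0" "q \<ge> 1" for x q :: real
  proof (cases "x \<le> 1")
    case False
    then have "x powr 1 \<le> x powr q" using that by (intro powr_mono) auto
    then show ?thesis using that False by simp
  qed (simp add: add_increasing2)
  have dZ: "norm (Z k t - z t) \<le> 1 + T k t" and dVv: "norm (V k t - v0 t) \<le> 1 + T k t" for k t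
  proof -
    have "norm (Z k t - z t) \<le> 1 + (norm (Z k t - z t))\<^sup>2" using yng[of "norm (Z k t - z t)" 2] by simp
    then show "norm (Z k t - z t) \<le> 1 + T k t"
      using powr_ge_zero[of "norm (V k t - v0 t)" p] unfolding T_def by linarith
    have "norm (V k t - v0 t) \<le> 1 + norm (V k t - v0 t) powr p" by (rule yng[OF norm_ge_zero p])
    then show "norm (V k t - v0 t) \<le> 1 + T k t"
      using zero_le_power2[of "norm (Z k t - z t)"] unfolding T_def by linarith
  qed
  have conv: "AE t in lborel. (\<forall>k. T k t \<le> S t) \<and> (\<lambda>k. V k t) \<longlonglongrightarrow> v0 t \<and> (\<lambda>k. Z k t) \<longlonglongrightarrow> z t"
    using TS
  proof eventually_elim
    case (elim t)
    have "(\<lambda>k. (norm (Z k t - z t))\<^sup>2) \<longlonglongrightarrow> 0"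
      by (rule tendsto_sandwich[OF _ _ tendsto_const conjunct2[OF elim]]) (auto simp: T_def)
    then have "(\<lambda>k. sqrt ((norm (Z k t - z t))\<^sup>2)) \<longlonglongrightarrow> sqrt 0" by (intro tendsto_intros)
    then have z: "(\<lambda>k. Z k t) \<longlonglongrightarrow> z t" by (simp add: tendsto_norm_zero_iff LIM_zero_iff)
    have "(\<lambda>k. norm (V k t - v0 t) powr p) \<longlonglongrightarrow> 0"
      by (rule tendsto_sandwich[OF _ _ tendsto_const conjunct2[OF elim]]) (auto simp: T_def)
    then have "(\<lambda>k. (norm (V k t - v0 t) powr p) powr (1 / p)) \<longlonglongrightarrow> 0 powr (1 / p)"
      by (rule tendsto_powr'[OF _ tendsto_const]) (use p in auto)
    then have "(\<lambda>k. V k t) \<longlonglongrightarrow> v0 t"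
      using p by (simp add: powr_powr tendsto_norm_zero_iff LIM_zero_iff)
    with z elim show ?case by blast
  qed
  define w0 where "w0 t = of_real \<kappa> * v0 t + z t" for t
  define W where "W k t = of_real \<kappa> * V k t + Z k t" for k t
  have [measurable]: "w0 \<in> borel_measurable borel" "W k \<in> borel_measurable borel" for k unfolding w0_def W_def by measurable
  have Wc: "continuous_on X (W k)" for X k unfolding W_def by (intro continuous_intros Vc Zc')
  define C where "C = \<bar>\<kappa>\<bar> + 1"
  have dW: "norm (W k t - w0 t) \<le> C * (1 + T k t)" for k t
  proof -
    have "W k t - w0 t = of_real \<kappa> * (V k t - v0 t) + (Z k t - z t)" by (simp add: W_def w0_def algebra_simps)
    then have "norm (W k t - w0 t) \<le> \<bar>\<kappa>\<bar> * norm (V k t - v0 t) + norm (Z k t - z t)"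
      using norm_triangle_ineq[of "of_real \<kappa> * (V k t - v0 t)" "Z k t - z t"] by (simp add: norm_mult)
    also have "\<dots> \<le> \<bar>\<kappa>\<bar> * (1 + T k t) + (1 + T k t)" by (intro add_mono mult_left_mono dZ dVv) auto
    finally show ?thesis by (simp add: C_def algebra_simps)
  qed
  have ci: "integrable lborel (\<lambda>t. indicator {a..b} t *\<^sub>R W k t)" for a b k
    by (rule borel_integrable_compact) (auto intro: Wc)
  have indi: "integrable lborel (\<lambda>t. C * (indicator {a..b} t + S t))" for a b
  proof -
    have "emeasure lborel {a..b} < \<infinity>" by (rule emeasure_bounded_finite) simp
    then have "integrable lborel (indicator {a..b} :: real \<Rightarrow> real)" by (intro integrable_real_indicator) auto
    then show ?thesis by (intro integrable_mult_right Bochner_Integration.integrable_add Si)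
  qed
  have TSk: "AE t in lborel. T k t \<le> S t" for k using TS by eventually_elim blast
  have w0i: "integrable lborel (\<lambda>t. indicator {a..b} t *\<^sub>R w0 t)" for a b
  proof (rule Bochner_Integration.integrable_bound)
    show "integrable lborel (\<lambda>t. norm (indicator {a..b} t *\<^sub>R W 0 t) + C * (indicator {a..b} t + S t))"
      by (intro Bochner_Integration.integrable_add integrable_norm ci indi)
    show "AE t in lborel. norm (indicator {a..b} t *\<^sub>R w0 t) \<le> norm (norm (indicator {a..b} t *\<^sub>R W 0 t) + C * (indicator {a..b} t + S t))"
      using TSk[of 0]
    proof eventually_elim
      case (elim t)
      have C0: "C \<ge> 0" by (simp add: C_def)
      have "norm (w0 t) \<le> norm (W 0 t) + norm (W 0 t - w0 t)"
        using norm_triangle_ineq4[of "W 0 t" "W 0 t - w0 t"] by simp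
      also have "norm (W 0 t - w0 t) \<le> C * (1 + S t)"
        using order_trans[OF dW[of 0 t] mult_left_mono[OF _ C0, of "1 + T 0 t" "1 + S t"]] elim by simp
      finally have "norm (w0 t) \<le> norm (W 0 t) + C * (1 + S t)" by simp
      moreover have "C * S t \<ge> 0" using C0 by (simp add: S_def)
      ultimately show ?case using C0 by (auto split: split_indicator)
    qed
  qed measurable
  have wai: "w0 absolutely_integrable_on {a..b}" for a b
    unfolding set_integrable_def using w0i[of a b] by (subst integrable_completion) auto
  have lim: "(\<lambda>k. LINT t|lborel. indicator {a..b} t *\<^sub>R W k t) \<longlonglongrightarrow> (LINT t|lborel. indicator {a..b} t *\<^sub>R w0 t)" for a b
  proof (rule integral_dominated_convergence)
    show "integrable lborel (\<lambda>t. norm (indicator {a..b} t *\<^sub>R w0 t) + C * (indicator {a..b} t + S t))"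
      by (intro Bochner_Integration.integrable_add integrable_norm w0i indi)
    show "AE t in lborel. (\<lambda>k. indicator {a..b} t *\<^sub>R W k t) \<longlonglongrightarrow> indicator {a..b} t *\<^sub>R w0 t"
      using conv by eventually_elim (auto simp: W_def w0_def intro!: tendsto_intros)
    fix k
    show "AE t in lborel. norm (indicator {a..b} t *\<^sub>R W k t) \<le> norm (indicator {a..b} t *\<^sub>R w0 t) + C * (indicator {a..b} t + S t)"
      using TSk[of k]
    proof eventually_elim
      case (elim t)
      have C0: "C \<ge> 0" by (simp add: C_def)
      have "norm (W k t) \<le> norm (w0 t) + norm (W k t - w0 t)"
        using norm_triangle_ineq[of "w0 t" "W k t - w0 t"] by simp
      also have "norm (W k t - w0 t) \<le> C * (1 + S t)"
        using order_trans[OF dW[of k t] mult_left_mono[OF _ C0, of "1 + T k t" "1 + S t"]] elim by simp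
      finally have "norm (W k t) \<le> norm (w0 t) + C * (1 + S t)" by simp
      moreover have "C * S t \<ge> 0" using C0 by (simp add: S_def)
      ultimately show ?case by (auto split: split_indicator)
    qed
  qed measurable
  have HK: "integral {a..b} f = (LINT t|lborel. indicator {a..b} t *\<^sub>R f t)"
    if "integrable lborel (\<lambda>t. indicator {a..b} t *\<^sub>R f t)" for f :: "real \<Rightarrow> complex" and a b
    using set_borel_integral_eq_integral(2)[of "{a..b}" f] that by (simp add: set_integrable_def set_lebesgue_integral_def)
  define Gd where "Gd = {t. (\<lambda>k. V k t) \<longlonglongrightarrow> v0 t}"
  have Gd: "AE t in lborel. t \<in> Gd" using conv by eventually_elim (simp add: Gd_def)
  have inc: "v0 b - v0 a = integral {a..b} w0" if "a \<in> Gd" "b \<in> Gd" "a \<le> b" for a b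
  proof -
    have "V k b - V k a = integral {a..b} (W k)" for k
    proof -
      have "(W k has_integral V k b - V k a) {a..b}"
        unfolding W_def by (rule fundamental_theorem_of_calculus[OF that(3)]) (rule has_vector_derivative_at_within[OF dV])
      then show ?thesis by (rule integral_unique[symmetric])
    qed
    then have "(\<lambda>k. V k b - V k a) \<longlonglongrightarrow> integral {a..b} w0"
      using lim[of a b] unfolding HK[OF ci] HK[OF w0i] by simp
    moreover have "(\<lambda>k. V k b - V k a) \<longlonglongrightarrow> v0 b - v0 a"
      using that by (intro tendsto_diff) (auto simp: Gd_def)
    ultimately show ?thesis using LIMSEQ_unique by blast
  qed
  have "\<exists>t. t \<in> Gd"
  proof (rule ccontr)
    assume "\<nexists>t. t \<in> Gd"
    with Gd have "AE t in (lborel :: real measure). False" by simp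
    then show False by (simp add: eventually_False ae_filter_eq_bot_iff)
  qed
  then obtain c where c: "c \<in> Gd" by blast
  \<comment> \<open>An integral over an interval with reversed ends is 0, so one formula serves on
    both sides of the base point \<open>c\<close>.\<close>
  define v where "v t = v0 c + integral {c..t} w0 - integral {t..c} w0" for t
  have int: "w0 integrable_on {a..b}" for a b using wai by (auto simp: absolutely_integrable_on_def)
  have comb: "integral {a..b} w0 + integral {b..e} w0 = integral {a..e} w0" if "a \<le> b" "b \<le> e" for a b e
    by (rule Henstock_Kurzweil_Integration.integral_combine[OF that int])
  have z1: "integral {a..b} w0 = 0" if "b \<le> a" for a b
    using that by (cases "a = b") auto
  have vinc: "v t - v s = integral {s..t} w0" if "s \<le> t" for s t
  proof -
    consider "c \<le> s" | "s \<le> c" "c \<le> t" | "t \<le> c" using that by linarith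
    then show ?thesis
    proof cases
      case 1
      then show ?thesis using comb[OF 1 that] z1[OF 1] z1[OF order_trans[OF 1 that]] unfolding v_def by (simp add: algebra_simps)
    next
      case 2
      then show ?thesis using comb[OF 2] z1[OF 2(1)] z1[OF 2(2)] unfolding v_def by (simp add: algebra_simps)
    next
      case 3
      then show ?thesis using comb[OF that 3] z1[OF 3] z1[OF order_trans[OF that 3]] unfolding v_def by (simp add: algebra_simps)
    qed
  qed
  have vv0: "v t = v0 t" if "t \<in> Gd" for t
  proof (cases "c \<le> t")
    case True
    then show ?thesis using inc[OF c that True] z1[OF True] unfolding v_def by (simp add: algebra_simps)
  next
    case False
    then have "t \<le> c" by simp
    then show ?thesis using inc[OF that c \<open>t \<le> c\<close>] z1[OF \<open>t \<le> c\<close>] unfolding v_def by (simp add: algebra_simps)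
  qed
  have AEv: "AE t in lborel. v t = v0 t" using Gd by eventually_elim (rule vv0)
  obtain N where N: "\<And>t. t \<notin> N \<Longrightarrow> v t = v0 t" "N \<in> null_sets lborel"
    using AE_E3[OF AEv] by auto
  have neg: "negligible N"
    using N(2) by (simp add: negligible_iff_null_sets null_sets_completionI)
  have sp: "of_real \<kappa> * v t + z t = w0 t" if "t \<in> X - N" for t X
    using that N(1)[of t] by (simp add: w0_def)
  have "weak_primitive v (\<lambda>t. of_real \<kappa> * v t + z t)"
    unfolding weak_primitive_def
  proof (intro conjI allI impI)
    fix a b :: real
    show "(\<lambda>t. of_real \<kappa> * v t + z t) absolutely_integrable_on {a..b}"
      by (rule absolutely_integrable_spike[OF wai neg sp])
  next
    fix s t :: real assume "s \<le> t"
    have "integral {s..t} w0 = integral {s..t} (\<lambda>t. of_real \<kappa> * v t + z t)"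
      by (rule integral_spike[OF neg sp])
    then show "v t - v s = integral {s..t} (\<lambda>t. of_real \<kappa> * v t + z t)" using vinc[OF \<open>s \<le> t\<close>] by simp
  qed
  then show thesis using AEv by (rule that)
qed

text \<open>A time shift by \<open>ln (norm x)\<close> moves the base point of the orbit to the unit
  sphere.\<close>

lemma nn_integral_orbit_normalize:
  fixes F :: "'a::euclidean_space \<Rightarrow> ennreal"
  assumes [measurable]: "F \<in> borel_measurable borel" and x: "x \<noteq> 0"
  shows "(\<integral>\<^sup>+t. ennreal (exp (real DIM('a) * t)) * F (exp t *\<^sub>R (x /\<^sub>R norm x)) \<partial>lborel) =
    ennreal (norm x ^ DIM('a)) * (\<integral>\<^sup>+t. ennreal (exp (real DIM('a) * t)) * F (exp t *\<^sub>R x) \<partial>lborel)"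
proof -
  have nx: "norm x > 0" using x by simp
  have "(\<integral>\<^sup>+t. ennreal (exp (real DIM('a) * t)) * F (exp t *\<^sub>R (x /\<^sub>R norm x)) \<partial>lborel) =
    (\<integral>\<^sup>+t. ennreal (exp (real DIM('a) * (ln (norm x) + t))) * F (exp (ln (norm x) + t) *\<^sub>R (x /\<^sub>R norm x)) \<partial>lborel)"
    using nn_integral_real_affine[of "\<lambda>t. ennreal (exp (real DIM('a) * t)) * F (exp t *\<^sub>R (x /\<^sub>R norm x))" 1 "ln (norm x)"] by simp
  also have "\<dots> = (\<integral>\<^sup>+t. ennreal (norm x ^ DIM('a)) * (ennreal (exp (real DIM('a) * t)) * F (exp t *\<^sub>R x)) \<partial>lborel)"
  proof (rule nn_integral_cong)
    fix t
    have "exp (real DIM('a) * (ln (norm x) + t)) = norm x ^ DIM('a) * exp (real DIM('a) * t)"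
      using nx by (simp add: distrib_left exp_add exp_of_nat_mult)
    moreover have "exp (ln (norm x) + t) *\<^sub>R (x /\<^sub>R norm x) = exp t *\<^sub>R x"
      using nx by (simp add: exp_add)
    ultimately show "ennreal (exp (real DIM('a) * (ln (norm x) + t))) * F (exp (ln (norm x) + t) *\<^sub>R (x /\<^sub>R norm x)) =
       ennreal (norm x ^ DIM('a)) * (ennreal (exp (real DIM('a) * t)) * F (exp t *\<^sub>R x))"
      by (simp only: ennreal_mult' zero_le_power norm_ge_zero exp_ge_zero mult.assoc)
  qed
  also have "\<dots> = ennreal (norm x ^ DIM('a)) * (\<integral>\<^sup>+t. ennreal (exp (real DIM('a) * t)) * F (exp t *\<^sub>R x) \<partial>lborel)"
    by (rule nn_integral_cmult) measurable
  finally show ?thesis .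
qed

text \<open>An averaging argument. For the measure with density \<open>1 / norm x ^ DIM('a)\<close>
  on the shell, of total mass \<open>sphere_area\<close>, the mean of the normalized orbit integrals
  of \<open>Q\<close> is determined by the full integral of \<open>Q\<close>. If almost every orbit
  exceeded this mean, integration would be contradictory; finiteness for \<open>H\<close> and
  avoidance of \<open>N0\<close> discard only null sets.\<close>

lemma orbit_selection:
  fixes H Q :: "'a::euclidean_space \<Rightarrow> ennreal"
  assumes H[measurable]: "H \<in> borel_measurable borel" and Hfin: "(\<integral>\<^sup>+x. H x \<partial>lborel) < \<infinity>"
    and N0: "N0 \<in> null_sets lborel"
    and Q[measurable]: "Q \<in> borel_measurable borel" and Qfin: "(\<integral>\<^sup>+x. Q x \<partial>lborel) < \<infinity>"
  obtains \<theta> :: 'a where "norm \<theta> = 1"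
    "(\<integral>\<^sup>+t. ennreal (exp (real DIM('a) * t)) * H (exp t *\<^sub>R \<theta>) \<partial>lborel) < \<infinity>"
    "AE t in lborel. exp t *\<^sub>R \<theta> \<notin> N0"
    "ennreal (sphere_area TYPE('a)) * (\<integral>\<^sup>+t. ennreal (exp (real DIM('a) * t)) * Q (exp t *\<^sub>R \<theta>) \<partial>lborel) \<le> (\<integral>\<^sup>+x. Q x \<partial>lborel)"
proof -
  have rad2: "(\<integral>\<^sup>+x. indicator unit_shell x * ennreal (1 / norm (x::'a) ^ DIM('a)) \<partial>lborel) = ennreal (sphere_area TYPE('a))"
    by (rule nn_integral_radial(2)[of "\<lambda>_. 0"]) simp
  define J where "J F x = (\<integral>\<^sup>+t. ennreal (exp (real DIM('a) * t)) * F (exp t *\<^sub>R x) \<partial>lborel)" for F :: "'a \<Rightarrow> ennreal" and x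
  have Jm: "(\<lambda>x. J F x) \<in> borel_measurable borel" if [measurable]: "F \<in> borel_measurable borel" for F :: "'a \<Rightarrow> ennreal"
  proof -
    have "(\<lambda>x. J F x) \<in> borel_measurable lborel" unfolding J_def by measurable
    then show ?thesis by simp
  qed
  have N0m[measurable]: "N0 \<in> sets borel" using N0 by auto
  have orb: "(\<integral>\<^sup>+x. indicator unit_shell x * J F x \<partial>lborel) = (\<integral>\<^sup>+x. F x \<partial>lborel)"
    if "F \<in> borel_measurable borel" for F :: "'a \<Rightarrow> ennreal"
    unfolding J_def by (rule nn_integral_dilation_orbits[OF that])
  note [measurable] = Jm[OF H] Jm[OF Q]
  have JNm[measurable]: "(\<lambda>x. J (indicator N0) x) \<in> borel_measurable borel" by (rule Jm) simp
  have "AE x in lborel. indicator unit_shell x * J H x \<noteq> \<infinity>"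
    by (rule nn_integral_noteq_infinite) (use orb[OF H] Hfin in auto)
  then have 1: "AE x in lborel. x \<in> unit_shell \<longrightarrow> J H x < \<infinity>"
    by eventually_elim (auto simp: less_top)
  have "(\<integral>\<^sup>+x. indicator unit_shell x * J (indicator N0) x \<partial>lborel) = 0"
    using orb[of "indicator N0"] N0 by auto
  then have "AE x in lborel. indicator unit_shell x * J (indicator N0) x = 0"
    by (subst (asm) nn_integral_0_iff_AE) auto
  then have 2: "AE x in lborel. x \<in> unit_shell \<longrightarrow> J (indicator N0) x = 0"
    by eventually_elim auto
  define q where "q = (\<integral>\<^sup>+x. Q x \<partial>lborel)"
  define S where "S = ennreal (sphere_area TYPE('a))"
  have "\<exists>x\<in>unit_shell. J H x < \<infinity> \<and> J (indicator N0) x = 0 \<and> S * (ennreal (norm x ^ DIM('a)) * J Q x) \<le> q"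
  proof (rule ccontr)
    assume neg: "\<not> ?thesis"
    \<comment> \<open>Both functions have the integral \<open>q * S\<close>, yet the negated claim
      gives \<open>f < g\<close> almost everywhere on the shell, a set of positive measure.\<close>
    define f where "f x = q * (indicator unit_shell x * ennreal (1 / norm x ^ DIM('a)))" for x :: 'a
    define g where "g x = S * (indicator unit_shell x * J Q x)" for x :: 'a
    have [measurable]: "f \<in> borel_measurable borel" "g \<in> borel_measurable borel" unfolding f_def g_def by measurable
    have lt: "AE x in lborel. x \<in> unit_shell \<longrightarrow> f x < g x"
      using 1 2
    proof eventually_elim
      case (elim x)
      show ?case
      proof
        assume x: "x \<in> unit_shell"
        then have nx: "norm x > 0" using unit_shell_nonzero by auto
        have "q < S * (ennreal (norm x ^ DIM('a)) * J Q x)" using neg elim x by (auto simp: not_le)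
        then have "q * ennreal (1 / norm x ^ DIM('a)) < S * (ennreal (norm x ^ DIM('a)) * J Q x) * ennreal (1 / norm x ^ DIM('a))"
          using nx by (intro ennreal_mult_strict_right_mono) auto
        also have "\<dots> = S * J Q x * (ennreal (norm x ^ DIM('a)) * ennreal (1 / norm x ^ DIM('a)))" by (simp only: mult_ac)
        also have "ennreal (norm x ^ DIM('a)) * ennreal (1 / norm x ^ DIM('a)) = 1" using nx by (simp flip: ennreal_mult')
        finally show "f x < g x" using x by (simp add: f_def g_def)
      qed
    qed
    have If: "(\<integral>\<^sup>+x. f x \<partial>lborel) = q * S"
      unfolding f_def S_def by (subst nn_integral_cmult) (auto simp: rad2)
    have Ig: "(\<integral>\<^sup>+x. g x \<partial>lborel) = S * q"
      unfolding g_def q_def by (subst nn_integral_cmult) (auto simp: orb[OF Q])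
    have "(\<integral>\<^sup>+x. f x \<partial>lborel) < (\<integral>\<^sup>+x. g x \<partial>lborel)"
    proof (rule nn_integral_less)
      show "(\<integral>\<^sup>+x. f x \<partial>lborel) \<noteq> \<infinity>" unfolding If using Qfin by (simp add: q_def S_def ennreal_mult_eq_top_iff)
      show "AE x in lborel. f x \<le> g x"
        using lt
      proof eventually_elim
        case (elim x)
        show ?case
        proof (cases "x \<in> unit_shell")
          case True
          then show ?thesis using elim by (simp add: less_imp_le)
        next
          case False
          then show ?thesis by (simp add: f_def)
        qed
      qed
      show "\<not> (AE x in lborel. g x \<le> f x)"
      proof
        assume "AE x in lborel. g x \<le> f x"
        with lt have "AE x in lborel. indicator unit_shell x * ennreal (1 / norm (x::'a) ^ DIM('a)) = 0"
          by eventually_elim (auto split: split_indicator)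
        then have "(\<integral>\<^sup>+x. indicator unit_shell x * ennreal (1 / norm (x::'a) ^ DIM('a)) \<partial>lborel) = 0"
          by (subst nn_integral_0_iff_AE) auto
        then show False using rad2 sphere_area_pos[where 'a='a] by simp
      qed
    qed auto
    then show False unfolding If Ig by (simp add: mult.commute)
  qed
  then obtain x where x: "x \<in> unit_shell" "J H x < \<infinity>" "J (indicator N0) x = 0"
     "S * (ennreal (norm x ^ DIM('a)) * J Q x) \<le> q" by blast
  have x0: "x \<noteq> 0" using x(1) by (rule unit_shell_nonzero)
  note norml = nn_integral_orbit_normalize[OF _ x0]
  show thesis
  proof (rule that[of "x /\<^sub>R norm x"])
    show "norm (x /\<^sub>R norm x) = 1" using x0 by simp
    show "(\<integral>\<^sup>+t. ennreal (exp (real DIM('a) * t)) * H (exp t *\<^sub>R (x /\<^sub>R norm x)) \<partial>lborel) < \<infinity>"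
      unfolding norml[OF H] using x(2) by (simp add: J_def ennreal_mult_less_top)
    have "(\<integral>\<^sup>+t. ennreal (exp (real DIM('a) * t)) * indicator N0 (exp t *\<^sub>R (x /\<^sub>R norm x)) \<partial>lborel) = 0"
      using x(3) norml[of "indicator N0"] by (simp add: J_def)
    then have "AE t in lborel. ennreal (exp (real DIM('a) * t)) * indicator N0 (exp t *\<^sub>R (x /\<^sub>R norm x)) = 0"
      by (subst (asm) nn_integral_0_iff_AE) auto
    then show "AE t in lborel. exp t *\<^sub>R (x /\<^sub>R norm x) \<notin> N0"
      by eventually_elim (auto split: split_indicator_asm)
    show "ennreal (sphere_area TYPE('a)) * (\<integral>\<^sup>+t. ennreal (exp (real DIM('a) * t)) * Q (exp t *\<^sub>R (x /\<^sub>R norm x)) \<partial>lborel) \<le> (\<integral>\<^sup>+x. Q x \<partial>lborel)"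
      unfolding norml[OF Q] using x(4) by (simp add: J_def S_def q_def)
  qed
qed

section \<open>Radial derivatives, and integrals expressed through the profile\<close>

lemma frechet_derivative_partial:
  fixes f :: "real ^ 'n::finite \<Rightarrow> complex"
  assumes f: "f \<in> test_functions"
  shows "frechet_derivative f (at x) h = (\<Sum>i\<in>UNIV. of_real (h $ i) * partial_deriv i f x)"
proof -
  have lin: "linear (frechet_derivative f (at x))"
    by (rule has_derivative_linear[OF test_function_has_derivative[OF f]])
  have "h = (\<Sum>i\<in>UNIV. (h $ i) *\<^sub>R axis i 1)"
    by (simp add: vec_eq_iff axis_def if_distrib[of "\<lambda>x. _ * x"] cong: if_cong)
  then have "frechet_derivative f (at x) h = frechet_derivative f (at x) (\<Sum>i\<in>UNIV. (h $ i) *\<^sub>R axis i 1)" by simp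
  also have "\<dots> = (\<Sum>i\<in>UNIV. (h $ i) *\<^sub>R frechet_derivative f (at x) (axis i 1))"
    by (simp only: linear_sum[OF lin] linear_scale[OF lin])
  finally show ?thesis by (simp add: partial_deriv_def scaleR_conv_of_real)
qed

lemma norm_real_complex_dot_le:
  fixes \<theta> :: "real ^ 'n::finite" and c :: "complex ^ 'n"
  shows "norm (\<Sum>i\<in>UNIV. of_real (\<theta> $ i) * c $ i) \<le> norm \<theta> * norm c"
proof -
  have "norm (\<Sum>i\<in>UNIV. of_real (\<theta> $ i) * c $ i) \<le> (\<Sum>i\<in>UNIV. \<bar>\<theta> $ i\<bar> * \<bar>norm (c $ i)\<bar>)"
    by (rule order_trans[OF norm_sum]) (simp add: norm_mult)
  also have "\<dots> \<le> L2_set (\<lambda>i. \<theta> $ i) UNIV * L2_set (\<lambda>i. norm (c $ i)) UNIV" by (rule L2_set_mult_ineq)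
  also have "\<dots> = norm \<theta> * norm c" by (simp add: norm_vec_def L2_set_def)
  finally show ?thesis .
qed

lemma locally_integrable_measurable:
  fixes f :: "real ^ 'n::finite \<Rightarrow> 'b::{banach, second_countable_topology}"
  assumes "locally_integrable f"
  shows "f \<in> borel_measurable lebesgue"
proof (rule borel_measurable_LIMSEQ_metric)
  fix n :: nat
  have "set_integrable lebesgue (cball 0 (real n)) f"
    using assms compact_cball unfolding locally_integrable_def by blast
  then show "(\<lambda>x. indicator (cball 0 (real n)) x *\<^sub>R f x) \<in> borel_measurable lebesgue"
    unfolding set_integrable_def by (rule borel_measurable_integrable)
next
  fix x :: "real ^ 'n"
  obtain N :: nat where N: "norm x \<le> real N" using real_arch_simple by blast
  have "eventually (\<lambda>n. indicator (cball 0 (real n)) x *\<^sub>R f x = f x) sequentially"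
    using eventually_ge_at_top[of N]
  proof eventually_elim
    case (elim n)
    then have "norm x \<le> real n" using N by linarith
    then show ?case by simp
  qed
  then show "(\<lambda>n. indicator (cball 0 (real n)) x *\<^sub>R f x) \<longlonglongrightarrow> f x" by (rule tendsto_eventually)
qed

text \<open>Once some weak gradient exists, the chosen one is a weak gradient too, and uniqueness
  gives it the integral of \<open>G\<close>. This discharges the choice made in
  \<open>hardy_form\<close>.\<close>

lemma integral_weak_gradient:
  assumes G: "is_weak_gradient u G" and Gm[measurable]: "G \<in> borel_measurable borel"
  shows "(LINT x|lebesgue. (norm (weak_gradient u x))\<^sup>2) = (LINT x|lborel. (norm (G x))\<^sup>2)"
proof -
  have "is_weak_gradient u (weak_gradient u)" unfolding weak_gradient_def by (rule someI[of _ G], rule G)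
  then have wm: "weak_gradient u \<in> borel_measurable lebesgue"
    by (intro locally_integrable_measurable) (simp add: is_weak_gradient_def)
  have GL: "G \<in> borel_measurable lebesgue" by (rule measurable_completion) simp
  have "(LINT x|lebesgue. (norm (weak_gradient u x))\<^sup>2) = (LINT x|lebesgue. (norm (G x))\<^sup>2)"
  proof (rule integral_cong_AE)
    show "AE x in lebesgue. (norm (weak_gradient u x))\<^sup>2 = (norm (G x))\<^sup>2"
      using weak_gradient_eq[OF G] by eventually_elim simp
  qed (intro borel_measurable_power measurable_compose[OF wm borel_measurable_norm] measurable_compose[OF GL borel_measurable_norm])+
  also have "\<dots> = (LINT x|lborel. (norm (G x))\<^sup>2)" by (rule integral_completion) measurable
  finally show ?thesis .
qed

lemma borel_measurable_lebesgue_AE: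
  fixes u u0 :: "'a::euclidean_space \<Rightarrow> 'b::topological_space"
  assumes u0: "u0 \<in> borel_measurable lebesgue" and eq: "AE x in lborel. u x = u0 x"
  shows "u \<in> borel_measurable lebesgue"
proof (rule measurableI)
  fix A :: "'b set" assume A: "A \<in> sets borel"
  obtain N where N: "\<And>x. x \<notin> N \<Longrightarrow> u x = u0 x" "N \<in> null_sets lborel" using AE_E3[OF eq] by auto
  have NL: "N \<in> null_sets lebesgue" using N(2) by (rule null_sets_completionI)
  have 1: "u0 -` A \<inter> space lebesgue \<in> sets lebesgue" by (rule measurable_sets[OF u0 A])
  have 2: "u -` A \<inter> N \<in> null_sets lebesgue" by (rule null_sets_completion_subset[OF _ NL]) auto
  have "u -` A \<inter> space lebesgue = (u0 -` A \<inter> space lebesgue - N) \<union> (u -` A \<inter> N)"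
    using N(1) by auto
  also have "\<dots> \<in> sets lebesgue" using 1 2 NL by (intro sets.Un sets.Diff) auto
  finally show "u -` A \<inter> space lebesgue \<in> sets lebesgue" .
qed auto

text \<open>The weight is the power of \<open>norm x\<close> of order minus the dimension, which
  cancels the Jacobian of polar coordinates. The squared gradient of a radial power times a profile,
  the Hardy integrand and the critical power all carry exactly this weight.\<close>

lemma integral_radial_weighted:
  fixes f :: "real \<Rightarrow> real"
  assumes [measurable]: "f \<in> borel_measurable borel"
  shows "integrable lborel (\<lambda>x::real ^ 'n::finite. exp (- real CARD('n) * ln (norm x)) * f (ln (norm x))) \<longleftrightarrow> integrable lborel f"
    and "(LINT x|lborel. exp (- real CARD('n) * ln (norm (x::real ^ 'n))) * f (ln (norm x))) = sphere_area TYPE(real ^ 'n) * (LINT t|lborel. f t)"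
proof -
  have c: "exp (real CARD('n) * t) * (exp (- real CARD('n) * t) * f t) = f t" for t
    by (simp flip: mult.assoc exp_add)
  have m: "(\<lambda>t. exp (- real CARD('n) * t) * f t) \<in> borel_measurable borel" by measurable
  show "integrable lborel (\<lambda>x::real ^ 'n. exp (- real CARD('n) * ln (norm x)) * f (ln (norm x))) \<longleftrightarrow> integrable lborel f"
    using integral_radial(1)[OF m, where 'a="real ^ 'n"] by (simp add: c[unfolded minus_mult_left[symmetric]])
  show "(LINT x|lborel. exp (- real CARD('n) * ln (norm (x::real ^ 'n))) * f (ln (norm x))) = sphere_area TYPE(real ^ 'n) * (LINT t|lborel. f t)"
    using integral_radial(2)[OF m, where 'a="real ^ 'n"] by (simp add: c[unfolded minus_mult_left[symmetric]])
qed

lemma norm_powr_exp_ln: "x \<noteq> 0 \<Longrightarrow> norm x powr a = exp (a * ln (norm x))"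
  by (simp add: powr_def)

lemma radial_power_AE:
  fixes u :: "real ^ 'n::finite \<Rightarrow> complex"
  assumes u: "AE x in lborel. u x = \<alpha> * of_real (norm x powr (- \<kappa>) * v (ln (norm x)))" and p: "\<kappa> * p = real CARD('n)"
  shows "AE x in lborel. norm (u x) powr p = exp (- real CARD('n) * ln (norm x)) * (norm \<alpha> powr p * \<bar>v (ln (norm x))\<bar> powr p)"
  using u AE_lborel_singleton[of "0 :: real ^ 'n"]
proof eventually_elim
  case (elim x)
  then have "norm (u x) powr p = norm \<alpha> powr p * ((norm x powr (- \<kappa>)) powr p * \<bar>v (ln (norm x))\<bar> powr p)"
    by (simp add: norm_mult powr_mult abs_mult)
  also have "(norm x powr (- \<kappa>)) powr p = exp (- real CARD('n) * ln (norm x))"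
    unfolding norm_powr_exp_ln[OF elim(2)] exp_powr_real p[symmetric] by (simp add: mult_ac)
  finally show ?case by simp
qed

lemma Lp_norm_profile:
  fixes u :: "real ^ 'n::finite \<Rightarrow> complex"
  assumes u: "AE x in lborel. u x = of_real (norm x powr (- \<kappa>)) * v (ln (norm x))"
    and v[measurable]: "v \<in> borel_measurable borel" and um: "u \<in> borel_measurable lebesgue" and p: "\<kappa> * p = real CARD('n)"
  shows "integrable lebesgue (\<lambda>x. norm (u x) powr p) \<Longrightarrow> integrable lborel (\<lambda>t. norm (v t) powr p)"
    and "(LINT x|lebesgue. norm (u x) powr p) = sphere_area TYPE(real ^ 'n) * (LINT t|lborel. norm (v t) powr p)"
proof -
  define g where "g x = exp (- real CARD('n) * ln (norm x)) * norm (v (ln (norm x))) powr p" for x :: "real ^ 'n"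
  have g: "g \<in> borel_measurable lborel" unfolding g_def by measurable
  have vm: "(\<lambda>t. norm (v t) powr p) \<in> borel_measurable borel" by measurable
  note R = integral_radial_weighted[OF vm, where 'n='n, folded g_def]
  have "AE x in lborel. complex_of_real (norm (u x)) = 1 * of_real (norm x powr (- \<kappa>) * norm (v (ln (norm x))))"
    using u by eventually_elim (simp add: norm_mult)
  from radial_power_AE[OF this p]
  have "AE x in lborel. norm (u x) powr p = g x" by (simp add: g_def)
  then have ae: "AE x in lebesgue. norm (u x) powr p = g x" by (rule AE_completion)
  have nm: "(\<lambda>x. norm (u x) powr p) \<in> borel_measurable lebesgue"
    by (rule measurable_compose[OF measurable_compose[OF um borel_measurable_norm], where g="\<lambda>r. r powr p"]) measurable
  show "integrable lborel (\<lambda>t. norm (v t) powr p)" if "integrable lebesgue (\<lambda>x. norm (u x) powr p)"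
    using integrable_cong_AE_imp[OF that measurable_completion[OF g] ae] R(1) integrable_completion[OF g] by simp
  show "(LINT x|lebesgue. norm (u x) powr p) = sphere_area TYPE(real ^ 'n) * (LINT t|lborel. norm (v t) powr p)"
    unfolding integral_cong_AE[OF nm measurable_completion[OF g] ae] integral_completion[OF g] by (rule R(2))
qed

lemma hardy_integral_profile:
  fixes u :: "real ^ 'n::finite \<Rightarrow> complex"
  assumes u: "AE x in lborel. u x = of_real (norm x powr (- \<kappa>)) * v (ln (norm x))"
    and v[measurable]: "v \<in> borel_measurable borel" and um: "u \<in> borel_measurable lebesgue" and \<kappa>: "2 * \<kappa> + 2 = real CARD('n)"
  shows "hardy_integral u = sphere_area TYPE(real ^ 'n) * (LINT t|lborel. (norm (v t))\<^sup>2)"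
proof -
  define g where "g x = exp (- real CARD('n) * ln (norm x)) * (norm (v (ln (norm x))))\<^sup>2" for x :: "real ^ 'n"
  have g: "g \<in> borel_measurable lborel" unfolding g_def by measurable
  have vm: "(\<lambda>t. (norm (v t))\<^sup>2) \<in> borel_measurable borel" by measurable
  note R = integral_radial_weighted(2)[OF vm, where 'n='n, folded g_def]
  have "AE x in lborel. (norm (u x))\<^sup>2 / (norm x)\<^sup>2 = g x"
    using u AE_lborel_singleton[of "0 :: real ^ 'n"]
  proof eventually_elim
    case (elim x)
    have "(norm x powr (- \<kappa>))\<^sup>2 / (norm x)\<^sup>2 = norm x powr (- \<kappa> + - \<kappa>) / norm x powr 2"
      using elim(2) by (simp add: power2_eq_square flip: powr_add)
    also have "\<dots> = norm x powr (- \<kappa> + - \<kappa> - 2)" by (simp add: powr_diff)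
    also have "- \<kappa> + - \<kappa> - 2 = - real CARD('n)" using \<kappa> by simp
    also have "norm x powr (- real CARD('n)) = exp (- real CARD('n) * ln (norm x))" by (rule norm_powr_exp_ln[OF elim(2)])
    finally have "(norm x powr (- \<kappa>))\<^sup>2 / (norm x)\<^sup>2 = exp (- real CARD('n) * ln (norm x))" .
    moreover have "(norm (u x))\<^sup>2 / (norm x)\<^sup>2 = (norm x powr (- \<kappa>))\<^sup>2 / (norm x)\<^sup>2 * (norm (v (ln (norm x))))\<^sup>2"
      using elim(1) by (simp add: norm_mult power_mult_distrib)
    ultimately show ?case by (simp only: g_def)
  qed
  then have ae: "AE x in lebesgue. (norm (u x))\<^sup>2 / (norm x)\<^sup>2 = g x" by (rule AE_completion)
  have "(norm :: real ^ 'n \<Rightarrow> real) \<in> borel_measurable lborel" by measurable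
  then have "(norm :: real ^ 'n \<Rightarrow> real) \<in> borel_measurable lebesgue" by (rule measurable_completion)
  then have m: "(\<lambda>x. (norm (u x))\<^sup>2 / (norm x)\<^sup>2) \<in> borel_measurable lebesgue"
    by (intro borel_measurable_divide borel_measurable_power measurable_compose[OF um borel_measurable_norm])
  show ?thesis
    unfolding hardy_integral_def integral_cong_AE[OF m measurable_completion[OF g] ae] integral_completion[OF g] by (rule R)
qed

text \<open>Along almost every dilation orbit \<open>t \<mapsto> exp t *\<^sub>R \<theta>\<close> a fast subsequence of the approximating test functions
  converges together with its derivative, and radial symmetry makes a single orbit sufficient.\<close>

lemma radial_profile:
  fixes u :: "real ^ 'n::finite \<Rightarrow> complex"
  assumes u: "u \<in> homogeneous_H1_rad" and d: "CARD('n) \<ge> 3"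
  defines "\<kappa> \<equiv> (real CARD('n) - 2) / 2" and "N \<equiv> sphere_area TYPE(real ^ 'n)"
  obtains v w where "H1_line v w"
    "AE x in lborel. u x = of_real (norm x powr (- \<kappa>)) * v (ln (norm x))"
    "N * (LINT t|lborel. (norm (w t))\<^sup>2) \<le> hardy_form u"
    "hardy_integral u = N * (LINT t|lborel. (norm (v t))\<^sup>2)"
proof -
  define n where "n = real CARD('n)"
  have n: "real DIM(real ^ 'n) = n" by (simp add: n_def)
  define p where "p = sobolev_exponent CARD('n)"
  have n3: "n \<ge> 3" using d by (simp add: n_def)
  have \<kappa>: "\<kappa> > 0" "2 * \<kappa> + 2 = n" using n3 by (auto simp: \<kappa>_def n_def field_simps)
  have p2: "p > 2" unfolding p_def by (rule sobolev_exponent_gt_2[OF d])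
  have \<kappa>p: "\<kappa> * p = n" using n3 by (simp add: \<kappa>_def p_def sobolev_exponent_def n_def)
  have N: "N > 0" unfolding N_def by (rule sphere_area_pos)
  have uH: "u \<in> homogeneous_H1" and ur: "radial u" using u by (auto simp: homogeneous_H1_rad_def)
  obtain \<phi> G u' where \<phi>: "\<And>k. \<phi> k \<in> test_functions" and u'[measurable]: "u' \<in> borel_measurable borel"
    and uu': "AE x in lborel. u x = u' x"
    and u'p: "integrable lborel (\<lambda>x. norm (u' x) powr p)"
    and ip: "\<And>k. integrable lborel (\<lambda>x. norm (\<phi> k x - u' x) powr p)"
    and lp: "(\<lambda>k. LINT x|lborel. norm (\<phi> k x - u' x) powr p) \<longlonglongrightarrow> 0"
    and G[measurable]: "G \<in> borel_measurable borel" and G2: "integrable lborel (\<lambda>x. (norm (G x))\<^sup>2)"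
    and iG: "\<And>k. integrable lborel (\<lambda>x. (norm (classical_gradient (\<phi> k) x - G x))\<^sup>2)"
    and lG: "(\<lambda>k. LINT x|lborel. (norm (classical_gradient (\<phi> k) x - G x))\<^sup>2) \<longlonglongrightarrow> 0"
    and wg: "is_weak_gradient u G"
    by (rule homogeneous_H1E[OF uH d, folded p_def]) (rule that, assumption+)
  have \<phi>m[measurable]: "\<phi> k \<in> borel_measurable borel" for k by (rule test_function_measurable[OF \<phi>])
  have gm[measurable]: "classical_gradient (\<phi> k) \<in> borel_measurable borel" for k by (rule gradient_test_function_measurable[OF \<phi>])
  \<comment> \<open>The errors of gradient and function are added so that one subsequence and one
    orbit serve for both.\<close>
  define g where "g k x = (norm (classical_gradient (\<phi> k) x - G x))\<^sup>2 + norm (\<phi> k x - u' x) powr p" for k x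
  have gi: "integrable lborel (g k)" for k unfolding g_def using iG ip by simp
  have gmm[measurable]: "g k \<in> borel_measurable borel" for k unfolding g_def by measurable
  have gnn: "g k x \<ge> 0" for k x by (simp add: g_def)
  have "(\<lambda>k. LINT x|lborel. g k x) \<longlonglongrightarrow> 0"
    unfolding g_def using tendsto_add[OF lG lp] iG ip by simp
  then have "\<exists>k. (LINT x|lborel. g k x) < (1 / 2) ^ j" for j :: nat
    using order_tendstoD(2)[of "\<lambda>k. LINT x|lborel. g k x" 0 sequentially "(1/2)^j"]
    by (auto simp: eventually_sequentially)
  then obtain r where r: "\<And>j. (LINT x|lborel. g (r j) x) < (1 / 2) ^ j" by metis
  define H where "H x = (\<Sum>j. ennreal (g (r j) x))" for x
  have Hm[measurable]: "H \<in> borel_measurable borel"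
  proof -
    have "H \<in> borel_measurable lborel" unfolding H_def by measurable
    then show ?thesis by simp
  qed
  have Hfin: "(\<integral>\<^sup>+x. H x \<partial>lborel) < \<infinity>"
  proof -
    have "(\<integral>\<^sup>+x. H x \<partial>lborel) = (\<Sum>j. \<integral>\<^sup>+x. ennreal (g (r j) x) \<partial>lborel)"
      unfolding H_def by (rule nn_integral_suminf) measurable
    also have "\<dots> \<le> (\<Sum>j. ennreal ((1 / 2) ^ j))"
    proof (intro suminf_le)
      fix j
      have "(\<integral>\<^sup>+x. ennreal (g (r j) x) \<partial>lborel) = ennreal (LINT x|lborel. g (r j) x)"
        by (rule nn_integral_eq_integral[OF gi]) (simp add: gnn)
      then show "(\<integral>\<^sup>+x. ennreal (g (r j) x) \<partial>lborel) \<le> ennreal ((1 / 2) ^ j)"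
        using less_imp_le[OF r[of j]] by (simp add: ennreal_leI)
    qed auto
    also have "\<dots> = ennreal (\<Sum>j. (1 / 2) ^ j)"
      using summable_half_power[of 1] by (intro suminf_ennreal2) auto
    also have "\<dots> < \<infinity>" by simp
    finally show ?thesis .
  qed
  obtain f where "AE x in lebesgue. u x = f (norm x)" using ur by (auto simp: radial_def)
  then have uf: "AE x in lborel. u x = f (norm x)" by (simp add: AE_completion_iff)
  have "AE x in lborel. u' x = f (norm x)" using uf uu' by eventually_elim simp
  from AE_E3[OF this] obtain N0 where N0: "\<And>x. x \<notin> N0 \<Longrightarrow> u' x = f (norm x)" "N0 \<in> null_sets lborel" by auto
  define Q where "Q x = ennreal ((norm (G x))\<^sup>2)" for x
  have Qm[measurable]: "Q \<in> borel_measurable borel" unfolding Q_def by measurable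
  have Qval: "(\<integral>\<^sup>+x. Q x \<partial>lborel) = ennreal (LINT x|lborel. (norm (G x))\<^sup>2)"
    unfolding Q_def by (rule nn_integral_eq_integral[OF G2]) simp
  have Qfin: "(\<integral>\<^sup>+x. Q x \<partial>lborel) < \<infinity>" unfolding Qval by simp
  obtain \<theta> :: "real ^ 'n" where \<theta>: "norm \<theta> = 1"
    and \<theta>H: "(\<integral>\<^sup>+t. ennreal (exp (n * t)) * H (exp t *\<^sub>R \<theta>) \<partial>lborel) < \<infinity>"
    and \<theta>N: "AE t in lborel. exp t *\<^sub>R \<theta> \<notin> N0"
    and \<theta>Q: "ennreal N * (\<integral>\<^sup>+t. ennreal (exp (n * t)) * Q (exp t *\<^sub>R \<theta>) \<partial>lborel) \<le> (\<integral>\<^sup>+x. Q x \<partial>lborel)"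
    by (rule orbit_selection[OF Hm Hfin N0(2) Qm Qfin, unfolded n, folded N_def]) (rule that, assumption+)
  \<comment> \<open>Restriction to the orbit in Emden-Fowler variables: \<open>V j\<close>
    approximates the profile, and \<open>Z j\<close> is the radial derivative with the weight for
    which the derivative of \<open>V j\<close> is \<open>\<kappa> * V j + Z j\<close>.\<close>
  define V where "V j t = of_real (exp (\<kappa> * t)) * \<phi> (r j) (exp t *\<^sub>R \<theta>)" for j t
  define Z where "Z j t = of_real (exp ((\<kappa> + 1) * t)) * (\<Sum>i\<in>UNIV. of_real (\<theta> $ i) * classical_gradient (\<phi> (r j)) (exp t *\<^sub>R \<theta>) $ i)" for j t
  define v0 where "v0 t = of_real (exp (\<kappa> * t)) * u' (exp t *\<^sub>R \<theta>)" for t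
  define z where "z t = of_real (exp ((\<kappa> + 1) * t)) * (\<Sum>i\<in>UNIV. of_real (\<theta> $ i) * G (exp t *\<^sub>R \<theta>) $ i)" for t
  have curve: "((\<lambda>t. exp t *\<^sub>R \<theta>) has_derivative (\<lambda>h. h *\<^sub>R (exp t *\<^sub>R \<theta>))) (at t)" for t :: real
    by (auto intro!: derivative_eq_intros simp: mult.commute)
  have dV: "(V j has_vector_derivative of_real \<kappa> * V j t + Z j t) (at t)" for j t
  proof -
    have "((\<lambda>t. \<phi> (r j) (exp t *\<^sub>R \<theta>)) has_derivative
        (\<lambda>h. frechet_derivative (\<phi> (r j)) (at (exp t *\<^sub>R \<theta>)) (h *\<^sub>R (exp t *\<^sub>R \<theta>)))) (at t)"
      by (rule has_derivative_compose[OF curve test_function_has_derivative[OF \<phi>]])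
    moreover have "frechet_derivative (\<phi> (r j)) (at (exp t *\<^sub>R \<theta>)) (h *\<^sub>R (exp t *\<^sub>R \<theta>)) =
        h *\<^sub>R (of_real (exp t) * (\<Sum>i\<in>UNIV. of_real (\<theta> $ i) * classical_gradient (\<phi> (r j)) (exp t *\<^sub>R \<theta>) $ i))" for h
    proof -
      have c: "(h *\<^sub>R (exp t *\<^sub>R \<theta>)) $ i = h * (exp t * \<theta> $ i)" for i by simp
      show ?thesis
      unfolding frechet_derivative_partial[OF \<phi>] c of_real_mult
      by (simp add: classical_gradient_def sum_distrib_left scaleR_conv_of_real mult.assoc)
    qed
    ultimately have 1: "((\<lambda>t. \<phi> (r j) (exp t *\<^sub>R \<theta>)) has_vector_derivative
        of_real (exp t) * (\<Sum>i\<in>UNIV. of_real (\<theta> $ i) * classical_gradient (\<phi> (r j)) (exp t *\<^sub>R \<theta>) $ i)) (at t)"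
      by (simp add: has_vector_derivative_def)
    have "((\<lambda>t. exp (\<kappa> * t)) has_real_derivative \<kappa> * exp (\<kappa> * t)) (at t)"
      by (auto intro!: derivative_eq_intros)
    from has_vector_derivative_scaleR[OF this 1]
    have "((\<lambda>t. exp (\<kappa> * t) *\<^sub>R \<phi> (r j) (exp t *\<^sub>R \<theta>)) has_vector_derivative
       exp (\<kappa> * t) *\<^sub>R (of_real (exp t) * (\<Sum>i\<in>UNIV. of_real (\<theta> $ i) * classical_gradient (\<phi> (r j)) (exp t *\<^sub>R \<theta>) $ i)) +
       (\<kappa> * exp (\<kappa> * t)) *\<^sub>R \<phi> (r j) (exp t *\<^sub>R \<theta>)) (at t)" .
    moreover have "exp (\<kappa> * t) *\<^sub>R (of_real (exp t) * X) + (\<kappa> * exp (\<kappa> * t)) *\<^sub>R Y =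
        of_real \<kappa> * (of_real (exp (\<kappa> * t)) * Y) + of_real (exp ((\<kappa> + 1) * t)) * X" for X Y :: complex
      by (simp add: scaleR_conv_of_real distrib_right exp_add mult.assoc)
    ultimately show ?thesis unfolding V_def Z_def scaleR_conv_of_real[symmetric] by (simp only: scaleR_conv_of_real)
  qed
  have ccurve: "continuous_on UNIV (\<lambda>t. exp t *\<^sub>R \<theta>)" by (intro continuous_intros)
  have Zc: "continuous_on UNIV (Z j)" for j
  proof -
    have "continuous_on UNIV (\<lambda>t. classical_gradient (\<phi> (r j)) (exp t *\<^sub>R \<theta>))"
      by (rule continuous_on_compose2[OF gradient_test_function_continuous[OF \<phi>] ccurve]) simp
    then show ?thesis unfolding Z_def by (intro continuous_intros)
  qed
  have mcurve[measurable]: "(\<lambda>t. exp t *\<^sub>R \<theta>) \<in> borel_measurable borel"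
    by (rule borel_measurable_continuous_onI[OF ccurve])
  have v0m[measurable]: "v0 \<in> borel_measurable borel" unfolding v0_def by measurable
  have comp[measurable]: "(\<lambda>t. G (exp t *\<^sub>R \<theta>) $ i) \<in> borel_measurable borel" for i
    by (rule measurable_compose[OF measurable_compose[OF mcurve G] borel_measurable_continuous_onI]) (intro continuous_intros)
  have zm[measurable]: "z \<in> borel_measurable borel" unfolding z_def by measurable
  \<comment> \<open>By \<open>2 * \<kappa> + 2 = n\<close>, squared gradients along the orbit
    receive exactly the weight of polar coordinates; for the p-th powers this is
    \<open>\<kappa> * p = n\<close>.\<close>
  have ee: "(exp ((\<kappa> + 1) * t))\<^sup>2 = exp (n * t)" for t
    by (simp add: \<kappa>(2)[symmetric] power2_eq_square algebra_simps flip: exp_add)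
  have dotb: "(norm (of_real (exp ((\<kappa> + 1) * t)) * (\<Sum>i\<in>UNIV. of_real (\<theta> $ i) * c $ i)))\<^sup>2 \<le> exp (n * t) * (norm c)\<^sup>2" for t and c :: "complex ^ 'n"
  proof -
    have "norm (of_real (exp ((\<kappa> + 1) * t)) * (\<Sum>i\<in>UNIV. of_real (\<theta> $ i) * c $ i)) \<le> exp ((\<kappa> + 1) * t) * norm c"
      using norm_real_complex_dot_le[of \<theta> c] \<theta> by (simp add: norm_mult)
    then have "(norm (of_real (exp ((\<kappa> + 1) * t)) * (\<Sum>i\<in>UNIV. of_real (\<theta> $ i) * c $ i)))\<^sup>2 \<le> (exp ((\<kappa> + 1) * t) * norm c)\<^sup>2"
      by (rule power_mono) simp
    then show ?thesis by (simp only: power_mult_distrib ee)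
  qed
  have Tb: "(norm (Z j t - z t))\<^sup>2 + norm (V j t - v0 t) powr p \<le> exp (n * t) * g (r j) (exp t *\<^sub>R \<theta>)" for j t
  proof -
    have Zz: "Z j t - z t = of_real (exp ((\<kappa> + 1) * t)) * (\<Sum>i\<in>UNIV. of_real (\<theta> $ i) * (classical_gradient (\<phi> (r j)) (exp t *\<^sub>R \<theta>) - G (exp t *\<^sub>R \<theta>)) $ i)"
      by (simp add: Z_def z_def right_diff_distrib sum_subtractf)
    have 1: "(norm (Z j t - z t))\<^sup>2 \<le> exp (n * t) * (norm (classical_gradient (\<phi> (r j)) (exp t *\<^sub>R \<theta>) - G (exp t *\<^sub>R \<theta>)))\<^sup>2"
      unfolding Zz by (rule dotb)
    have "V j t - v0 t = of_real (exp (\<kappa> * t)) * (\<phi> (r j) (exp t *\<^sub>R \<theta>) - u' (exp t *\<^sub>R \<theta>))"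
      by (simp add: V_def v0_def right_diff_distrib)
    then have "norm (V j t - v0 t) powr p = exp (\<kappa> * t) powr p * norm (\<phi> (r j) (exp t *\<^sub>R \<theta>) - u' (exp t *\<^sub>R \<theta>)) powr p"
      by (simp add: norm_mult powr_mult)
    also have "exp (\<kappa> * t) powr p = exp (n * t)" unfolding exp_powr_real \<kappa>p[symmetric] by (simp add: mult_ac)
    finally show ?thesis using 1 by (simp add: g_def distrib_left)
  qed
  have fin: "(\<integral>\<^sup>+t. (\<Sum>j. ennreal ((norm (Z j t - z t))\<^sup>2 + norm (V j t - v0 t) powr p)) \<partial>lborel) < \<infinity>"
  proof -
    have "(\<integral>\<^sup>+t. (\<Sum>j. ennreal ((norm (Z j t - z t))\<^sup>2 + norm (V j t - v0 t) powr p)) \<partial>lborel) \<le>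
      (\<integral>\<^sup>+t. ennreal (exp (n * t)) * H (exp t *\<^sub>R \<theta>) \<partial>lborel)"
    proof (rule nn_integral_mono)
      fix t
      have "(\<Sum>j. ennreal ((norm (Z j t - z t))\<^sup>2 + norm (V j t - v0 t) powr p)) \<le> (\<Sum>j. ennreal (exp (n * t)) * ennreal (g (r j) (exp t *\<^sub>R \<theta>)))"
      proof (intro suminf_le)
        fix j
        show "ennreal ((norm (Z j t - z t))\<^sup>2 + norm (V j t - v0 t) powr p) \<le> ennreal (exp (n * t)) * ennreal (g (r j) (exp t *\<^sub>R \<theta>))"
          using ennreal_leI[OF Tb[of j t]] by (simp only: ennreal_mult'[OF exp_ge_zero])
      qed auto
      also have "\<dots> = ennreal (exp (n * t)) * H (exp t *\<^sub>R \<theta>)" unfolding H_def by simp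
      finally show "(\<Sum>j. ennreal ((norm (Z j t - z t))\<^sup>2 + norm (V j t - v0 t) powr p)) \<le> ennreal (exp (n * t)) * H (exp t *\<^sub>R \<theta>)" .
    qed
    then show ?thesis using \<theta>H by (rule le_less_trans)
  qed
  obtain v where v: "weak_primitive v (\<lambda>t. of_real \<kappa> * v t + z t)" and vv0: "AE t in lborel. v t = v0 t"
    by (rule weak_primitive_of_limit[OF dV Zc v0m zm _ fin]) (use p2 in simp, rule that, assumption+)
  \<comment> \<open>Almost all points of the orbit avoid \<open>N0\<close>, so radial symmetry
    identifies \<open>v\<close> with the profile of \<open>f\<close>. The one orbit thus determines
    \<open>u\<close> almost everywhere.\<close>
  have vf: "AE t in lborel. v t = of_real (exp (\<kappa> * t)) * f (exp t)"
    using vv0 \<theta>N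
  proof eventually_elim
    case (elim t)
    then show ?case using N0(1)[of "exp t *\<^sub>R \<theta>"] \<theta> by (simp add: v0_def)
  qed
  have uv: "AE x in lborel. u x = of_real (norm x powr (- \<kappa>)) * v (ln (norm x))"
    using AE_radial[OF vf] uf AE_lborel_singleton[of "0 :: real ^ 'n"]
  proof eventually_elim
    case (elim x)
    then have nx: "norm x > 0" by simp
    have "of_real (norm x powr (- \<kappa>)) * v (ln (norm x)) = of_real (norm x powr (- \<kappa>) * norm x powr \<kappa>) * f (norm x)"
      unfolding elim(1) using nx by (simp add: powr_def)
    also have "norm x powr (- \<kappa>) * norm x powr \<kappa> = 1" using nx by (simp flip: powr_add)
    finally show ?case using elim(2) by simp
  qed
  have vm[measurable]: "v \<in> borel_measurable borel"
    by (rule borel_measurable_continuous_onI[OF weak_primitive_continuous[OF v]])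
  have um: "u \<in> borel_measurable lebesgue" and upL: "integrable lebesgue (\<lambda>x. norm (u x) powr p)"
    using uH by (auto simp: homogeneous_H1_def Let_def p_def)
  have vp: "integrable lborel (\<lambda>t. norm (v t) powr p)"
    by (rule Lp_norm_profile(1)[OF uv vm um _ upL]) (use \<kappa>p in \<open>simp add: n_def\<close>)
  have zb: "(norm (z t))\<^sup>2 \<le> exp (n * t) * (norm (G (exp t *\<^sub>R \<theta>)))\<^sup>2" for t
    unfolding z_def by (rule dotb)
  have nnz: "ennreal N * (\<integral>\<^sup>+t. ennreal ((norm (z t))\<^sup>2) \<partial>lborel) \<le> ennreal (LINT x|lborel. (norm (G x))\<^sup>2)"
  proof -
    have "(\<integral>\<^sup>+t. ennreal ((norm (z t))\<^sup>2) \<partial>lborel) \<le> (\<integral>\<^sup>+t. ennreal (exp (n * t)) * Q (exp t *\<^sub>R \<theta>) \<partial>lborel)"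
      by (rule nn_integral_mono) (use zb in \<open>simp add: Q_def ennreal_mult'[symmetric] ennreal_leI\<close>)
    from mult_left_mono[OF this, of "ennreal N"] \<theta>Q show ?thesis unfolding Qval by simp
  qed
  have z2: "integrable lborel (\<lambda>t. (norm (z t))\<^sup>2)"
  proof (rule integrableI_nonneg)
    have "ennreal N * (\<integral>\<^sup>+t. ennreal ((norm (z t))\<^sup>2) \<partial>lborel) < \<infinity>" using nnz by (rule le_less_trans) simp
    then show "(\<integral>\<^sup>+t. ennreal ((norm (z t))\<^sup>2) \<partial>lborel) < \<infinity>" using N by (auto simp: ennreal_mult_less_top)
  qed auto
  have Nz: "N * (LINT t|lborel. (norm (z t))\<^sup>2) \<le> (LINT x|lborel. (norm (G x))\<^sup>2)"
  proof -
    have "ennreal (N * (LINT t|lborel. (norm (z t))\<^sup>2)) \<le> ennreal (LINT x|lborel. (norm (G x))\<^sup>2)"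
      using nnz N by (subst (asm) nn_integral_eq_integral[OF z2]) (auto simp: ennreal_mult')
    moreover have "(LINT x|lborel. (norm (G x))\<^sup>2) \<ge> 0" by (rule Bochner_Integration.integral_nonneg) simp
    ultimately show ?thesis by simp
  qed
  define w where "w t = of_real \<kappa> * v t + z t" for t
  have vw: "weak_primitive v w" using v unfolding w_def .
  have "p > 0" using p2 by simp
  note hb = hardy_half_line_bound[OF vw w_def \<kappa>(1) zm z2 vp this]
  have hi: "hardy_integral u = N * (LINT t|lborel. (norm (v t))\<^sup>2)"
    unfolding N_def by (rule hardy_integral_profile[OF uv vm um]) (use \<kappa>(2) in \<open>simp add: n_def\<close>)
  \<comment> \<open>Only an inequality results: the gradient is bounded from below by its radial
    part, on an orbit of at most average energy. The Hardy constant \<open>\<kappa>\<^sup>2\<close>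
    removes the mass term of \<open>hardy_half_line_bound\<close>.\<close>
  have "N * (LINT t|lborel. (norm (w t))\<^sup>2) \<le> hardy_form u"
  proof -
    have "(real CARD('n) - 2)\<^sup>2 / 4 = \<kappa>\<^sup>2" by (simp add: \<kappa>_def power_divide)
    then have "hardy_form u = (LINT x|lborel. (norm (G x))\<^sup>2) - \<kappa>\<^sup>2 * hardy_integral u"
      unfolding hardy_form_def integral_weak_gradient[OF wg G] by simp
    moreover have "N * ((LINT t|lborel. (norm (w t))\<^sup>2) + \<kappa>\<^sup>2 * (LINT t|lborel. (norm (v t))\<^sup>2)) \<le> N * (LINT t|lborel. (norm (z t))\<^sup>2)"
      using hb(2) N by (intro mult_left_mono) auto
    ultimately show ?thesis using Nz unfolding hi by (simp add: algebra_simps)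
  qed
  then show thesis using hb(1) uv hi by (intro that)
qed

section \<open>Functions with a prescribed profile\<close>

text \<open>The norm is not smooth at 0, so radial functions are written through
  \<open>\<rho> = (norm x)\<^sup>2\<close>, a polynomial in the coordinates. The lifted function is
  smooth on \<open>{0<..}\<close> and vanishes on an open half line that reaches beyond 0; together
  these cover the real line.\<close>

lemma differentiable_order_radial_lift:
  fixes V :: "real \<Rightarrow> real"
  assumes V: "\<And>k. differentiable_order k UNIV V" and T: "\<And>t. \<bar>t\<bar> \<ge> T \<Longrightarrow> V t = 0"
  shows "differentiable_order k UNIV (\<lambda>\<rho>. if \<rho> > 0 then \<rho> powr (- \<kappa> / 2) * V (1 / 2 * ln \<rho>) else 0)"
    (is "differentiable_order k UNIV ?\<Phi>")
proof -
  have 1: "differentiable_order k {0<..} ?\<Phi>"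
  proof (rule differentiable_order_cong)
    have a: "differentiable_order k {0<..} (\<lambda>\<rho>::real. \<rho> powr (- \<kappa> / 2))"
      by (rule differentiable_order_powr[OF _ differentiable_order_ident]) auto
    have b: "differentiable_order k {0<..} (\<lambda>\<rho>::real. V (1 / 2 * ln \<rho>))"
      by (rule differentiable_order_compose[OF _ open_UNIV _ V differentiable_order_cmult[OF _ differentiable_order_ln]]) auto
    show "differentiable_order k {0<..} (\<lambda>\<rho>::real. \<rho> powr (- \<kappa> / 2) * V (1 / 2 * ln \<rho>))"
      by (rule differentiable_order_mult[OF _ a b]) simp
  qed auto
  \<comment> \<open>For positive \<open>\<rho> < c\<close> the logarithm of the radius is below
    \<open>- \<bar>T\<bar>\<close>, where \<open>V\<close> vanishes.\<close>
  define c where "c = exp (- 2 * \<bar>T\<bar>)"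
  have c0: "c > 0" by (simp add: c_def)
  have 2: "differentiable_order k {..<c} ?\<Phi>"
  proof (rule differentiable_order_cong[OF _ differentiable_order_const[of "{..<c}" k 0]])
    fix \<rho> assume \<rho>: "\<rho> \<in> {..<c}"
    show "0 = ?\<Phi> \<rho>"
    proof (cases "\<rho> > 0")
      case True
      then have "ln \<rho> < ln c" using \<rho> by simp
      then have "ln \<rho> < - 2 * \<bar>T\<bar>" by (simp add: c_def)
      then have "\<bar>1 / 2 * ln \<rho>\<bar> \<ge> T" by simp
      then show ?thesis using T by simp
    qed simp
  qed auto
  have "differentiable_order k ({0<..} \<union> {..<c}) ?\<Phi>"
    by (rule differentiable_order_Un[OF _ _ 1 2]) auto
  also have "{0<..} \<union> {..<c} = UNIV" using c0 by auto
  finally show ?thesis .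
qed

lemma radial_test_function:
  fixes V :: "real \<Rightarrow> real"
  assumes V: "\<And>k. differentiable_order k UNIV V" and T: "\<And>t. \<bar>t\<bar> \<ge> T \<Longrightarrow> V t = 0"
  shows "(\<lambda>x::real ^ 'n::finite. \<alpha> * of_real (norm x powr (- \<kappa>) * V (ln (norm x)))) \<in> test_functions"
proof (rule test_functionsI[where K="cball 0 (exp \<bar>T\<bar>)"])
  fix k
  define \<Phi> where "\<Phi> \<rho> = (if \<rho> > 0 then \<rho> powr (- \<kappa> / 2) * V (1 / 2 * ln \<rho>) else 0)" for \<rho> :: real
  have eq: "norm x powr (- \<kappa>) * V (ln (norm x)) = \<Phi> (\<Sum>i\<in>UNIV. x $ i * x $ i)" for x :: "real ^ 'n"
  proof -
    have s: "(\<Sum>i\<in>UNIV. x $ i * x $ i) = (norm x)\<^sup>2"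
      by (simp add: power2_norm_eq_inner inner_vec_def)
    show ?thesis
    proof (cases "x = 0")
      case False
      then have nx: "norm x > 0" by simp
      have "((norm x)\<^sup>2) powr (- \<kappa> / 2) = norm x powr (- \<kappa>)"
      proof -
        have "(norm x)\<^sup>2 = norm x powr 2" using nx by simp
        then have "((norm x)\<^sup>2) powr (- \<kappa> / 2) = norm x powr (2 * (- \<kappa> / 2))" by (simp only: powr_powr)
        then show ?thesis by simp
      qed
      moreover have "1 / 2 * ln ((norm x)\<^sup>2) = ln (norm x)" using nx by (simp add: ln_realpow)
      ultimately show ?thesis using nx unfolding s \<Phi>_def by simp
    qed (simp add: s \<Phi>_def)
  qed
  have 1: "C_k k (\<lambda>x::real ^ 'n. complex_of_real (\<Sum>i\<in>UNIV. x $ i * x $ i))"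
    unfolding of_real_sum of_real_mult by (rule C_k_sum[OF _ C_k_mult[OF C_k_coord C_k_coord]]) simp
  have "C_k k (\<lambda>x::real ^ 'n. complex_of_real (\<Phi> (\<Sum>i\<in>UNIV. x $ i * x $ i)))"
    by (rule C_k_compose[OF _ 1]) (unfold \<Phi>_def, rule differentiable_order_radial_lift[OF V T])
  then show "C_k k (\<lambda>x::real ^ 'n. \<alpha> * of_real (norm x powr (- \<kappa>) * V (ln (norm x))))"
    unfolding eq by (rule C_k_mult[OF C_k_const])
next
  fix x :: "real ^ 'n" assume "x \<notin> cball 0 (exp \<bar>T\<bar>)"
  then have "exp \<bar>T\<bar> < norm x" by simp
  then have "\<bar>T\<bar> < ln (norm x)" using exp_gt_zero[of "\<bar>T\<bar>"] by (subst ln_exp[symmetric], subst ln_less_cancel_iff) auto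
  then have "V (ln (norm x)) = 0" by (intro T) simp
  then show "\<alpha> * of_real (norm x powr (- \<kappa>) * V (ln (norm x))) = 0" by simp
qed simp

text \<open>The gradient of \<open>\<alpha> * norm x powr (- \<kappa>) * V (ln (norm x))\<close>,
  with \<open>f\<close> in the place of \<open>V' - \<kappa> * V\<close>. Linearity in
  \<open>f\<close> reduces errors of gradients to errors of profiles.\<close>

definition radial_gradient :: "complex \<Rightarrow> real \<Rightarrow> (real \<Rightarrow> real) \<Rightarrow> real ^ 'n::finite \<Rightarrow> complex ^ 'n" where
  "radial_gradient \<alpha> \<kappa> f x = (\<chi> i. \<alpha> * of_real (x $ i / norm x * norm x powr (- \<kappa> - 1) * f (ln (norm x))))"

lemma classical_gradient_radial:
  fixes x :: "real ^ 'n::finite"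
  assumes V: "\<And>t. (V has_real_derivative V' t) (at t)" and x: "x \<noteq> 0"
  shows "classical_gradient (\<lambda>x::real ^ 'n. \<alpha> * of_real (norm x powr (- \<kappa>) * V (ln (norm x)))) x =
    radial_gradient \<alpha> \<kappa> (\<lambda>t. V' t - \<kappa> * V t) x"
proof -
  have nx: "norm x > 0" using x by simp
  have d1: "((\<lambda>r. r powr (- \<kappa>)) has_real_derivative - \<kappa> * norm x powr (- \<kappa> - 1)) (at (norm x))"
    by (rule has_real_derivative_powr[OF nx])
  have d2: "((\<lambda>r. V (ln r)) has_real_derivative V' (ln (norm x)) * inverse (norm x)) (at (norm x))"
    by (rule DERIV_chain2[OF V DERIV_ln[OF nx]])
  have "((\<lambda>r. r powr (- \<kappa>) * V (ln r)) has_real_derivative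
      - \<kappa> * norm x powr (- \<kappa> - 1) * V (ln (norm x)) + V' (ln (norm x)) * inverse (norm x) * norm x powr (- \<kappa>)) (at (norm x))"
    by (rule DERIV_mult[OF d1 d2])
  also have "- \<kappa> * norm x powr (- \<kappa> - 1) * V (ln (norm x)) + V' (ln (norm x)) * inverse (norm x) * norm x powr (- \<kappa>) =
      norm x powr (- \<kappa> - 1) * (V' (ln (norm x)) - \<kappa> * V (ln (norm x)))"
    using nx by (simp add: powr_diff algebra_simps divide_inverse)
  finally have d: "((\<lambda>r. r powr (- \<kappa>) * V (ln r)) has_derivative (\<lambda>h. norm x powr (- \<kappa> - 1) * (V' (ln (norm x)) - \<kappa> * V (ln (norm x))) * h)) (at (norm x))"
    by (simp add: has_field_derivative_def)
  have n: "(norm has_derivative (\<lambda>h. sgn x \<bullet> h)) (at x)" using has_derivative_norm[OF x] by (simp add: inner_commute)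
  have "((\<lambda>x::real ^ 'n. norm x powr (- \<kappa>) * V (ln (norm x))) has_derivative
     (\<lambda>h. norm x powr (- \<kappa> - 1) * (V' (ln (norm x)) - \<kappa> * V (ln (norm x))) * (sgn x \<bullet> h))) (at x)"
    by (rule has_derivative_compose[OF n d])
  from bounded_linear.has_derivative[OF bounded_linear_mult_right bounded_linear.has_derivative[OF bounded_linear_of_real this]]
  have D: "((\<lambda>x::real ^ 'n. \<alpha> * of_real (norm x powr (- \<kappa>) * V (ln (norm x)))) has_derivative
     (\<lambda>h. \<alpha> * of_real (norm x powr (- \<kappa> - 1) * (V' (ln (norm x)) - \<kappa> * V (ln (norm x))) * (sgn x \<bullet> h)))) (at x)" .
  have sg: "sgn x \<bullet> axis i 1 = x $ i / norm x" for i
    by (simp add: inner_axis sgn_div_norm divide_inverse mult.commute)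
  show ?thesis
    unfolding classical_gradient_def radial_gradient_def vec_eq_iff vec_lambda_beta partial_deriv_eqI[OF D] sg
    by (simp add: mult_ac)
qed

lemma radial_gradient_diff:
  "radial_gradient \<alpha> \<kappa> f x - radial_gradient \<alpha> \<kappa> g x = radial_gradient \<alpha> \<kappa> (\<lambda>t. f t - g t) x"
  unfolding radial_gradient_def vec_eq_iff vector_minus_component vec_lambda_beta
  by (intro allI) (simp only: right_diff_distrib of_real_diff)

lemma norm_radial_gradient:
  fixes x :: "real ^ 'n::finite"
  assumes x: "x \<noteq> 0"
  shows "(norm (radial_gradient \<alpha> \<kappa> f x))\<^sup>2 = (norm \<alpha>)\<^sup>2 * (exp (- (2 * \<kappa> + 2) * ln (norm x)) * (f (ln (norm x)))\<^sup>2)"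
proof -
  have nx: "norm x > 0" using x by simp
  have "(norm (radial_gradient \<alpha> \<kappa> f x))\<^sup>2 = (\<Sum>i\<in>UNIV. (norm (radial_gradient \<alpha> \<kappa> f x $ i))\<^sup>2)"
    by (simp add: norm_vec_def L2_set_def sum_nonneg)
  also have "\<dots> = (\<Sum>i\<in>UNIV. (x $ i)\<^sup>2 * ((norm \<alpha>)\<^sup>2 * (norm x powr (- \<kappa> - 1))\<^sup>2 * (f (ln (norm x)))\<^sup>2 / (norm x)\<^sup>2))"
    by (simp add: radial_gradient_def norm_mult power_mult_distrib norm_divide power_divide mult_ac)
  also have "\<dots> = (\<Sum>i\<in>UNIV. (x $ i)\<^sup>2) * ((norm \<alpha>)\<^sup>2 * (norm x powr (- \<kappa> - 1))\<^sup>2 * (f (ln (norm x)))\<^sup>2 / (norm x)\<^sup>2)"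
    by (rule sum_distrib_right[symmetric])
  also have "(\<Sum>i\<in>UNIV. (x $ i)\<^sup>2) = (norm x)\<^sup>2"
    unfolding power2_norm_eq_inner inner_vec_def by (simp add: power2_eq_square)
  also have "(norm x powr (- \<kappa> - 1))\<^sup>2 = exp (- (2 * \<kappa> + 2) * ln (norm x))"
    using nx by (simp add: powr_def power2_eq_square algebra_simps flip: exp_add)
  finally show ?thesis using nx by (simp add: mult_ac)
qed

lemma radial_gradient_measurable:
  fixes f :: "real \<Rightarrow> real"
  assumes [measurable]: "f \<in> borel_measurable borel"
  shows "(radial_gradient \<alpha> \<kappa> f :: real ^ 'n::finite \<Rightarrow> complex ^ 'n) \<in> borel_measurable borel"
proof -
  have c: "(\<lambda>x::real ^ 'n. x $ i) \<in> borel_measurable borel" for i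
    by (intro borel_measurable_continuous_onI continuous_intros)
  have m: "(\<lambda>x::real ^ 'n. \<alpha> * of_real (x $ i / norm x * norm x powr (- \<kappa> - 1) * f (ln (norm x)))) \<in> borel_measurable borel" for i
    using c[of i] by measurable
  have "(\<lambda>x::real ^ 'n. \<Sum>i\<in>UNIV. (axis i (\<alpha> * of_real (x $ i / norm x * norm x powr (- \<kappa> - 1) * f (ln (norm x)))) :: complex ^ 'n)) \<in> borel_measurable borel"
  proof (rule borel_measurable_sum)
    fix i :: 'n
    have "continuous_on UNIV (\<lambda>z::complex. if j = i then z else 0)" for j
      by (cases "j = i") auto
    then have "continuous_on UNIV (\<lambda>z::complex. axis i z :: complex ^ 'n)"
      unfolding axis_def by (intro continuous_on_vec_lambda)
    from measurable_compose[OF m borel_measurable_continuous_onI[OF this]]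
    show "(\<lambda>x::real ^ 'n. (axis i (\<alpha> * of_real (x $ i / norm x * norm x powr (- \<kappa> - 1) * f (ln (norm x)))) :: complex ^ 'n)) \<in> borel_measurable borel" .
  qed
  moreover have "radial_gradient \<alpha> \<kappa> f = (\<lambda>x::real ^ 'n. \<Sum>i\<in>UNIV. (axis i (\<alpha> * of_real (x $ i / norm x * norm x powr (- \<kappa> - 1) * f (ln (norm x)))) :: complex ^ 'n))"
    by (simp add: fun_eq_iff radial_gradient_def vec_eq_iff axis_def)
  ultimately show ?thesis by simp
qed

section \<open>From approximations of a profile to a Sobolev function\<close>

lemma homogeneous_H1_AE:
  fixes u u0 :: "real ^ 'n::finite \<Rightarrow> complex"
  assumes u0: "u0 \<in> homogeneous_H1" and eq: "AE x in lborel. u x = u0 x"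
  shows "u \<in> homogeneous_H1"
proof -
  define p where "p = sobolev_exponent CARD('n)"
  have eqL: "AE x in lebesgue. u x = u0 x" by (rule AE_completion[OF eq])
  have u0m: "u0 \<in> borel_measurable lebesgue" and u0i: "integrable lebesgue (\<lambda>x. norm (u0 x) powr p)"
    using u0 by (auto simp: homogeneous_H1_def p_def Let_def)
  obtain \<phi> where \<phi>: "\<And>k. \<phi> k \<in> test_functions"
    and cau: "\<forall>e>0. \<exists>N. \<forall>m\<ge>N. \<forall>n\<ge>N. Lp_norm 2 (\<lambda>x. classical_gradient (\<phi> m) x - classical_gradient (\<phi> n) x) < e"
    and lim: "(\<lambda>k. Lp_norm p (\<lambda>x. \<phi> k x - u0 x)) \<longlonglongrightarrow> 0"
    using u0 unfolding homogeneous_H1_def p_def Let_def by blast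
  have um: "u \<in> borel_measurable lebesgue" by (rule borel_measurable_lebesgue_AE[OF u0m eq])
  have nm: "(\<lambda>x. norm (f x) powr q) \<in> borel_measurable lebesgue" if "f \<in> borel_measurable lebesgue" for f :: "real ^ 'n \<Rightarrow> complex" and q
    by (rule measurable_compose[OF measurable_compose[OF that borel_measurable_norm], where g="\<lambda>r. r powr q"]) measurable
  have ui: "integrable lebesgue (\<lambda>x. norm (u x) powr p)"
    by (rule integrable_cong_AE_imp[OF u0i nm[OF um]]) (use eqL in \<open>eventually_elim, simp\<close>)
  have "Lp_norm p (\<lambda>x. \<phi> k x - u x) = Lp_norm p (\<lambda>x. \<phi> k x - u0 x)" for k
  proof -
    have \<phi>L: "\<phi> k \<in> borel_measurable lebesgue"
      by (rule measurable_completion) (use test_function_measurable[OF \<phi>[of k]] in simp)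
    have "(LINT x|lebesgue. norm (\<phi> k x - u x) powr p) = (LINT x|lebesgue. norm (\<phi> k x - u0 x) powr p)"
      by (rule integral_cong_AE[OF nm[OF borel_measurable_diff[OF \<phi>L um]] nm[OF borel_measurable_diff[OF \<phi>L u0m]]])
         (use eqL in \<open>eventually_elim, simp\<close>)
    then show ?thesis by (simp add: Lp_norm_def)
  qed
  then have "(\<lambda>k. Lp_norm p (\<lambda>x. \<phi> k x - u x)) \<longlonglongrightarrow> 0" using lim by simp
  with \<phi> cau um ui show ?thesis unfolding homogeneous_H1_def p_def Let_def by blast
qed

lemma is_weak_gradient_AE:
  fixes u u0 :: "real ^ 'n::finite \<Rightarrow> complex"
  assumes wg: "is_weak_gradient u0 G" and eq: "AE x in lborel. u x = u0 x"
  shows "is_weak_gradient u G"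
proof -
  have eqL: "AE x in lebesgue. u x = u0 x" by (rule AE_completion[OF eq])
  have lu0: "locally_integrable u0" using wg by (simp add: is_weak_gradient_def)
  have u0m: "u0 \<in> borel_measurable lebesgue" by (rule locally_integrable_measurable[OF lu0])
  have um: "u \<in> borel_measurable lebesgue" by (rule borel_measurable_lebesgue_AE[OF u0m eq])
  have "locally_integrable u"
    unfolding locally_integrable_def set_integrable_def
  proof (intro allI impI)
    fix K :: "(real ^ 'n) set" assume K: "compact K"
    then have "integrable lebesgue (\<lambda>x. indicator K x *\<^sub>R u0 x)"
      using lu0 by (simp add: locally_integrable_def set_integrable_def)
    then show "integrable lebesgue (\<lambda>x. indicator K x *\<^sub>R u x)"
    proof (rule integrable_cong_AE_imp)
      show "(\<lambda>x. indicator K x *\<^sub>R u x) \<in> borel_measurable lebesgue"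
        using K by (intro borel_measurable_scaleR borel_measurable_indicator um) (simp add: compact_imp_closed)
      show "AE x in lebesgue. indicator K x *\<^sub>R u0 x = indicator K x *\<^sub>R u x" using eqL by eventually_elim simp
    qed
  qed
  moreover have "(LINT x|lebesgue. u x * partial_deriv i \<psi> x) = (LINT x|lebesgue. u0 x * partial_deriv i \<psi> x)"
    if \<psi>: "\<psi> \<in> test_functions" for \<psi> i
  proof (rule integral_cong_AE)
    have m: "partial_deriv i \<psi> \<in> borel_measurable lebesgue"
      by (rule measurable_completion) (use test_function_measurable[OF partial_deriv_test_function[OF \<psi>]] in simp)
    show "(\<lambda>x. u x * partial_deriv i \<psi> x) \<in> borel_measurable lebesgue" by (rule borel_measurable_times[OF um m])
    show "(\<lambda>x. u0 x * partial_deriv i \<psi> x) \<in> borel_measurable lebesgue" by (rule borel_measurable_times[OF u0m m])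
    show "AE x in lebesgue. u x * partial_deriv i \<psi> x = u0 x * partial_deriv i \<psi> x" using eqL by eventually_elim simp
  qed
  ultimately show ?thesis using wg by (simp add: is_weak_gradient_def)
qed

text \<open>The radial functions with profiles \<open>V j\<close> are test functions, and all their
  errors are integrals over the line. The hypothesis \<open>odd\<close> removes the cross term from
  the square of \<open>v' t - \<kappa> * v t\<close>, so subtracting the Hardy term leaves exactly
  the integral of \<open>(v' t)\<^sup>2\<close>. Certifying optimizers requires this exact value,
  not just a bound.\<close>

lemma explicit_profile:
  fixes u :: "real ^ 'n::finite \<Rightarrow> complex" and V V' :: "nat \<Rightarrow> real \<Rightarrow> real" and v v' :: "real \<Rightarrow> real"
  assumes d: "CARD('n) \<ge> 3"
  defines "\<kappa> \<equiv> (real CARD('n) - 2) / 2" and "N \<equiv> sphere_area TYPE(real ^ 'n)" and "p \<equiv> sobolev_exponent CARD('n)"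
  assumes V: "\<And>j k. differentiable_order k UNIV (V j)" and supp: "\<And>j. \<exists>T. \<forall>t. \<bar>t\<bar> \<ge> T \<longrightarrow> V j t = 0"
    and dV: "\<And>j t. (V j has_real_derivative V' j t) (at t)"
    and v[measurable]: "v \<in> borel_measurable borel" and v'[measurable]: "v' \<in> borel_measurable borel"
    and V'm[measurable]: "\<And>j. V' j \<in> borel_measurable borel"
    and v2: "integrable lborel (\<lambda>t. (v t)\<^sup>2)" and v'2: "integrable lborel (\<lambda>t. (v' t)\<^sup>2)"
    and vp: "integrable lborel (\<lambda>t. \<bar>v t\<bar> powr p)"
    and i1: "\<And>j. integrable lborel (\<lambda>t. (V' j t - v' t)\<^sup>2)" and i2: "\<And>j. integrable lborel (\<lambda>t. (V j t - v t)\<^sup>2)"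
    and l1: "(\<lambda>j. LINT t|lborel. (V' j t - v' t)\<^sup>2) \<longlonglongrightarrow> 0" and l2: "(\<lambda>j. LINT t|lborel. (V j t - v t)\<^sup>2) \<longlonglongrightarrow> 0"
    and lp: "(\<lambda>j. LINT t|lborel. \<bar>V j t - v t\<bar> powr p) \<longlonglongrightarrow> 0"
    and odd: "(LINT t|lborel. v t * v' t) = 0"
    and u: "AE x in lborel. u x = \<alpha> * of_real (norm x powr (- \<kappa>) * v (ln (norm x)))"
  shows "u \<in> homogeneous_H1_rad"
    and "hardy_form u = N * (norm \<alpha>)\<^sup>2 * (LINT t|lborel. (v' t)\<^sup>2)"
    and "hardy_integral u = N * (norm \<alpha>)\<^sup>2 * (LINT t|lborel. (v t)\<^sup>2)"
    and "(LINT x|lebesgue. norm (u x) powr p) = N * norm \<alpha> powr p * (LINT t|lborel. \<bar>v t\<bar> powr p)"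
proof -
  define n where "n = real CARD('n)"
  have n3: "n \<ge> 3" using d by (simp add: n_def)
  have \<kappa>n: "2 * \<kappa> + 2 = n" by (simp add: \<kappa>_def n_def field_simps)
  have \<kappa>p: "\<kappa> * p = n" using n3 by (simp add: \<kappa>_def p_def sobolev_exponent_def n_def)
  have p2: "p > 2" unfolding p_def by (rule sobolev_exponent_gt_2[OF d])
  define u0 where "u0 x = \<alpha> * of_real (norm x powr (- \<kappa>) * v (ln (norm x)))" for x :: "real ^ 'n"
  have u0m[measurable]: "u0 \<in> borel_measurable borel" unfolding u0_def by measurable
  have uu0: "AE x in lborel. u x = u0 x" using u by (simp add: u0_def)
  define \<phi> where "\<phi> j x = \<alpha> * of_real (norm x powr (- \<kappa>) * V j (ln (norm x)))" for j and x :: "real ^ 'n"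
  have \<phi>: "\<phi> j \<in> test_functions" for j
  proof -
    obtain T where "\<And>t. \<bar>t\<bar> \<ge> T \<Longrightarrow> V j t = 0" using supp by blast
    then show ?thesis unfolding \<phi>_def by (rule radial_test_function[OF V])
  qed
  have Vm[measurable]: "V j \<in> borel_measurable borel" for j
    using differentiable_order_continuous[OF V[of 0 j]] by (rule borel_measurable_continuous_onI)
  define f where "f t = v' t - \<kappa> * v t" for t
  have fm[measurable]: "f \<in> borel_measurable borel" unfolding f_def by measurable
  define G :: "real ^ 'n \<Rightarrow> complex ^ 'n" where "G = radial_gradient \<alpha> \<kappa> f"
  have Gm[measurable]: "G \<in> borel_measurable borel" unfolding G_def by (rule radial_gradient_measurable[OF fm])
  have vv': "integrable lborel (\<lambda>t. v t * v' t)"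
    using integrable_inner_L2[of v lborel v'] v2 v'2 by simp
  have f2: "(f t)\<^sup>2 = (v' t)\<^sup>2 - 2 * \<kappa> * (v t * v' t) + \<kappa>\<^sup>2 * (v t)\<^sup>2" for t
    by (simp add: f_def power2_eq_square algebra_simps)
  have fi: "integrable lborel (\<lambda>t. (f t)\<^sup>2)" unfolding f2 using v2 v'2 vv' by simp
  have fI: "(LINT t|lborel. (f t)\<^sup>2) = (LINT t|lborel. (v' t)\<^sup>2) + \<kappa>\<^sup>2 * (LINT t|lborel. (v t)\<^sup>2)"
    unfolding f2 using v2 v'2 vv' odd by simp
  have Gn: "AE x in lborel. (norm (radial_gradient \<alpha> \<kappa> h x))\<^sup>2 = exp (- n * ln (norm x)) * ((norm \<alpha>)\<^sup>2 * (h (ln (norm (x::real ^ 'n))))\<^sup>2)" for h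
    using AE_lborel_singleton[of "0 :: real ^ 'n"]
  proof eventually_elim
    case (elim x)
    then show ?case unfolding norm_radial_gradient[OF elim] \<kappa>n by simp
  qed
  have Gint: "integrable lborel (\<lambda>x. (norm (radial_gradient \<alpha> \<kappa> h (x::real ^ 'n)))\<^sup>2)"
       "(LINT x|lborel. (norm (radial_gradient \<alpha> \<kappa> h (x::real ^ 'n)))\<^sup>2) = N * (norm \<alpha>)\<^sup>2 * (LINT t|lborel. (h t)\<^sup>2)"
    if [measurable]: "h \<in> borel_measurable borel" and hi: "integrable lborel (\<lambda>t. (h t)\<^sup>2)" for h
  proof -
    have rm[measurable]: "(radial_gradient \<alpha> \<kappa> h :: real ^ 'n \<Rightarrow> _) \<in> borel_measurable borel" by (rule radial_gradient_measurable) fact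
    have m: "(\<lambda>t. (norm \<alpha>)\<^sup>2 * (h t)\<^sup>2) \<in> borel_measurable borel" by measurable
    have i: "integrable lborel (\<lambda>x::real ^ 'n. exp (- n * ln (norm x)) * ((norm \<alpha>)\<^sup>2 * (h (ln (norm x)))\<^sup>2))"
      using integral_radial_weighted(1)[OF m, where 'n='n] hi unfolding n_def by simp
    show "integrable lborel (\<lambda>x. (norm (radial_gradient \<alpha> \<kappa> h (x::real ^ 'n)))\<^sup>2)"
      by (rule integrable_cong_AE_imp[OF i _ AE_symmetric[OF Gn]]) measurable
    have "(LINT x|lborel. (norm (radial_gradient \<alpha> \<kappa> h (x::real ^ 'n)))\<^sup>2) = (LINT x|lborel. exp (- n * ln (norm (x::real ^ 'n))) * ((norm \<alpha>)\<^sup>2 * (h (ln (norm x)))\<^sup>2))"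
      by (rule integral_cong_AE[OF _ _ Gn]) measurable
    also have "\<dots> = N * (LINT t|lborel. (norm \<alpha>)\<^sup>2 * (h t)\<^sup>2)"
      using integral_radial_weighted(2)[OF m, where 'n='n] unfolding n_def N_def by simp
    finally show "(LINT x|lborel. (norm (radial_gradient \<alpha> \<kappa> h (x::real ^ 'n)))\<^sup>2) = N * (norm \<alpha>)\<^sup>2 * (LINT t|lborel. (h t)\<^sup>2)" by simp
  qed
  have Pint: "integrable lborel (\<lambda>x. norm (h x) powr p)" "(LINT x|lborel. norm (h x) powr p) = N * norm \<alpha> powr p * (LINT t|lborel. \<bar>y t\<bar> powr p)"
    if y[measurable]: "y \<in> borel_measurable borel" and yi: "integrable lborel (\<lambda>t. \<bar>y t\<bar> powr p)"
      and h: "\<And>x. h x = \<alpha> * of_real (norm x powr (- \<kappa>) * y (ln (norm x)))" for h :: "real ^ 'n \<Rightarrow> complex" and y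
  proof -
    have hm[measurable]: "h \<in> borel_measurable borel" unfolding h[abs_def] by measurable
    have m: "(\<lambda>t. norm \<alpha> powr p * \<bar>y t\<bar> powr p) \<in> borel_measurable borel" by measurable
    have i: "integrable lborel (\<lambda>x::real ^ 'n. exp (- n * ln (norm x)) * (norm \<alpha> powr p * \<bar>y (ln (norm x))\<bar> powr p))"
      using integral_radial_weighted(1)[OF m, where 'n='n] yi unfolding n_def by simp
    have ae: "AE x in lborel. norm (h x) powr p = exp (- n * ln (norm x)) * (norm \<alpha> powr p * \<bar>y (ln (norm x))\<bar> powr p)"
      unfolding n_def by (rule radial_power_AE[of h \<alpha> \<kappa> y]) (use h \<kappa>p in \<open>auto simp: n_def\<close>)
    show "integrable lborel (\<lambda>x. norm (h x) powr p)"
      by (rule integrable_cong_AE_imp[OF i _ AE_symmetric[OF ae]]) measurable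
    have "(LINT x|lborel. norm (h x) powr p) = (LINT x|lborel. exp (- n * ln (norm (x::real ^ 'n))) * (norm \<alpha> powr p * \<bar>y (ln (norm x))\<bar> powr p))"
      by (rule integral_cong_AE[OF _ _ ae]) measurable
    also have "\<dots> = N * (LINT t|lborel. norm \<alpha> powr p * \<bar>y t\<bar> powr p)"
      using integral_radial_weighted(2)[OF m, where 'n='n] unfolding n_def N_def by simp
    finally show "(LINT x|lborel. norm (h x) powr p) = N * norm \<alpha> powr p * (LINT t|lborel. \<bar>y t\<bar> powr p)" by simp
  qed
  have ip: "integrable lborel (\<lambda>t. \<bar>V j t - v t\<bar> powr p)" for j
  proof -
    obtain T where T: "\<And>t. \<bar>t\<bar> \<ge> T \<Longrightarrow> V j t = 0" using supp by blast
    have "integrable lborel (\<lambda>t. \<bar>V j t\<bar> powr p)"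
      by (rule integrable_continuous_compact_support[of _ T])
         (use T p2 in \<open>auto intro!: continuous_on_powr' continuous_on_rabs differentiable_order_continuous[OF V[of 0 j]] continuous_on_const\<close>)
    then show ?thesis
      using integrable_norm_diff_powr[of "\<lambda>t. complex_of_real (V j t)" lborel "\<lambda>t. complex_of_real (v t)" p] vp p2
      by (simp flip: of_real_diff)
  qed
  have up: "integrable lborel (\<lambda>x. norm (u0 x) powr p)"
    by (rule Pint(1)[OF v vp]) (simp add: u0_def)
  have lim: "(\<lambda>j. LINT x|lborel. norm (\<phi> j x - u0 x) powr p) \<longlonglongrightarrow> 0"
  proof -
    have "(LINT x|lborel. norm (\<phi> j x - u0 x) powr p) = N * norm \<alpha> powr p * (LINT t|lborel. \<bar>V j t - v t\<bar> powr p)" for j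
      by (rule Pint(2)[OF _ ip]) (simp_all add: \<phi>_def u0_def algebra_simps)
    then show ?thesis using tendsto_mult_left[OF lp, of "N * norm \<alpha> powr p"] by simp
  qed
  have limG: "(\<lambda>j. LINT x|lborel. (norm (classical_gradient (\<phi> j) x - G x))\<^sup>2) \<longlonglongrightarrow> 0"
  proof -
    define e where "e j t = (V' j t - \<kappa> * V j t) - f t" for j t
    have em[measurable]: "e j \<in> borel_measurable borel" for j unfolding e_def by measurable
    have eb: "(e j t)\<^sup>2 \<le> 2 * (V' j t - v' t)\<^sup>2 + 2 * \<kappa>\<^sup>2 * (V j t - v t)\<^sup>2" for j t
    proof -
      have "e j t = (V' j t - v' t) - \<kappa> * (V j t - v t)" by (simp add: e_def f_def algebra_simps)
      then show ?thesis using norm_diff_square_le[of "V' j t - v' t" "\<kappa> * (V j t - v t)"] by (simp add: power_mult_distrib)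
    qed
    have bi: "integrable lborel (\<lambda>t. 2 * (V' j t - v' t)\<^sup>2 + 2 * \<kappa>\<^sup>2 * (V j t - v t)\<^sup>2)" for j using i1 i2 by simp
    have ei: "integrable lborel (\<lambda>t. (e j t)\<^sup>2)" for j
    proof (rule Bochner_Integration.integrable_bound[OF bi])
      show "AE t in lborel. norm ((e j t)\<^sup>2) \<le> norm (2 * (V' j t - v' t)\<^sup>2 + 2 * \<kappa>\<^sup>2 * (V j t - v t)\<^sup>2)"
        using eb by (intro AE_I2) simp
    qed measurable
    have "(\<lambda>j. LINT t|lborel. (e j t)\<^sup>2) \<longlonglongrightarrow> 0"
    proof (rule tendsto_sandwich[OF _ _ tendsto_const])
      show "(\<lambda>j. 2 * (LINT t|lborel. (V' j t - v' t)\<^sup>2) + 2 * \<kappa>\<^sup>2 * (LINT t|lborel. (V j t - v t)\<^sup>2)) \<longlonglongrightarrow> 0"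
        using tendsto_add[OF tendsto_mult_left[OF l1, of 2] tendsto_mult_left[OF l2, of "2 * \<kappa>\<^sup>2"]] by simp
      have "(LINT t|lborel. (e j t)\<^sup>2) \<le> (LINT t|lborel. 2 * (V' j t - v' t)\<^sup>2 + 2 * \<kappa>\<^sup>2 * (V j t - v t)\<^sup>2)" for j
        by (rule integral_mono[OF ei bi eb])
      then show "\<forall>\<^sub>F j in sequentially. (LINT t|lborel. (e j t)\<^sup>2) \<le> 2 * (LINT t|lborel. (V' j t - v' t)\<^sup>2) + 2 * \<kappa>\<^sup>2 * (LINT t|lborel. (V j t - v t)\<^sup>2)"
        using i1 i2 by simp
    qed (simp add: Bochner_Integration.integral_nonneg)
    moreover have "(LINT x|lborel. (norm (classical_gradient (\<phi> j) x - G x))\<^sup>2) = N * (norm \<alpha>)\<^sup>2 * (LINT t|lborel. (e j t)\<^sup>2)" for j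
    proof -
      have rm[measurable]: "(radial_gradient \<alpha> \<kappa> (e j) :: real ^ 'n \<Rightarrow> _) \<in> borel_measurable borel" by (rule radial_gradient_measurable) simp
      have [measurable]: "classical_gradient (\<phi> j) \<in> borel_measurable borel" by (rule gradient_test_function_measurable[OF \<phi>])
      have "AE x in lborel. (norm (classical_gradient (\<phi> j) x - G x))\<^sup>2 = (norm (radial_gradient \<alpha> \<kappa> (e j) x))\<^sup>2"
        using AE_lborel_singleton[of "0 :: real ^ 'n"]
      proof eventually_elim
        case (elim x)
        show ?case
          unfolding \<phi>_def G_def classical_gradient_radial[OF dV elim] radial_gradient_diff e_def ..
      qed
      then have "(LINT x|lborel. (norm (classical_gradient (\<phi> j) x - G x))\<^sup>2) = (LINT x|lborel. (norm (radial_gradient \<alpha> \<kappa> (e j) (x::real ^ 'n)))\<^sup>2)"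
        by (intro integral_cong_AE) measurable
      then show ?thesis using Gint(2)[OF em ei] by simp
    qed
    ultimately show ?thesis using tendsto_mult_left[of "\<lambda>j. LINT t|lborel. (e j t)\<^sup>2" 0 sequentially "N * (norm \<alpha>)\<^sup>2"] by simp
  qed
  have G2: "integrable lborel (\<lambda>x. (norm (G x))\<^sup>2)" unfolding G_def by (rule Gint(1)[OF fm fi])
  note H1 = homogeneous_H1I[OF \<phi> d u0m up[unfolded p_def] lim[unfolded p_def] Gm G2 limG]
  have wg: "is_weak_gradient u G" by (rule is_weak_gradient_AE[OF H1(2) uu0])
  have "radial u"
    unfolding radial_def
    by (rule exI[of _ "\<lambda>r. \<alpha> * of_real (r powr (- \<kappa>) * v (ln r))"]) (rule AE_completion[OF u])
  then show "u \<in> homogeneous_H1_rad"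
    using homogeneous_H1_AE[OF H1(1) uu0] by (simp add: homogeneous_H1_rad_def)
  have u0L: "u0 \<in> borel_measurable lebesgue" by (rule measurable_completion) simp
  have uL: "u \<in> borel_measurable lebesgue" by (rule borel_measurable_lebesgue_AE[OF u0L uu0])
  have ua: "AE x in lborel. u x = of_real (norm x powr (- \<kappa>)) * (\<alpha> * of_real (v (ln (norm x))))"
    using u by eventually_elim simp
  have vam: "(\<lambda>t. \<alpha> * of_real (v t)) \<in> borel_measurable borel" by measurable
  show hi: "hardy_integral u = N * (norm \<alpha>)\<^sup>2 * (LINT t|lborel. (v t)\<^sup>2)"
    using hardy_integral_profile[OF ua vam uL \<kappa>n[unfolded n_def]]
    by (simp add: N_def norm_mult power_mult_distrib)
  have "(real CARD('n) - 2)\<^sup>2 / 4 = \<kappa>\<^sup>2" by (simp add: \<kappa>_def power_divide)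
  then have "hardy_form u = (LINT x|lborel. (norm (G x))\<^sup>2) - \<kappa>\<^sup>2 * hardy_integral u"
    unfolding hardy_form_def integral_weak_gradient[OF wg Gm] by simp
  then show "hardy_form u = N * (norm \<alpha>)\<^sup>2 * (LINT t|lborel. (v' t)\<^sup>2)"
    unfolding hi G_def Gint(2)[OF fm fi] fI by (simp add: algebra_simps)
  show "(LINT x|lebesgue. norm (u x) powr p) = N * norm \<alpha> powr p * (LINT t|lborel. \<bar>v t\<bar> powr p)"
    using Lp_norm_profile(2)[OF ua vam uL \<kappa>p[unfolded n_def]] by (simp add: N_def norm_mult powr_mult)
qed

lemma decaying_powr:
  fixes f :: "nat \<Rightarrow> real \<Rightarrow> real"
  assumes c: "c > 0" and q: "q > 0" and [measurable]: "\<And>j. f j \<in> borel_measurable borel"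
    and b: "\<And>j t. \<bar>f j t\<bar> \<le> M * exp (- c * \<bar>t\<bar>)"
  shows "integrable lborel (\<lambda>t. \<bar>f j t\<bar> powr q)"
    and "AE t in lborel. (\<lambda>j. f j t) \<longlonglongrightarrow> 0 \<Longrightarrow> (\<lambda>j. LINT t|lborel. \<bar>f j t\<bar> powr q) \<longlonglongrightarrow> 0"
proof -
  have M: "M \<ge> 0" using b[of 0 0] by simp
  have d: "\<bar>f j t\<bar> powr q \<le> M powr q * exp (- (c * q) * \<bar>t\<bar>)" for j t
  proof -
    have "\<bar>f j t\<bar> powr q \<le> (M * exp (- c * \<bar>t\<bar>)) powr q" using q by (intro powr_mono2 b) auto
    also have "\<dots> = M powr q * exp (- (c * q) * \<bar>t\<bar>)" using M by (simp add: powr_mult exp_powr_real mult_ac)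
    finally show ?thesis .
  qed
  have I: "integrable lborel (\<lambda>t. M powr q * exp (- (c * q) * \<bar>t\<bar>))"
    using integrable_exp_abs[of "c * q"] c q by simp
  show "integrable lborel (\<lambda>t. \<bar>f j t\<bar> powr q)"
    by (rule Bochner_Integration.integrable_bound[OF I]) (use d in \<open>auto intro!: AE_I2\<close>)
  assume l: "AE t in lborel. (\<lambda>j. f j t) \<longlonglongrightarrow> 0"
  have "(\<lambda>j. LINT t|lborel. \<bar>f j t\<bar> powr q) \<longlonglongrightarrow> integral\<^sup>L lborel (\<lambda>_::real. 0::real)"
  proof (rule integral_dominated_convergence[where s="\<lambda>j t. \<bar>f j t\<bar> powr q" and f="\<lambda>_. 0" and w="\<lambda>t. M powr q * exp (- (c * q) * \<bar>t\<bar>)"])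
    show "AE t in lborel. (\<lambda>j. \<bar>f j t\<bar> powr q) \<longlonglongrightarrow> 0"
      using l
    proof eventually_elim
      case (elim t)
      have "(\<lambda>j. \<bar>f j t\<bar> powr q) \<longlonglongrightarrow> 0 powr q"
        using q by (intro tendsto_powr2 tendsto_rabs_zero[OF elim] tendsto_const) auto
      then show ?case using q by simp
    qed
  qed (use d I in \<open>auto intro!: AE_I2\<close>)
  then show "(\<lambda>j. LINT t|lborel. \<bar>f j t\<bar> powr q) \<longlonglongrightarrow> 0" by simp
qed

lemma smooth_cutoff:
  obtains cut cut' :: "real \<Rightarrow> real" and K :: real where
    "\<And>k. differentiable_order k UNIV cut" "\<And>t. (cut has_real_derivative cut' t) (at t)"
    "cut 0 = 1" "\<And>t. \<bar>t\<bar> \<ge> 1 \<Longrightarrow> cut t = 0" "\<And>t. \<bar>cut t\<bar> \<le> K" "\<And>t. \<bar>cut' t\<bar> \<le> K"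
proof -
  \<comment> \<open>At 0 both flat factors equal \<open>exp (- 1)\<close>; the factor
    \<open>exp 2\<close> makes the value there 1.\<close>
  define cut where "cut t = exp 2 * (flat_exp 0 (1 + t) * flat_exp 0 (1 - t))" for t :: real
  define cut' where "cut' t = exp 2 * (flat_exp 2 (1 + t) * flat_exp 0 (1 - t) - flat_exp 0 (1 + t) * flat_exp 2 (1 - t))" for t :: real
  have aff: "differentiable_order k UNIV (\<lambda>t. 1 + t :: real)" "differentiable_order k UNIV (\<lambda>t. 1 - t :: real)" for k
    using differentiable_order_add[OF open_UNIV differentiable_order_const[OF open_UNIV, of k 1] differentiable_order_ident[OF open_UNIV]]
      differentiable_order_add[OF open_UNIV differentiable_order_const[OF open_UNIV, of k 1]
        differentiable_order_cmult[OF open_UNIV differentiable_order_ident[OF open_UNIV], where c="-1"]] by simp_all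
  have sm: "differentiable_order k UNIV cut" for k
    unfolding cut_def[abs_def]
    by (intro differentiable_order_cmult differentiable_order_mult open_UNIV aff
         differentiable_order_compose[OF open_UNIV open_UNIV UNIV_I differentiable_order_flat_exp])
  have d1: "((\<lambda>t. flat_exp 0 (1 + t)) has_real_derivative flat_exp 2 (1 + t)) (at t)" for t
    using DERIV_chain2[where g="\<lambda>t. 1 + t", OF flat_exp_deriv[of 0 "1 + t"] DERIV_add[OF DERIV_const DERIV_ident], of UNIV] by (simp add: numeral_2_eq_2)
  have d2: "((\<lambda>t. flat_exp 0 (1 - t)) has_real_derivative - flat_exp 2 (1 - t)) (at t)" for t
    using DERIV_chain2[where g="\<lambda>t. 1 - t", OF flat_exp_deriv[of 0 "1 - t"] DERIV_diff[OF DERIV_const DERIV_ident], of UNIV] by (simp add: numeral_2_eq_2)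
  have d: "(cut has_real_derivative cut' t) (at t)" for t
    unfolding cut_def cut'_def by (rule derivative_eq_intros d1 d2 refl)+ (simp add: algebra_simps)
  have fc: "continuous_on UNIV (flat_exp n)" for n
    by (rule differentiable_order_continuous[OF differentiable_order_flat_exp])
  have fc1: "continuous_on S (\<lambda>t. flat_exp n (1 + t))" "continuous_on S (\<lambda>t. flat_exp n (1 - t))" for n S
    by (auto intro!: continuous_on_compose2[OF fc] continuous_intros)
  have "continuous_on {-1..1} cut" "continuous_on {-1..1} cut'"
    unfolding cut_def cut'_def by (intro continuous_intros fc1)+
  then have "compact (cut ` {-1..1})" "compact (cut' ` {-1..1})" by (auto intro: compact_continuous_image)
  then have "bounded (cut ` {-1..1} \<union> cut' ` {-1..1})" by (auto intro: compact_imp_bounded)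
  then obtain K where K: "\<And>y. y \<in> cut ` {-1..1} \<union> cut' ` {-1..1} \<Longrightarrow> norm y \<le> K" unfolding bounded_iff by blast
  have z: "cut t = 0" "cut' t = 0" if "\<bar>t\<bar> \<ge> 1" for t
    using that by (auto simp: cut_def cut'_def flat_exp_def)
  have K0: "K \<ge> 0" using K[of "cut 0"] norm_ge_zero[of "cut 0"] by (auto intro: order_trans)
  have "\<bar>cut t\<bar> \<le> K" "\<bar>cut' t\<bar> \<le> K" for t
    using K[of "cut t"] K[of "cut' t"] z[of t] K0 by (cases "\<bar>t\<bar> \<ge> 1"; force)+
  moreover have "cut 0 = 1" by (simp add: cut_def flat_exp_def flip: exp_add)
  ultimately show thesis using sm d z(1) that by blast
qed

text \<open>Multiplication by \<open>cut (s j * t)\<close> with \<open>s j\<close> tending to 0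
  gives compact support. The additional term in the derivative carries the factor
  \<open>s j\<close>, and a common exponential bound dominates all errors. A sequence
  \<open>P\<close> stands beside \<open>v\<close> because the exponential profile has a corner and
  must be smoothed.\<close>

lemma decaying_profile:
  fixes u :: "real ^ 'n::finite \<Rightarrow> complex" and P P' :: "nat \<Rightarrow> real \<Rightarrow> real" and v v' :: "real \<Rightarrow> real"
  assumes d: "CARD('n) \<ge> 3"
  defines "\<kappa> \<equiv> (real CARD('n) - 2) / 2" and "N \<equiv> sphere_area TYPE(real ^ 'n)" and "p \<equiv> sobolev_exponent CARD('n)"
  assumes P: "\<And>j k. differentiable_order k UNIV (P j)" and dP: "\<And>j t. (P j has_real_derivative P' j t) (at t)"
    and v[measurable]: "v \<in> borel_measurable borel" and v'[measurable]: "v' \<in> borel_measurable borel"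
    and c: "c > 0"
    and b: "\<And>j t. \<bar>P j t\<bar> \<le> M * exp (- c * \<bar>t\<bar>)" "\<And>j t. \<bar>P' j t\<bar> \<le> M * exp (- c * \<bar>t\<bar>)"
      "\<And>t. \<bar>v t\<bar> \<le> M * exp (- c * \<bar>t\<bar>)" "\<And>t. \<bar>v' t\<bar> \<le> M * exp (- c * \<bar>t\<bar>)"
    and lim: "AE t in lborel. (\<lambda>j. P j t) \<longlonglongrightarrow> v t" "AE t in lborel. (\<lambda>j. P' j t) \<longlonglongrightarrow> v' t"
    and odd: "(LINT t|lborel. v t * v' t) = 0"
    and u: "AE x in lborel. u x = \<alpha> * of_real (norm x powr (- \<kappa>) * v (ln (norm x)))"
  shows "u \<in> homogeneous_H1_rad"
    and "hardy_form u = N * (norm \<alpha>)\<^sup>2 * (LINT t|lborel. (v' t)\<^sup>2)"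
    and "hardy_integral u = N * (norm \<alpha>)\<^sup>2 * (LINT t|lborel. (v t)\<^sup>2)"
    and "(LINT x|lebesgue. norm (u x) powr p) = N * norm \<alpha> powr p * (LINT t|lborel. \<bar>v t\<bar> powr p)"
proof -
  have p2: "p > 2" unfolding p_def by (rule sobolev_exponent_gt_2[OF d])
  obtain cut cut' :: "real \<Rightarrow> real" and K where cut: "\<And>k. differentiable_order k UNIV cut" "\<And>t. (cut has_real_derivative cut' t) (at t)"
    and cut0: "cut 0 = 1" and cut1: "\<And>t. \<bar>t\<bar> \<ge> 1 \<Longrightarrow> cut t = 0" and K: "\<And>t. \<bar>cut t\<bar> \<le> K" "\<And>t. \<bar>cut' t\<bar> \<le> K"
    by (rule smooth_cutoff) (rule that, assumption+)
  have K0: "K \<ge> 0" using K(1)[of 0] by (auto intro: order_trans[OF abs_ge_zero])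
  have M0: "M \<ge> 0" using b(3)[of 0] by simp
  define s where "s j = inverse (real (Suc j))" for j
  have s: "0 < s j" "s j \<le> 1" for j by (auto simp: s_def inverse_le_1_iff)
  have s0: "s \<longlonglongrightarrow> 0" unfolding s_def by (rule LIMSEQ_inverse_real_of_nat)
  define V where "V j t = P j t * cut (s j * t)" for j t
  define V' where "V' j t = P' j t * cut (s j * t) + s j * (P j t * cut' (s j * t))" for j t
  have V: "differentiable_order k UNIV (V j)" for j k
    unfolding V_def[abs_def]
    by (intro differentiable_order_mult open_UNIV P differentiable_order_compose[OF open_UNIV open_UNIV UNIV_I cut(1)]
        differentiable_order_cmult differentiable_order_ident)
  have dV: "(V j has_real_derivative V' j t) (at t)" for j t
  proof -
    have "((\<lambda>t. cut (s j * t)) has_real_derivative cut' (s j * t) * s j) (at t)"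
      by (rule DERIV_chain2[OF cut(2)]) (auto intro!: derivative_eq_intros)
    from DERIV_mult[OF dP this] show ?thesis unfolding V_def[abs_def] V'_def by (simp add: mult_ac add.commute)
  qed
  have dm: "D \<in> borel_measurable borel"
    if "differentiable_order (Suc 0) UNIV f" "\<And>t. (f has_real_derivative D t) (at t)" for f D :: "real \<Rightarrow> real"
  proof -
    have "deriv f = D" using DERIV_imp_deriv[OF that(2)] by (intro ext)
    then have "continuous_on UNIV D" using that(1) by simp
    then show ?thesis by (rule borel_measurable_continuous_onI)
  qed
  have [measurable]: "V j \<in> borel_measurable borel" "V' j \<in> borel_measurable borel" for j
    using borel_measurable_continuous_onI[OF differentiable_order_continuous[OF V[of 0 j]]] dm[OF V dV] by auto
  have supp: "\<exists>T. \<forall>t. \<bar>t\<bar> \<ge> T \<longrightarrow> V j t = 0" for j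
  proof (intro exI allI impI)
    fix t assume "\<bar>t\<bar> \<ge> 1 / s j"
    then have "\<bar>s j * t\<bar> \<ge> 1" using s[of j] by (simp add: abs_mult field_simps)
    then show "V j t = 0" by (simp add: V_def cut1)
  qed
  have chb: "\<bar>x * cut y\<bar> \<le> M * K * exp (- c * \<bar>t\<bar>)" "\<bar>x * cut' y\<bar> \<le> M * K * exp (- c * \<bar>t\<bar>)"
    if "\<bar>x\<bar> \<le> M * exp (- c * \<bar>t\<bar>)" for x y t
    using mult_mono[OF that K(1)[of y]] mult_mono[OF that K(2)[of y]] M0 by (simp_all add: abs_mult mult_ac)
  define M' where "M' = M * K + M * K + M"
  have Mge: "M * exp (- c * \<bar>t\<bar>) \<ge> 0" "M * K * exp (- c * \<bar>t\<bar>) \<ge> 0" for t using M0 K0 by auto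
  have e1: "\<bar>V j t - v t\<bar> \<le> M' * exp (- c * \<bar>t\<bar>)" for j t
    using chb(1)[OF b(1)[of j t], of "s j * t"] b(3)[of t] Mge(2)[of t]
      abs_triangle_ineq4[of "V j t" "v t"] unfolding V_def M'_def distrib_right by linarith
  have e2: "\<bar>V' j t - v' t\<bar> \<le> M' * exp (- c * \<bar>t\<bar>)" for j t
  proof -
    have "\<bar>s j * (P j t * cut' (s j * t))\<bar> \<le> 1 * (M * K * exp (- c * \<bar>t\<bar>))"
      unfolding abs_mult[of "s j"] using s[of j] by (intro mult_mono chb(2) b) auto
    then show ?thesis
      using chb(1)[OF b(2)[of j t], of "s j * t"] b(4)[of t] unfolding V'_def M'_def distrib_right by linarith
  qed
  have cutlim: "(\<lambda>j. cut (s j * t)) \<longlonglongrightarrow> 1" for t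
  proof -
    have "(\<lambda>j. s j * t) \<longlonglongrightarrow> 0" using tendsto_mult_right[OF s0, of t] by simp
    from isCont_tendsto_compose[OF DERIV_isCont[OF cut(2)] this] show ?thesis by (simp add: cut0)
  qed
  have L1: "AE t in lborel. (\<lambda>j. V j t - v t) \<longlonglongrightarrow> 0"
    using lim(1)
  proof eventually_elim
    case (elim t)
    from tendsto_diff[OF tendsto_mult[OF elim cutlim[of t]] tendsto_const[of "v t"]] show ?case by (simp add: V_def)
  qed
  have L2: "AE t in lborel. (\<lambda>j. V' j t - v' t) \<longlonglongrightarrow> 0"
    using lim(2)
  proof eventually_elim
    case (elim t)
    have "(\<lambda>j. s j * (P j t * cut' (s j * t))) \<longlonglongrightarrow> 0"
    proof (rule Lim_null_comparison)
      show "\<forall>\<^sub>F j in sequentially. norm (s j * (P j t * cut' (s j * t))) \<le> s j * (M * K * exp (- c * \<bar>t\<bar>))"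
      proof (rule always_eventually, rule allI)
        fix j
        show "norm (s j * (P j t * cut' (s j * t))) \<le> s j * (M * K * exp (- c * \<bar>t\<bar>))"
          unfolding real_norm_def abs_mult[of "s j"] using s[of j] by (intro mult_mono chb(2) b) auto
      qed
      show "(\<lambda>j. s j * (M * K * exp (- c * \<bar>t\<bar>))) \<longlonglongrightarrow> 0" using tendsto_mult_right[OF s0] by simp
    qed
    from tendsto_diff[OF tendsto_add[OF tendsto_mult[OF elim cutlim[of t]] this] tendsto_const[of "v' t"]] show ?case
      by (simp add: V'_def)
  qed
  have sq: "\<bar>x\<bar> powr 2 = x\<^sup>2" for x :: real by simp
  have m1: "(\<lambda>t. V j t - v t) \<in> borel_measurable borel" "(\<lambda>t. V' j t - v' t) \<in> borel_measurable borel" for j by measurable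
  have p0: "p > 0" using p2 by simp
  have D1: "integrable lborel (\<lambda>t. \<bar>V j t - v t\<bar> powr q)" "(\<lambda>j. LINT t|lborel. \<bar>V j t - v t\<bar> powr q) \<longlonglongrightarrow> 0" if "q > 0" for q j
    by (rule decaying_powr[where f="\<lambda>j t. V j t - v t", OF c that m1(1) e1] decaying_powr(2)[where f="\<lambda>j t. V j t - v t", OF c that m1(1) e1 L1])+
  have D2: "integrable lborel (\<lambda>t. \<bar>V' j t - v' t\<bar> powr q)" "(\<lambda>j. LINT t|lborel. \<bar>V' j t - v' t\<bar> powr q) \<longlonglongrightarrow> 0" if "q > 0" for q j
    by (rule decaying_powr[where f="\<lambda>j t. V' j t - v' t", OF c that m1(2) e2] decaying_powr(2)[where f="\<lambda>j t. V' j t - v' t", OF c that m1(2) e2 L2])+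
  have v2: "integrable lborel (\<lambda>t. (v t)\<^sup>2)" using decaying_powr(1)[OF c _ v b(3), of 2] by (simp only: sq zero_less_numeral simp_thms)
  have v'2: "integrable lborel (\<lambda>t. (v' t)\<^sup>2)" using decaying_powr(1)[OF c _ v' b(4), of 2] by (simp only: sq zero_less_numeral simp_thms)
  have vp: "integrable lborel (\<lambda>t. \<bar>v t\<bar> powr p)" using decaying_powr(1)[OF c p0 v b(3)] .
  have i1: "integrable lborel (\<lambda>t. (V' j t - v' t)\<^sup>2)" for j using D2(1)[of 2 j] by (simp only: sq zero_less_numeral simp_thms)
  have i2: "integrable lborel (\<lambda>t. (V j t - v t)\<^sup>2)" for j using D1(1)[of 2 j] by (simp only: sq zero_less_numeral simp_thms)
  have l1: "(\<lambda>j. LINT t|lborel. (V' j t - v' t)\<^sup>2) \<longlonglongrightarrow> 0" using D2(2)[of 2] by (simp only: sq zero_less_numeral simp_thms)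
  have l2: "(\<lambda>j. LINT t|lborel. (V j t - v t)\<^sup>2) \<longlonglongrightarrow> 0" using D1(2)[of 2] by (simp only: sq zero_less_numeral simp_thms)
  have lp: "(\<lambda>j. LINT t|lborel. \<bar>V j t - v t\<bar> powr p) \<longlonglongrightarrow> 0" by (rule D1(2)[OF p0])
  have V'm: "V' j \<in> borel_measurable borel" for j by measurable
  note R = explicit_profile[OF d V supp dV v v' V'm v2 v'2 vp[unfolded p_def] i1 i2 l1 l2 lp[unfolded p_def] odd u[unfolded \<kappa>_def]]
  show "u \<in> homogeneous_H1_rad" by (rule R(1))
  show "hardy_form u = N * (norm \<alpha>)\<^sup>2 * (LINT t|lborel. (v' t)\<^sup>2)" unfolding N_def by (rule R(2))
  show "hardy_integral u = N * (norm \<alpha>)\<^sup>2 * (LINT t|lborel. (v t)\<^sup>2)" unfolding N_def by (rule R(3))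
  show "(LINT x|lebesgue. norm (u x) powr p) = N * norm \<alpha> powr p * (LINT t|lborel. \<bar>v t\<bar> powr p)"
    unfolding N_def p_def by (rule R(4))
qed

section \<open>The soliton and the exponential profiles\<close>

lemma lborel_integral_dilation:
  fixes f :: "real \<Rightarrow> real"
  assumes "l > 0"
  shows "(LINT t|lborel. f (l * (t - t0))) = (LINT t|lborel. f t) / l"
  using lborel_integral_real_affine[of l f "- l * t0"] assms by (simp add: algebra_simps)

lemma lborel_integral_antisymmetric:
  fixes f :: "real \<Rightarrow> real"
  assumes "\<And>t. f (2 * s - t) = - f t"
  shows "(LINT t|lborel. f t) = 0"
  using lborel_integral_real_affine[of "-1" f "2 * s"] assms by simp

lemma exp_abs_shift:
  fixes c t t0 :: real
  assumes "c > 0"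
  shows "exp (- c * \<bar>t - t0\<bar>) \<le> exp (c * \<bar>t0\<bar>) * exp (- c * \<bar>t\<bar>)"
proof -
  have "c * \<bar>t\<bar> \<le> c * (\<bar>t - t0\<bar> + \<bar>t0\<bar>)" using assms by (intro mult_left_mono) auto
  then show ?thesis by (simp add: algebra_simps flip: exp_add)
qed

lemma differentiable_order_affine: "differentiable_order k UNIV (\<lambda>t. a * t + b)"
  by (intro differentiable_order_add differentiable_order_cmult differentiable_order_ident differentiable_order_const open_UNIV)

lemma sobolev_exponent_eq:
  assumes "d \<ge> 3"
  shows "sobolev_exponent d = 2 + 2 / ((real d - 2) / 2)"
  using assms by (simp add: sobolev_exponent_def field_simps)

text \<open>The profile is smooth, so the constant sequence approximates it, and its symmetry about
  \<open>t0\<close> annihilates the cross term.\<close>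

lemma soliton_profile:
  fixes u :: "real ^ 'n::finite \<Rightarrow> complex"
  assumes d: "CARD('n) \<ge> 3" and l: "l > 0"
  defines "\<kappa> \<equiv> (real CARD('n) - 2) / 2" and "N \<equiv> sphere_area TYPE(real ^ 'n)" and "p \<equiv> sobolev_exponent CARD('n)"
  assumes u: "AE x in lborel. u x = \<alpha> * of_real (norm x powr (- \<kappa>) * soliton \<kappa> (l * (ln (norm x) - t0)))"
  shows "u \<in> homogeneous_H1_rad"
    and "hardy_form u = N * (norm \<alpha>)\<^sup>2 * (l * soliton_energy \<kappa>)"
    and "hardy_integral u = N * (norm \<alpha>)\<^sup>2 * (soliton_mass \<kappa> / l)"
    and "(LINT x|lebesgue. norm (u x) powr p) = N * norm \<alpha> powr p * (soliton_potential \<kappa> / l)"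
proof -
  have \<kappa>: "\<kappa> > 0" using d by (simp add: \<kappa>_def)
  have p: "p = 2 + 2 / \<kappa>" unfolding p_def \<kappa>_def by (rule sobolev_exponent_eq[OF d])
  define v where "v t = soliton \<kappa> (l * (t - t0))" for t
  define v' where "v' t = - l * (tanh (l * (t - t0) / \<kappa>) * soliton \<kappa> (l * (t - t0)))" for t
  have dv: "(v has_real_derivative v' t) (at t)" for t
  proof -
    have "((\<lambda>t. l * (t - t0)) has_real_derivative l) (at t)" by (auto intro!: derivative_eq_intros)
    from DERIV_chain2[OF soliton_deriv[OF \<kappa>] this] show ?thesis unfolding v_def[abs_def] v'_def by (simp add: mult_ac)
  qed
  have vs: "differentiable_order k UNIV v" for k
  proof -
    have "v = (\<lambda>t. ((1 / 2) * (exp ((l / \<kappa>) * t + - (l * t0 / \<kappa>)) + exp ((- l / \<kappa>) * t + l * t0 / \<kappa>))) powr (- \<kappa>))"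
      unfolding v_def soliton_def cosh_def by (simp add: diff_divide_distrib right_diff_distrib)
    moreover have "differentiable_order k UNIV \<dots>"
      by (intro differentiable_order_powr differentiable_order_cmult differentiable_order_add open_UNIV
          differentiable_order_compose[OF open_UNIV open_UNIV UNIV_I differentiable_order_exp] differentiable_order_affine)
         (simp add: add_pos_pos)
    ultimately show ?thesis by simp
  qed
  have lm: "(\<lambda>t. l * (t - t0)) \<in> borel_measurable borel" by measurable
  have sm: "(\<lambda>t. soliton \<kappa> (l * (t - t0))) \<in> borel_measurable borel"
    by (rule measurable_compose[OF lm soliton_measurable[OF \<kappa>]])
  have tm: "(\<lambda>t. tanh (l * (t - t0) / \<kappa>)) \<in> borel_measurable borel"
    by (rule measurable_compose[OF lm borel_measurable_continuous_onI[OF tanh_quot_continuous[OF \<kappa>]]])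
  have vm: "v \<in> borel_measurable borel" using sm unfolding v_def .
  have v'm: "v' \<in> borel_measurable borel" using sm tm unfolding v'_def by measurable
  define M where "M = (1 + l) * (2 powr \<kappa> * exp (l * \<bar>t0\<bar>))"
  have vb0: "\<bar>v t\<bar> \<le> 2 powr \<kappa> * exp (l * \<bar>t0\<bar>) * exp (- l * \<bar>t\<bar>)" for t
  proof -
    have "\<bar>v t\<bar> \<le> 2 powr \<kappa> * exp (- \<bar>l * (t - t0)\<bar>)"
      using soliton_le_exp[OF \<kappa>, of "l * (t - t0)"] soliton_pos[of \<kappa> "l * (t - t0)"] by (simp add: v_def)
    also have "\<dots> = 2 powr \<kappa> * exp (- l * \<bar>t - t0\<bar>)" using l by (simp add: abs_mult)
    also have "\<dots> \<le> 2 powr \<kappa> * (exp (l * \<bar>t0\<bar>) * exp (- l * \<bar>t\<bar>))"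
      by (intro mult_left_mono exp_abs_shift[OF l]) simp
    finally show ?thesis by (simp only: mult.assoc)
  qed
  have vb: "\<bar>v t\<bar> \<le> M * exp (- l * \<bar>t\<bar>)" for t
  proof -
    have "0 \<le> l * (2 powr \<kappa> * exp (l * \<bar>t0\<bar>) * exp (- l * \<bar>t\<bar>))" using l by simp
    then show ?thesis using vb0[of t] unfolding M_def by (simp only: distrib_right mult_1 mult.assoc)
  qed
  have v'b: "\<bar>v' t\<bar> \<le> M * exp (- l * \<bar>t\<bar>)" for t
  proof -
    have "\<bar>v' t\<bar> = l * (\<bar>tanh (l * (t - t0) / \<kappa>)\<bar> * \<bar>v t\<bar>)" using l by (simp add: v'_def v_def abs_mult)
    also have "\<dots> \<le> l * (1 * (2 powr \<kappa> * exp (l * \<bar>t0\<bar>) * exp (- l * \<bar>t\<bar>)))"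
      using l by (intro mult_left_mono mult_mono abs_tanh_le_1 vb0) auto
    finally show ?thesis using vb0[of t] abs_ge_zero[of "v t"] unfolding M_def by (simp only: distrib_right mult_1 mult.assoc)
  qed
  have refl: "v (2 * t0 - t) * v' (2 * t0 - t) = - (v t * v' t)" for t
  proof -
    have "l * (2 * t0 - t - t0) = - (l * (t - t0))" by (simp add: algebra_simps)
    then show ?thesis by (simp add: v_def v'_def soliton_even)
  qed
  have odd: "(LINT t|lborel. v t * v' t) = 0" by (rule lborel_integral_antisymmetric[where s=t0 and f="\<lambda>t. v t * v' t", OF refl])
  have l1: "AE t in lborel. (\<lambda>j::nat. v t) \<longlonglongrightarrow> v t" "AE t in lborel. (\<lambda>j::nat. v' t) \<longlonglongrightarrow> v' t" by auto
  note R = decaying_profile[OF d vs dv vm v'm l vb v'b vb v'b l1 odd u[unfolded \<kappa>_def, folded \<kappa>_def v_def, unfolded \<kappa>_def], folded N_def p_def]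
  show "u \<in> homogeneous_H1_rad" by (rule R(1))
  have sq: "(v t)\<^sup>2 = (soliton \<kappa> (l * (t - t0)))\<^sup>2" "(v' t)\<^sup>2 = l\<^sup>2 * (tanh (l * (t - t0) / \<kappa>) * soliton \<kappa> (l * (t - t0)))\<^sup>2"
    "\<bar>v t\<bar> powr p = soliton \<kappa> (l * (t - t0)) powr (2 + 2 / \<kappa>)" for t
    using soliton_pos[of \<kappa> "l * (t - t0)"] by (simp_all add: v_def v'_def power_mult_distrib p)
  show "hardy_form u = N * (norm \<alpha>)\<^sup>2 * (l * soliton_energy \<kappa>)"
    unfolding R(2) sq soliton_energy_def
    using lborel_integral_dilation[OF l, of "\<lambda>s. (tanh (s / \<kappa>) * soliton \<kappa> s)\<^sup>2" t0] l by (simp add: power2_eq_square)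
  show "hardy_integral u = N * (norm \<alpha>)\<^sup>2 * (soliton_mass \<kappa> / l)"
    unfolding R(3) sq soliton_mass_def
    using lborel_integral_dilation[OF l, of "\<lambda>s. (soliton \<kappa> s)\<^sup>2" t0] by simp
  show "(LINT x|lebesgue. norm (u x) powr p) = N * norm \<alpha> powr p * (soliton_potential \<kappa> / l)"
    unfolding R(4) sq soliton_potential_def
    using lborel_integral_dilation[OF l, of "\<lambda>s. soliton \<kappa> s powr (2 + 2 / \<kappa>)" t0] by simp
qed

lemma lborel_integral_exp_abs:
  assumes c: "(c::real) > 0"
  shows "(LINT t|lborel. exp (- c * \<bar>t\<bar>)) = 2 / c"
proof -
  have p: "(\<integral>\<^sup>+t. ennreal (exp (c * t)) * indicator {..<0} t \<partial>lborel) = ennreal (1 / c)"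
    using nn_integral_exp_neg[OF c] by simp
  have "(\<integral>\<^sup>+t. ennreal (exp (- c * \<bar>t\<bar>)) \<partial>lborel)
      = (\<integral>\<^sup>+t. (ennreal (exp (c * t)) * indicator {..<0} t + ennreal (exp (c * - t)) * indicator {..<0} (- t)) \<partial>lborel)"
    by (rule nn_integral_cong_AE)
       (use AE_lborel_singleton[of "0::real"] in \<open>eventually_elim, auto split: split_indicator\<close>)
  also have "\<dots> = ennreal (1 / c) + (\<integral>\<^sup>+t. ennreal (exp (c * - t)) * indicator {..<0} (- t) \<partial>lborel)"
    unfolding p[symmetric] by (rule nn_integral_add) measurable
  also have "(\<integral>\<^sup>+t. ennreal (exp (c * - t)) * indicator {..<0} (- t) \<partial>lborel) = ennreal (1 / c)"
    using nn_integral_real_affine[of "\<lambda>t. ennreal (exp (c * t)) * indicator {..<0} t" "-1" 0] p by simp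
  also have "ennreal (1 / c) + ennreal (1 / c) = ennreal (2 / c)" using c by (simp flip: ennreal_plus)
  finally have "(\<integral>\<^sup>+t. ennreal (exp (- c * \<bar>t\<bar>)) \<partial>lborel) = ennreal (2 / c)" .
  then show ?thesis using c by (subst integral_eq_nn_integral) auto
qed

lemma exponential_profile:
  fixes u :: "real ^ 'n::finite \<Rightarrow> complex"
  assumes d: "CARD('n) \<ge> 3" and c: "c > 0"
  defines "\<kappa> \<equiv> (real CARD('n) - 2) / 2" and "N \<equiv> sphere_area TYPE(real ^ 'n)"
  assumes u: "AE x in lborel. u x = \<alpha> * of_real (norm x powr (- \<kappa>) * exp (- c * \<bar>ln (norm x) - t0\<bar>))"
  shows "u \<in> homogeneous_H1_rad"
    and "hardy_form u = N * (norm \<alpha>)\<^sup>2 * c"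
    and "hardy_integral u = N * (norm \<alpha>)\<^sup>2 / c"
proof -
  define v where "v t = exp (- c * \<bar>t - t0\<bar>)" for t
  define v' where "v' t = - c * (sgn (t - t0) * v t)" for t
  define \<epsilon> where "\<epsilon> j = inverse (real (Suc j))" for j
  have \<epsilon>: "\<epsilon> j > 0" for j by (simp add: \<epsilon>_def)
  have \<epsilon>0: "\<epsilon> \<longlonglongrightarrow> 0" unfolding \<epsilon>_def by (rule LIMSEQ_inverse_real_of_nat)
  define q where "q j t = sqrt ((t - t0)\<^sup>2 + \<epsilon> j)" for j t
  define P where "P j t = exp (- c * q j t)" for j t
  define P' where "P' j t = - c * ((t - t0) / q j t * P j t)" for j t
  have pos: "(t - t0)\<^sup>2 + \<epsilon> j > 0" for j t using \<epsilon>[of j] by (simp add: add_nonneg_pos)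
  have q: "q j t > 0" "\<bar>t - t0\<bar> \<le> q j t" for j t
    using pos[of t j] \<epsilon>[of j] by (auto simp: q_def intro!: real_le_rsqrt)
  have dP: "(P j has_real_derivative P' j t) (at t)" for j t
  proof -
    have "((\<lambda>t. (t - t0)\<^sup>2 + \<epsilon> j) has_real_derivative 2 * (t - t0)) (at t)"
      by (auto intro!: derivative_eq_intros)
    then have "((\<lambda>t. sqrt ((t - t0)\<^sup>2 + \<epsilon> j)) has_real_derivative inverse (sqrt ((t - t0)\<^sup>2 + \<epsilon> j)) / 2 * (2 * (t - t0))) (at t)"
      by (rule DERIV_chain2[where f=sqrt and g="\<lambda>t. (t - t0)\<^sup>2 + \<epsilon> j" and x=t, OF DERIV_real_sqrt[OF pos[of t j]]])
    moreover have "inverse y / 2 * (2 * z) = z / y" for y z :: real by (cases "y = 0") (auto simp: field_simps)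
    ultimately
    have "(q j has_real_derivative (t - t0) / q j t) (at t)"
      unfolding q_def[abs_def] by (simp only:)
    from DERIV_chain2[OF DERIV_exp DERIV_cmult[OF this, of "- c"]] show ?thesis
      unfolding P_def[abs_def] P'_def by (simp add: mult_ac)
  qed
  have Ps: "differentiable_order k UNIV (P j)" for j k
  proof -
    have "P j = (\<lambda>t. exp (- c * ((1 * t + - t0) * (1 * t + - t0) + \<epsilon> j) powr (1 / 2)))"
      using pos[of _ j, THEN less_imp_le] by (intro ext) (simp add: P_def q_def powr_half_sqrt power2_eq_square)
    moreover have "differentiable_order k UNIV \<dots>"
      using pos[of _ j]
      by (intro differentiable_order_compose[OF open_UNIV open_UNIV UNIV_I differentiable_order_exp] differentiable_order_cmult
          differentiable_order_powr differentiable_order_add differentiable_order_mult differentiable_order_affine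
          differentiable_order_const open_UNIV) (simp add: power2_eq_square)
    ultimately show ?thesis by simp
  qed
  have vm[measurable]: "v \<in> borel_measurable borel" unfolding v_def by measurable
  have v'm: "v' \<in> borel_measurable borel" unfolding v'_def by measurable
  define M where "M = (1 + c) * exp (c * \<bar>t0\<bar>)"
  have b: "\<bar>x\<bar> \<le> M * exp (- c * \<bar>t\<bar>)" if "\<bar>x\<bar> \<le> v t \<or> \<bar>x\<bar> \<le> c * v t" for x t
  proof -
    define E where "E = exp (c * \<bar>t0\<bar>) * exp (- c * \<bar>t\<bar>)"
    have vE: "v t \<le> E" "0 \<le> v t" unfolding v_def E_def using exp_abs_shift[OF c] by auto
    then have "c * v t \<le> c * E" "0 \<le> c * v t" using c by auto
    moreover have "M * exp (- c * \<bar>t\<bar>) = E + c * E" by (simp add: M_def E_def distrib_right mult.assoc)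
    ultimately show ?thesis using that vE by linarith
  qed
  have Pv: "P j t \<le> v t" "P j t > 0" for j t using q(2)[of t j] c by (auto simp: P_def v_def)
  have Pb: "\<bar>P j t\<bar> \<le> M * exp (- c * \<bar>t\<bar>)" for j t using b[of "P j t" t] Pv[of j t] by simp
  have P'b: "\<bar>P' j t\<bar> \<le> M * exp (- c * \<bar>t\<bar>)" for j t
  proof -
    have "\<bar>P' j t\<bar> = c * (\<bar>t - t0\<bar> / q j t * P j t)" using c q(1)[of j t] Pv(2)[of j t] by (simp add: P'_def abs_mult)
    also have "\<dots> \<le> c * (1 * v t)" using c q(1)[of j t] q(2)[of t j] Pv[of j t] by (intro mult_left_mono mult_mono) auto
    finally show ?thesis using b by simp
  qed
  have vb: "\<bar>v t\<bar> \<le> M * exp (- c * \<bar>t\<bar>)" for t by (rule b) (simp add: v_def)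
  have v'b: "\<bar>v' t\<bar> \<le> M * exp (- c * \<bar>t\<bar>)" for t
    by (rule b, rule disjI2) (use c in \<open>auto simp: v'_def v_def abs_mult sgn_real_def\<close>)
  have ql: "(\<lambda>j. q j t) \<longlonglongrightarrow> \<bar>t - t0\<bar>" for t
    using tendsto_real_sqrt[OF tendsto_add[OF tendsto_const[of "(t - t0)\<^sup>2"] \<epsilon>0]] by (simp add: q_def)
  have Pl: "(\<lambda>j. P j t) \<longlonglongrightarrow> v t" for t
    unfolding P_def v_def by (intro tendsto_intros ql)
  have l1: "AE t in lborel. (\<lambda>j. P j t) \<longlonglongrightarrow> v t" using Pl by simp
  have l2: "AE t in lborel. (\<lambda>j. P' j t) \<longlonglongrightarrow> v' t"
    using AE_lborel_singleton[of t0]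
  proof eventually_elim
    case (elim t)
    then have "\<bar>t - t0\<bar> \<noteq> 0" by simp
    then have "(\<lambda>j. P' j t) \<longlonglongrightarrow> - c * ((t - t0) / \<bar>t - t0\<bar> * v t)"
      unfolding P'_def by (intro tendsto_intros ql Pl)
    then show ?case by (simp add: v'_def real_sgn_eq)
  qed
  have refl: "v (2 * t0 - t) * v' (2 * t0 - t) = - (v t * v' t)" for t
    by (auto simp: v_def v'_def abs_minus_commute sgn_real_def)
  have odd: "(LINT t|lborel. v t * v' t) = 0" by (rule lborel_integral_antisymmetric[where s=t0 and f="\<lambda>t. v t * v' t", OF refl])
  note R = decaying_profile[OF d Ps dP vm v'm c Pb P'b vb v'b l1 l2 odd u[folded v_def, unfolded \<kappa>_def], folded N_def]
  have I: "(LINT t|lborel. (v t)\<^sup>2) = 1 / c"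
  proof -
    have "(v t)\<^sup>2 = exp (- (2 * c) * \<bar>1 * (t - t0)\<bar>)" for t by (simp add: v_def power2_eq_square flip: exp_add)
    then show ?thesis
      using lborel_integral_dilation[of 1 "\<lambda>t. exp (- (2 * c) * \<bar>t\<bar>)" t0] lborel_integral_exp_abs[of "2 * c"] c by simp
  qed
  have I': "(LINT t|lborel. (v' t)\<^sup>2) = c"
  proof -
    have "(LINT t|lborel. (v' t)\<^sup>2) = (LINT t|lborel. c\<^sup>2 * (v t)\<^sup>2)"
    proof (rule integral_cong_AE)
      show "AE t in lborel. (v' t)\<^sup>2 = c\<^sup>2 * (v t)\<^sup>2"
        using AE_lborel_singleton[of t0] by eventually_elim (auto simp: v'_def power_mult_distrib sgn_real_def)
    qed (use v'm in measurable)
    then show ?thesis using I c by (simp add: power2_eq_square)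
  qed
  show "u \<in> homogeneous_H1_rad" by (rule R(1))
  show "hardy_form u = N * (norm \<alpha>)\<^sup>2 * c" unfolding R(2) I' ..
  show "hardy_integral u = N * (norm \<alpha>)\<^sup>2 / c" unfolding R(3) I by simp
qed

section \<open>The weak norm\<close>

lemma measure_ball_exp:
  fixes T \<kappa> p :: real
  defines "B \<equiv> ball 0 (exp T) :: (real ^ 'n::finite) set"
  shows "measure lebesgue B = unit_ball_vol (real CARD('n)) * exp (real CARD('n) * T)"
    and "\<kappa> * p = real CARD('n) \<Longrightarrow> p > 0 \<Longrightarrow>
      measure lebesgue B powr (1 / p) = unit_ball_vol (real CARD('n)) powr (1 / p) * exp (\<kappa> * T)"
proof -
  show 1: "measure lebesgue B = unit_ball_vol (real CARD('n)) * exp (real CARD('n) * T)"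
    unfolding B_def using content_ball[of "exp T" "0 :: real ^ 'n"] by (simp add: exp_of_nat_mult[symmetric])
  assume p: "\<kappa> * p = real CARD('n)" "p > 0"
  then have "real CARD('n) * T * (1 / p) = \<kappa> * T" by (simp add: p(1)[symmetric])
  then show "measure lebesgue B powr (1 / p) = unit_ball_vol (real CARD('n)) powr (1 / p) * exp (\<kappa> * T)"
    unfolding 1 by (simp add: powr_mult exp_powr_real)
qed

lemma measure_lebesgue_mono_AE:
  assumes "AE x in lebesgue. x \<in> A \<longrightarrow> x \<in> B" "B \<in> lmeasurable"
  shows "measure lebesgue A \<le> measure lebesgue B"
  unfolding measure_def
  by (rule enn2real_mono[OF emeasure_mono_AE]) (use assms in \<open>auto simp: fmeasurable_def\<close>)

text \<open>Up to the origin, the superlevel set of \<open>m * norm x powr (- \<kappa>)\<close> at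
  \<open>s\<close> is a ball whose radius has the logarithm \<open>(ln m - ln s) / \<kappa>\<close>.
  Since \<open>\<kappa> * p\<close> is the dimension, \<open>s\<close> times the power
  \<open>1 / p\<close> of its measure is the same for all \<open>s\<close>.\<close>

lemma weak_level_bound:
  fixes u :: "real ^ 'n::finite \<Rightarrow> complex"
  assumes \<kappa>: "\<kappa> > 0" "\<kappa> * p = real CARD('n)" "p > 0" and m: "m > 0" and s: "s > 0"
    and u: "AE x in lborel. norm (u x) \<le> m * norm x powr (- \<kappa>)"
  shows "AE x in lebesgue. s < norm (u x) \<longrightarrow> x \<in> ball 0 (exp ((ln m - ln s) / \<kappa>))"
    and "s * measure lebesgue {x. norm (u x) > s} powr (1 / p) \<le> m * unit_ball_vol (real CARD('n)) powr (1 / p)"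
proof -
  define T where "T = (ln m - ln s) / \<kappa>"
  have "AE x in lborel. s < norm (u x) \<longrightarrow> x \<in> ball 0 (exp T)"
    using u AE_lborel_singleton[of "0 :: real ^ 'n"]
  proof (eventually_elim, intro impI)
    fix x :: "real ^ 'n" assume x: "norm (u x) \<le> m * norm x powr (- \<kappa>)" "x \<noteq> 0" "s < norm (u x)"
    then have nx: "norm x > 0" by simp
    have "ln s < ln (m * norm x powr (- \<kappa>))" using x s by (subst ln_less_cancel_iff) auto
    also have "\<dots> = ln m - \<kappa> * ln (norm x)" using m nx by (simp add: ln_mult ln_powr)
    finally have "ln (norm x) < T" using \<kappa>(1) by (simp add: T_def field_simps)
    then show "x \<in> ball 0 (exp T)" using ln_less_cancel_iff[OF nx exp_gt_zero[of T]] by simp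
  qed
  then show ae: "AE x in lebesgue. s < norm (u x) \<longrightarrow> x \<in> ball 0 (exp ((ln m - ln s) / \<kappa>))"
    unfolding T_def by (rule AE_completion)
  have "measure lebesgue {x. norm (u x) > s} powr (1 / p) \<le> measure lebesgue (ball 0 (exp T) :: (real ^ 'n) set) powr (1 / p)"
    by (intro powr_mono2 measure_lebesgue_mono_AE) (use ae \<kappa> in \<open>auto simp: T_def\<close>)
  also have "\<dots> = unit_ball_vol (real CARD('n)) powr (1 / p) * exp (\<kappa> * T)" by (rule measure_ball_exp(2)[OF \<kappa>(2,3)])
  also have "exp (\<kappa> * T) = m / s" using \<kappa>(1) m s by (simp add: T_def exp_diff)
  finally have "s * measure lebesgue {x. norm (u x) > s} powr (1 / p) \<le> s * (unit_ball_vol (real CARD('n)) powr (1 / p) * (m / s))"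
    by (rule mult_left_mono) (use s in simp)
  then show "s * measure lebesgue {x. norm (u x) > s} powr (1 / p) \<le> m * unit_ball_vol (real CARD('n)) powr (1 / p)"
    using s by (simp add: mult_ac)
qed

lemma weak_Lp_norm_le:
  fixes u :: "real ^ 'n::finite \<Rightarrow> complex"
  assumes \<kappa>: "\<kappa> > 0" "\<kappa> * p = real CARD('n)" "p > 0" and m: "m > 0"
    and u: "AE x in lborel. norm (u x) \<le> m * norm x powr (- \<kappa>)"
  shows "bdd_above ((\<lambda>s. s * measure lebesgue {x. norm (u x) > s} powr (1 / p)) ` {0<..})"
    and "weak_Lp_norm p u \<le> m * unit_ball_vol (real CARD('n)) powr (1 / p)"
    and "weak_Lp_norm p u \<ge> 0"
proof -
  note W = weak_level_bound(2)[OF \<kappa> m _ u]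
  show bdd: "bdd_above ((\<lambda>s. s * measure lebesgue {x. norm (u x) > s} powr (1 / p)) ` {0<..})"
    by (rule bdd_aboveI2[where M="m * unit_ball_vol (real CARD('n)) powr (1 / p)"]) (use W in auto)
  show "weak_Lp_norm p u \<le> m * unit_ball_vol (real CARD('n)) powr (1 / p)"
    unfolding weak_Lp_norm_def by (rule cSUP_least) (use W in auto)
  have "0 \<le> (1::real) * measure lebesgue {x. norm (u x) > 1} powr (1 / p)" by simp
  also have "\<dots> \<le> weak_Lp_norm p u" unfolding weak_Lp_norm_def by (rule cSUP_upper[OF _ bdd]) simp
  finally show "weak_Lp_norm p u \<ge> 0" .
qed

lemma weak_Lp_norm_zero:
  assumes "AE x in lebesgue. u x = 0" "p > 0"
  shows "weak_Lp_norm p u = 0"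
proof -
  have "measure lebesgue {x. norm (u x) > s} = 0" if "s > 0" for s
  proof -
    have "AE x in lebesgue. x \<in> {x. norm (u x) > s} \<longrightarrow> x \<in> {}" using assms(1) by eventually_elim (use that in simp)
    from measure_lebesgue_mono_AE[OF this] have "measure lebesgue {x. norm (u x) > s} \<le> 0" by simp
    then show ?thesis by (simp add: antisym)
  qed
  then have "(\<lambda>s. s * measure lebesgue {x. norm (u x) > s} powr (1 / p)) ` {0<..} = {0}"
    using assms(2) by (auto simp: image_iff intro!: exI[of _ 1])
  then show ?thesis by (simp add: weak_Lp_norm_def)
qed

lemma exponential_profile_le:
  fixes u :: "real ^ 'n::finite \<Rightarrow> complex"
  assumes u: "AE x in lborel. norm (u x) = m * (norm x powr (- \<kappa>) * exp (- c * \<bar>ln (norm x) - t0\<bar>))" and "m > 0" "c > 0"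
  shows "AE x in lborel. norm (u x) \<le> m * norm x powr (- \<kappa>)"
  using u
proof eventually_elim
  case (elim x)
  have "norm x powr (- \<kappa>) * exp (- c * \<bar>ln (norm x) - t0\<bar>) \<le> norm x powr (- \<kappa>) * 1"
    using assms(3) by (intro mult_left_mono) auto
  then show ?case using elim assms(2) by simp
qed

text \<open>For \<open>c \<le> \<kappa>\<close> the modulus does not increase with the radius up to
  \<open>exp t0\<close>, where its value is \<open>S\<close>. Every superlevel set with
  \<open>s < S\<close> therefore contains the whole ball of this radius up to a null set, and
  letting \<open>s\<close> tend to \<open>S\<close> reaches the upper bound.\<close>

lemma weak_Lp_norm_exponential_eq:
  fixes u :: "real ^ 'n::finite \<Rightarrow> complex"
  assumes \<kappa>: "\<kappa> > 0" "\<kappa> * p = real CARD('n)" "p > 0" and m: "m > 0" and c: "0 < c" "c \<le> \<kappa>"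
    and um: "u \<in> borel_measurable lebesgue"
    and u: "AE x in lborel. norm (u x) = m * (norm x powr (- \<kappa>) * exp (- c * \<bar>ln (norm x) - t0\<bar>))"
  shows "weak_Lp_norm p u = m * unit_ball_vol (real CARD('n)) powr (1 / p)"
proof (rule antisym)
  note ub = exponential_profile_le[OF u m c(1)]
  show "weak_Lp_norm p u \<le> m * unit_ball_vol (real CARD('n)) powr (1 / p)" by (rule weak_Lp_norm_le(2)[OF \<kappa> m ub])
  define S where "S = m * exp (- \<kappa> * t0)"
  have S: "S > 0" using m by (simp add: S_def)
  have lower: "s * (unit_ball_vol (real CARD('n)) powr (1 / p) * exp (\<kappa> * t0)) \<le> weak_Lp_norm p u" if s: "0 < s" "s < S" for s
  proof -
    have set: "{x. norm (u x) > s} \<in> sets lebesgue"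
      using measurable_sets[OF measurable_compose[OF um borel_measurable_norm], of "{s<..}"] by (simp add: vimage_def)
    have "emeasure lebesgue {x. norm (u x) > s} \<le> emeasure lebesgue (ball 0 (exp ((ln m - ln s) / \<kappa>)) :: (real ^ 'n) set)"
      by (rule emeasure_mono_AE) (use weak_level_bound(1)[OF \<kappa> m s(1) ub] in auto)
    also have "\<dots> < \<infinity>" using emeasure_bounded_finite[OF bounded_ball, of "0 :: real ^ 'n"] by simp
    finally have lm: "{x. norm (u x) > s} \<in> lmeasurable" using set by (auto simp: fmeasurable_def)
    have "AE x in lborel. x \<in> ball 0 (exp t0) \<longrightarrow> norm (u x) > s"
      using u AE_lborel_singleton[of "0 :: real ^ 'n"]
    proof (eventually_elim, intro impI)
      fix x :: "real ^ 'n"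
      assume x: "norm (u x) = m * (norm x powr (- \<kappa>) * exp (- c * \<bar>ln (norm x) - t0\<bar>))" "x \<noteq> 0" "x \<in> ball 0 (exp t0)"
      then have nx: "norm x > 0" and "ln (norm x) < t0" using ln_less_cancel_iff[of "norm x" "exp t0"] by auto
      then have "(\<kappa> - c) * ln (norm x) \<le> (\<kappa> - c) * t0" using c by (intro mult_left_mono) auto
      then have "- \<kappa> * t0 \<le> - \<kappa> * ln (norm x) + - c * \<bar>ln (norm x) - t0\<bar>"
        using \<open>ln (norm x) < t0\<close> by (simp add: algebra_simps)
      then have "exp (- \<kappa> * t0) \<le> norm x powr (- \<kappa>) * exp (- c * \<bar>ln (norm x) - t0\<bar>)"
        unfolding norm_powr_exp_ln[OF x(2)] exp_add[symmetric] by (simp only: exp_le_cancel_iff)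
      then have "S \<le> norm (u x)" unfolding x(1) S_def using m by (intro mult_left_mono) auto
      then show "norm (u x) > s" using s by simp
    qed
    then have "AE x in lebesgue. x \<in> ball 0 (exp t0) \<longrightarrow> norm (u x) > s" by (rule AE_completion)
    then have "measure lebesgue (ball 0 (exp t0) :: (real ^ 'n) set) \<le> measure lebesgue {x. norm (u x) > s}"
      by (intro measure_lebesgue_mono_AE lm) simp
    then have "measure lebesgue (ball 0 (exp t0) :: (real ^ 'n) set) powr (1 / p) \<le> measure lebesgue {x. norm (u x) > s} powr (1 / p)"
      using \<kappa> by (intro powr_mono2) auto
    then have "s * (unit_ball_vol (real CARD('n)) powr (1 / p) * exp (\<kappa> * t0)) \<le> s * measure lebesgue {x. norm (u x) > s} powr (1 / p)"
      unfolding measure_ball_exp(2)[OF \<kappa>(2,3)] using s by (intro mult_left_mono) auto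
    also have "\<dots> \<le> weak_Lp_norm p u"
      unfolding weak_Lp_norm_def by (rule cSUP_upper[OF _ weak_Lp_norm_le(1)[OF \<kappa> m ub]]) (use s in simp)
    finally show ?thesis .
  qed
  have "((\<lambda>s. s * (unit_ball_vol (real CARD('n)) powr (1 / p) * exp (\<kappa> * t0))) \<longlongrightarrow> S * (unit_ball_vol (real CARD('n)) powr (1 / p) * exp (\<kappa> * t0))) (at_left S)"
    by (intro tendsto_intros)
  moreover have "\<forall>\<^sub>F s in at_left S. s * (unit_ball_vol (real CARD('n)) powr (1 / p) * exp (\<kappa> * t0)) \<le> weak_Lp_norm p u"
    using eventually_at_left_real[OF S] by eventually_elim (use lower in auto)
  ultimately have "S * (unit_ball_vol (real CARD('n)) powr (1 / p) * exp (\<kappa> * t0)) \<le> weak_Lp_norm p u"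
    by (intro tendsto_upperbound[OF _ _ trivial_limit_at_left_real])
  moreover have "S * (unit_ball_vol (real CARD('n)) powr (1 / p) * exp (\<kappa> * t0)) = m * unit_ball_vol (real CARD('n)) powr (1 / p) * (exp (- \<kappa> * t0) * exp (\<kappa> * t0))"
    by (simp add: S_def)
  ultimately show "m * unit_ball_vol (real CARD('n)) powr (1 / p) \<le> weak_Lp_norm p u" by (simp flip: exp_add)
qed

text \<open>For \<open>l > \<kappa>\<close> the function is small near the origin, so high superlevel sets miss a fixed proportion of the
  ball that realises the upper bound, while low levels lose a factor from the decay at infinity.\<close>

lemma weak_Lp_norm_exponential_less:
  fixes u :: "real ^ 'n::finite \<Rightarrow> complex"
  assumes \<kappa>: "\<kappa> > 0" "\<kappa> * p = real CARD('n)" "p > 0" and m: "m > 0" and l: "l > \<kappa>"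
    and u: "AE x in lborel. norm (u x) = m * (norm x powr (- \<kappa>) * exp (- l * \<bar>ln (norm x) - t0\<bar>))"
  shows "weak_Lp_norm p u < m * unit_ball_vol (real CARD('n)) powr (1 / p)"
proof -
  define n where "n = real CARD('n)"
  have n: "n > 0" by (simp add: n_def)
  define W where "W = unit_ball_vol n powr (1 / p)"
  have \<omega>: "unit_ball_vol n > 0" using n by simp
  have W: "W > 0" using \<omega> by (simp add: W_def)
  \<comment> \<open>In the logarithm of the radius: for levels above half the value at
    \<open>t0\<close>, the superlevel set begins after \<open>t0 - ln 2 / (l - \<kappa>)\<close>,
    and the comparison ball ends before \<open>t0 + ln 2 / \<kappa>\<close>. \<open>D\<close> is the
    distance between these two bounds.\<close>
  define D where "D = ln 2 / (l - \<kappa>) + ln 2 / \<kappa>"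
  have D: "D > 0" using l \<kappa> by (auto simp: D_def intro!: add_pos_pos divide_pos_pos)
  \<comment> \<open>The factor lost at half the value at \<open>t0\<close> through the tail, which
    decays at the rate \<open>\<kappa> + l\<close> instead of \<open>\<kappa>\<close>; lower levels
    lose more.\<close>
  define q1 where "q1 = exp (- (l * ln 2 / (\<kappa> + l)))"
  define q2 where "q2 = (1 - exp (- n * D)) powr (1 / p)"
  have l0: "l > 0" using l \<kappa> by simp
  have q1: "q1 < 1" using l0 \<kappa> by (simp add: q1_def)
  have q2: "q2 < 1" unfolding q2_def using D n \<kappa>(3) powr_less_mono2[of "1 / p" "1 - exp (- n * D)" 1] by simp
  have logu: "AE x in lborel. s < norm (u x) \<longrightarrow> x \<noteq> 0 \<and> ln s < ln m - \<kappa> * ln (norm x) - l * \<bar>ln (norm x) - t0\<bar>" if s: "s > 0" for s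
    using u AE_lborel_singleton[of "0 :: real ^ 'n"]
  proof (eventually_elim, intro impI)
    fix x :: "real ^ 'n"
    assume x: "norm (u x) = m * (norm x powr (- \<kappa>) * exp (- l * \<bar>ln (norm x) - t0\<bar>))" "x \<noteq> 0" "s < norm (u x)"
    have "ln s < ln (norm (u x))" using x(3) s by (subst ln_less_cancel_iff) auto
    also have "\<dots> = ln m - \<kappa> * ln (norm x) - l * \<bar>ln (norm x) - t0\<bar>"
      unfolding x(1) norm_powr_exp_ln[OF x(2)] using m by (simp add: ln_mult)
    finally show "x \<noteq> 0 \<and> ln s < ln m - \<kappa> * ln (norm x) - l * \<bar>ln (norm x) - t0\<bar>" using x by simp
  qed
  \<comment> \<open>A strict inequality for each \<open>s\<close> would not survive the supremum, so
    a factor below 1 common to all levels is needed. Splitting at half the value at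
    \<open>t0\<close> gives a uniform loss on either side.\<close>
  have level: "s * measure lebesgue {x. norm (u x) > s} powr (1 / p) \<le> m * W * max q1 q2" if s: "s > 0" for s
  proof (cases "ln s \<le> ln m - \<kappa> * t0 - ln 2")
    case True
    \<comment> \<open>The logarithm of the radius at which the outer branch, extended to all radii
      as an upper bound, reaches the level \<open>s\<close>.\<close>
    define T where "T = (ln m - ln s + l * t0) / (\<kappa> + l)"
    have kl: "\<kappa> + l > 0" using \<kappa> l0 by simp
    have "AE x in lborel. s < norm (u x) \<longrightarrow> x \<in> ball 0 (exp T)"
      using logu[OF s]
    proof (eventually_elim, intro impI)
      fix x :: "real ^ 'n"
      assume "s < norm (u x) \<longrightarrow> x \<noteq> 0 \<and> ln s < ln m - \<kappa> * ln (norm x) - l * \<bar>ln (norm x) - t0\<bar>" "s < norm (u x)"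
      then have x: "x \<noteq> 0" "ln s < ln m - \<kappa> * ln (norm x) - l * \<bar>ln (norm x) - t0\<bar>" by auto
      have "l * (ln (norm x) - t0) \<le> l * \<bar>ln (norm x) - t0\<bar>" using l0 by (intro mult_left_mono) auto
      then have "(\<kappa> + l) * ln (norm x) < ln m - ln s + l * t0" using x(2) by (simp add: algebra_simps)
      then have "ln (norm x) < T" unfolding T_def using kl by (simp add: pos_less_divide_eq mult.commute)
      then show "x \<in> ball 0 (exp T)" using ln_less_cancel_iff[OF _ exp_gt_zero[of T], of "norm x"] x(1) by simp
    qed
    then have ae: "AE x in lebesgue. s < norm (u x) \<longrightarrow> x \<in> ball 0 (exp T)" by (rule AE_completion)
    have "measure lebesgue {x. norm (u x) > s} powr (1 / p) \<le> measure lebesgue (ball 0 (exp T) :: (real ^ 'n) set) powr (1 / p)"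
      by (intro powr_mono2 measure_lebesgue_mono_AE) (use ae \<kappa> in auto)
    also have "\<dots> = W * exp (\<kappa> * T)" unfolding W_def n_def by (rule measure_ball_exp(2)[OF \<kappa>(2,3)])
    finally have 1: "s * measure lebesgue {x. norm (u x) > s} powr (1 / p) \<le> s * (W * exp (\<kappa> * T))"
      by (rule mult_left_mono) (use s in simp)
    have "ln s + \<kappa> * T = (l * ln s + \<kappa> * ln m + \<kappa> * (l * t0)) / (\<kappa> + l)"
      using kl by (simp add: T_def field_simps)
    also have "\<dots> \<le> (l * (ln m - \<kappa> * t0 - ln 2) + \<kappa> * ln m + \<kappa> * (l * t0)) / (\<kappa> + l)"
      using True kl l0 \<kappa>(1) by (intro divide_right_mono add_mono mult_left_mono) auto
    also have "\<dots> = ln m - l * ln 2 / (\<kappa> + l)" using kl by (simp add: field_simps)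
    finally have "exp (ln s + \<kappa> * T) \<le> exp (ln m - l * ln 2 / (\<kappa> + l))" by (simp only: exp_le_cancel_iff)
    then have "s * exp (\<kappa> * T) \<le> m * q1" using s m by (simp add: exp_add exp_diff q1_def exp_minus divide_inverse)
    then have "s * (W * exp (\<kappa> * T)) \<le> m * W * q1" using mult_left_mono[of "s * exp (\<kappa> * T)" "m * q1" W] W by (simp add: mult_ac)
    also have "\<dots> \<le> m * W * max q1 q2" using m W by (intro mult_left_mono) auto
    finally show ?thesis using 1 by simp
  next
    case False
    define T where "T = (ln m - ln s) / \<kappa>"
    have "AE x in lborel. s < norm (u x) \<longrightarrow> x \<in> ball 0 (exp T) - ball 0 (exp (T - D))"
      using logu[OF s]
    proof (eventually_elim, intro impI)
      fix x :: "real ^ 'n"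
      assume "s < norm (u x) \<longrightarrow> x \<noteq> 0 \<and> ln s < ln m - \<kappa> * ln (norm x) - l * \<bar>ln (norm x) - t0\<bar>" "s < norm (u x)"
      then have x: "x \<noteq> 0" "ln s < ln m - \<kappa> * ln (norm x) - l * \<bar>ln (norm x) - t0\<bar>" by auto
      define t where "t = ln (norm x)"
      have "l * (t0 - t) \<le> l * \<bar>t - t0\<bar>" "0 \<le> l * \<bar>t - t0\<bar>" using l0 by (auto intro!: mult_left_mono)
      then have 1: "ln s < ln m - \<kappa> * t" "ln s < ln m - \<kappa> * t - l * (t0 - t)" using x(2) unfolding t_def by linarith+
      have "t < T" unfolding T_def using 1(1) \<kappa>(1) by (simp add: pos_less_divide_eq mult.commute)
      have "(l - \<kappa>) * t0 - ln 2 < (l - \<kappa>) * t" using 1(2) False by (simp add: algebra_simps)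
      then have "t0 - ln 2 / (l - \<kappa>) < t" using l by (simp add: field_simps)
      moreover have "T < (\<kappa> * t0 + ln 2) / \<kappa>"
        unfolding T_def using False \<kappa>(1) by (intro divide_strict_right_mono) auto
      then have "T - ln 2 / \<kappa> < t0" using \<kappa>(1) by (simp add: add_divide_distrib)
      ultimately have "T - D \<le> t" by (simp add: D_def)
      have "exp t = norm x" using x(1) by (simp add: t_def)
      moreover have "exp t < exp T" "exp (T - D) \<le> exp t" using \<open>t < T\<close> \<open>T - D \<le> t\<close> by simp_all
      ultimately show "x \<in> ball 0 (exp T) - ball 0 (exp (T - D))" by simp
    qed
    then have ae: "AE x in lebesgue. s < norm (u x) \<longrightarrow> x \<in> ball 0 (exp T) - ball 0 (exp (T - D))" by (rule AE_completion)
    have sub: "ball 0 (exp (T - D)) \<subseteq> (ball 0 (exp T) :: (real ^ 'n) set)" using D by (intro subset_ball) simp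
    have "measure lebesgue {x. norm (u x) > s} \<le> measure lebesgue (ball 0 (exp T) - ball 0 (exp (T - D)) :: (real ^ 'n) set)"
      by (intro measure_lebesgue_mono_AE) (use ae in auto)
    also have "\<dots> = unit_ball_vol n * exp (n * T) - unit_ball_vol n * exp (n * (T - D))"
      unfolding n_def measure_ball_exp(1)[symmetric] by (rule measurable_measure_Diff) (use sub in auto)
    also have "\<dots> = unit_ball_vol n * exp (n * T) * (1 - exp (- n * D))"
      by (simp add: algebra_simps flip: exp_add)
    finally have "measure lebesgue {x. norm (u x) > s} powr (1 / p) \<le> (unit_ball_vol n * exp (n * T) * (1 - exp (- n * D))) powr (1 / p)"
      using \<kappa>(3) by (intro powr_mono2) auto
    also have "\<dots> = (unit_ball_vol n * exp (n * T)) powr (1 / p) * q2"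
      unfolding q2_def using \<omega> D n by (intro powr_mult)
    also have "(unit_ball_vol n * exp (n * T)) powr (1 / p) = W * exp (\<kappa> * T)"
      using measure_ball_exp(2)[OF \<kappa>(2,3), of T] unfolding W_def n_def measure_ball_exp(1) .
    also have "exp (\<kappa> * T) = m / s" using \<kappa>(1) m s by (simp add: T_def exp_diff)
    finally have "s * measure lebesgue {x. norm (u x) > s} powr (1 / p) \<le> s * (W * (m / s) * q2)"
      by (rule mult_left_mono) (use s in simp)
    also have "\<dots> = m * W * q2" using s by simp
    also have "\<dots> \<le> m * W * max q1 q2" using m W by (intro mult_left_mono) auto
    finally show ?thesis .
  qed
  have "weak_Lp_norm p u \<le> m * W * max q1 q2"
    unfolding weak_Lp_norm_def by (rule cSUP_least) (use level in auto)
  also have "\<dots> < m * W * 1" using m W q1 q2 by (intro mult_strict_left_mono) auto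
  finally show ?thesis by (simp add: W_def n_def)
qed

section \<open>The sharp inequalities\<close>

text \<open>With \<open>y = b * norm x\<close> the denominator of the family is
  \<open>2 * y * cosh (\<eta> * ln y)\<close> raised to the power \<open>\<kappa>\<close>. Thus
  \<open>\<eta>\<close> turns into the time scale \<open>\<kappa> * \<eta>\<close> of the soliton,
  and the dilation into the translation by \<open>- ln b\<close>.\<close>

lemma u_eta_dilation:
  fixes x :: "real ^ 'n::finite"
  defines "\<kappa> \<equiv> (real CARD('n) - 2) / 2"
  assumes x: "x \<noteq> 0" and b: "b > 0" and \<kappa>: "\<kappa> > 0"
  shows "u_eta \<eta> (b *\<^sub>R x) = (2 * b) powr (- \<kappa>) * (norm x powr (- \<kappa>) * soliton \<kappa> (\<kappa> * \<eta> * (ln (norm x) - (- ln b))))"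
proof -
  define y where "y = b * norm x"
  have y: "y > 0" using x b by (simp add: y_def)
  have ly: "ln y = ln (norm x) - (- ln b)" using x b by (simp add: y_def ln_mult)
  have "y powr (1 - \<eta>) * (1 + y powr (2 * \<eta>)) = y * (y powr (- \<eta>) * (1 + y powr (2 * \<eta>)))"
    using y by (simp add: powr_diff powr_minus_divide)
  also have "y powr (- \<eta>) * (1 + y powr (2 * \<eta>)) = y powr (- \<eta>) + y powr \<eta>"
    by (simp add: distrib_left flip: powr_add)
  also have "\<dots> = 2 * cosh (\<eta> * ln y)" using y by (simp add: powr_def cosh_def)
  finally have E: "y powr (1 - \<eta>) * (1 + y powr (2 * \<eta>)) = y * (2 * cosh (\<eta> * ln y))" .
  have "u_eta \<eta> (b *\<^sub>R x) = 1 / (y * (2 * cosh (\<eta> * ln y))) powr \<kappa>"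
    using b E unfolding u_eta_def \<kappa>_def y_def by simp
  also have "\<dots> = (y * (2 * cosh (\<eta> * ln y))) powr (- \<kappa>)" by (simp add: powr_minus_divide)
  also have "\<dots> = (2 * b) powr (- \<kappa>) * (norm x powr (- \<kappa>) * cosh (\<eta> * ln y) powr (- \<kappa>))"
    using b by (simp add: y_def powr_mult)
  also have "cosh (\<eta> * ln y) powr (- \<kappa>) = soliton \<kappa> (\<kappa> * \<eta> * ln y)" using \<kappa> by (simp add: soliton_def)
  finally show ?thesis unfolding ly .
qed

text \<open>Both branches equal \<open>y powr (- \<kappa>) * exp (- c * \<bar>ln y\<bar>)\<close>
  with \<open>y = b * norm x\<close>.\<close>

lemma u_c_dilation:
  fixes x :: "real ^ 'n::finite"
  defines "\<kappa> \<equiv> (real CARD('n) - 2) / 2"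
  assumes x: "x \<noteq> 0" and b: "b > 0"
  shows "u_c c (b *\<^sub>R x) = b powr (- \<kappa>) * (norm x powr (- \<kappa>) * exp (- c * \<bar>ln (norm x) - (- ln b)\<bar>))"
proof -
  define y where "y = b * norm x"
  have y: "y > 0" using x b by (simp add: y_def)
  have ly: "ln y = ln (norm x) - (- ln b)" using x b by (simp add: y_def ln_mult)
  have k: "c - real CARD('n) / 2 + 1 = c + - \<kappa>" "- c - real CARD('n) / 2 + 1 = - c + - \<kappa>"
    by (simp_all add: \<kappa>_def field_simps)
  have "u_c c (b *\<^sub>R x) = (if y \<le> 1 then y powr (c + - \<kappa>) else y powr (- c + - \<kappa>))"
    using b unfolding u_c_def k y_def by simp
  also have "\<dots> = exp (- c * \<bar>ln y\<bar>) * y powr (- \<kappa>)"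
    unfolding powr_add using y by (auto simp: powr_def abs_if)
  also have "y powr (- \<kappa>) = b powr (- \<kappa>) * norm x powr (- \<kappa>)" using b by (simp add: y_def powr_mult)
  finally show ?thesis unfolding ly by simp
qed

lemma u_eta_family_iff:
  fixes u :: "real ^ 'n::finite \<Rightarrow> complex"
  defines "\<kappa> \<equiv> (real CARD('n) - 2) / 2"
  assumes d: "CARD('n) \<ge> 3"
  shows "(\<exists>\<eta>>0. \<exists>a :: complex. \<exists>b>0. AE x in lebesgue. u x = a * of_real (u_eta \<eta> (b *\<^sub>R x))) \<longleftrightarrow>
    (\<exists>\<alpha> l t0. l > 0 \<and> (AE x in lborel. u x = \<alpha> * of_real (norm x powr (- \<kappa>) * soliton \<kappa> (l * (ln (norm x) - t0)))))"
    (is "?L \<longleftrightarrow> ?R")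
proof
  have \<kappa>: "\<kappa> > 0" using d by (simp add: \<kappa>_def)
  {
    assume ?L
    then obtain \<eta> a b where eb: "\<eta> > 0" "b > 0" and "AE x in lebesgue. u x = a * of_real (u_eta \<eta> (b *\<^sub>R x))" by blast
    then have "AE x in lborel. u x = a * of_real (u_eta \<eta> (b *\<^sub>R x))" by (simp add: AE_completion_iff)
    then have "AE x in lborel. u x = a * of_real ((2 * b) powr (- \<kappa>)) * of_real (norm x powr (- \<kappa>) * soliton \<kappa> (\<kappa> * \<eta> * (ln (norm x) - (- ln b))))"
      using AE_lborel_singleton[of "0 :: real ^ 'n"]
    proof eventually_elim
      case (elim x)
      then show ?case using u_eta_dilation[OF elim(2) eb(2), folded \<kappa>_def, OF \<kappa>] by (simp add: mult.assoc)
    qed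
    moreover have "\<kappa> * \<eta> > 0" using \<kappa> eb by simp
    ultimately show ?R by blast
  next
    assume ?R
    then obtain \<alpha> l t0 where l: "l > 0"
      and u: "AE x in lborel. u x = \<alpha> * of_real (norm x powr (- \<kappa>) * soliton \<kappa> (l * (ln (norm x) - t0)))" by blast
    \<comment> \<open>\<open>b = exp (- t0)\<close> and \<open>\<eta> = l / \<kappa>\<close> invert
      the substitution; the factor \<open>(2 * b) powr \<kappa>\<close> moves into the
      amplitude.\<close>
    define b where "b = exp (- t0)"
    have b: "b > 0" by (simp add: b_def)
    have "AE x in lborel. u x = \<alpha> * of_real ((2 * b) powr \<kappa>) * of_real (u_eta (l / \<kappa>) (b *\<^sub>R x))"
      using u AE_lborel_singleton[of "0 :: real ^ 'n"]
    proof eventually_elim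
      case (elim x)
      have "(2 * b) powr \<kappa> * u_eta (l / \<kappa>) (b *\<^sub>R x) =
          (2 * b) powr \<kappa> * (2 * b) powr (- \<kappa>) * (norm x powr (- \<kappa>) * soliton \<kappa> (l * (ln (norm x) - t0)))"
        using u_eta_dilation[OF elim(2) b, folded \<kappa>_def, OF \<kappa>, of "l / \<kappa>"] \<kappa> by (simp add: b_def)
      also have "(2 * b) powr \<kappa> * (2 * b) powr (- \<kappa>) = 1" using b by (simp flip: powr_add)
      finally show ?case using elim(1) by (simp flip: of_real_mult add: mult.assoc)
    qed
    then have "AE x in lebesgue. u x = \<alpha> * of_real ((2 * b) powr \<kappa>) * of_real (u_eta (l / \<kappa>) (b *\<^sub>R x))" by (rule AE_completion)
    moreover have "l / \<kappa> > 0" using l \<kappa> by simp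
    ultimately show ?L using b by blast
  }
qed

lemma u_c_family_iff:
  fixes u :: "real ^ 'n::finite \<Rightarrow> complex"
  defines "\<kappa> \<equiv> (real CARD('n) - 2) / 2"
  shows "(\<exists>a :: complex. \<exists>b>0. AE x in lebesgue. u x = a * of_real (u_c c (b *\<^sub>R x))) \<longleftrightarrow>
    (\<exists>\<alpha> t0. AE x in lborel. u x = \<alpha> * of_real (norm x powr (- \<kappa>) * exp (- c * \<bar>ln (norm x) - t0\<bar>)))"
    (is "?L \<longleftrightarrow> ?R")
proof
  assume ?L
  then obtain a b where b: "b > 0" and "AE x in lebesgue. u x = a * of_real (u_c c (b *\<^sub>R x))" by blast
  then have "AE x in lborel. u x = a * of_real (u_c c (b *\<^sub>R x))" by (simp add: AE_completion_iff)
  then have "AE x in lborel. u x = a * of_real (b powr (- \<kappa>)) * of_real (norm x powr (- \<kappa>) * exp (- c * \<bar>ln (norm x) - (- ln b)\<bar>))"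
    using AE_lborel_singleton[of "0 :: real ^ 'n"]
  proof eventually_elim
    case (elim x)
    then show ?case using u_c_dilation[OF elim(2) b, folded \<kappa>_def] by (simp add: mult.assoc)
  qed
  then show ?R by blast
next
  assume ?R
  then obtain \<alpha> t0 where
    u: "AE x in lborel. u x = \<alpha> * of_real (norm x powr (- \<kappa>) * exp (- c * \<bar>ln (norm x) - t0\<bar>))" by blast
  define b where "b = exp (- t0)"
  have b: "b > 0" by (simp add: b_def)
  have "AE x in lborel. u x = \<alpha> * of_real (b powr \<kappa>) * of_real (u_c c (b *\<^sub>R x))"
    using u AE_lborel_singleton[of "0 :: real ^ 'n"]
  proof eventually_elim
    case (elim x)
    have "b powr \<kappa> * u_c c (b *\<^sub>R x) = b powr \<kappa> * b powr (- \<kappa>) * (norm x powr (- \<kappa>) * exp (- c * \<bar>ln (norm x) - t0\<bar>))"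
      using u_c_dilation[OF elim(2) b, folded \<kappa>_def, of c] by (simp add: b_def)
    also have "b powr \<kappa> * b powr (- \<kappa>) = 1" using b by (simp flip: powr_add)
    finally show ?case using elim(1) by (simp flip: of_real_mult add: mult.assoc)
  qed
  then have "AE x in lebesgue. u x = \<alpha> * of_real (b powr \<kappa>) * of_real (u_c c (b *\<^sub>R x))" by (rule AE_completion)
  then show ?L using b by blast
qed

section \<open>The two sharp inequalities for radial functions and the values on the
  optimizers\<close>

lemma powr_weights: "(X::real) \<ge> 0 \<Longrightarrow> X powr \<theta> * X powr (1 - \<theta>) = X"
  by (cases "X = 0") (simp_all flip: powr_add)

lemma Lp_norm_square: "(Lp_norm p u)\<^sup>2 = (LINT x|lebesgue. norm (u x) powr p) powr (2 / p)"
  by (simp add: Lp_norm_def power2_eq_square flip: powr_add)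

text \<open>The two sides scale in \<open>l\<close> with the exponents
  \<open>2 * \<theta> - 1\<close> and \<open>- (2 / p)\<close>, which agree only if
  \<open>\<theta>\<close> is the inverse of the dimension. This yields equality for all members of
  the family as well as the failure of every other exponent.\<close>

lemma soliton_profile_quotient:
  fixes u :: "real ^ 'n::finite \<Rightarrow> complex"
  assumes d: "CARD('n) \<ge> 3" and l: "l > 0"
  defines "\<kappa> \<equiv> (real CARD('n) - 2) / 2" and "N \<equiv> sphere_area TYPE(real ^ 'n)" and "p \<equiv> sobolev_exponent CARD('n)"
  assumes u: "AE x in lborel. u x = \<alpha> * of_real (norm x powr (- \<kappa>) * soliton \<kappa> (l * (ln (norm x) - t0)))"
  shows "u \<in> homogeneous_H1_rad"
    and "hardy_form u powr \<theta> * hardy_integral u powr (1 - \<theta>) =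
      N * (norm \<alpha>)\<^sup>2 * (soliton_energy \<kappa> powr \<theta> * soliton_mass \<kappa> powr (1 - \<theta>)) * l powr (2 * \<theta> - 1)"
    and "(Lp_norm p u)\<^sup>2 = N powr (2 / p) * (norm \<alpha>)\<^sup>2 * soliton_potential \<kappa> powr (2 / p) * l powr (- (2 / p))"
proof -
  have \<kappa>: "\<kappa> > 0" using d by (simp add: \<kappa>_def)
  have N: "N > 0" unfolding N_def by (rule sphere_area_pos)
  have p: "p > 0" unfolding p_def using sobolev_exponent_gt_2[OF d] by simp
  note S = soliton_profile[OF d l u[unfolded \<kappa>_def], folded \<kappa>_def N_def p_def]
  note P = soliton_energy_pos[OF \<kappa>]
  show "u \<in> homogeneous_H1_rad" by (rule S(1))
  have "hardy_form u powr \<theta> * hardy_integral u powr (1 - \<theta>) =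
      ((N * (norm \<alpha>)\<^sup>2) powr \<theta> * (N * (norm \<alpha>)\<^sup>2) powr (1 - \<theta>)) * (soliton_energy \<kappa> powr \<theta> * soliton_mass \<kappa> powr (1 - \<theta>)) *
      (l powr \<theta> / l powr (1 - \<theta>))"
    unfolding S(2,3) powr_mult powr_divide by (simp add: mult_ac)
  also have "(N * (norm \<alpha>)\<^sup>2) powr \<theta> * (N * (norm \<alpha>)\<^sup>2) powr (1 - \<theta>) = N * (norm \<alpha>)\<^sup>2"
    by (rule powr_weights) (use N in simp)
  also have "l powr \<theta> / l powr (1 - \<theta>) = l powr (2 * \<theta> - 1)" by (simp flip: powr_diff)
  finally show "hardy_form u powr \<theta> * hardy_integral u powr (1 - \<theta>) =
      N * (norm \<alpha>)\<^sup>2 * (soliton_energy \<kappa> powr \<theta> * soliton_mass \<kappa> powr (1 - \<theta>)) * l powr (2 * \<theta> - 1)" .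
  have "(norm \<alpha> powr p) powr (2 / p) = (norm \<alpha>)\<^sup>2" using p by (simp add: powr_powr)
  moreover have "(soliton_potential \<kappa> / l) powr (2 / p) = soliton_potential \<kappa> powr (2 / p) * l powr (- (2 / p))"
    by (simp add: powr_divide powr_minus_divide)
  ultimately show "(Lp_norm p u)\<^sup>2 = N powr (2 / p) * (norm \<alpha>)\<^sup>2 * soliton_potential \<kappa> powr (2 / p) * l powr (- (2 / p))"
    unfolding Lp_norm_square S(4) powr_mult by simp
qed

text \<open>The area of the sphere enters the product of the two forms with total power 1 and the
  squared norm with power \<open>2 / p\<close>, which explains its exponent in \<open>C\<close>.
  Since the energy of the profile is at most its share of \<open>hardy_form u\<close>, equality for
  \<open>u\<close> forces equality for the profile.\<close>

lemma sharp_critical_inequality: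
  fixes u :: "real ^ 'n::finite \<Rightarrow> complex"
  assumes d: "CARD('n) \<ge> 3" and u: "u \<in> homogeneous_H1_rad"
  defines "\<kappa> \<equiv> (real CARD('n) - 2) / 2" and "p \<equiv> sobolev_exponent CARD('n)" and "\<theta> \<equiv> 1 / real CARD('n)"
    and "C \<equiv> sphere_area TYPE(real ^ 'n) powr (1 - 2 / sobolev_exponent CARD('n)) * gn_const ((real CARD('n) - 2) / 2)"
  shows "C * (Lp_norm p u)\<^sup>2 \<le> hardy_form u powr \<theta> * hardy_integral u powr (1 - \<theta>)"
    and "hardy_form u powr \<theta> * hardy_integral u powr (1 - \<theta>) = C * (Lp_norm p u)\<^sup>2 \<Longrightarrow>
      \<exists>\<alpha> l t0. l > 0 \<and> (AE x in lborel. u x = \<alpha> * of_real (norm x powr (- \<kappa>) * soliton \<kappa> (l * (ln (norm x) - t0))))"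
proof -
  define N where "N = sphere_area TYPE(real ^ 'n)"
  have N: "N > 0" unfolding N_def by (rule sphere_area_pos)
  have \<kappa>: "\<kappa> > 0" using d by (simp add: \<kappa>_def)
  have p: "p = 2 + 2 / \<kappa>" unfolding p_def \<kappa>_def by (rule sobolev_exponent_eq[OF d])
  have n: "real CARD('n) = 2 * \<kappa> + 2" by (simp add: \<kappa>_def field_simps)
  have \<theta>: "\<theta> = 1 / (2 * \<kappa> + 2)" by (simp add: \<theta>_def n)
  have \<theta>1: "0 \<le> \<theta>" "0 \<le> 1 - \<theta>" using \<kappa> by (auto simp: \<theta>)
  have kp: "\<kappa> * p = real CARD('n)" using \<kappa> by (simp add: p n distrib_left)
  have p2: "2 / p = \<kappa> / (\<kappa> + 1)" using \<kappa> by (simp add: p field_simps)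
  have C: "C = N powr (1 - 2 / p) * gn_const \<kappa>" by (simp add: C_def N_def p_def \<kappa>_def)
  obtain v w where vw: "H1_line v w" and uv: "AE x in lborel. u x = of_real (norm x powr (- \<kappa>)) * v (ln (norm x))"
    and h: "N * (LINT t|lborel. (norm (w t))\<^sup>2) \<le> hardy_form u"
    and H: "hardy_integral u = N * (LINT t|lborel. (norm (v t))\<^sup>2)"
    by (rule radial_profile[OF u d, folded N_def \<kappa>_def]) (rule that, assumption+)
  define A where "A = (LINT t|lborel. (norm (w t))\<^sup>2)"
  define B where "B = (LINT t|lborel. (norm (v t))\<^sup>2)"
  define D where "D = (LINT t|lborel. norm (v t) powr (2 + 2 / \<kappa>))"
  have nn: "A \<ge> 0" "B \<ge> 0" "D \<ge> 0" by (auto simp: A_def B_def D_def intro: Bochner_Integration.integral_nonneg)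
  have um: "u \<in> borel_measurable lebesgue" using u by (auto simp: homogeneous_H1_rad_def homogeneous_H1_def Let_def)
  have L: "(Lp_norm p u)\<^sup>2 = N powr (2 / p) * D powr (\<kappa> / (\<kappa> + 1))"
    unfolding Lp_norm_square Lp_norm_profile(2)[OF uv H1_lineD(3)[OF vw] um kp]
    by (simp add: powr_mult N_def[symmetric] D_def p[symmetric] p2[symmetric])
  have CL: "C * (Lp_norm p u)\<^sup>2 = N * (gn_const \<kappa> * D powr (\<kappa> / (\<kappa> + 1)))"
  proof -
    have "N powr (1 - 2 / p) * N powr (2 / p) = N" using N by (simp flip: powr_add)
    then show ?thesis unfolding C L by (simp add: mult_ac flip: mult.assoc)
  qed
  have g1: "gn_const \<kappa> * D powr (\<kappa> / (\<kappa> + 1)) \<le> A powr \<theta> * B powr (1 - \<theta>)"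
    unfolding A_def B_def D_def \<theta> by (rule gagliardo_nirenberg_sharp(1)[OF \<kappa> vw])
  have AB: "N * (A powr \<theta> * B powr (1 - \<theta>)) \<le> hardy_form u powr \<theta> * hardy_integral u powr (1 - \<theta>)"
  proof -
    have "N * (A powr \<theta> * B powr (1 - \<theta>)) = (N powr \<theta> * N powr (1 - \<theta>)) * (A powr \<theta> * B powr (1 - \<theta>))"
      by (subst powr_weights) (use N in auto)
    also have "\<dots> = (N * A) powr \<theta> * hardy_integral u powr (1 - \<theta>)" by (simp add: H B_def powr_mult mult_ac)
    also have "\<dots> \<le> hardy_form u powr \<theta> * hardy_integral u powr (1 - \<theta>)"
      using h N nn \<theta>1 by (intro mult_right_mono powr_mono2) (auto simp: A_def)
    finally show ?thesis .
  qed
  show "C * (Lp_norm p u)\<^sup>2 \<le> hardy_form u powr \<theta> * hardy_integral u powr (1 - \<theta>)"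
    unfolding CL using mult_left_mono[OF g1, of N] AB N by linarith
  assume eq: "hardy_form u powr \<theta> * hardy_integral u powr (1 - \<theta>) = C * (Lp_norm p u)\<^sup>2"
  have "gn_const \<kappa> * D powr (\<kappa> / (\<kappa> + 1)) = A powr \<theta> * B powr (1 - \<theta>)"
  proof (rule antisym[OF g1])
    have "N * (A powr \<theta> * B powr (1 - \<theta>)) \<le> N * (gn_const \<kappa> * D powr (\<kappa> / (\<kappa> + 1)))" using AB eq CL by simp
    then show "A powr \<theta> * B powr (1 - \<theta>) \<le> gn_const \<kappa> * D powr (\<kappa> / (\<kappa> + 1))" using N by simp
  qed
  from gagliardo_nirenberg_sharp(2)[OF \<kappa> vw, folded A_def B_def D_def \<theta>, OF this]
  obtain c l t0 where l: "l > 0" and v: "AE t in lborel. v t = c * of_real (soliton \<kappa> (l * (t - t0)))" by blast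
  have "AE x in lborel. u x = c * of_real (norm x powr (- \<kappa>) * soliton \<kappa> (l * (ln (norm x) - t0)))"
    using AE_radial[OF v] uv by eventually_elim simp
  then show "\<exists>\<alpha> l t0. l > 0 \<and> (AE x in lborel. u x = \<alpha> * of_real (norm x powr (- \<kappa>) * soliton \<kappa> (l * (ln (norm x) - t0))))"
    using l by blast
qed

text \<open>With \<open>m\<close> the maximum of the profile, the weak norm side is at most
  \<open>N * m\<^sup>2\<close>, this is at most \<open>N * sqrt (A * B)\<close>, and that is at most
  the product of the forms. Equality in the second estimate makes the profile exponential, and
  equality in the first one bounds its rate by \<open>\<kappa>\<close>.\<close>

lemma sharp_weak_inequality:
  fixes u :: "real ^ 'n::finite \<Rightarrow> complex"
  assumes d: "CARD('n) \<ge> 3" and u: "u \<in> homogeneous_H1_rad"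
  defines "\<kappa> \<equiv> (real CARD('n) - 2) / 2" and "p \<equiv> sobolev_exponent CARD('n)"
    and "C \<equiv> sphere_area TYPE(real ^ 'n) / unit_ball_vol (real CARD('n)) powr (2 / sobolev_exponent CARD('n))"
  shows "C * (weak_Lp_norm p u)\<^sup>2 \<le> hardy_form u powr (1 / 2) * hardy_integral u powr (1 - 1 / 2)"
    and "hardy_form u powr (1 / 2) * hardy_integral u powr (1 - 1 / 2) = C * (weak_Lp_norm p u)\<^sup>2 \<Longrightarrow>
      \<exists>c. 0 < c \<and> c \<le> \<kappa> \<and> (\<exists>\<alpha> t0. AE x in lborel. u x = \<alpha> * of_real (norm x powr (- \<kappa>) * exp (- c * \<bar>ln (norm x) - t0\<bar>)))"
proof -
  define N where "N = sphere_area TYPE(real ^ 'n)"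
  have N: "N > 0" unfolding N_def by (rule sphere_area_pos)
  have \<kappa>: "\<kappa> > 0" using d by (simp add: \<kappa>_def)
  have p: "p = 2 + 2 / \<kappa>" unfolding p_def \<kappa>_def by (rule sobolev_exponent_eq[OF d])
  have n: "real CARD('n) = 2 * \<kappa> + 2" by (simp add: \<kappa>_def field_simps)
  have p0: "p > 0" using \<kappa> by (simp add: p add_pos_pos)
  have kp: "\<kappa> * p = real CARD('n)" using \<kappa> by (simp add: p n distrib_left)
  define \<omega> where "\<omega> = unit_ball_vol (real CARD('n))"
  have \<omega>: "\<omega> > 0" unfolding \<omega>_def by simp
  have W2: "(\<omega> powr (1 / p))\<^sup>2 = \<omega> powr (2 / p)" by (simp add: power2_eq_square flip: powr_add)
  have Wp: "\<omega> powr (1 / p) > 0" using \<omega> by simp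
  have C: "C = N / (\<omega> powr (1 / p))\<^sup>2" unfolding W2 by (simp add: C_def N_def p_def \<omega>_def)
  obtain v w where vw: "H1_line v w" and uv: "AE x in lborel. u x = of_real (norm x powr (- \<kappa>)) * v (ln (norm x))"
    and h: "N * (LINT t|lborel. (norm (w t))\<^sup>2) \<le> hardy_form u"
    and H: "hardy_integral u = N * (LINT t|lborel. (norm (v t))\<^sup>2)"
    by (rule radial_profile[OF u d, folded N_def \<kappa>_def]) (rule that, assumption+)
  define A where "A = (LINT t|lborel. (norm (w t))\<^sup>2)"
  define B where "B = (LINT t|lborel. (norm (v t))\<^sup>2)"
  have nn: "A \<ge> 0" "B \<ge> 0" by (auto simp: A_def B_def intro: Bochner_Integration.integral_nonneg)
  define Q where "Q = hardy_form u powr (1 / 2) * hardy_integral u powr (1 - 1 / 2)"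
  have half: "1 - 1 / 2 = (1 / 2 :: real)" by simp
  have "0 \<le> N * A" using N nn(1) by simp
  also have "N * A \<le> hardy_form u" using h by (simp only: A_def)
  finally have h0: "hardy_form u \<ge> 0" .
  have Q: "N * sqrt (A * B) \<le> Q"
  proof -
    have "N * sqrt (A * B) = sqrt (N * A) * sqrt (N * B)" using N by (simp add: real_sqrt_mult mult_ac)
    also have "\<dots> \<le> sqrt (hardy_form u) * sqrt (hardy_integral u)"
      using h h0 N nn by (intro mult_mono) (auto simp: A_def B_def H)
    also have "\<dots> = Q"
    proof -
      have "hardy_integral u \<ge> 0" using N nn(2) by (simp add: H B_def)
      then show ?thesis using h0 unfolding Q_def half by (simp add: powr_half_sqrt)
    qed
    finally show ?thesis .
  qed
  obtain s where vs: "\<And>t. norm (v t) \<le> norm (v s)" by (rule H1_line_attains_max[OF vw]) blast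
  define m where "m = norm (v s)"
  have m4: "m ^ 4 \<le> A * B" unfolding m_def A_def B_def by (rule sup_inequality_sharp(1)[OF vw])
  have m2: "m\<^sup>2 \<le> sqrt (A * B)"
  proof (rule real_le_rsqrt)
    show "(m\<^sup>2)\<^sup>2 \<le> A * B" using m4 by (simp flip: power_mult)
  qed
  have \<kappa>': "0 < \<kappa> \<and> \<kappa> \<le> \<kappa>" using \<kappa> by simp
  have "C * (weak_Lp_norm p u)\<^sup>2 \<le> Q \<and> (Q = C * (weak_Lp_norm p u)\<^sup>2 \<longrightarrow>
      (\<exists>c. 0 < c \<and> c \<le> \<kappa> \<and> (\<exists>\<alpha> t0. AE x in lborel. u x = \<alpha> * of_real (norm x powr (- \<kappa>) * exp (- c * \<bar>ln (norm x) - t0\<bar>)))))"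
  proof (cases "m = 0")
    case True
    then have v0: "v t = 0" for t using vs[of t] by (simp add: m_def)
    then have u0: "AE x in lborel. u x = 0" using uv by simp
    have "weak_Lp_norm p u = 0" by (rule weak_Lp_norm_zero[OF AE_completion[OF u0] p0])
    moreover have "Q \<ge> 0" by (rule order_trans[OF _ Q]) (use N nn in simp)
    \<comment> \<open>The zero function has amplitude 0 and may be given the admissible rate
      \<open>\<kappa>\<close>.\<close>
    moreover have "\<exists>\<alpha> t0. AE x in lborel. u x = \<alpha> * of_real (norm x powr (- \<kappa>) * exp (- \<kappa> * \<bar>ln (norm x) - t0\<bar>))"
      using u0 by (intro exI[of _ 0]) simp
    ultimately show ?thesis using \<kappa>' by auto
  next
    case False
    then have m: "m > 0" by (simp add: m_def)
    have ub: "AE x in lborel. norm (u x) \<le> m * norm x powr (- \<kappa>)"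
      using uv
    proof eventually_elim
      case (elim x)
      then show ?case using vs[of "ln (norm x)"] by (simp add: norm_mult m_def mult.commute mult_right_mono)
    qed
    note wle = weak_Lp_norm_le(2)[OF \<kappa> kp p0 m ub, folded \<omega>_def] and wnn = weak_Lp_norm_le(3)[OF \<kappa> kp p0 m ub]
    have le: "C * x\<^sup>2 = N * (x / \<omega> powr (1 / p))\<^sup>2" for x by (simp add: C power_divide)
    have xm: "weak_Lp_norm p u / \<omega> powr (1 / p) \<le> m" "0 \<le> weak_Lp_norm p u / \<omega> powr (1 / p)"
      using wle wnn Wp by (simp_all add: pos_divide_le_eq)
    have 1: "C * (weak_Lp_norm p u)\<^sup>2 \<le> N * m\<^sup>2" unfolding le using xm N by (intro mult_left_mono power_mono) auto
    have 2: "N * m\<^sup>2 \<le> N * sqrt (A * B)" using m2 N by simp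
    have opt: "\<exists>c. 0 < c \<and> c \<le> \<kappa> \<and> (\<exists>\<alpha> t0. AE x in lborel. u x = \<alpha> * of_real (norm x powr (- \<kappa>) * exp (- c * \<bar>ln (norm x) - t0\<bar>)))"
      if eq: "Q = C * (weak_Lp_norm p u)\<^sup>2"
    proof -
      have "N * sqrt (A * B) = N * m\<^sup>2" and e2: "C * (weak_Lp_norm p u)\<^sup>2 = N * m\<^sup>2" using 1 2 Q eq by linarith+
      then have "sqrt (A * B) = m\<^sup>2" using N by simp
      then have "(sqrt (A * B))\<^sup>2 = (m\<^sup>2)\<^sup>2" by simp
      then have "A * B = norm (v s) ^ 4" using nn by (simp add: m_def flip: power_mult)
      from sup_inequality_sharp(2)[OF vw, of s, folded A_def B_def, OF this] m
      obtain l where l: "l > 0" and v: "\<And>t. v t = v s * of_real (exp (- l * \<bar>t - s\<bar>))" by (auto simp: m_def)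
      have ue: "AE x in lborel. u x = v s * of_real (norm x powr (- \<kappa>) * exp (- l * \<bar>ln (norm x) - s\<bar>))"
        using uv
      proof eventually_elim
        case (elim x)
        then show ?case by (subst (asm) v) simp
      qed
      have "l \<le> \<kappa>"
      proof (rule ccontr)
        assume "\<not> l \<le> \<kappa>"
        then have lk: "l > \<kappa>" by simp
        have "AE x in lborel. norm (u x) = m * (norm x powr (- \<kappa>) * exp (- l * \<bar>ln (norm x) - s\<bar>))"
          using ue by eventually_elim (simp add: norm_mult m_def)
        from weak_Lp_norm_exponential_less[OF \<kappa> kp p0 m lk this, folded \<omega>_def]
        have "weak_Lp_norm p u / \<omega> powr (1 / p) < m" using Wp by (simp add: pos_divide_less_eq)
        then have "(weak_Lp_norm p u / \<omega> powr (1 / p))\<^sup>2 < m\<^sup>2" using xm(2) by (intro power_strict_mono) auto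
        then show False using e2 N unfolding le by simp
      qed
      then show ?thesis using l ue by blast
    qed
    have "C * (weak_Lp_norm p u)\<^sup>2 \<le> Q" using 1 2 Q by linarith
    then show ?thesis by (intro conjI impI opt)
  qed
  then show "C * (weak_Lp_norm p u)\<^sup>2 \<le> hardy_form u powr (1 / 2) * hardy_integral u powr (1 - 1 / 2)"
    and "hardy_form u powr (1 / 2) * hardy_integral u powr (1 - 1 / 2) = C * (weak_Lp_norm p u)\<^sup>2 \<Longrightarrow>
      \<exists>c. 0 < c \<and> c \<le> \<kappa> \<and> (\<exists>\<alpha> t0. AE x in lborel. u x = \<alpha> * of_real (norm x powr (- \<kappa>) * exp (- c * \<bar>ln (norm x) - t0\<bar>)))"
    unfolding Q_def by blast+
qed

text \<open>\<open>hardy_form u\<close> is proportional to \<open>c\<close> and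
  \<open>hardy_integral u\<close> to \<open>1 / c\<close>, so the rate cancels in their geometric
  mean. The weak norm is independent of \<open>c\<close> precisely because of
  \<open>c \<le> \<kappa>\<close>.\<close>

lemma exponential_profile_quotient:
  fixes u :: "real ^ 'n::finite \<Rightarrow> complex"
  assumes d: "CARD('n) \<ge> 3"
  defines "\<kappa> \<equiv> (real CARD('n) - 2) / 2" and "p \<equiv> sobolev_exponent CARD('n)"
    and "C \<equiv> sphere_area TYPE(real ^ 'n) / unit_ball_vol (real CARD('n)) powr (2 / sobolev_exponent CARD('n))"
  assumes c: "0 < c" "c \<le> \<kappa>"
    and u: "AE x in lborel. u x = \<alpha> * of_real (norm x powr (- \<kappa>) * exp (- c * \<bar>ln (norm x) - t0\<bar>))"
  shows "u \<in> homogeneous_H1_rad"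
    and "hardy_form u powr (1 / 2) * hardy_integral u powr (1 - 1 / 2) = C * (weak_Lp_norm p u)\<^sup>2"
    and "\<alpha> \<noteq> 0 \<Longrightarrow> weak_Lp_norm p u > 0"
proof -
  define N where "N = sphere_area TYPE(real ^ 'n)"
  have N: "N > 0" unfolding N_def by (rule sphere_area_pos)
  have \<kappa>: "\<kappa> > 0" using c by simp
  have p: "p = 2 + 2 / \<kappa>" unfolding p_def \<kappa>_def by (rule sobolev_exponent_eq[OF d])
  have n: "real CARD('n) = 2 * \<kappa> + 2" by (simp add: \<kappa>_def field_simps)
  have p0: "p > 0" using \<kappa> by (simp add: p add_pos_pos)
  have kp: "\<kappa> * p = real CARD('n)" using \<kappa> by (simp add: p n distrib_left)
  define \<omega> where "\<omega> = unit_ball_vol (real CARD('n))"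
  have \<omega>: "\<omega> > 0" unfolding \<omega>_def by simp
  have W2: "(\<omega> powr (1 / p))\<^sup>2 = \<omega> powr (2 / p)" by (simp add: power2_eq_square flip: powr_add)
  have Wp: "\<omega> powr (1 / p) > 0" using \<omega> by simp
  have C: "C = N / (\<omega> powr (1 / p))\<^sup>2" unfolding W2 by (simp add: C_def N_def p_def \<omega>_def)
  note E = exponential_profile[OF d c(1) u[unfolded \<kappa>_def], folded \<kappa>_def N_def]
  show ur: "u \<in> homogeneous_H1_rad" by (rule E(1))
  have um: "u \<in> borel_measurable lebesgue" using ur by (auto simp: homogeneous_H1_rad_def homogeneous_H1_def Let_def)
  have w: "weak_Lp_norm p u = norm \<alpha> * \<omega> powr (1 / p)"
  proof (cases "\<alpha> = 0")
    case True
    then have u0: "AE x in lborel. u x = 0" using u by simp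
    show ?thesis using weak_Lp_norm_zero[OF AE_completion[OF u0] p0] True by simp
  next
    case False
    then have m: "norm \<alpha> > 0" by simp
    have "AE x in lborel. norm (u x) = norm \<alpha> * (norm x powr (- \<kappa>) * exp (- c * \<bar>ln (norm x) - t0\<bar>))"
      using u by eventually_elim (simp add: norm_mult)
    from weak_Lp_norm_exponential_eq[OF \<kappa> kp p0 m c um this] show ?thesis by (simp add: \<omega>_def)
  qed
  have half: "1 - 1 / 2 = (1 / 2 :: real)" by simp
  have "hardy_form u powr (1 / 2) * hardy_integral u powr (1 - 1 / 2) = sqrt (N * (norm \<alpha>)\<^sup>2 * c) * sqrt (N * (norm \<alpha>)\<^sup>2 / c)"
    unfolding half E(2,3) using N c by (simp add: powr_half_sqrt)
  also have "\<dots> = N * (norm \<alpha>)\<^sup>2"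
  proof -
    have "sqrt (X * c) * sqrt (X / c) = X" if "X \<ge> 0" for X
      using c that by (simp flip: real_sqrt_mult)
    then show ?thesis using N by simp
  qed
  finally show "hardy_form u powr (1 / 2) * hardy_integral u powr (1 - 1 / 2) = C * (weak_Lp_norm p u)\<^sup>2"
    unfolding w C using Wp by (simp add: power_mult_distrib)
  show "\<alpha> \<noteq> 0 \<Longrightarrow> weak_Lp_norm p u > 0" unfolding w using Wp by simp
qed

theorem theorem3:
  fixes d :: nat and p :: real
  assumes d: "d = CARD('n::finite)" "d \<ge> 3"
    and p: "p = sobolev_exponent d"
  shows
    "1 / 2 - 1 / p = 1 / real d
     \<and> (let \<theta> = 1 / real d in
          \<exists>C>0.
            (\<forall>u \<in> (homogeneous_H1_rad :: (real ^ 'n \<Rightarrow> complex) set).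
               hardy_form u powr \<theta> * hardy_integral u powr (1 - \<theta>) \<ge> C * (Lp_norm p u)\<^sup>2)
            \<and> (\<forall>C'. (\<forall>u \<in> (homogeneous_H1_rad :: (real ^ 'n \<Rightarrow> complex) set).
                  hardy_form u powr \<theta> * hardy_integral u powr (1 - \<theta>) \<ge> C' * (Lp_norm p u)\<^sup>2)
                 \<longrightarrow> C' \<le> C)
            \<and> (\<forall>u :: real ^ 'n \<Rightarrow> complex.
                 (u \<in> homogeneous_H1_rad \<and>
                  hardy_form u powr \<theta> * hardy_integral u powr (1 - \<theta>) = C * (Lp_norm p u)\<^sup>2)
                 \<longleftrightarrow> (\<exists>\<eta>>0. \<exists>a :: complex. \<exists>b>0.
                       AE x in lebesgue. u x = a * of_real (u_eta \<eta> (b *\<^sub>R x)))))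
     \<and> (\<forall>\<theta> :: real. \<theta> \<noteq> 1 / real d \<longrightarrow>
          \<not> (\<exists>C>0. \<forall>u \<in> (homogeneous_H1_rad :: (real ^ 'n \<Rightarrow> complex) set).
               \<not> (AE x in lebesgue. u x = 0) \<longrightarrow>
               hardy_form u powr \<theta> * hardy_integral u powr (1 - \<theta>) \<ge> C * (Lp_norm p u)\<^sup>2))
     \<and> (let \<theta> = 1 / 2 in
          \<exists>C>0.
            (\<forall>u \<in> (homogeneous_H1_rad :: (real ^ 'n \<Rightarrow> complex) set).
               hardy_form u powr \<theta> * hardy_integral u powr (1 - \<theta>) \<ge> C * (weak_Lp_norm p u)\<^sup>2)
            \<and> (\<forall>C'. (\<forall>u \<in> (homogeneous_H1_rad :: (real ^ 'n \<Rightarrow> complex) set).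
                  hardy_form u powr \<theta> * hardy_integral u powr (1 - \<theta>) \<ge> C' * (weak_Lp_norm p u)\<^sup>2)
                 \<longrightarrow> C' \<le> C)
            \<and> (\<forall>u :: real ^ 'n \<Rightarrow> complex.
                 (u \<in> homogeneous_H1_rad \<and>
                  hardy_form u powr \<theta> * hardy_integral u powr (1 - \<theta>) = C * (weak_Lp_norm p u)\<^sup>2)
                 \<longleftrightarrow> (\<exists>c. 0 < c \<and> c \<le> real d / 2 - 1 \<and>
                       (\<exists>a :: complex. \<exists>b>0.
                         AE x in lebesgue. u x = a * of_real (u_c c (b *\<^sub>R x))))))"
proof -
  define \<kappa> where "\<kappa> = (real CARD('n) - 2) / 2"
  have d3: "CARD('n) \<ge> 3" using d by simp
  have \<kappa>: "\<kappa> > 0" using d3 by (simp add: \<kappa>_def)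
  have p': "p = sobolev_exponent CARD('n)" using p d by simp
  have pk: "p = 2 + 2 / \<kappa>" unfolding p' \<kappa>_def by (rule sobolev_exponent_eq[OF d3])
  have dk: "real d = 2 * \<kappa> + 2" using d by (simp add: \<kappa>_def field_simps)
  have n: "real CARD('n) = 2 * \<kappa> + 2" using dk d by simp
  have dk2: "real d / 2 - 1 = \<kappa>" by (simp add: dk field_simps)
  have p2: "2 / p = \<kappa> / (\<kappa> + 1)" using \<kappa> by (simp add: pk field_simps)
  define N where "N = sphere_area TYPE(real ^ 'n)"
  have N: "N > 0" unfolding N_def by (rule sphere_area_pos)
  note P = soliton_energy_pos[OF \<kappa>]
  let ?X = "homogeneous_H1_rad :: (real ^ 'n \<Rightarrow> complex) set"
  let ?\<theta> = "1 / real d"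
  let ?Q = "\<lambda>\<theta> (u :: real ^ 'n \<Rightarrow> complex). hardy_form u powr \<theta> * hardy_integral u powr (1 - \<theta>)"
  let ?sol = "\<lambda>\<alpha> l t0 (x :: real ^ 'n). \<alpha> * complex_of_real (norm x powr (- \<kappa>) * soliton \<kappa> (l * (ln (norm x) - t0)))"
  define C1 where "C1 = N powr (1 - 2 / p) * gn_const \<kappa>"
  have C1': "C1 = sphere_area TYPE(real ^ 'n) powr (1 - 2 / sobolev_exponent CARD('n)) * gn_const ((real CARD('n) - 2) / 2)"
    by (simp add: C1_def N_def p' \<kappa>_def)
  have C1pos: "C1 > 0" using N P by (simp add: C1_def gn_const_def)
  have expo: "1 / 2 - 1 / p = 1 / real d" unfolding pk dk using \<kappa> by (simp add: field_simps)
  note I1 = sharp_critical_inequality[OF d3, folded C1' p' \<kappa>_def d(1)]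
  note S = soliton_profile_quotient[OF d3, folded p' \<kappa>_def N_def]
  have Seq: "?Q ?\<theta> u = C1 * (Lp_norm p u)\<^sup>2" if l: "l > 0" and u: "AE x in lborel. u x = ?sol \<alpha> l t0 x" for u \<alpha> l t0
  proof -
    have 1: "2 * ?\<theta> - 1 = - (2 / p)" unfolding p2 dk using \<kappa> by (simp add: field_simps)
    have 2: "N powr (1 - 2 / p) * N powr (2 / p) = N" using N by (simp flip: powr_add)
    have 3: "gn_const \<kappa> * soliton_potential \<kappa> powr (2 / p) = soliton_energy \<kappa> powr ?\<theta> * soliton_mass \<kappa> powr (1 - ?\<theta>)"
      using P by (simp add: gn_const_def p2 dk)
    have 4: "x * g * (y * a * f * e) = (x * y) * a * (g * f) * e" for x g y a f e :: real by (simp only: mult_ac)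
    show ?thesis unfolding S(2)[OF l u] S(3)[OF l u] C1_def 4 1 2 3 ..
  qed
  have Snz: "Lp_norm p u \<noteq> 0" if l: "l > 0" and u: "AE x in lborel. u x = ?sol 1 l 0 x" for u l
    using S(3)[OF l u] N P l by auto
  have solI: "AE x in lborel. ?sol 1 l 0 x = ?sol 1 l 0 x" for l by simp
  have part1: "\<exists>C>0. (\<forall>u\<in>?X. ?Q ?\<theta> u \<ge> C * (Lp_norm p u)\<^sup>2) \<and>
      (\<forall>C'. (\<forall>u\<in>?X. ?Q ?\<theta> u \<ge> C' * (Lp_norm p u)\<^sup>2) \<longrightarrow> C' \<le> C) \<and>
      (\<forall>u. (u \<in> ?X \<and> ?Q ?\<theta> u = C * (Lp_norm p u)\<^sup>2) \<longleftrightarrow>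
        (\<exists>\<eta>>0. \<exists>a :: complex. \<exists>b>0. AE x in lebesgue. u x = a * of_real (u_eta \<eta> (b *\<^sub>R x))))"
  proof (intro exI[of _ C1] conjI allI impI ballI)
    show "C1 > 0" by (rule C1pos)
    show "C1 * (Lp_norm p u)\<^sup>2 \<le> ?Q ?\<theta> u" if "u \<in> ?X" for u by (rule I1(1)[OF that])
    show "C' \<le> C1" if "\<forall>u\<in>?X. C' * (Lp_norm p u)\<^sup>2 \<le> ?Q ?\<theta> u" for C'
    proof -
      \<comment> \<open>The soliton with \<open>l = 1\<close> gives equality and has nonzero norm,
        so no larger constant is admissible.\<close>
      have "C' * (Lp_norm p (?sol 1 1 0))\<^sup>2 \<le> C1 * (Lp_norm p (?sol 1 1 0))\<^sup>2"
        using bspec[OF that S(1)[OF zero_less_one solI]] unfolding Seq[OF zero_less_one solI] .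
      then show ?thesis using Snz[OF zero_less_one solI] by simp
    qed
    show "(u \<in> ?X \<and> ?Q ?\<theta> u = C1 * (Lp_norm p u)\<^sup>2) \<longleftrightarrow>
        (\<exists>\<eta>>0. \<exists>a :: complex. \<exists>b>0. AE x in lebesgue. u x = a * of_real (u_eta \<eta> (b *\<^sub>R x)))" for u
      unfolding u_eta_family_iff[OF d3, folded \<kappa>_def]
    proof (intro iffI conjI)
      assume "\<exists>\<alpha> l t0. l > 0 \<and> (AE x in lborel. u x = ?sol \<alpha> l t0 x)"
      then obtain \<alpha> l t0 where l: "l > 0" and ae: "AE x in lborel. u x = ?sol \<alpha> l t0 x" by blast
      show "u \<in> ?X" by (rule S(1)[OF l ae])
      show "?Q ?\<theta> u = C1 * (Lp_norm p u)\<^sup>2" by (rule Seq[OF l ae])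
    qed (elim conjE, rule I1(2))
  qed
  have part1': "\<not> (\<exists>C>0. \<forall>u\<in>?X. \<not> (AE x in lebesgue. u x = 0) \<longrightarrow> ?Q \<theta> u \<ge> C * (Lp_norm p u)\<^sup>2)" if \<theta>: "\<theta> \<noteq> ?\<theta>" for \<theta>
  proof
    assume "\<exists>C>0. \<forall>u\<in>?X. \<not> (AE x in lebesgue. u x = 0) \<longrightarrow> ?Q \<theta> u \<ge> C * (Lp_norm p u)\<^sup>2"
    then obtain C where C: "C > 0" and ineq: "\<And>u. u \<in> ?X \<Longrightarrow> \<not> (AE x in lebesgue. u x = 0) \<Longrightarrow> ?Q \<theta> u \<ge> C * (Lp_norm p u)\<^sup>2" by blast
    define E where "E = soliton_energy \<kappa> powr \<theta> * soliton_mass \<kappa> powr (1 - \<theta>)"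
    define F where "F = soliton_potential \<kappa> powr (2 / p)"
    have EF: "E > 0" "F > 0" using P by (auto simp: E_def F_def)
    define K where "K = C * N powr (2 / p) * F / (N * E)"
    have K: "K > 0" using C N EF by (simp add: K_def)
    \<comment> \<open>Along the solitons the assumed inequality becomes
      \<open>K \<le> l powr e\<close> for all positive \<open>l\<close>, and \<open>e\<close>
      vanishes only at the critical \<open>\<theta>\<close>.\<close>
    define e where "e = 2 * \<theta> - 1 + 2 / p"
    have "2 / p = 1 - 2 * ?\<theta>" unfolding p2 dk using \<kappa> by (simp add: field_simps)
    then have e: "e \<noteq> 0" using \<theta> by (simp add: e_def)
    have Kl: "K \<le> l powr e" if l: "l > 0" for l
    proof -
      have "\<not> (AE x in lebesgue. ?sol 1 l 0 x = 0)"
      proof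
        assume z: "AE x in lebesgue. ?sol 1 l 0 x = 0"
        have "(LINT x|lebesgue. norm (?sol 1 l 0 x) powr p) = 0"
          by (rule integral_eq_zero_AE) (use z in \<open>eventually_elim, simp\<close>)
        then show False using Snz[OF l solI] by (simp add: Lp_norm_def)
      qed
      from ineq[OF S(1)[OF l solI] this]
      have "C * (N powr (2 / p) * F * l powr (- (2 / p))) \<le> N * E * l powr (2 * \<theta> - 1)"
        unfolding S(2)[OF l solI] S(3)[OF l solI] E_def F_def by simp
      then have "C * (N powr (2 / p) * F * l powr (- (2 / p))) * l powr (2 / p) \<le> N * E * l powr (2 * \<theta> - 1) * l powr (2 / p)"
        by (rule mult_right_mono) simp
      moreover have "C * (N powr (2 / p) * F * l powr (- (2 / p))) * l powr (2 / p) = C * N powr (2 / p) * F * (l powr (- (2 / p)) * l powr (2 / p))"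
        by (simp only: mult_ac)
      moreover have "l powr (- (2 / p)) * l powr (2 / p) = 1" using l by (simp flip: powr_add)
      moreover have "l powr (2 * \<theta> - 1) * l powr (2 / p) = l powr e" by (simp add: e_def flip: powr_add)
      ultimately have "C * N powr (2 / p) * F \<le> l powr e * (N * E)" by (simp add: mult_ac)
      then show ?thesis unfolding K_def using N EF by (simp add: pos_divide_le_eq)
    qed
    \<comment> \<open>For nonzero \<open>e\<close> the power \<open>l powr e\<close> takes every
      positive value; this \<open>l\<close> gives \<open>K / 2\<close>.\<close>
    have "K \<le> ((K / 2) powr (1 / e)) powr e" by (rule Kl) (use K in simp)
    also have "\<dots> = K / 2" using K e by (simp add: powr_powr)
    finally show False using K by simp
  qed
  let ?ex = "\<lambda>c \<alpha> t0 (x :: real ^ 'n). \<alpha> * complex_of_real (norm x powr (- \<kappa>) * exp (- c * \<bar>ln (norm x) - t0\<bar>))"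
  define C2 where "C2 = N / unit_ball_vol (real CARD('n)) powr (2 / p)"
  have C2': "C2 = sphere_area TYPE(real ^ 'n) / unit_ball_vol (real CARD('n)) powr (2 / sobolev_exponent CARD('n))"
    by (simp add: C2_def N_def p')
  have "unit_ball_vol (real CARD('n)) \<noteq> 0"
    using unit_ball_vol_pos[of "real CARD('n)"] by (metis less_irrefl of_nat_0_le_iff)
  then have C2pos: "C2 > 0" using N by (simp add: C2_def)
  note I2 = sharp_weak_inequality[OF d3, folded C2' p' \<kappa>_def]
  note E = exponential_profile_quotient[OF d3, folded C2' p' \<kappa>_def]
  have part2: "\<exists>C>0. (\<forall>u\<in>?X. ?Q (1 / 2) u \<ge> C * (weak_Lp_norm p u)\<^sup>2) \<and>
      (\<forall>C'. (\<forall>u\<in>?X. ?Q (1 / 2) u \<ge> C' * (weak_Lp_norm p u)\<^sup>2) \<longrightarrow> C' \<le> C) \<and>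
      (\<forall>u. (u \<in> ?X \<and> ?Q (1 / 2) u = C * (weak_Lp_norm p u)\<^sup>2) \<longleftrightarrow>
        (\<exists>c. 0 < c \<and> c \<le> real d / 2 - 1 \<and> (\<exists>a :: complex. \<exists>b>0. AE x in lebesgue. u x = a * of_real (u_c c (b *\<^sub>R x)))))"
  proof (intro exI[of _ C2] conjI allI impI ballI)
    show "C2 > 0" by (rule C2pos)
    show "C2 * (weak_Lp_norm p u)\<^sup>2 \<le> ?Q (1 / 2) u" if "u \<in> ?X" for u by (rule I2(1)[OF that])
    \<comment> \<open>Optimality of the constant is tested on the exponential profile with the
      largest admissible rate.\<close>
    have ae: "AE x in lborel. ?ex \<kappa> 1 0 x = ?ex \<kappa> 1 0 x" by simp
    show "C' \<le> C2" if "\<forall>u\<in>?X. C' * (weak_Lp_norm p u)\<^sup>2 \<le> ?Q (1 / 2) u" for C'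
    proof -
      have "C' * (weak_Lp_norm p (?ex \<kappa> 1 0))\<^sup>2 \<le> C2 * (weak_Lp_norm p (?ex \<kappa> 1 0))\<^sup>2"
        using bspec[OF that E(1)[OF \<kappa> order_refl ae]] unfolding E(2)[OF \<kappa> order_refl ae] .
      then show ?thesis using E(3)[OF \<kappa> order_refl ae] by simp
    qed
    show "(u \<in> ?X \<and> ?Q (1 / 2) u = C2 * (weak_Lp_norm p u)\<^sup>2) \<longleftrightarrow>
        (\<exists>c. 0 < c \<and> c \<le> real d / 2 - 1 \<and> (\<exists>a :: complex. \<exists>b>0. AE x in lebesgue. u x = a * of_real (u_c c (b *\<^sub>R x))))" for u
      unfolding u_c_family_iff \<kappa>_def[symmetric] dk2
    proof (intro iffI conjI)
      assume "\<exists>c. 0 < c \<and> c \<le> \<kappa> \<and> (\<exists>\<alpha> t0. AE x in lborel. u x = ?ex c \<alpha> t0 x)"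
      then obtain c \<alpha> t0 where c: "0 < c" "c \<le> \<kappa>" and ae: "AE x in lborel. u x = ?ex c \<alpha> t0 x" by blast
      show "u \<in> ?X" by (rule E(1)[OF c ae])
      show "?Q (1 / 2) u = C2 * (weak_Lp_norm p u)\<^sup>2" by (rule E(2)[OF c ae])
    qed (elim conjE, rule I2(2))
  qed
  show ?thesis unfolding Let_def by (intro conjI allI impI expo part1 part2 part1')
qed

end
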